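(* Let $A=\operatorname{diag}(\lambda_1,\dots,\lambda_n)$ with pairwise distinct $\lambda_i\in\mathbb C$. Assume that $C=C(p^* )$ is a Morse--Bott critical torus for the residual flow, that is, at each point of $C$ the kernel of the Hessian of $\rho_A$ is exactly the tangent space of $C$. Assume also that no inactive eigenvalue lies on its critical circle: \[ |\lambda_k-c|\neq R\qquad(k\notin S). \] Let $\nu$ denote Fubini--Study volume on $\mathbb{CP}^{n-1}$. There exists a sufficiently small adapted tubular neighborhood $U$ of $C$ such that, if \[ E_T(U,C)=\{x\in U:\Phi_t(x)\in U\text{ for all }0\le t\le T\}, \] then there are constants $K_1,K_2>0$ and $T_0>0$ such that for all $T\ge T_0$, \[ K_1e^{-\Gamma(C)T}\le \nu(E_T(U,C))\le K_2e^{-\Gamma(C)T}. \] In particular, \[ \lim_{T\to\infty}\frac1T\log\nu(E_T(U,C))=-\Gamma(C). \]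
   Context: For a unit vector $u\in\mathbb C^n$ put $z=u^*Au$, $\rho_A(u)=\|Au-zu\|^2$; $\rho_A$ is phase invariant and descends to $\mathbb{CP}^{n-1}$. The residual flow $\Phi_t$ is the negative gradient flow of $\rho_A$ on $\mathbb{CP}^{n-1}$ for the Fubini--Study metric, normalized so that the metric on the horizontal space $\{h:u^*h=0\}$ is $\operatorname{Re}(h^*h')$; in coordinates it is induced by $\dot u_i=2(\rho_A(u)-|\lambda_i-z|^2)u_i$. Write $p_i=|u_i|^2$, $z(p)=\sum_ip_i\lambda_i$, $\rho(p)=\sum_ip_i|\lambda_i-z(p)|^2$. A critical torus $C(p^* )$ is the set of all $[u]\in\mathbb{CP}^{n-1}$ with $|u_i|^2=p_i^*$ for all $i$, where $p^*$ is a probability vector such that these points are critical for $\rho_A$; equivalently, with $S=\{i:p_i^*>0\}$ (the active indices; other indices are inactive), $c=z(p^* )$ and $R^2=\rho(p^* )$, $R\ge0$, one has $|\lambda_i-c|=R$ for all $i\in S$. The critical circle is the circle with center $c$ and radius $R$. Put $q_i=\lambda_i-c$. Let $V_S=\{a\in\mathbb R^S:\sum_{i\in S}a_i=0\}$ and let $L_S:V_S\to V_S$ be the linearization of the flow in the active weights, $(L_Sa)_i=8p_i^*\operatorname{Re}(q_i\overline{\delta z})$, where $\delta z=\sum_{i\in S}a_iq_i$. Let $\gamma_1^{\rm act},\dots,\gamma_r^{\rm act}>0$ be the positive eigenvalues of $L_S$ on $V_S$, with multiplicity. Let $I_{\rm in}(C)=\{k\notin S:|\lambda_k-c|<R\}$.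 The local escape exponent is \[ \Gamma(C)=\sum_{\ell=1}^r\gamma_\ell^{\rm act}+4\sum_{k\in I_{\rm in}(C)}\left(R^2-|\lambda_k-c|^2\right). \] "Adapted tubular neighborhood" means a tubular neighborhood of $C$ that is of product type in local coordinates $(\theta,y,x)$, with $\theta$ along $C$, $y$ the stable and $x$ the unstable transverse coordinates of the flow. *)

theory Defs
  imports "HOL-Analysis.Analysis"
begin

text \<open>
  Complex projective space: a point is a complex line in \<open>complex^'n\<close>, i.e. the set of all multiples
  of a nonzero vector, so \<open>CARD('n)\<close> is the \<open>n\<close> of \<open>CP^(n-1)\<close>. The tangent space at \<open>[u]\<close>,
  \<open>u\<close> a unit vector, is the horizontal space of \<open>u\<close>. The library's real inner product
  \<open>h \<bullet> k\<close> on \<open>complex^'n\<close> equals \<open>Re (h\<^sup>* k)\<close>, so its restriction to horizontal spaces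
  is the Fubini--Study metric.
\<close>

type_synonym 'n cpoint = "(complex^'n) set"

definition cdot :: "complex^'n \<Rightarrow> complex^'n \<Rightarrow> complex"
  where "cdot u v = (\<Sum>i\<in>UNIV. cnj (u$i) * v$i)"

definition proj :: "complex^'n \<Rightarrow> 'n cpoint"
  where "proj w = range (\<lambda>a. a *s w)"

definition CP :: "'n::finite cpoint set"
  where "CP = proj ` (- {0})"

text \<open>The quotient topology.\<close>
definition cp_open :: "'n::finite cpoint set \<Rightarrow> bool"
  where "cp_open U \<longleftrightarrow> U \<subseteq> CP \<and> open {w. w \<noteq> 0 \<and> proj w \<in> U}"

definition horizontal :: "complex^'n \<Rightarrow> (complex^'n) set"
  where "horizontal u = {h. cdot u h = 0}"

definition hor_part :: "complex^'n \<Rightarrow> complex^'n \<Rightarrow> complex^'n"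
  where "hor_part u h = h - cdot u h *s u"

text \<open>
  The surface measure of the unit sphere, as cone measure. The Hopf map from the unit sphere to
  \<open>CP^(n-1)\<close> is a Riemannian submersion for the Fubini--Study metric above, and its
  fibres are circles of length \<open>2 * pi\<close>; hence the Riemannian volume of \<open>E\<close> is the surface measure
  of its preimage divided by \<open>2 * pi\<close> (total volume \<open>pi ^ (n-1) / fact (n-1)\<close>).
\<close>
definition sphere_measure :: "(complex^'n) measure"
  where "sphere_measure =
    scale_measure (of_nat DIM(complex^'n)) (distr (restrict_space lborel (cball 0 1)) borel sgn)"

definition fs_volume :: "'n::finite cpoint set \<Rightarrow> real"
  where "fs_volume E = measure sphere_measure {u. norm u = 1 \<and> proj u \<in> E} / (2 * pi)"

text \<open>
  A function on \<open>CP^(n-1)\<close> is given by a phase invariant function \<open>f\<close> on the unit sphere.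
  It is differentiated through its extension to nonzero vectors, which is constant on complex lines.
\<close>
definition hom_ext :: "(complex^'n \<Rightarrow> real) \<Rightarrow> complex^'n \<Rightarrow> real"
  where "hom_ext f w = f (sgn w)"

definition fs_differential :: "(complex^'n \<Rightarrow> real) \<Rightarrow> complex^'n \<Rightarrow> complex^'n \<Rightarrow> real"
  where "fs_differential f u h = frechet_derivative (hom_ext f) (at u) h"

text \<open>The horizontal lift to \<open>u\<close> of the Fubini--Study gradient.\<close>
definition fs_gradient :: "(complex^'n \<Rightarrow> real) \<Rightarrow> complex^'n \<Rightarrow> complex^'n"
  where "fs_gradient f u =
    (THE g. g \<in> horizontal u \<and> (\<forall>h\<in>horizontal u. fs_differential f u h = g \<bullet> h))"

definition fs_critical :: "(complex^'n \<Rightarrow> real) \<Rightarrow> complex^'n \<Rightarrow> bool"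
  where "fs_critical f u \<longleftrightarrow> (\<forall>h\<in>horizontal u. fs_differential f u h = 0)"

text \<open>
  The Hessian, only used at critical points, where it does not depend on a choice of chart or
  connection (here: the chart \<open>h \<mapsto> [u + h]\<close> on the horizontal space).
\<close>
definition fs_hessian ::
    "(complex^'n \<Rightarrow> real) \<Rightarrow> complex^'n \<Rightarrow> complex^'n \<Rightarrow> complex^'n \<Rightarrow> real"
  where "fs_hessian f u h k = frechet_derivative (\<lambda>w. frechet_derivative (hom_ext f) (at w) k) (at u) h"

definition hessian_kernel :: "(complex^'n \<Rightarrow> real) \<Rightarrow> complex^'n \<Rightarrow> (complex^'n) set"
  where "hessian_kernel f u = {h \<in> horizontal u. \<forall>k\<in>horizontal u. fs_hessian f u h k = 0}"

text \<open>
  The linearization of the negative gradient flow at a critical point is minus the Hessian, so the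
  stable (unstable) directions are the eigenvectors of positive (negative) Hessian eigenvalues.
\<close>
definition stable_space :: "(complex^'n \<Rightarrow> real) \<Rightarrow> complex^'n \<Rightarrow> (complex^'n) set"
  where "stable_space f u =
    span {h \<in> horizontal u. \<exists>\<mu>>0. \<forall>k\<in>horizontal u. fs_hessian f u h k = \<mu> * (h \<bullet> k)}"

definition unstable_space :: "(complex^'n \<Rightarrow> real) \<Rightarrow> complex^'n \<Rightarrow> (complex^'n) set"
  where "unstable_space f u =
    span {h \<in> horizontal u. \<exists>\<mu><0. \<forall>k\<in>horizontal u. fs_hessian f u h k = \<mu> * (h \<bullet> k)}"

text \<open>
  Tangent space at \<open>[u]\<close> of a submanifold \<open>M\<close> of \<open>CP^(n-1)\<close>: the velocities of curves in \<open>M\<close>,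
  lifted so that the velocity at \<open>u\<close> is horizontal.
\<close>
definition tangent_in :: "'n cpoint set \<Rightarrow> complex^'n \<Rightarrow> (complex^'n) set"
  where "tangent_in M u = {h \<in> horizontal u. \<exists>\<gamma> :: real \<Rightarrow> complex^'n.
    \<gamma> 0 = u \<and> (\<forall>s. \<gamma> s \<noteq> 0 \<and> proj (\<gamma> s) \<in> M) \<and> (\<gamma> has_vector_derivative h) (at 0)}"

definition rayleigh :: "complex^'n^'n \<Rightarrow> complex^'n \<Rightarrow> complex"
  where "rayleigh A u = cdot u (A *v u)"

definition residual :: "complex^'n^'n \<Rightarrow> complex^'n \<Rightarrow> real"
  where "residual A u = (norm (A *v u - rayleigh A u *s u))\<^sup>2"

definition diag_mat :: "complex^'n \<Rightarrow> complex^'n^'n"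
  where "diag_mat lam = (\<chi> i j. if i = j then lam$i else 0)"

text \<open>
  \<open>\<Phi> t\<close> is the time \<open>t\<close> map of the flow on \<open>CP^(n-1)\<close>: its orbits are the projections of the
  integral curves of the horizontal lift of the negative gradient.
\<close>
definition is_residual_flow :: "complex^'n^'n \<Rightarrow> (real \<Rightarrow> 'n cpoint \<Rightarrow> 'n cpoint) \<Rightarrow> bool"
  where "is_residual_flow A \<Phi> \<longleftrightarrow> (\<forall>u. norm u = 1 \<longrightarrow>
    (\<exists>v :: real \<Rightarrow> complex^'n. v 0 = u \<and>
      (\<forall>t. norm (v t) = 1 \<and>
           (v has_vector_derivative - fs_gradient (residual A) (v t)) (at t) \<and>
           \<Phi> t (proj u) = proj (v t))))"

definition prob_vector :: "real^'n \<Rightarrow> bool"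
  where "prob_vector p \<longleftrightarrow> (\<forall>i. 0 \<le> p$i) \<and> (\<Sum>i\<in>UNIV. p$i) = 1"

definition torus_lift :: "real^'n \<Rightarrow> (complex^'n) set"
  where "torus_lift p = {u. \<forall>i. (cmod (u$i))\<^sup>2 = p$i}"

definition torus :: "real^'n \<Rightarrow> 'n cpoint set"
  where "torus p = proj ` torus_lift p"

definition critical_torus :: "complex^'n^'n \<Rightarrow> real^'n \<Rightarrow> bool"
  where "critical_torus A p \<longleftrightarrow> prob_vector p \<and> (\<forall>u\<in>torus_lift p. fs_critical (residual A) u)"

definition morse_bott_torus :: "complex^'n^'n \<Rightarrow> real^'n \<Rightarrow> bool"
  where "morse_bott_torus A p \<longleftrightarrow> critical_torus A p \<and>
    (\<forall>u\<in>torus_lift p. hessian_kernel (residual A) u = tangent_in (torus p) u)"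

definition active :: "real^'n \<Rightarrow> 'n set"
  where "active p = {i. 0 < p$i}"

definition center :: "complex^'n \<Rightarrow> real^'n \<Rightarrow> complex"
  where "center lam p = (\<Sum>i\<in>UNIV. of_real (p$i) * lam$i)"

definition radius_sq :: "complex^'n \<Rightarrow> real^'n \<Rightarrow> real"
  where "radius_sq lam p = (\<Sum>i\<in>UNIV. p$i * (cmod (lam$i - center lam p))\<^sup>2)"

definition radius :: "complex^'n \<Rightarrow> real^'n \<Rightarrow> real"
  where "radius lam p = sqrt (radius_sq lam p)"

text \<open>
  The space of weight variations \<open>V_S\<close>, embedded in \<open>real^'n\<close> by extension by zero; \<open>L_act\<close>
  maps it to itself because \<open>p$i = 0\<close> for inactive \<open>i\<close>.
\<close>
definition V_act :: "real^'n \<Rightarrow> (real^'n) set"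
  where "V_act p = {a. (\<forall>i. i \<notin> active p \<longrightarrow> a$i = 0) \<and> (\<Sum>i\<in>active p. a$i) = 0}"

definition L_act :: "complex^'n \<Rightarrow> real^'n \<Rightarrow> real^'n \<Rightarrow> real^'n"
  where "L_act lam p a = (\<chi> i. 8 * p$i * Re ((lam$i - center lam p) *
    cnj (\<Sum>j\<in>active p. of_real (a$j) * (lam$j - center lam p))))"

definition eigenvalue_on ::
    "('a::real_vector) set \<Rightarrow> ('a \<Rightarrow> 'a) \<Rightarrow> real \<Rightarrow> bool"
  where "eigenvalue_on V L g \<longleftrightarrow> (\<exists>a\<in>V. a \<noteq> 0 \<and> L a = g *\<^sub>R a)"

text \<open>Algebraic multiplicity, as the dimension of the generalized eigenspace.\<close>
definition multiplicity_on ::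
    "('a::real_vector) set \<Rightarrow> ('a \<Rightarrow> 'a) \<Rightarrow> real \<Rightarrow> nat"
  where "multiplicity_on V L g = dim {a \<in> V. \<exists>k. ((\<lambda>b. L b - g *\<^sub>R b) ^^ k) a = 0}"

definition inner_indices :: "complex^'n \<Rightarrow> real^'n \<Rightarrow> 'n set"
  where "inner_indices lam p = {k. k \<notin> active p \<and> cmod (lam$k - center lam p) < radius lam p}"

definition escape_exponent :: "complex^'n \<Rightarrow> real^'n \<Rightarrow> real"
  where "escape_exponent lam p =
    (\<Sum>g\<in>{g. 0 < g \<and> eigenvalue_on (V_act p) (L_act lam p) g}.
       real (multiplicity_on (V_act p) (L_act lam p) g) * g)
    + 4 * (\<Sum>k\<in>inner_indices lam p. (radius lam p)\<^sup>2 - (cmod (lam$k - center lam p))\<^sup>2)"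

primrec Ck_on ::
    "nat \<Rightarrow> 'a::real_normed_vector set \<Rightarrow> ('a \<Rightarrow> 'b::real_normed_vector) \<Rightarrow> bool"
  where
    "Ck_on 0 D f \<longleftrightarrow> continuous_on D f"
  | "Ck_on (Suc k) D f \<longleftrightarrow> (\<forall>x\<in>D. f differentiable (at x)) \<and>
       (\<forall>v. Ck_on k D (\<lambda>x. frechet_derivative f (at x) v))"

definition smooth_on_open ::
    "'a::real_normed_vector set \<Rightarrow> ('a \<Rightarrow> 'b::real_normed_vector) \<Rightarrow> bool"
  where "smooth_on_open D f \<longleftrightarrow> open D \<and> (\<forall>k. Ck_on k D f)"

definition torus_point :: "real^'n \<Rightarrow> real^'n \<Rightarrow> complex^'n"
  where "torus_point p \<theta> = (\<chi> i. of_real (sqrt (p$i)) * cis (\<theta>$i))"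

text \<open>
  \<open>U\<close> is the diffeomorphic image of \<open>torus p \<times> (ball in Y) \<times> (ball in X)\<close> under
  \<open>(\<theta>, y, x) \<mapsto> [\<Psi> (\<theta>, y, x)]\<close>. The coordinate \<open>\<theta>\<close> consists of the phases of \<open>torus_point p \<theta>\<close>; it
  is redundant, only the point \<open>[torus_point p \<theta>]\<close> matters, that is, the active phases up to a common
  shift. The coordinates \<open>y\<close> and \<open>x\<close> range over balls of real vector spaces \<open>Y\<close> and \<open>X\<close>, realized as
  subspaces of \<open>complex^'n\<close> only because their dimensions are not fixed in advance. \<open>\<Psi>\<close> is a lift
  to nonzero vectors; a direction is killed by the projection to \<open>CP^(n-1)\<close> iff it is a
  complex multiple of the base point. Along the torus, the \<open>y\<close> and \<open>x\<close> directions are the stable and the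
  unstable space of the linearized flow.
\<close>
definition adapted_tubular_nbhd ::
    "complex^'n^'n \<Rightarrow> real^'n \<Rightarrow> 'n::finite cpoint set \<Rightarrow> bool"
  where "adapted_tubular_nbhd A p U \<longleftrightarrow> cp_open U \<and>
    (\<exists>(\<Psi> :: (real^'n) \<times> (complex^'n) \<times> (complex^'n) \<Rightarrow> complex^'n) Y X r s.
       subspace Y \<and> subspace X \<and> 0 < r \<and> 0 < s \<and>
       smooth_on_open (UNIV \<times> ball 0 r \<times> ball 0 s) \<Psi> \<and>
       (let D = UNIV \<times> (Y \<inter> ball 0 r) \<times> (X \<inter> ball 0 s) in
          (\<forall>d\<in>D. \<Psi> d \<noteq> 0) \<and>
          U = (\<lambda>d. proj (\<Psi> d)) ` D \<and>
          (\<forall>\<theta> y x \<theta>' y' x'. (\<theta>, y, x) \<in> D \<longrightarrow> (\<theta>', y', x') \<in> D \<longrightarrow>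
             (proj (\<Psi> (\<theta>, y, x)) = proj (\<Psi> (\<theta>', y', x')) \<longleftrightarrow>
              proj (torus_point p \<theta>) = proj (torus_point p \<theta>') \<and> y = y' \<and> x = x')) \<and>
          (\<forall>d\<in>D. \<forall>\<alpha>. \<forall>\<eta>\<in>Y. \<forall>\<xi>\<in>X.
             (\<exists>a. frechet_derivative \<Psi> (at d) (\<alpha>, \<eta>, \<xi>) = a *s \<Psi> d) \<longrightarrow>
             (\<exists>\<kappa>. \<forall>i\<in>active p. \<alpha>$i = \<kappa>) \<and> \<eta> = 0 \<and> \<xi> = 0) \<and>
          (\<forall>\<theta>. let u = torus_point p \<theta> in
             \<Psi> (\<theta>, 0, 0) = u \<and>
             (\<lambda>\<eta>. hor_part u (frechet_derivative \<Psi> (at (\<theta>, 0, 0)) (0, \<eta>, 0))) ` Y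
               = stable_space (residual A) u \<and>
             (\<lambda>\<xi>. hor_part u (frechet_derivative \<Psi> (at (\<theta>, 0, 0)) (0, 0, \<xi>))) ` X
               = unstable_space (residual A) u)))"

definition stay_set ::
    "(real \<Rightarrow> 'n cpoint \<Rightarrow> 'n cpoint) \<Rightarrow> 'n cpoint set \<Rightarrow> real \<Rightarrow> 'n cpoint set"
  where "stay_set \<Phi> U T = {x \<in> U. \<forall>t. 0 \<le> t \<and> t \<le> T \<longrightarrow> \<Phi> t x \<in> U}"

end

theory Submission
  imports Defs
begin

text \<open>
  Let \<open>q j\<close> be the eigenvalue with index \<open>j\<close> minus the center of the critical circle, \<open>R\<close> its radius and
  \<open>kap j = 2 * (R\<^sup>2 - (norm (q j))\<^sup>2)\<close>. Inactive indices are called inner if \<open>norm (q j) < R\<close>, so that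
  \<open>kap j > 0\<close>, and outer if \<open>R < norm (q j)\<close>.

  \<^emph>\<open>Reduction to the plane.\<close> Along an orbit, coordinate \<open>j\<close> is multiplied by the positive number
  \<open>exp (c t + kap j * t + q j \<bullet> s t / 2)\<close>, where \<open>c t\<close> and the path \<open>s\<close> in the complex plane are the same for all
  \<open>j\<close> (\<open>orbit_formula\<close>). Projectively \<open>c\<close> drops out. Hence, if the initial vector is written as
  \<open>(norm (w$j))\<^sup>2 = g\<^sup>2 * (m j * exp (q j \<bullet> y))\<close> with \<open>m = p\<close> on the active indices, the flow becomes
  \<open>m j \<mapsto> m j * exp (2 * kap j * t)\<close> together with a single planar equation \<open>y' = 8 *\<^sub>R F m y\<close>, in which \<open>F m\<close> is the
  gradient of \<open>ln (\<Sum>j. m j * exp (q j \<bullet> y))\<close> (\<open>flow_weight_coords\<close>). Such coordinates exist because of the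
  Morse--Bott condition: a variation of the active weights that does not move \<open>z\<close> to first order is in the
  kernel of the Hessian, so it is tangent to the torus and therefore zero (\<open>weights_independent\<close>); consequently
  every vector of log weights with mean zero has the form \<open>q j \<bullet> y\<close> (\<open>log_weights_planar\<close>). The derivative of
  \<open>F p\<close> at \<open>0\<close> is the covariance \<open>M\<close> of the \<open>q j\<close>, with eigenvalues \<open>mu1 \<le> mu2\<close>, and the escape exponent is
  \<open>8 * mu1 + 8 * mu2\<close> plus the sum of \<open>2 * kap k\<close> over the inner indices (\<open>escape_exponent_eq\<close>).

  \<^emph>\<open>Growth estimates.\<close> As long as a solution stays near the torus, the inner masses grow, the outer masses decay
  and \<open>sqrt (M y \<bullet> y)\<close> grows, each at an exponential rate. So the time integral of the distance to the torus is
  bounded independently of the length of the time interval (\<open>integral_Mnorm_inactive_mass_le\<close>). The difference of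
  two such solutions then satisfies \<open>d' = 8 *\<^sub>R M d\<close> up to a relative error with small time integral, and so
  its growth is that of the linear equation up to constant factors (\<open>pair_growth\<close>).

  \<^emph>\<open>Volume.\<close> The volume of the stay set is a multiple of the Lebesgue measure of the cone of its representatives
  in the unit ball (\<open>fs_volume_cone\<close>). The diagonal map \<open>shift a\<close>, which multiplies coordinate \<open>j\<close> by
  \<open>exp (q j \<bullet> a / 2)\<close>, adds \<open>a\<close> to \<open>y\<close> and preserves \<open>m\<close>. If two points of the cone have the same \<open>m\<close> and
  values of \<open>y\<close> at distance at most one, then this distance is at most a multiple of \<open>exp (- 8 * mu1 * T)\<close>, and of
  \<open>exp (- 8 * mu2 * T)\<close> if the difference is parallel to the second eigenvector (\<open>staying_separation\<close>). If \<open>a\<close> runs through a grid in a fixed square with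
  these mesh widths, the shifted cones are disjoint; they have comparable volumes, and they lie in a fixed ball whose inner
  coordinates are scaled by \<open>exp (- kap k * T)\<close>, because an inner mass that is small at time \<open>T\<close> was
  smaller by the factor \<open>exp (- 2 * kap k * T)\<close> initially. Comparing volumes gives the upper bound
  (\<open>volume_upper_bound\<close>). Conversely, for small inner masses at time \<open>T\<close> and small outer masses at time \<open>0\<close>,
  shooting backward from time \<open>T\<close> produces an interval of first coordinates of \<open>y\<close> of length proportional
  to \<open>exp (- 8 * mu1 * T)\<close>, and for each of them an interval of second coordinates of length proportional to
  \<open>exp (- 8 * mu2 * T)\<close>, for which the solution stays (\<open>staying_initial_values\<close>). So the shifted cones cover
  such a scaled ball, which is the lower bound (\<open>volume_lower_bound\<close>).
\<close>

section \<open>Perturbed diagonal linear systems in the plane\<close>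

text \<open>
  The weight \<open>exp (- 2 * b * t)\<close> turns \<open>x\<^sup>2 + y\<^sup>2\<close> into a quantity whose logarithmic derivative is at most \<open>2 * E t\<close>; this is
  the first bound. If \<open>x\<close> vanishes initially, \<open>exp (- b * t) * y t\<close> changes by at most
  \<open>1/8\<close> times the largest weighted size of the solution, which is at most \<open>3/2\<close> times its initial value. So more than half of it survives.
\<close>
lemma dominated_forward:
  fixes x y u v E :: "real \<Rightarrow> real"
  assumes T: "0 \<le> T" and ab: "a \<le> b"
    and dx: "\<And>t. 0 \<le> t \<Longrightarrow> t \<le> T \<Longrightarrow> (x has_real_derivative a * x t + u t) (at t)"
    and dy: "\<And>t. 0 \<le> t \<Longrightarrow> t \<le> T \<Longrightarrow> (y has_real_derivative b * y t + v t) (at t)"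
    and err: "\<And>t. 0 \<le> t \<Longrightarrow> t \<le> T \<Longrightarrow> (u t)\<^sup>2 + (v t)\<^sup>2 \<le> (E t)\<^sup>2 * ((x t)\<^sup>2 + (y t)\<^sup>2)"
    and E0: "\<And>t. 0 \<le> t \<Longrightarrow> t \<le> T \<Longrightarrow> 0 \<le> E t"
    and contE: "continuous_on {0..T} E"
    and small: "integral {0..T} E \<le> 1/8"
  shows "sqrt ((x T)\<^sup>2 + (y T)\<^sup>2) \<le> 2 * exp (b * T) * sqrt ((x 0)\<^sup>2 + (y 0)\<^sup>2)"
    and "x 0 = 0 \<Longrightarrow> \<bar>y 0\<bar> \<le> 2 * exp (- b * T) * \<bar>y T\<bar>"
proof -
  define H where "H t = integral {0..t} E" for t
  have dH: "(H has_real_derivative E t) (at t)" if "0 < t" "t < T" for t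
  proof -
    have "(H has_real_derivative E t) (at t within {0..T})"
      unfolding H_def using integral_has_real_derivative[OF contE, of t] that by simp
    moreover have "at t within {0..T} = at t" using that by (intro at_within_interior) auto
    ultimately show ?thesis by simp
  qed
  have cH: "continuous_on {0..T} H"
    unfolding H_def by (intro indefinite_integral_continuous_1 integrable_continuous_real contE)
  have H0: "H 0 = 0" by (simp add: H_def)
  have HT: "0 \<le> H t" "H t \<le> 1/8" if "0 \<le> t" "t \<le> T" for t
  proof -
    show "0 \<le> H t" unfolding H_def
      by (rule integral_nonneg) (use that E0 in \<open>auto intro!: integrable_continuous_real continuous_on_subset[OF contE]\<close>)
    have "H t \<le> H T" unfolding H_def
      by (rule integral_subset_le) (use that E0 T in \<open>auto intro!: integrable_continuous_real continuous_on_subset[OF contE]\<close>)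
    then show "H t \<le> 1/8" using small by (simp add: H_def)
  qed
  have cx: "continuous_on {0..T} x" and cy: "continuous_on {0..T} y"
    by (auto intro!: continuous_at_imp_continuous_on DERIV_isCont dx dy)
  have cs: "\<bar>x t * u t + y t * v t\<bar> \<le> E t * ((x t)\<^sup>2 + (y t)\<^sup>2)" if "0 \<le> t" "t \<le> T" for t
  proof -
    have "(x t * u t + y t * v t)\<^sup>2 \<le> ((x t)\<^sup>2 + (y t)\<^sup>2) * ((u t)\<^sup>2 + (v t)\<^sup>2)"
    proof -
      have "((x t)\<^sup>2 + (y t)\<^sup>2) * ((u t)\<^sup>2 + (v t)\<^sup>2) - (x t * u t + y t * v t)\<^sup>2 = (x t * v t - y t * u t)\<^sup>2"
        by (simp add: power2_eq_square algebra_simps)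
      then show ?thesis by (metis diff_ge_0_iff_ge zero_le_power2)
    qed
    also have "\<dots> \<le> ((x t)\<^sup>2 + (y t)\<^sup>2) * ((E t)\<^sup>2 * ((x t)\<^sup>2 + (y t)\<^sup>2))"
      by (intro mult_left_mono err that) auto
    also have "\<dots> = (E t * ((x t)\<^sup>2 + (y t)\<^sup>2))\<^sup>2" by (simp add: power2_eq_square algebra_simps)
    finally show ?thesis using E0[OF that] by (subst (asm) abs_le_square_iff[symmetric]) auto
  qed
  define P where "P t = exp (- 2 * b * t) * ((x t)\<^sup>2 + (y t)\<^sup>2)" for t
  have dP: "P t * exp (- 2 * H t) \<le> P 0" if t: "0 \<le> t" "t \<le> T" for t
  proof -
    have "P t * exp (- 2 * H t) \<le> P 0 * exp (- 2 * H 0)"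
    proof (rule DERIV_nonpos_imp_decreasing_open[OF t(1)])
      fix r assume r: "0 < r" "r < t"
      have r': "0 \<le> r" "r \<le> T" using r t by auto
      have dHr: "(H has_real_derivative E r) (at r)" using dH r t by auto
      have "((\<lambda>t. P t * exp (- 2 * H t)) has_real_derivative
          exp (- 2 * b * r) * exp (- 2 * H r) * (2 * (a - b) * (x r)\<^sup>2 + 2 * (x r * u r + y r * v r)
             - 2 * E r * ((x r)\<^sup>2 + (y r)\<^sup>2))) (at r)"
        unfolding P_def
        by (rule DERIV_cong, (rule derivative_eq_intros refl dx[OF r'] dy[OF r'] dHr)+)
          (simp add: algebra_simps power2_eq_square)
      moreover have "exp (- 2 * b * r) * exp (- 2 * H r) * (2 * (a - b) * (x r)\<^sup>2 + 2 * (x r * u r + y r * v r)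
             - 2 * E r * ((x r)\<^sup>2 + (y r)\<^sup>2)) \<le> 0"
      proof -
        have "(a - b) * (x r)\<^sup>2 \<le> 0" using ab by (intro mult_nonpos_nonneg) auto
        moreover have "x r * u r + y r * v r \<le> E r * ((x r)\<^sup>2 + (y r)\<^sup>2)"
          using cs[OF r'] by (meson abs_le_D1)
        moreover have "2 * A + 2 * B - 2 * C \<le> 0" if "A \<le> 0" "B \<le> C" for A B C :: real
          using that by simp
        ultimately have "2 * (a - b) * (x r)\<^sup>2 + 2 * (x r * u r + y r * v r)
             - 2 * E r * ((x r)\<^sup>2 + (y r)\<^sup>2) \<le> 0" unfolding mult.assoc by blast
        then show ?thesis by (rule mult_nonneg_nonpos[rotated]) simp
      qed
      ultimately show "\<exists>l. ((\<lambda>t. P t * exp (- 2 * H t)) has_real_derivative l) (at r) \<and> l \<le> 0" by blast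
    next
      show "continuous_on {0..t} (\<lambda>t. P t * exp (- 2 * H t))" unfolding P_def
        by (intro continuous_intros continuous_on_subset[OF cx] continuous_on_subset[OF cy]
            continuous_on_subset[OF cH]) (use t in auto)
    qed
    then show ?thesis by (simp add: H0)
  qed
  have e8: "exp (1/8::real) \<le> 3/2" using exp_bound[of "1/8"] by (simp add: power2_eq_square)
  have P: "sqrt (P t) \<le> 3/2 * sqrt (P 0)" if t: "0 \<le> t" "t \<le> T" for t
  proof -
    have P0: "0 \<le> P 0" by (simp add: P_def)
    have "P t = (P t * exp (- 2 * H t)) * exp (2 * H t)" by (simp add: exp_minus)
    also have "\<dots> \<le> P 0 * exp (2 * (1/8))"
      by (intro mult_mono dP t P0) (use HT[OF t] in auto)
    also have "\<dots> = P 0 * (exp (1/8))\<^sup>2" using exp_double[of "1/8::real"] by simp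
    finally have "sqrt (P t) \<le> sqrt (P 0 * (exp (1/8))\<^sup>2)" by (rule real_sqrt_le_mono)
    also have "\<dots> = sqrt (P 0) * exp (1/8)" by (simp add: real_sqrt_mult)
    also have "\<dots> \<le> sqrt (P 0) * (3/2)" by (intro mult_left_mono e8) (simp add: P0)
    finally show ?thesis by simp
  qed
  have Ps: "sqrt (P t) = exp (- b * t) * sqrt ((x t)\<^sup>2 + (y t)\<^sup>2)" for t
  proof -
    have "exp (- 2 * b * t) = (exp (- b * t))\<^sup>2" by (simp add: exp_double[symmetric])
    then show ?thesis by (simp add: P_def real_sqrt_mult)
  qed
  have s0: "sqrt (P 0) = sqrt ((x 0)\<^sup>2 + (y 0)\<^sup>2)" by (simp add: P_def)
  have "0 \<le> sqrt (P 0)" by (simp add: P_def)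
  then have "sqrt (P T) \<le> 2 * sqrt (P 0)" using P[OF T order_refl] by linarith
  then have "exp (- b * T) * sqrt ((x T)\<^sup>2 + (y T)\<^sup>2) \<le> 2 * sqrt ((x 0)\<^sup>2 + (y 0)\<^sup>2)"
    using s0 Ps[of T] by simp
  then show "sqrt ((x T)\<^sup>2 + (y T)\<^sup>2) \<le> 2 * exp (b * T) * sqrt ((x 0)\<^sup>2 + (y 0)\<^sup>2)"
    by (simp add: exp_minus field_simps)
  assume x0: "x 0 = 0"
  \<comment> \<open>By the bound on \<open>P\<close>, an upper bound for \<open>exp (- b * t)\<close> times the norm of the solution.\<close>
  define K where "K = 3/2 * \<bar>y 0\<bar>"
  have PK: "sqrt (P t) \<le> K" if "0 \<le> t" "t \<le> T" for t
    using P[OF that] by (simp add: Ps x0 K_def)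
  define c where "c t = exp (- b * t) * y t" for t
  have dc: "(c has_real_derivative exp (- b * r) * v r) (at r)" "\<bar>exp (- b * r) * v r\<bar> \<le> K * E r"
    if r: "0 \<le> r" "r \<le> T" for r
  proof -
    show "(c has_real_derivative exp (- b * r) * v r) (at r)" unfolding c_def
      by (rule DERIV_cong, (rule derivative_eq_intros refl dy[OF r])+) (simp add: algebra_simps)
    have "\<bar>v r\<bar> \<le> E r * sqrt ((x r)\<^sup>2 + (y r)\<^sup>2)"
    proof -
      have "\<bar>v r\<bar> = sqrt ((v r)\<^sup>2)" by simp
      also have "\<dots> \<le> sqrt ((E r)\<^sup>2 * ((x r)\<^sup>2 + (y r)\<^sup>2))"
        using err[OF r] zero_le_power2[of "u r"] by (intro real_sqrt_le_mono) linarith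
      also have "\<dots> = E r * sqrt ((x r)\<^sup>2 + (y r)\<^sup>2)" using E0[OF r] by (simp add: real_sqrt_mult)
      finally show ?thesis .
    qed
    then have "exp (- b * r) * \<bar>v r\<bar> \<le> E r * sqrt (P r)"
      unfolding Ps by (simp add: mult.left_commute)
    also have "\<dots> \<le> E r * K" by (intro mult_left_mono PK r E0)
    finally show "\<bar>exp (- b * r) * v r\<bar> \<le> K * E r" by (simp add: abs_mult mult.commute)
  qed
  have cc: "continuous_on {0..T} c" unfolding c_def by (intro continuous_intros cy)
  have "c 0 - K * H 0 \<ge> c T - K * H T"
  proof (rule DERIV_nonpos_imp_decreasing_open[OF T])
    fix r assume "0 < r" "r < T"
    then show "\<exists>l. ((\<lambda>t. c t - K * H t) has_real_derivative l) (at r) \<and> l \<le> 0"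
      using dc[of r] dH[of r]
      by (intro exI[of _ "exp (- b * r) * v r - K * E r"]) (auto intro!: derivative_eq_intros)
  qed (intro continuous_intros cc cH)
  moreover have "c 0 + K * H 0 \<le> c T + K * H T"
  proof (rule DERIV_nonneg_imp_increasing_open[OF T])
    fix r assume "0 < r" "r < T"
    then show "\<exists>l. ((\<lambda>t. c t + K * H t) has_real_derivative l) (at r) \<and> l \<ge> 0"
      using dc[of r] dH[of r]
      by (intro exI[of _ "exp (- b * r) * v r + K * E r"]) (auto intro!: derivative_eq_intros)
  qed (intro continuous_intros cc cH)
  moreover have "K * H T \<le> K * (1/8)" using HT[OF T] by (intro mult_left_mono) (auto simp: K_def)
  moreover have "K = 3/2 * \<bar>c 0\<bar>" "K * H 0 = 0" by (simp_all add: K_def c_def H0)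
  ultimately have "\<bar>c 0\<bar> \<le> 2 * \<bar>c T\<bar>" by linarith
  then have "\<bar>y 0\<bar> \<le> 2 * \<bar>exp (- b * T) * y T\<bar>" by (simp add: c_def)
  then show "\<bar>y 0\<bar> \<le> 2 * exp (- b * T) * \<bar>y T\<bar>" by (simp add: abs_mult)
qed

text \<open>
  Time reversal exchanges the roles of the two components and the signs of the rates.
\<close>
lemma dominated_backward:
  fixes x y u v E :: "real \<Rightarrow> real"
  assumes T: "0 \<le> T" and ab: "a \<le> b"
    and dx: "\<And>t. 0 \<le> t \<Longrightarrow> t \<le> T \<Longrightarrow> (x has_real_derivative a * x t + u t) (at t)"
    and dy: "\<And>t. 0 \<le> t \<Longrightarrow> t \<le> T \<Longrightarrow> (y has_real_derivative b * y t + v t) (at t)"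
    and err: "\<And>t. 0 \<le> t \<Longrightarrow> t \<le> T \<Longrightarrow> (u t)\<^sup>2 + (v t)\<^sup>2 \<le> (E t)\<^sup>2 * ((x t)\<^sup>2 + (y t)\<^sup>2)"
    and E0: "\<And>t. 0 \<le> t \<Longrightarrow> t \<le> T \<Longrightarrow> 0 \<le> E t"
    and contE: "continuous_on {0..T} E"
    and small: "integral {0..T} E \<le> 1/8"
  shows "sqrt ((x 0)\<^sup>2 + (y 0)\<^sup>2) \<le> 2 * exp (- a * T) * sqrt ((x T)\<^sup>2 + (y T)\<^sup>2)"
    and "y T = 0 \<Longrightarrow> \<bar>x T\<bar> \<le> 2 * exp (a * T) * \<bar>x 0\<bar>"
proof -
  have ab': "- b \<le> - a" using ab by simp
  have dX: "((\<lambda>t. y (T - t)) has_real_derivative - b * y (T - t) + - v (T - t)) (at t)"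
    if "0 \<le> t" "t \<le> T" for t
    by (rule DERIV_chain2[OF dy, THEN DERIV_cong]) (use that in \<open>auto intro!: derivative_eq_intros\<close>)
  have dY: "((\<lambda>t. x (T - t)) has_real_derivative - a * x (T - t) + - u (T - t)) (at t)"
    if "0 \<le> t" "t \<le> T" for t
    by (rule DERIV_chain2[OF dx, THEN DERIV_cong]) (use that in \<open>auto intro!: derivative_eq_intros\<close>)
  have er: "(- v (T - t))\<^sup>2 + (- u (T - t))\<^sup>2 \<le> (E (T - t))\<^sup>2 * ((y (T - t))\<^sup>2 + (x (T - t))\<^sup>2)"
    if "0 \<le> t" "t \<le> T" for t
    using err[of "T - t"] that by (simp add: add.commute)
  have cE: "continuous_on {0..T} (\<lambda>t. E (T - t))"
    by (rule continuous_on_compose2[OF contE]) (auto intro!: continuous_intros)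
  have "integral {0..T} (\<lambda>t. E (T - t)) = integral {0..T} E"
  proof -
    have "(E has_integral integral {0..T} E) (cbox 0 T)"
      using integrable_integral[OF integrable_continuous_real[OF contE]] by simp
    from has_integral_affinity[OF this, of "-1" T]
    have "((\<lambda>t. E (T - t)) has_integral integral {0..T} E) {0..T}"
      using T by simp
    then show ?thesis by (rule integral_unique)
  qed
  then have sm: "integral {0..T} (\<lambda>t. E (T - t)) \<le> 1/8" using small by simp
  have E0': "0 \<le> E (T - t)" if "0 \<le> t" "t \<le> T" for t using E0[of "T-t"] that by simp
  note fw = dominated_forward[OF T ab' dX dY er E0' cE sm]
  show "sqrt ((x 0)\<^sup>2 + (y 0)\<^sup>2) \<le> 2 * exp (- a * T) * sqrt ((x T)\<^sup>2 + (y T)\<^sup>2)"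
    using fw(1) by (simp add: add.commute)
  show "y T = 0 \<Longrightarrow> \<bar>x T\<bar> \<le> 2 * exp (a * T) * \<bar>x 0\<bar>"
    using fw(2) by simp
qed

section \<open>The planar vector field\<close>

lemma exp_quadratic_bounds:
  fixes x :: real
  assumes "\<bar>x\<bar> \<le> 1"
  shows "0 \<le> exp x - 1 - x" "exp x - 1 - x \<le> x\<^sup>2" "\<bar>exp x - 1\<bar> \<le> 2 * \<bar>x\<bar>"
proof -
  show lo: "0 \<le> exp x - 1 - x" using exp_ge_add_one_self[of x] by linarith
  show up: "exp x - 1 - x \<le> x\<^sup>2"
  proof (cases "0 \<le> x")
    case True
    then show ?thesis using exp_bound[of x] assms by simp
  next
    case False
    define y where "y = - x"
    have y: "0 \<le> y" "y \<le> 1" using False assms by (auto simp: y_def)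
    have "1 + y + y\<^sup>2 / 2 \<le> exp y" using exp_lower_Taylor_quadratic[OF y(1)] .
    moreover have "0 \<le> 1 - y + y\<^sup>2" using y by (simp add: power2_eq_square)
    ultimately have "(1 - y + y\<^sup>2) * (1 + y + y\<^sup>2 / 2) \<le> (1 - y + y\<^sup>2) * exp y"
      by (intro mult_left_mono) auto
    moreover have "(1 - y + y\<^sup>2) * (1 + y + y\<^sup>2 / 2) = 1 + y\<^sup>2 / 2 + y ^ 3 / 2 + y ^ 4 / 2"
      by (simp add: power2_eq_square power3_eq_cube power4_eq_xxxx field_simps)
    moreover have "0 \<le> y\<^sup>2" "0 \<le> y ^ 3" "0 \<le> y ^ 4" using y by auto
    ultimately have "1 \<le> (1 - y + y\<^sup>2) * exp y" by linarith
    then have "exp (- y) \<le> 1 - y + y\<^sup>2" by (simp add: exp_minus field_simps)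
    then show ?thesis by (simp add: y_def)
  qed
  have "x\<^sup>2 \<le> \<bar>x\<bar>" using assms power2_eq_square[of "\<bar>x\<bar>"] mult_left_mono[of "\<bar>x\<bar>" 1 "\<bar>x\<bar>"] by simp
  then show "\<bar>exp x - 1\<bar> \<le> 2 * \<bar>x\<bar>" using lo up by linarith
qed

text \<open>
  The data of the planar equation. The vectors \<open>e1\<close>, \<open>e2\<close> are an orthonormal eigenbasis of the covariance of \<open>q\<close>
  under \<open>p\<close>. The eigenvalue \<open>mu1\<close> vanishes if the active \<open>q i\<close> lie on a line through \<open>0\<close>, and both eigenvalues vanish
  if \<open>R = 0\<close>.
\<close>
locale planar_flow =
  fixes q :: "'n::finite \<Rightarrow> complex" and p :: "'n \<Rightarrow> real" and R :: real
    and e1 e2 :: complex and mu1 mu2 :: real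
  assumes p_nonneg: "0 \<le> p i"
    and p_sum: "(\<Sum>i\<in>UNIV. p i) = 1"
    and p_centered: "(\<Sum>i\<in>UNIV. p i *\<^sub>R q i) = 0"
    and on_circle: "0 < p i \<Longrightarrow> norm (q i) = R"
    and off_circle: "p i = 0 \<Longrightarrow> norm (q i) \<noteq> R"
    and e_norm: "norm e1 = 1" "norm e2 = 1"
    and e_orth: "e1 \<bullet> e2 = 0"
    and eigen1: "(\<Sum>i\<in>UNIV. (p i * (q i \<bullet> e1)) *\<^sub>R q i) = mu1 *\<^sub>R e1"
    and eigen2: "(\<Sum>i\<in>UNIV. (p i * (q i \<bullet> e2)) *\<^sub>R q i) = mu2 *\<^sub>R e2"
    and mu_nonneg: "0 \<le> mu1"
    and mu_le: "mu1 \<le> mu2"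
begin

text \<open>
  The covariance of \<open>q\<close> under \<open>p\<close>; it is the derivative of \<open>F p\<close> at \<open>0\<close>.
\<close>
definition M :: "complex \<Rightarrow> complex"
  where "M y = (\<Sum>i\<in>UNIV. (p i * (q i \<bullet> y)) *\<^sub>R q i)"

text \<open>
  The seminorm \<open>sqrt (M y \<bullet> y)\<close>: the size of \<open>y\<close> as far as the active weights can see it.
\<close>
definition Mnorm :: "complex \<Rightarrow> real"
  where "Mnorm y = sqrt (\<Sum>i\<in>UNIV. p i * (q i \<bullet> y)\<^sup>2)"

text \<open>
  In the linearization at the torus, an inactive coordinate grows like \<open>exp (kap i * t)\<close>, relative to the active ones.
\<close>
definition kap :: "'n \<Rightarrow> real"
  where "kap i = 2 * (R\<^sup>2 - (norm (q i))\<^sup>2)"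

text \<open>
  A weight is written as \<open>m i * exp (q i \<bullet> y)\<close>. Fixing the active masses to be \<open>p\<close> leaves only \<open>y\<close>
  to describe the active weights.
\<close>
definition mass_profile :: "('n \<Rightarrow> real) \<Rightarrow> bool"
  where "mass_profile m \<longleftrightarrow> (\<forall>i. 0 \<le> m i \<and> (0 < p i \<longrightarrow> m i = p i))"

definition Z :: "('n \<Rightarrow> real) \<Rightarrow> complex \<Rightarrow> real"
  where "Z m y = (\<Sum>i\<in>UNIV. m i * exp (q i \<bullet> y))"

text \<open>
  The gradient of \<open>ln (Z m y)\<close> with respect to \<open>y\<close>, or the mean of \<open>q\<close> under the normalized weights.
\<close>
definition F :: "('n \<Rightarrow> real) \<Rightarrow> complex \<Rightarrow> complex"
  where "F m y = (\<Sum>i\<in>UNIV. (m i * exp (q i \<bullet> y)) *\<^sub>R q i) /\<^sub>R Z m y"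

definition inactive_mass :: "('n \<Rightarrow> real) \<Rightarrow> complex \<Rightarrow> real"
  where "inactive_mass m y = (\<Sum>k\<in>{k. p k = 0}. m k * exp (q k \<bullet> y))"

definition evol :: "('n \<Rightarrow> real) \<Rightarrow> real \<Rightarrow> 'n \<Rightarrow> real"
  where "evol m t i = m i * exp (2 * kap i * t)"

text \<open>
  Solutions live on the whole time axis, since they are prescribed at time \<open>0\<close> as well as at a terminal time.
\<close>
definition solution :: "('n \<Rightarrow> real) \<Rightarrow> (real \<Rightarrow> complex) \<Rightarrow> bool"
  where "solution m y \<longleftrightarrow> (\<forall>t. (y has_vector_derivative 8 *\<^sub>R F (evol m t) (y t)) (at t))"

definition B :: real
  where "B = (\<Sum>i\<in>UNIV. norm (q i)) + 1"

lemma B: "norm (q i) \<le> B" "1 \<le> B" "0 < B" "0 \<le> B"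
proof -
  have "norm (q i) \<le> (\<Sum>i\<in>UNIV. norm (q i))" by (rule member_le_sum) auto
  then show "norm (q i) \<le> B" by (simp add: B_def)
  show "1 \<le> B" by (simp add: B_def sum_nonneg)
  then show "0 < B" "0 \<le> B" by auto
qed

lemma inner_q_le: "\<bar>q i \<bullet> h\<bar> \<le> B * norm h"
  using Cauchy_Schwarz_ineq2[of "q i" h] mult_right_mono[OF B(1)[of i], of "norm h"] by simp

lemma eigen_expansion: "y = (y \<bullet> e1) *\<^sub>R e1 + (y \<bullet> e2) *\<^sub>R e2"
proof -
  have n: "(Re e1)\<^sup>2 + (Im e1)\<^sup>2 = 1" "(Re e2)\<^sup>2 + (Im e2)\<^sup>2 = 1"
    using e_norm by (auto simp: cmod_def)
  have o: "Re e1 * Re e2 + Im e1 * Im e2 = 0" using e_orth by (simp add: inner_complex_def)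
  have "(Re e1)\<^sup>2 + (Re e2)\<^sup>2 = 1" "(Im e1)\<^sup>2 + (Im e2)\<^sup>2 = 1" "Re e1 * Im e1 + Re e2 * Im e2 = 0"
    using n o by algebra+
  then show ?thesis
    by (simp add: complex_eq_iff inner_complex_def) algebra
qed

lemma inner_eigen: "x \<bullet> y = (x \<bullet> e1) * (y \<bullet> e1) + (x \<bullet> e2) * (y \<bullet> e2)"
  by (subst eigen_expansion[of y]) (simp add: inner_add_right)

lemma norm_eigen: "(norm y)\<^sup>2 = (y \<bullet> e1)\<^sup>2 + (y \<bullet> e2)\<^sup>2"
  unfolding power2_norm_eq_inner inner_eigen[of y y] by (simp add: power2_eq_square)

lemma M_linear: "linear M"
  unfolding M_def
  by (intro linearI) (simp_all add: inner_add_right algebra_simps sum.distrib scaleR_sum_right)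

lemma M_eigen: "M y = (mu1 * (y \<bullet> e1)) *\<^sub>R e1 + (mu2 * (y \<bullet> e2)) *\<^sub>R e2"
proof -
  have "M e1 = mu1 *\<^sub>R e1" "M e2 = mu2 *\<^sub>R e2" using eigen1 eigen2 by (simp_all add: M_def)
  then show ?thesis
    by (subst eigen_expansion[of y])
      (simp add: linear_add[OF M_linear] linear_scale[OF M_linear] mult.commute)
qed

lemma M_inner: "M y \<bullet> e1 = mu1 * (y \<bullet> e1)" "M y \<bullet> e2 = mu2 * (y \<bullet> e2)"
  using e_orth e_norm
  by (auto simp: M_eigen inner_add_left inner_commute[of e2 e1] power2_norm_eq_inner[symmetric])

lemma Mnorm_sq: "(Mnorm y)\<^sup>2 = (\<Sum>i\<in>UNIV. p i * (q i \<bullet> y)\<^sup>2)"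
  unfolding Mnorm_def by (rule real_sqrt_pow2) (auto intro!: sum_nonneg mult_nonneg_nonneg p_nonneg)

lemma Mnorm_nonneg: "0 \<le> Mnorm y"
  unfolding Mnorm_def by (auto intro!: real_sqrt_ge_zero sum_nonneg mult_nonneg_nonneg p_nonneg)

lemma Mnorm_sq_inner: "(Mnorm y)\<^sup>2 = M y \<bullet> y"
  unfolding Mnorm_sq M_def inner_sum_left by (simp add: power2_eq_square mult.assoc)

lemma Mnorm_eigen: "(Mnorm y)\<^sup>2 = mu1 * (y \<bullet> e1)\<^sup>2 + mu2 * (y \<bullet> e2)\<^sup>2"
  unfolding Mnorm_sq_inner M_eigen inner_add_left by (simp add: inner_commute[of _ y] power2_eq_square)

lemma Mnorm_L2: "Mnorm y = L2_set (\<lambda>i. sqrt (p i) * (q i \<bullet> y)) UNIV"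
  unfolding Mnorm_def L2_set_def by (simp add: power_mult_distrib p_nonneg)

lemma Mnorm_triangle: "Mnorm (x + y) \<le> Mnorm x + Mnorm y"
  unfolding Mnorm_L2 using L2_set_triangle_ineq[of "\<lambda>i. sqrt (p i) * (q i \<bullet> x)" "\<lambda>i. sqrt (p i) * (q i \<bullet> y)" UNIV]
  by (simp add: inner_add_right distrib_left)

lemma Mnorm_scale: "Mnorm (c *\<^sub>R y) = \<bar>c\<bar> * Mnorm y"
proof -
  have "(\<Sum>i\<in>UNIV. p i * (q i \<bullet> (c *\<^sub>R y))\<^sup>2) = c\<^sup>2 * (\<Sum>i\<in>UNIV. p i * (q i \<bullet> y)\<^sup>2)"
    by (simp add: sum_distrib_left power_mult_distrib mult.left_commute)
  then show ?thesis by (simp add: Mnorm_def real_sqrt_mult)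
qed

lemma weighted_abs_le_Mnorm: "(\<Sum>i\<in>UNIV. p i * \<bar>q i \<bullet> y\<bar>) \<le> Mnorm y"
proof -
  define a where "a = (\<Sum>i\<in>UNIV. p i * \<bar>q i \<bullet> y\<bar>)"
  have "0 \<le> (\<Sum>i\<in>UNIV. p i * (\<bar>q i \<bullet> y\<bar> - a)\<^sup>2)" by (auto intro!: sum_nonneg mult_nonneg_nonneg p_nonneg)
  also have "\<dots> = (\<Sum>i\<in>UNIV. p i * (q i \<bullet> y)\<^sup>2 - 2 * a * (p i * \<bar>q i \<bullet> y\<bar>) + a\<^sup>2 * p i)"
    by (intro sum.cong refl) (simp add: power2_diff algebra_simps)
  also have "\<dots> = (Mnorm y)\<^sup>2 - a\<^sup>2"
    by (simp add: sum.distrib sum_subtractf sum_distrib_left[symmetric] p_sum Mnorm_sq a_def[symmetric] power2_eq_square[of a])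
  finally have "a\<^sup>2 \<le> (Mnorm y)\<^sup>2" by simp
  then show ?thesis using Mnorm_nonneg unfolding a_def[symmetric] by (rule power2_le_imp_le)
qed

lemma Mnorm_le_norm: "Mnorm y \<le> B * norm y"
proof (rule power2_le_imp_le)
  have "(Mnorm y)\<^sup>2 \<le> (\<Sum>i\<in>UNIV. p i * (B * norm y)\<^sup>2)"
    unfolding Mnorm_sq using inner_q_le by (intro sum_mono mult_left_mono p_nonneg) (metis abs_ge_zero power2_abs power_mono)
  also have "\<dots> = (B * norm y)\<^sup>2" by (simp add: sum_distrib_right[symmetric] p_sum)
  finally show "(Mnorm y)\<^sup>2 \<le> (B * norm y)\<^sup>2" .
qed (use B in simp)

lemma norm_M_le: "norm (M y) \<le> B * Mnorm y"
proof -
  have "norm (M y) \<le> (\<Sum>i\<in>UNIV. B * (p i * \<bar>q i \<bullet> y\<bar>))"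
    unfolding M_def
    by (rule sum_norm_le) (simp add: abs_mult p_nonneg mult.commute[of B] mult_left_mono B(1))
  also have "\<dots> \<le> B * Mnorm y"
    unfolding sum_distrib_left[symmetric] by (intro mult_left_mono weighted_abs_le_Mnorm B)
  finally show ?thesis .
qed

lemma sum_p_inner: "(\<Sum>i\<in>UNIV. p i * (q i \<bullet> y)) = 0"
proof -
  have "(\<Sum>i\<in>UNIV. p i * (q i \<bullet> y)) = (\<Sum>i\<in>UNIV. p i *\<^sub>R q i) \<bullet> y"
    by (simp add: inner_sum_left)
  then show ?thesis by (simp add: p_centered)
qed

definition inact :: "('n \<Rightarrow> real) \<Rightarrow> complex \<Rightarrow> 'n \<Rightarrow> real"
  where "inact m y i = (if p i = 0 then m i * exp (q i \<bullet> y) else 0)"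

lemma inact_nonneg: "mass_profile m \<Longrightarrow> 0 \<le> inact m y i"
  by (simp add: inact_def mass_profile_def)

lemma mass_profile_split: "mass_profile m \<Longrightarrow> m i * exp (q i \<bullet> y) = p i * exp (q i \<bullet> y) + inact m y i"
  using p_nonneg[of i] by (cases "p i = 0") (auto simp: inact_def mass_profile_def)

lemma inactive_mass_inact: "inactive_mass m y = (\<Sum>i\<in>UNIV. inact m y i)"
  unfolding inactive_mass_def inact_def by (subst sum.If_cases) auto

lemma inactive_mass_nonneg: "mass_profile m \<Longrightarrow> 0 \<le> inactive_mass m y"
  unfolding inactive_mass_inact by (intro sum_nonneg inact_nonneg)

text \<open>
  Below this size of \<open>y\<close> all exponents \<open>q i \<bullet> y\<close> of active weights are at most one in absolute value, so that \<open>exp\<close> can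
  be expanded.
\<close>
definition N0 :: real
  where "N0 = min 1 (sqrt (Min (p ` {i. 0 < p i})))"

lemma active_nonempty: "{i. 0 < p i} \<noteq> {}"
proof
  assume "{i. 0 < p i} = {}"
  then have "p i = 0" for i using p_nonneg[of i] by (metis (mono_tags) empty_Collect_eq order_le_less)
  then show False using p_sum by simp
qed

lemma N0: "0 < N0" "N0 \<le> 1"
  unfolding N0_def using active_nonempty by (auto simp: Min_gr_iff)

lemma Mnorm_small_imp: "Mnorm y \<le> N0 \<Longrightarrow> 0 < p i \<Longrightarrow> \<bar>q i \<bullet> y\<bar> \<le> 1"
proof -
  assume a: "Mnorm y \<le> N0" "0 < p i"
  have "p i * (q i \<bullet> y)\<^sup>2 \<le> (Mnorm y)\<^sup>2"
    unfolding Mnorm_sq by (rule member_le_sum) (auto intro!: mult_nonneg_nonneg p_nonneg)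
  also have "\<dots> \<le> N0\<^sup>2" using a Mnorm_nonneg by (intro power_mono) auto
  also have "\<dots> \<le> (sqrt (Min (p ` {i. 0 < p i})))\<^sup>2"
    using N0 unfolding N0_def by (intro power_mono) auto
  also have "\<dots> = Min (p ` {i. 0 < p i})"
    using active_nonempty by (intro real_sqrt_pow2 order_less_imp_le) (auto simp: Min_gr_iff)
  also have "\<dots> \<le> p i" using a by (intro Min_le) auto
  finally have "(q i \<bullet> y)\<^sup>2 \<le> 1" using a by simp
  then show ?thesis by (simp add: abs_square_le_1)
qed

lemma exp_weight_bounds:
  assumes "Mnorm y \<le> N0"
  shows "0 \<le> p i * (exp (q i \<bullet> y) - 1 - q i \<bullet> y)"
    and "p i * (exp (q i \<bullet> y) - 1 - q i \<bullet> y) \<le> p i * (q i \<bullet> y)\<^sup>2"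
    and "p i * \<bar>exp (q i \<bullet> y) - 1\<bar> \<le> 2 * (p i * \<bar>q i \<bullet> y\<bar>)"
proof -
  have *: "p i = 0 \<or> (0 < p i \<and> \<bar>q i \<bullet> y\<bar> \<le> 1)"
    using Mnorm_small_imp[OF assms, of i] p_nonneg[of i] by linarith
  then show "0 \<le> p i * (exp (q i \<bullet> y) - 1 - q i \<bullet> y)"
    using exp_ge_add_one_self[of "q i \<bullet> y"] p_nonneg[of i] by (intro mult_nonneg_nonneg) linarith+
  show "p i * (exp (q i \<bullet> y) - 1 - q i \<bullet> y) \<le> p i * (q i \<bullet> y)\<^sup>2"
    using * exp_quadratic_bounds(2)[of "q i \<bullet> y"] by auto
  show "p i * \<bar>exp (q i \<bullet> y) - 1\<bar> \<le> 2 * (p i * \<bar>q i \<bullet> y\<bar>)"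
    using * exp_quadratic_bounds(3)[of "q i \<bullet> y"] by (auto simp: mult.left_commute)
qed

lemma Z_bounds:
  assumes m: "mass_profile m" and y: "Mnorm y \<le> N0"
  shows "1 \<le> Z m y" and "Z m y - 1 \<le> (Mnorm y)\<^sup>2 + inactive_mass m y"
proof -
  have "Z m y = (\<Sum>i\<in>UNIV. p i * (exp (q i \<bullet> y) - 1 - q i \<bullet> y) + p i + p i * (q i \<bullet> y) + inact m y i)"
    unfolding Z_def by (intro sum.cong refl) (simp add: mass_profile_split[OF m] algebra_simps)
  also have "\<dots> = (\<Sum>i\<in>UNIV. p i * (exp (q i \<bullet> y) - 1 - q i \<bullet> y)) + 1 + inactive_mass m y"
    by (simp add: sum.distrib p_sum sum_p_inner inactive_mass_inact)
  finally have e: "Z m y = (\<Sum>i\<in>UNIV. p i * (exp (q i \<bullet> y) - 1 - q i \<bullet> y)) + 1 + inactive_mass m y" .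
  have "0 \<le> (\<Sum>i\<in>UNIV. p i * (exp (q i \<bullet> y) - 1 - q i \<bullet> y))"
    by (intro sum_nonneg exp_weight_bounds y)
  then show "1 \<le> Z m y" using inactive_mass_nonneg[OF m, of y] e by simp
  have "(\<Sum>i\<in>UNIV. p i * (exp (q i \<bullet> y) - 1 - q i \<bullet> y)) \<le> (Mnorm y)\<^sup>2"
    unfolding Mnorm_sq by (intro sum_mono exp_weight_bounds y)
  then show "Z m y - 1 \<le> (Mnorm y)\<^sup>2 + inactive_mass m y" using e by simp
qed

text \<open>
  In the numerator the constant terms of the active exponentials cancel because \<open>q\<close> is centered, the linear terms add up to \<open>M y\<close>,
  and the rest is of the order of \<open>(Mnorm y)\<^sup>2\<close>; every inactive weight is an error of the size of its mass. The
  denominator differs from one by an error of the same size.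
\<close>
lemma F_approx:
  assumes m: "mass_profile m" and y: "Mnorm y \<le> N0"
  shows "norm (F m y - M y) \<le> 2 * B * ((Mnorm y)\<^sup>2 + inactive_mass m y)"
proof -
  note Z = Z_bounds[OF m y]
  have num: "(\<Sum>i\<in>UNIV. (m i * exp (q i \<bullet> y)) *\<^sub>R q i) - M y =
     (\<Sum>i\<in>UNIV. (p i * (exp (q i \<bullet> y) - 1 - q i \<bullet> y) + inact m y i) *\<^sub>R q i)"
  proof -
    have "(\<Sum>i\<in>UNIV. (m i * exp (q i \<bullet> y)) *\<^sub>R q i) - M y - 0 =
       (\<Sum>i\<in>UNIV. (m i * exp (q i \<bullet> y)) *\<^sub>R q i - (p i * (q i \<bullet> y)) *\<^sub>R q i - p i *\<^sub>R q i)"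
      unfolding p_centered[symmetric] M_def by (simp add: sum_subtractf)
    also have "\<dots> = (\<Sum>i\<in>UNIV. (p i * (exp (q i \<bullet> y) - 1 - q i \<bullet> y) + inact m y i) *\<^sub>R q i)"
      by (intro sum.cong refl) (simp add: mass_profile_split[OF m] algebra_simps)
    finally show ?thesis by simp
  qed
  have n1: "norm ((\<Sum>i\<in>UNIV. (m i * exp (q i \<bullet> y)) *\<^sub>R q i) - M y) \<le> B * ((Mnorm y)\<^sup>2 + inactive_mass m y)"
  proof -
    have "norm ((\<Sum>i\<in>UNIV. (m i * exp (q i \<bullet> y)) *\<^sub>R q i) - M y) \<le> (\<Sum>i\<in>UNIV. B * (p i * (q i \<bullet> y)\<^sup>2 + inact m y i))"
      unfolding num
    proof (rule sum_norm_le)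
      fix i
      have *: "0 \<le> p i * (exp (q i \<bullet> y) - 1 - q i \<bullet> y) + inact m y i"
        using exp_weight_bounds[OF y, of i] inact_nonneg[OF m, of y i] by simp
      show "norm ((p i * (exp (q i \<bullet> y) - 1 - q i \<bullet> y) + inact m y i) *\<^sub>R q i) \<le> B * (p i * (q i \<bullet> y)\<^sup>2 + inact m y i)"
        using * exp_weight_bounds(2)[OF y, of i] B
        by (simp only: norm_scaleR abs_of_nonneg[OF *] mult.commute[of B], intro mult_mono) auto
    qed
    also have "\<dots> = B * ((Mnorm y)\<^sup>2 + inactive_mass m y)"
      by (simp add: sum_distrib_left[symmetric] sum.distrib Mnorm_sq inactive_mass_inact)
    finally show ?thesis .
  qed
  have n2: "norm ((Z m y - 1) *\<^sub>R M y) \<le> ((Mnorm y)\<^sup>2 + inactive_mass m y) * B"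
  proof -
    have "norm (M y) \<le> B * 1" using norm_M_le[of y] y N0 B
      by (meson mult_left_mono order_trans)
    then show ?thesis using Z by (simp only: norm_scaleR) (intro mult_mono, auto)
  qed
  have "F m y - M y = (((\<Sum>i\<in>UNIV. (m i * exp (q i \<bullet> y)) *\<^sub>R q i) - M y) - (Z m y - 1) *\<^sub>R M y) /\<^sub>R Z m y"
    using Z unfolding F_def by (simp add: scaleR_diff_right scaleR_diff_left divide_simps)
  also have "norm \<dots> \<le> norm (((\<Sum>i\<in>UNIV. (m i * exp (q i \<bullet> y)) *\<^sub>R q i) - M y) - (Z m y - 1) *\<^sub>R M y)"
    using Z by (simp add: divide_simps mult_le_cancel_left1)
  also have "\<dots> \<le> 2 * B * ((Mnorm y)\<^sup>2 + inactive_mass m y)"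
    using norm_triangle_ineq4[of "(\<Sum>i\<in>UNIV. (m i * exp (q i \<bullet> y)) *\<^sub>R q i) - M y" "(Z m y - 1) *\<^sub>R M y"] n1 n2
    by (simp add: algebra_simps)
  finally show ?thesis .
qed

lemma F_small:
  assumes m: "mass_profile m" and y: "Mnorm y \<le> N0"
  shows "norm (F m y) \<le> 3 * B * (Mnorm y + inactive_mass m y)"
proof -
  have "(Mnorm y)\<^sup>2 \<le> Mnorm y" using y N0 Mnorm_nonneg[of y]
    by (simp add: power2_eq_square mult_left_le)
  then have "2 * B * ((Mnorm y)\<^sup>2 + inactive_mass m y) \<le> 2 * B * (Mnorm y + inactive_mass m y)" using B by (intro mult_left_mono) auto
  moreover have "norm (F m y) \<le> norm (M y) + norm (F m y - M y)" by (metis add_diff_cancel_left' diff_add_cancel norm_triangle_ineq add.commute)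
  moreover have "0 \<le> B * inactive_mass m y" using B inactive_mass_nonneg[OF m] by simp
  ultimately show ?thesis using F_approx[OF m y] norm_M_le[of y] by (simp add: algebra_simps)
qed

text \<open>
  The covariance of \<open>q\<close> under the normalized weights, applied to \<open>h\<close>.
\<close>
definition DF :: "('n \<Rightarrow> real) \<Rightarrow> complex \<Rightarrow> complex \<Rightarrow> complex"
  where "DF m y h = (\<Sum>i\<in>UNIV. (m i * exp (q i \<bullet> y) / Z m y * (q i \<bullet> h)) *\<^sub>R q i) - (F m y \<bullet> h) *\<^sub>R F m y"

lemma F_has_derivative:
  assumes Z: "Z m y \<noteq> 0"
  shows "(F m has_derivative DF m y) (at y)"
proof -
  have dZ: "(Z m has_derivative (\<lambda>h. \<Sum>i\<in>UNIV. m i * exp (q i \<bullet> y) * (q i \<bullet> h))) (at y)"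
    unfolding Z_def by (rule derivative_eq_intros refl)+ (simp add: mult_ac)
  have dI: "((\<lambda>y. inverse (Z m y)) has_derivative (\<lambda>h. - (inverse (Z m y) * (\<Sum>i\<in>UNIV. m i * exp (q i \<bullet> y) * (q i \<bullet> h)) * inverse (Z m y)))) (at y)"
    by (rule Deriv.has_derivative_inverse[OF Z dZ])
  have dN: "((\<lambda>y. \<Sum>i\<in>UNIV. (m i * exp (q i \<bullet> y)) *\<^sub>R q i) has_derivative
     (\<lambda>h. \<Sum>i\<in>UNIV. (m i * exp (q i \<bullet> y) * (q i \<bullet> h)) *\<^sub>R q i)) (at y)"
    by (rule derivative_eq_intros refl)+ (simp add: mult_ac)
  have Fh: "F m y \<bullet> h = (\<Sum>i\<in>UNIV. m i * exp (q i \<bullet> y) * (q i \<bullet> h)) / Z m y" for h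
    by (simp add: F_def inner_sum_left divide_inverse mult.commute)
  have "((\<lambda>y. inverse (Z m y) *\<^sub>R (\<Sum>i\<in>UNIV. (m i * exp (q i \<bullet> y)) *\<^sub>R q i)) has_derivative DF m y) (at y)"
    apply (rule has_derivative_eq_rhs[OF has_derivative_scaleR[OF dI dN]])
    unfolding DF_def Fh
    by (rule ext) (simp add: F_def scaleR_sum_right divide_inverse mult_ac sum_negf)
  then show ?thesis unfolding F_def[abs_def] .
qed

text \<open>
  The normalized weights differ from \<open>p\<close> by at most \<open>3 * (Mnorm y + inactive_mass m y)\<close> in \<open>\<ell>\<^sup>1\<close>, and the covariances
  differ accordingly; the mean \<open>F m y\<close>, which vanishes for \<open>p\<close>, enters quadratically.
\<close>
lemma DF_approx:
  assumes m: "mass_profile m" and y: "Mnorm y \<le> N0" and n: "inactive_mass m y \<le> 1"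
  shows "norm (DF m y h - M h) \<le> 21 * B\<^sup>2 * (Mnorm y + inactive_mass m y) * norm h"
proof -
  note Z = Z_bounds[OF m y]
  have sq: "(Mnorm y)\<^sup>2 \<le> Mnorm y" using y N0 Mnorm_nonneg[of y] by (simp add: power2_eq_square mult_left_le)
  let ?\<pi> = "\<lambda>i. m i * exp (q i \<bullet> y) / Z m y"
  have pd: "\<bar>?\<pi> i - p i\<bar> \<le> 2 * (p i * \<bar>q i \<bullet> y\<bar>) + p i * ((Mnorm y)\<^sup>2 + inactive_mass m y) + inact m y i" for i
  proof -
    have "?\<pi> i - p i = (p i * (exp (q i \<bullet> y) - 1) - p i * (Z m y - 1) + inact m y i) / Z m y"
      using Z by (simp add: mass_profile_split[OF m] field_simps)
    then have "\<bar>?\<pi> i - p i\<bar> = \<bar>p i * (exp (q i \<bullet> y) - 1) - p i * (Z m y - 1) + inact m y i\<bar> / Z m y"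
      using Z by (simp add: abs_divide)
    also have "\<dots> \<le> \<bar>p i * (exp (q i \<bullet> y) - 1) - p i * (Z m y - 1) + inact m y i\<bar>"
      using Z by (simp add: divide_simps mult_le_cancel_left1)
    also have "\<dots> \<le> \<bar>p i * (exp (q i \<bullet> y) - 1)\<bar> + \<bar>p i * (Z m y - 1)\<bar> + \<bar>inact m y i\<bar>" by linarith
    also have "\<bar>p i * (Z m y - 1)\<bar> \<le> p i * ((Mnorm y)\<^sup>2 + inactive_mass m y)"
      using Z p_nonneg[of i] by (simp add: abs_mult mult_left_mono)
    finally show ?thesis using exp_weight_bounds(3)[OF y, of i] inact_nonneg[OF m, of y i] p_nonneg[of i]
      by (simp add: abs_mult)
  qed
  have s: "(\<Sum>i\<in>UNIV. \<bar>?\<pi> i - p i\<bar>) \<le> 3 * (Mnorm y + inactive_mass m y)"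
  proof -
    have "(\<Sum>i\<in>UNIV. \<bar>?\<pi> i - p i\<bar>) \<le> (\<Sum>i\<in>UNIV. 2 * (p i * \<bar>q i \<bullet> y\<bar>) + p i * ((Mnorm y)\<^sup>2 + inactive_mass m y) + inact m y i)"
      by (intro sum_mono pd)
    also have "\<dots> = 2 * (\<Sum>i\<in>UNIV. p i * \<bar>q i \<bullet> y\<bar>) + ((Mnorm y)\<^sup>2 + inactive_mass m y) + inactive_mass m y"
      by (simp add: sum.distrib sum_distrib_left[symmetric] sum_distrib_right[symmetric] p_sum inactive_mass_inact)
    also have "\<dots> \<le> 3 * (Mnorm y + inactive_mass m y)" using weighted_abs_le_Mnorm[of y] sq inactive_mass_nonneg[OF m, of y] by simp
    finally show ?thesis .
  qed
  have a: "norm (\<Sum>i\<in>UNIV. ((?\<pi> i - p i) * (q i \<bullet> h)) *\<^sub>R q i) \<le> 3 * B\<^sup>2 * (Mnorm y + inactive_mass m y) * norm h"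
  proof -
    have "norm (\<Sum>i\<in>UNIV. ((?\<pi> i - p i) * (q i \<bullet> h)) *\<^sub>R q i) \<le> (\<Sum>i\<in>UNIV. \<bar>?\<pi> i - p i\<bar> * (B\<^sup>2 * norm h))"
    proof (rule sum_norm_le)
      fix i
      have "\<bar>q i \<bullet> h\<bar> * norm (q i) \<le> (B * norm h) * B" by (intro mult_mono inner_q_le B) (use B in auto)
      then have "\<bar>?\<pi> i - p i\<bar> * (\<bar>q i \<bullet> h\<bar> * norm (q i)) \<le> \<bar>?\<pi> i - p i\<bar> * (B\<^sup>2 * norm h)"
        by (intro mult_left_mono) (auto simp: power2_eq_square mult_ac)
      then show "norm (((?\<pi> i - p i) * (q i \<bullet> h)) *\<^sub>R q i) \<le> \<bar>?\<pi> i - p i\<bar> * (B\<^sup>2 * norm h)"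
        by (simp add: abs_mult mult.assoc)
    qed
    also have "\<dots> \<le> 3 * (Mnorm y + inactive_mass m y) * (B\<^sup>2 * norm h)"
      unfolding sum_distrib_right[symmetric] by (intro mult_right_mono s) auto
    also have "\<dots> = 3 * B\<^sup>2 * (Mnorm y + inactive_mass m y) * norm h" by (simp only: mult_ac)
    finally show ?thesis .
  qed
  have b: "norm ((F m y \<bullet> h) *\<^sub>R F m y) \<le> 18 * B\<^sup>2 * (Mnorm y + inactive_mass m y) * norm h"
  proof -
    have w: "Mnorm y + inactive_mass m y \<le> 2" "0 \<le> Mnorm y + inactive_mass m y" using y N0 n Mnorm_nonneg[of y] inactive_mass_nonneg[OF m, of y] by auto
    have "norm (F m y) * norm (F m y) \<le> (3 * B * (Mnorm y + inactive_mass m y)) * (3 * B * 2)"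
      using F_small[OF m y] w B by (intro mult_mono) (auto intro!: order_trans[OF F_small[OF m y]])
    then have "norm (F m y) * norm h * norm (F m y) \<le> 18 * B\<^sup>2 * (Mnorm y + inactive_mass m y) * norm h"
      using mult_right_mono[of _ _ "norm h"] by (fastforce simp: power2_eq_square mult_ac)
    moreover have "norm ((F m y \<bullet> h) *\<^sub>R F m y) \<le> norm (F m y) * norm h * norm (F m y)"
      by (simp add: Cauchy_Schwarz_ineq2 mult_right_mono)
    ultimately show ?thesis by linarith
  qed
  have "DF m y h - M h = (\<Sum>i\<in>UNIV. ((?\<pi> i - p i) * (q i \<bullet> h)) *\<^sub>R q i) - (F m y \<bullet> h) *\<^sub>R F m y"
    unfolding DF_def M_def by (simp add: sum_subtractf[symmetric] algebra_simps)
  then have "norm (DF m y h - M h) \<le> norm (\<Sum>i\<in>UNIV. ((?\<pi> i - p i) * (q i \<bullet> h)) *\<^sub>R q i)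
      + norm ((F m y \<bullet> h) *\<^sub>R F m y)"
    by (simp only: norm_triangle_ineq4)
  also have "\<dots> \<le> 3 * B\<^sup>2 * (Mnorm y + inactive_mass m y) * norm h + 18 * B\<^sup>2 * (Mnorm y + inactive_mass m y) * norm h"
    by (rule add_mono[OF a b])
  also have "\<dots> = 21 * B\<^sup>2 * (Mnorm y + inactive_mass m y) * norm h" by (simp add: algebra_simps)
  finally show ?thesis .
qed

lemma inactive_mass_convex:
  assumes m: "mass_profile m" and s: "0 \<le> s" "s \<le> 1"
  shows "inactive_mass m ((1 - s) *\<^sub>R x + s *\<^sub>R y) \<le> (1 - s) * inactive_mass m x + s * inactive_mass m y"
proof -
  have "m k * exp (q k \<bullet> ((1 - s) *\<^sub>R x + s *\<^sub>R y)) \<le> m k * ((1 - s) * exp (q k \<bullet> x) + s * exp (q k \<bullet> y))" for k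
  proof (rule mult_left_mono)
    from convex_onD[OF exp_convex s] show "exp (q k \<bullet> ((1 - s) *\<^sub>R x + s *\<^sub>R y)) \<le> (1 - s) * exp (q k \<bullet> x) + s * exp (q k \<bullet> y)"
      by (simp add: inner_add_right)
  qed (use m in \<open>simp add: mass_profile_def\<close>)
  then have "inactive_mass m ((1 - s) *\<^sub>R x + s *\<^sub>R y) \<le> (\<Sum>k\<in>{k. p k = 0}. m k * ((1 - s) * exp (q k \<bullet> x) + s * exp (q k \<bullet> y)))"
    unfolding inactive_mass_def by (rule sum_mono)
  also have "\<dots> = (1 - s) * inactive_mass m x + s * inactive_mass m y"
    unfolding inactive_mass_def by (simp add: sum_distrib_left sum.distrib sum_subtractf algebra_simps)
  finally show ?thesis .
qed

text \<open>
  The mean value inequality for \<open>F m - M\<close> on the segment between the two points. The bound of the derivative is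
  controlled by the end points because \<open>Mnorm\<close> and \<open>inactive_mass\<close> are convex.
\<close>
lemma F_pair:
  assumes m: "mass_profile m" and y: "Mnorm y \<le> N0" "Mnorm x \<le> N0" and n: "inactive_mass m y \<le> 1" "inactive_mass m x \<le> 1"
  shows "norm (F m y - F m x - M (y - x)) \<le> 21 * B\<^sup>2 * (Mnorm y + Mnorm x + inactive_mass m y + inactive_mass m x) * norm (y - x)"
proof -
  define K where "K = 21 * B\<^sup>2 * (Mnorm y + Mnorm x + inactive_mass m y + inactive_mass m x)"
  have seg: "Mnorm z \<le> N0 \<and> inactive_mass m z \<le> 1 \<and> Mnorm z + inactive_mass m z \<le> Mnorm y + Mnorm x + inactive_mass m y + inactive_mass m x"
    if z: "z \<in> closed_segment x y" for z
  proof -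
    obtain s where s: "0 \<le> s" "s \<le> 1" "z = (1 - s) *\<^sub>R x + s *\<^sub>R y"
      using z by (auto simp: in_segment)
    have a: "Mnorm z \<le> (1 - s) * Mnorm x + s * Mnorm y"
      using Mnorm_triangle[of "(1 - s) *\<^sub>R x" "s *\<^sub>R y"] s by (simp add: Mnorm_scale)
    have b: "inactive_mass m z \<le> (1 - s) * inactive_mass m x + s * inactive_mass m y" using inactive_mass_convex[OF m s(1,2)] s(3) by simp
    have c: "(1 - s) * u + s * v \<le> w" if "u \<le> w" "v \<le> w" for u v w :: real
      using convex_bound_le[OF that, of "1 - s" s] s by simp
    have "(1 - s) * u + s * v \<le> u + v" if "0 \<le> u" "0 \<le> v" for u v :: real
      using that s mult_left_le_one_le[of u "1-s"] mult_left_le_one_le[of v s] by simp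
    then have "(1 - s) * Mnorm x + s * Mnorm y \<le> Mnorm x + Mnorm y" "(1 - s) * inactive_mass m x + s * inactive_mass m y \<le> inactive_mass m x + inactive_mass m y"
      by (simp_all add: Mnorm_nonneg inactive_mass_nonneg[OF m])
    then show ?thesis using a b c[OF y(2,1)] c[OF n(2,1)] by linarith
  qed
  have "norm ((F m y - M y) - (F m x - M x)) \<le> K * norm (y - x)"
  proof (rule differentiable_bound[where f' = "\<lambda>z h. DF m z h - M h" and S = "closed_segment x y"])
    fix z assume z: "z \<in> closed_segment x y"
    have "Z m z \<noteq> 0" using Z_bounds(1)[OF m, of z] seg[OF z] by linarith
    then show "((\<lambda>z. F m z - M z) has_derivative (\<lambda>h. DF m z h - M h)) (at z within closed_segment x y)"
      using M_linear
      by (intro has_derivative_diff has_derivative_at_withinI[OF F_has_derivative]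
          linear_imp_has_derivative) auto
    show "onorm (\<lambda>h. DF m z h - M h) \<le> K"
    proof (rule onorm_le)
      fix h
      have "21 * B\<^sup>2 * (Mnorm z + inactive_mass m z) \<le> K" unfolding K_def using seg[OF z] by (intro mult_left_mono) auto
      then show "norm (DF m z h - M h) \<le> K * norm h"
        using DF_approx[OF m, of z h] seg[OF z] mult_right_mono[of _ K "norm h"] by force
    qed
  qed auto
  moreover have "(F m y - M y) - (F m x - M x) = F m y - F m x - M (y - x)"
    by (simp add: linear_diff[OF M_linear])
  ultimately show ?thesis by (simp add: K_def)
qed

end

section \<open>Solutions near the torus\<close>

lemma integral_le_increment:
  fixes g g' h :: "real \<Rightarrow> real"
  assumes ab: "a \<le> b"
    and dg: "\<And>t. a \<le> t \<Longrightarrow> t \<le> b \<Longrightarrow> (g has_real_derivative g' t) (at t)"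
    and h: "\<And>t. a \<le> t \<Longrightarrow> t \<le> b \<Longrightarrow> h t \<le> g' t"
    and ch: "continuous_on {a..b} h"
  shows "integral {a..b} h \<le> g b - g a"
proof -
  have G: "(g' has_integral (g b - g a)) {a..b}"
    using dg by (intro fundamental_theorem_of_calculus ab)
      (auto simp: has_real_derivative_iff_has_vector_derivative intro: has_vector_derivative_at_within)
  have "(h has_integral integral {a..b} h) {a..b}"
    by (intro integrable_integral integrable_continuous_real ch)
  from has_integral_le[OF this G] h show ?thesis by simp
qed

lemma has_real_derivative_inner_left:
  assumes "(y has_vector_derivative y') (at t)"
  shows "((\<lambda>t. c \<bullet> y t) has_real_derivative c \<bullet> y') (at t)"
  using bounded_linear.has_vector_derivative[OF bounded_linear_inner_right assms]
  by (simp add: has_real_derivative_iff_has_vector_derivative)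

text \<open>
  A bootstrap argument: the bound \<open>r\<close> on a final piece of the interval improves itself to \<open>r' < r\<close>, so the continuous
  function \<open>f\<close> never reaches \<open>r\<close> when followed backward from \<open>T\<close>.
\<close>
lemma backward_continuation:
  fixes f :: "real \<Rightarrow> real"
  assumes T: "0 \<le> T" and c: "continuous_on {0..T} f" and fT: "f T < r"
    and step: "\<And>s. 0 \<le> s \<Longrightarrow> s \<le> T \<Longrightarrow> (\<And>t. s \<le> t \<Longrightarrow> t \<le> T \<Longrightarrow> f t \<le> r) \<Longrightarrow> f s \<le> r'"
    and r: "r' < r" and t: "0 \<le> t" "t \<le> T"
  shows "f t \<le> r'"
proof -
  have "f t \<le> r" if t: "0 \<le> t" "t \<le> T" for t
  proof (rule ccontr)
    assume n: "\<not> f t \<le> r"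
    have "compact ({0..T} \<inter> f -` {r..})"
      by (intro compact_Int_closed[of "{0..T}" "{0..T} \<inter> f -` {r..}", simplified Int_assoc[symmetric] Int_absorb]
          continuous_closed_preimage c) auto
    moreover have "{0..T} \<inter> f -` {r..} \<noteq> {}" using n t by auto
    ultimately obtain s where s: "s \<in> {0..T} \<inter> f -` {r..}" "\<forall>u\<in>{0..T} \<inter> f -` {r..}. u \<le> s"
      using compact_attains_sup by metis
    have sT: "0 \<le> s" "s \<le> T" "r \<le> f s" using s by auto
    have "f s \<le> r"
    proof (rule ccontr)
      assume "\<not> f s \<le> r"
      then obtain u where u: "s \<le> u" "u \<le> T" "f u = r"
        using IVT2'[of f T r s] fT sT continuous_on_subset[OF c, of "{s..T}"] by auto
      then have "u \<le> s" using s(2) sT by auto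
      then show False using u \<open>\<not> f s \<le> r\<close> by auto
    qed
    have "f u \<le> r" if u: "s \<le> u" "u \<le> T" for u
    proof (cases "r \<le> f u")
      case True
      then have "u = s" using s(2) u sT by (intro antisym) auto
      then show ?thesis using \<open>f s \<le> r\<close> by simp
    qed auto
    from step[OF sT(1,2) this] r sT show False by simp
  qed
  then show ?thesis using step[OF t] t by auto
qed

lemma forward_continuation:
  fixes f :: "real \<Rightarrow> real"
  assumes T: "0 \<le> T" and c: "continuous_on {0..T} f" and f0: "f 0 < r"
    and step: "\<And>s. 0 \<le> s \<Longrightarrow> s \<le> T \<Longrightarrow> (\<And>t. 0 \<le> t \<Longrightarrow> t \<le> s \<Longrightarrow> f t \<le> r) \<Longrightarrow> f s \<le> r'"
    and r: "r' < r" and t: "0 \<le> t" "t \<le> T"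
  shows "f t \<le> r'"
proof -
  have "f (T - (T - t)) \<le> r'"
  proof (rule backward_continuation[where f = "\<lambda>t. f (T - t)" and T = T and r = r])
    show "continuous_on {0..T} (\<lambda>t. f (T - t))"
      by (rule continuous_on_compose2[OF c]) (auto intro!: continuous_intros)
    fix s assume s: "0 \<le> s" "s \<le> T" "\<And>t. s \<le> t \<Longrightarrow> t \<le> T \<Longrightarrow> f (T - t) \<le> r"
    show "f (T - s) \<le> r'"
    proof (rule step)
      fix t assume "0 \<le> t" "t \<le> T - s"
      then show "f t \<le> r" using s(3)[of "T - t"] by simp
    qed (use s in auto)
  qed (use assms in auto)
  then show ?thesis by simp
qed

lemma rate_sign_dominates:
  fixes a b k :: real
  assumes "0 < k" "k \<le> \<bar>a\<bar>" "\<bar>b\<bar> \<le> k"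
  shows "k \<le> sgn a * (2 * a + b)"
proof (cases "0 < a")
  case True
  then show ?thesis using assms by simp
next
  case False
  then have "a < 0" using assms by linarith
  then show ?thesis using assms by simp
qed

context planar_flow
begin

lemma R_nonneg: "0 \<le> R"
proof -
  obtain i where "0 < p i" using active_nonempty by auto
  then show ?thesis using on_circle[of i] norm_ge_zero[of "q i"] by simp
qed

lemma kap_active: "0 < p i \<Longrightarrow> kap i = 0"
  by (simp add: kap_def on_circle)

lemma mass_profile_evol: "mass_profile m \<Longrightarrow> mass_profile (evol m t)"
  by (auto simp: mass_profile_def evol_def kap_active)

lemma evol_evol: "evol (evol m s) t = evol m (s + t)"
  by (rule ext) (simp add: evol_def distrib_left exp_add)

lemma evol_0: "evol m 0 = m"
  by (rule ext) (simp add: evol_def)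

text \<open>
  The slowest rate of an inactive coordinate. The element \<open>1\<close> keeps the set nonempty if all indices are active.
\<close>
definition kmin :: real
  where "kmin = Min (insert 1 ((\<lambda>k. \<bar>kap k\<bar>) ` {k. p k = 0}))"

lemma kmin: "0 < kmin" "p k = 0 \<Longrightarrow> kmin \<le> \<bar>kap k\<bar>"
proof -
  have "kap k \<noteq> 0" if "p k = 0" for k
  proof -
    have "(norm (q k))\<^sup>2 \<noteq> R\<^sup>2" using off_circle[OF that] R_nonneg by (simp add: power2_eq_iff_nonneg)
    then show ?thesis by (simp add: kap_def)
  qed
  then show "0 < kmin" by (auto simp: kmin_def Min_gr_iff)
  show "p k = 0 \<Longrightarrow> kmin \<le> \<bar>kap k\<bar>" unfolding kmin_def by (rule Min_le) auto
qed

text \<open>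
  The least positive eigenvalue of \<open>M\<close>, or \<open>1\<close> if \<open>M\<close> vanishes.
\<close>
definition mup :: real
  where "mup = (if 0 < mu1 then mu1 else if 0 < mu2 then mu2 else 1)"

lemma mup: "0 < mup" "mup * (Mnorm y)\<^sup>2 \<le> (norm (M y))\<^sup>2"
proof -
  show "0 < mup" by (simp add: mup_def)
  have n: "(norm (M y))\<^sup>2 = mu1 * (mu1 * (y \<bullet> e1)\<^sup>2) + mu2 * (mu2 * (y \<bullet> e2)\<^sup>2)"
    unfolding norm_eigen M_inner by (simp add: power_mult_distrib power2_eq_square mult_ac)
  have "mup * (mu1 * (y \<bullet> e1)\<^sup>2) \<le> mu1 * (mu1 * (y \<bullet> e1)\<^sup>2)"
    using mu_nonneg mu_le by (cases "mu1 = 0") (auto simp: mup_def)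
  moreover have "mup * (mu2 * (y \<bullet> e2)\<^sup>2) \<le> mu2 * (mu2 * (y \<bullet> e2)\<^sup>2)"
  proof (cases "mu2 = 0")
    case False
    then have "mup \<le> mu2" using mu_nonneg mu_le by (auto simp: mup_def)
    then show ?thesis using mu_nonneg mu_le by (intro mult_right_mono mult_nonneg_nonneg) auto
  qed auto
  ultimately show "mup * (Mnorm y)\<^sup>2 \<le> (norm (M y))\<^sup>2"
    unfolding n Mnorm_eigen distrib_left by simp
qed

text \<open>
  Up to this size of the solution, the nonlinear terms change the rates of the inactive masses by at most half, and the
  growth rate of \<open>Mnorm\<close> is at least half its linear value, apart from the contribution of the inactive masses.
\<close>
definition d0 :: real
  where "d0 = min N0 (min (kmin / (48 * B\<^sup>2)) (mup / (4 * B\<^sup>2)))"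

lemma d0: "0 < d0" "d0 \<le> N0" "d0 \<le> 1" "48 * B\<^sup>2 * d0 \<le> kmin" "4 * B\<^sup>2 * d0 \<le> mup"
proof -
  have b: "0 < 48 * B\<^sup>2" "0 < 4 * B\<^sup>2" using B by auto
  show "0 < d0" using N0 kmin(1) mup(1) b by (simp add: d0_def)
  show "d0 \<le> N0" by (simp add: d0_def)
  then show "d0 \<le> 1" using N0 by simp
  have "d0 \<le> kmin / (48 * B\<^sup>2)" "d0 \<le> mup / (4 * B\<^sup>2)" by (simp_all add: d0_def)
  then show "48 * B\<^sup>2 * d0 \<le> kmin" "4 * B\<^sup>2 * d0 \<le> mup"
    using b by (simp_all add: pos_le_divide_eq mult.commute)
qed

lemma solutionD: "solution m y \<Longrightarrow> (y has_vector_derivative 8 *\<^sub>R F (evol m t) (y t)) (at t)"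
  by (simp add: solution_def)

lemma solution_continuous: "solution m y \<Longrightarrow> continuous_on A y"
  by (meson continuous_at_imp_continuous_on has_vector_derivative_continuous solutionD)

lemma solution_continuous_Mnorm: "solution m y \<Longrightarrow> continuous_on A (\<lambda>t. Mnorm (y t))"
  unfolding Mnorm_def by (intro continuous_intros solution_continuous)

lemma solution_continuous_inactive_mass: "solution m y \<Longrightarrow> continuous_on A (\<lambda>t. inactive_mass (evol m t) (y t))"
  unfolding inactive_mass_def evol_def by (intro continuous_intros solution_continuous)

lemma mass_has_derivative:
  assumes "solution m y"
  shows "((\<lambda>t. evol m t k * exp (q k \<bullet> y t)) has_real_derivative
     evol m t k * exp (q k \<bullet> y t) * (2 * kap k + 8 * (q k \<bullet> F (evol m t) (y t)))) (at t)"
proof -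
  have d: "((\<lambda>t. q k \<bullet> y t) has_real_derivative q k \<bullet> (8 *\<^sub>R F (evol m t) (y t))) (at t)"
    by (rule has_real_derivative_inner_left[OF solutionD[OF assms]])
  have e: "((\<lambda>t. evol m t k) has_real_derivative evol m t k * (2 * kap k)) (at t)"
    unfolding evol_def by (rule DERIV_cong, (rule derivative_eq_intros refl)+) simp
  show ?thesis
    by (rule DERIV_cong, (rule derivative_eq_intros refl d e)+) (simp add: algebra_simps)
qed

text \<open>
  The sum of the inner masses minus the sum of the outer masses increases at a rate of at least \<open>kmin\<close> times the
  inactive mass, and it is bounded in absolute value by the inactive mass, hence by \<open>\<beta>\<close>.
\<close>
lemma integral_inactive_mass_le:
  assumes m: "mass_profile m" and y: "solution m y" and ab: "a \<le> b"
    and N: "\<And>t. a \<le> t \<Longrightarrow> t \<le> b \<Longrightarrow> Mnorm (y t) \<le> d0"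
    and n: "\<And>t. a \<le> t \<Longrightarrow> t \<le> b \<Longrightarrow> inactive_mass (evol m t) (y t) \<le> \<beta>"
    and \<beta>: "\<beta> \<le> d0"
  shows "integral {a..b} (\<lambda>t. inactive_mass (evol m t) (y t)) \<le> 2 * \<beta> / kmin"
proof -
  define f where "f k t = evol m t k * exp (q k \<bullet> y t)" for k t
  define r where "r k t = 2 * kap k + 8 * (q k \<bullet> F (evol m t) (y t))" for k t
  have f0: "0 \<le> f k t" for k t using mass_profile_evol[OF m, of t] by (simp add: f_def mass_profile_def)
  have df: "(f k has_real_derivative f k t * r k t) (at t)" for k t
    unfolding f_def r_def by (rule mass_has_derivative[OF y])
  have nhf: "inactive_mass (evol m t) (y t) = (\<Sum>k\<in>{k. p k = 0}. f k t)" for t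
    by (simp add: inactive_mass_def f_def)
  \<comment> \<open>The signed sum weights inner masses by \<open>1\<close> and outer masses by \<open>- 1\<close>.\<close>
  have "integral {a..b} (\<lambda>t. kmin * inactive_mass (evol m t) (y t))
     \<le> (\<Sum>k\<in>{k. p k = 0}. sgn (kap k) * f k b) - (\<Sum>k\<in>{k. p k = 0}. sgn (kap k) * f k a)"
  proof (rule integral_le_increment[OF ab, where g = "\<lambda>t. \<Sum>k\<in>{k. p k = 0}. sgn (kap k) * f k t"
        and g' = "\<lambda>t. \<Sum>k\<in>{k. p k = 0}. sgn (kap k) * (f k t * r k t)"])
    fix t assume t: "a \<le> t" "t \<le> b"
    show "((\<lambda>t. \<Sum>k\<in>{k. p k = 0}. sgn (kap k) * f k t) has_real_derivative
        (\<Sum>k\<in>{k. p k = 0}. sgn (kap k) * (f k t * r k t))) (at t)"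
      by (intro DERIV_sum DERIV_cmult df)
    show "kmin * inactive_mass (evol m t) (y t) \<le> (\<Sum>k\<in>{k. p k = 0}. sgn (kap k) * (f k t * r k t))"
      unfolding nhf sum_distrib_left
    proof (rule sum_mono)
      fix k assume k: "k \<in> {k. p k = 0}"
      have "norm (F (evol m t) (y t)) \<le> 3 * B * (Mnorm (y t) + inactive_mass (evol m t) (y t))"
        by (rule F_small[OF mass_profile_evol[OF m] order_trans[OF N[OF t] d0(2)]])
      also have "\<dots> \<le> 3 * B * (2 * d0)" using N[OF t] n[OF t] \<beta> B by (intro mult_left_mono) auto
      finally have "B * norm (F (evol m t) (y t)) \<le> B * (3 * B * (2 * d0))" using B by (intro mult_left_mono) auto
      then have s: "\<bar>8 * (q k \<bullet> F (evol m t) (y t))\<bar> \<le> 48 * B\<^sup>2 * d0"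
        using inner_q_le[of k "F (evol m t) (y t)"] by (simp add: power2_eq_square)
      have "kmin \<le> \<bar>kap k\<bar>" using k by (intro kmin) simp
      then have "kmin \<le> sgn (kap k) * r k t"
        unfolding r_def by (rule rate_sign_dominates[OF kmin(1)]) (use s d0(4) in linarith)
      then show "kmin * f k t \<le> sgn (kap k) * (f k t * r k t)"
        using f0[of k t] mult_right_mono[of kmin "sgn (kap k) * r k t" "f k t"] by (simp add: mult_ac)
    qed
  qed (intro continuous_intros solution_continuous_inactive_mass y)
  also have "\<dots> \<le> inactive_mass (evol m b) (y b) + inactive_mass (evol m a) (y a)"
  proof -
    have "sgn (kap k) * f k b - sgn (kap k) * f k a \<le> f k b + f k a" for k
      using f0[of k a] f0[of k b] by (auto simp: sgn_real_def)
    then show ?thesis unfolding nhf sum_subtractf[symmetric] sum.distrib[symmetric] by (rule sum_mono)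
  qed
  also have "\<dots> \<le> 2 * \<beta>" using n[of a] n[of b] ab by simp
  finally have "kmin * integral {a..b} (\<lambda>t. inactive_mass (evol m t) (y t)) \<le> 2 * \<beta>"
    unfolding integral_mult_right .
  then show ?thesis unfolding pos_le_divide_eq[OF kmin(1)] by (simp only: mult.commute)
qed

text \<open>
  The first term comes from the final value of \<open>Mnorm\<close>, the second from the influence of the inactive mass on \<open>Mnorm\<close>, and the
  third from the inactive mass itself.
\<close>
definition CI :: real
  where "CI = 1 / (4 * mup) + 8 * B\<^sup>2 / (mup * kmin) + 2 / kmin"

lemma CI_pos: "0 < CI"
  unfolding CI_def using mup(1) kmin(1) by (intro add_pos_pos add_pos_nonneg) auto

text \<open>
  Up to the inactive mass, whose integral is known to be small, the derivative of \<open>Mnorm (y t)\<close> is at least \<open>4 * mup\<close> times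
  \<open>Mnorm (y t)\<close>. So the integral of the latter is bounded by its final value, whatever the length of the interval.
\<close>
lemma integral_Mnorm_inactive_mass_le:
  assumes m: "mass_profile m" and y: "solution m y" and ab: "a \<le> b"
    and N: "\<And>t. a \<le> t \<Longrightarrow> t \<le> b \<Longrightarrow> Mnorm (y t) \<le> d0"
    and n: "\<And>t. a \<le> t \<Longrightarrow> t \<le> b \<Longrightarrow> inactive_mass (evol m t) (y t) \<le> \<beta>"
    and \<beta>: "\<beta> \<le> d0"
  shows "integral {a..b} (\<lambda>t. Mnorm (y t) + inactive_mass (evol m t) (y t)) \<le> CI * (Mnorm (y b) + \<beta>)"
proof -
  let ?IN = "integral {a..b} (\<lambda>t. Mnorm (y t))" and ?In = "integral {a..b} (\<lambda>t. inactive_mass (evol m t) (y t))"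
  have iN: "(\<lambda>t. Mnorm (y t)) integrable_on {a..b}" and in': "(\<lambda>t. inactive_mass (evol m t) (y t)) integrable_on {a..b}"
    by (auto intro!: integrable_continuous_real solution_continuous_Mnorm[OF y] solution_continuous_inactive_mass[OF y])
  have In: "?In \<le> 2 * \<beta> / kmin" by (rule integral_inactive_mass_le[OF m y ab N n \<beta>])
  have \<beta>0: "0 \<le> \<beta>" using n[OF order_refl ab] inactive_mass_nonneg[OF mass_profile_evol[OF m], of a "y a"] by simp
  have main: "4 * mup * ?IN - 16 * B\<^sup>2 * ?In \<le> Mnorm (y b) + \<eta> * (1 + 4 * mup * (b - a))" if \<eta>: "0 < \<eta>" for \<eta>
  proof -
    \<comment> \<open>A differentiable substitute for \<open>Mnorm (y t)\<close>, which may vanish.\<close>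
    define g where "g t = sqrt ((Mnorm (y t))\<^sup>2 + \<eta>\<^sup>2)" for t
    define g' where "g' t = 8 * (M (y t) \<bullet> F (evol m t) (y t)) / g t" for t
    have g0: "0 < g t" for t unfolding g_def using \<eta> by (simp add: add_nonneg_pos)
    have gN: "Mnorm (y t) \<le> g t" "g t \<le> Mnorm (y t) + \<eta>" for t
    proof -
      show "Mnorm (y t) \<le> g t" unfolding g_def using \<eta> by (intro real_le_rsqrt) simp
      show "g t \<le> Mnorm (y t) + \<eta>" unfolding g_def using \<eta> Mnorm_nonneg[of "y t"]
        by (intro real_le_lsqrt) (auto simp: power2_sum)
    qed
    have "integral {a..b} (\<lambda>t. 4 * mup * (Mnorm (y t) - \<eta>) - 16 * B\<^sup>2 * inactive_mass (evol m t) (y t)) \<le> g b - g a"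
    proof (rule integral_le_increment[OF ab, where g' = g'])
      fix t assume t: "a \<le> t" "t \<le> b"
      have dq: "((\<lambda>t. q i \<bullet> y t) has_real_derivative q i \<bullet> (8 *\<^sub>R F (evol m t) (y t))) (at t)" for i
        by (rule has_real_derivative_inner_left[OF solutionD[OF y]])
      have "((\<lambda>t. (Mnorm (y t))\<^sup>2) has_real_derivative 16 * (M (y t) \<bullet> F (evol m t) (y t))) (at t)"
        unfolding Mnorm_sq M_def inner_sum_left
        by (rule DERIV_cong, (rule derivative_eq_intros refl dq)+) (simp add: sum_distrib_left mult_ac)
      from DERIV_add[OF this DERIV_const[of "\<eta>\<^sup>2"]]
      have dN: "((\<lambda>t. (Mnorm (y t))\<^sup>2 + \<eta>\<^sup>2) has_real_derivative 16 * (M (y t) \<bullet> F (evol m t) (y t)) + 0) (at t)" .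
      have pos: "0 < (Mnorm (y t))\<^sup>2 + \<eta>\<^sup>2" using \<eta> by (simp add: add_nonneg_pos)
      have gd: "g = (\<lambda>t. sqrt ((Mnorm (y t))\<^sup>2 + \<eta>\<^sup>2))" by (simp add: g_def fun_eq_iff)
      have "(g has_real_derivative inverse (sqrt ((Mnorm (y t))\<^sup>2 + \<eta>\<^sup>2)) / 2 *
          (16 * (M (y t) \<bullet> F (evol m t) (y t)) + 0)) (at t)"
        unfolding gd
        by (rule DERIV_chain2[where f = sqrt and g = "\<lambda>t. (Mnorm (y t))\<^sup>2 + \<eta>\<^sup>2" and x = t,
              OF DERIV_real_sqrt[OF pos] dN])
      then show "(g has_real_derivative g' t) (at t)"
        by (rule DERIV_cong) (simp only: g'_def g_def divide_inverse, simp)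
      let ?N = "Mnorm (y t)" and ?n = "inactive_mass (evol m t) (y t)"
      have n0: "0 \<le> ?n" by (rule inactive_mass_nonneg[OF mass_profile_evol[OF m]])
      have e: "norm (F (evol m t) (y t) - M (y t)) \<le> 2 * B * (?N\<^sup>2 + ?n)"
        by (rule F_approx[OF mass_profile_evol[OF m] order_trans[OF N[OF t] d0(2)]])
      have "- (M (y t) \<bullet> (F (evol m t) (y t) - M (y t))) \<le> norm (M (y t)) * norm (F (evol m t) (y t) - M (y t))"
        using Cauchy_Schwarz_ineq2[of "M (y t)" "F (evol m t) (y t) - M (y t)"] by linarith
      also have "\<dots> \<le> (B * ?N) * (2 * B * (?N\<^sup>2 + ?n))"
        by (intro mult_mono norm_M_le e) (use B Mnorm_nonneg in auto)
      also have "\<dots> = 2 * B\<^sup>2 * ?N * ?N\<^sup>2 + 2 * B\<^sup>2 * ?N * ?n" by (simp add: algebra_simps power2_eq_square)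
      also have "2 * B\<^sup>2 * ?N * ?N\<^sup>2 \<le> 2 * B\<^sup>2 * d0 * ?N\<^sup>2"
        by (intro mult_right_mono mult_left_mono N t) auto
      also have "2 * B\<^sup>2 * d0 * ?N\<^sup>2 \<le> (mup / 2) * ?N\<^sup>2" using d0(5) by (intro mult_right_mono) auto
      finally have low: "(mup / 2) * ?N\<^sup>2 - 2 * B\<^sup>2 * ?N * ?n \<le> M (y t) \<bullet> F (evol m t) (y t)"
        using mup(2)[of "y t"] by (simp add: inner_diff_right power2_norm_eq_inner[symmetric])
      have "(?N - \<eta>) * g t \<le> ?N\<^sup>2"
      proof (cases "?N \<le> \<eta>")
        case True
        then have "(?N - \<eta>) * g t \<le> 0" using g0[of t] by (intro mult_nonpos_nonneg) auto
        then show ?thesis using zero_le_power2[of ?N] by linarith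
      next
        case False
        then have "(?N - \<eta>) * g t \<le> (?N - \<eta>) * (?N + \<eta>)" by (intro mult_left_mono gN) auto
        also have "\<dots> \<le> ?N\<^sup>2" by (simp add: power2_eq_square algebra_simps)
        finally show ?thesis .
      qed
      then have "4 * mup * ((?N - \<eta>) * g t) \<le> 4 * mup * ?N\<^sup>2" using mup(1) by (intro mult_left_mono) auto
      moreover have "16 * B\<^sup>2 * ?n * ?N \<le> 16 * B\<^sup>2 * ?n * g t" using gN n0 by (intro mult_left_mono) auto
      ultimately have "(4 * mup * (?N - \<eta>) - 16 * B\<^sup>2 * ?n) * g t \<le> 8 * (M (y t) \<bullet> F (evol m t) (y t))"
        using low by (simp add: algebra_simps)
      then show "4 * mup * (?N - \<eta>) - 16 * B\<^sup>2 * ?n \<le> g' t"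
        unfolding g'_def using g0[of t] by (simp add: pos_le_divide_eq)
    qed (intro continuous_intros solution_continuous_inactive_mass[OF y] solution_continuous_Mnorm[OF y])
    also have "\<dots> \<le> Mnorm (y b) + \<eta>" using gN[of b] g0[of a] by simp
    finally have "integral {a..b} (\<lambda>t. 4 * mup * (Mnorm (y t) - \<eta>) - 16 * B\<^sup>2 * inactive_mass (evol m t) (y t)) \<le> Mnorm (y b) + \<eta>" .
    moreover have "integral {a..b} (\<lambda>t. 4 * mup * (Mnorm (y t) - \<eta>) - 16 * B\<^sup>2 * inactive_mass (evol m t) (y t))
       = 4 * mup * (?IN - \<eta> * (b - a)) - 16 * B\<^sup>2 * ?In"
    proof -
      have "((\<lambda>t. 4 * mup * (Mnorm (y t) - \<eta>) - 16 * B\<^sup>2 * inactive_mass (evol m t) (y t)) has_integral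
         4 * mup * (?IN - \<eta> * (b - a)) - 16 * B\<^sup>2 * ?In) {a..b}"
        using has_integral_const_real[of \<eta> a b] ab
        by (intro has_integral_diff has_integral_mult_right integrable_integral iN in')
          (simp add: mult.commute)
      then show ?thesis by (rule integral_unique)
    qed
    ultimately show ?thesis by (simp add: algebra_simps)
  qed
  have "4 * mup * ?IN - 16 * B\<^sup>2 * ?In \<le> Mnorm (y b)"
  proof (rule field_le_epsilon)
    fix e :: real assume e: "0 < e"
    define c where "c = 1 + 4 * mup * (b - a)"
    have c: "0 < c" using mup(1) ab by (simp add: c_def add_pos_nonneg)
    show "4 * mup * ?IN - 16 * B\<^sup>2 * ?In \<le> Mnorm (y b) + e"
      using main[of "e / c"] e c by (simp add: c_def[symmetric])
  qed
  moreover have "16 * B\<^sup>2 * ?In \<le> 16 * B\<^sup>2 * (2 * \<beta> / kmin)" by (intro mult_left_mono In) auto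
  ultimately have "4 * mup * ?IN \<le> Mnorm (y b) + 32 * B\<^sup>2 * \<beta> / kmin" by simp
  then have "?IN \<le> (Mnorm (y b) + 32 * B\<^sup>2 * \<beta> / kmin) / (4 * mup)"
    using mup(1) by (simp add: pos_le_divide_eq mult.commute)
  also have "\<dots> = 1 / (4 * mup) * Mnorm (y b) + 8 * B\<^sup>2 / (mup * kmin) * \<beta>"
    using mup(1) kmin(1) by (simp add: field_simps)
  finally have "?IN + ?In \<le> 1 / (4 * mup) * Mnorm (y b) + (8 * B\<^sup>2 / (mup * kmin) + 2 / kmin) * \<beta>"
    using In by (simp add: algebra_simps)
  also have "\<dots> \<le> CI * Mnorm (y b) + CI * \<beta>"
    unfolding CI_def using mup(1) kmin(1) \<beta>0 Mnorm_nonneg[of "y b"] by (intro add_mono mult_right_mono) auto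
  finally show ?thesis unfolding integral_add[OF iN in'] distrib_left .
qed

text \<open>
  The speed \<open>8 * norm (F m y)\<close> is at most a multiple of the integrand of the preceding estimate, so a solution near the torus travels only a short way.
\<close>
lemma drift_le:
  assumes m: "mass_profile m" and y: "solution m y" and ab: "a \<le> b"
    and N: "\<And>t. a \<le> t \<Longrightarrow> t \<le> b \<Longrightarrow> Mnorm (y t) \<le> d0"
    and n: "\<And>t. a \<le> t \<Longrightarrow> t \<le> b \<Longrightarrow> inactive_mass (evol m t) (y t) \<le> \<beta>"
    and \<beta>: "\<beta> \<le> d0"
  shows "norm (y b - y a) \<le> 24 * B * CI * (Mnorm (y b) + \<beta>)"
proof -
  have c: "continuous_on {a..b} (\<lambda>t. Mnorm (y t) + inactive_mass (evol m t) (y t))"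
    by (rule continuous_on_add[OF solution_continuous_Mnorm[OF y] solution_continuous_inactive_mass[OF y]])
  have h: "((\<lambda>t. 8 *\<^sub>R F (evol m t) (y t)) has_integral (y b - y a)) {a..b}"
    by (rule fundamental_theorem_of_calculus[OF ab]) (rule has_vector_derivative_at_within[OF solutionD[OF y]])
  have "norm (integral {a..b} (\<lambda>t. 8 *\<^sub>R F (evol m t) (y t)))
     \<le> integral {a..b} (\<lambda>t. 24 * B * (Mnorm (y t) + inactive_mass (evol m t) (y t)))"
  proof (rule integral_norm_bound_integral)
    show "(\<lambda>t. 8 *\<^sub>R F (evol m t) (y t)) integrable_on {a..b}" using h by blast
    show "(\<lambda>t. 24 * B * (Mnorm (y t) + inactive_mass (evol m t) (y t))) integrable_on {a..b}"
      by (intro integrable_continuous_real continuous_intros c)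
    fix t assume t: "t \<in> {a..b}"
    then have "norm (F (evol m t) (y t)) \<le> 3 * B * (Mnorm (y t) + inactive_mass (evol m t) (y t))"
      using N[of t] d0(2) by (intro F_small mass_profile_evol m) auto
    then show "norm (8 *\<^sub>R F (evol m t) (y t)) \<le> 24 * B * (Mnorm (y t) + inactive_mass (evol m t) (y t))" by simp
  qed
  also have "\<dots> = 24 * B * integral {a..b} (\<lambda>t. Mnorm (y t) + inactive_mass (evol m t) (y t))" by simp
  also have "\<dots> \<le> 24 * B * (CI * (Mnorm (y b) + \<beta>))"
    using B by (intro mult_left_mono integral_Mnorm_inactive_mass_le[OF m y ab N n \<beta>]) auto
  finally show ?thesis unfolding integral_unique[OF h] by (simp only: mult.assoc)
qed

text \<open>
  The difference of two solutions satisfies the linear equation \<open>d' = 8 *\<^sub>R M d\<close> with a perturbation that, by \<open>F_pair\<close>, is bounded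
  by \<open>E t * norm (d t)\<close>, where \<open>E\<close> measures the distance of both solutions to the torus. The integral of \<open>E\<close> is small, so
  the difference grows like a solution of the diagonal system with the rates \<open>8 * mu1\<close> and \<open>8 * mu2\<close>.
\<close>
lemma pair_growth:
  assumes m: "mass_profile m" and y: "solution m y" and x: "solution m x" and T: "0 \<le> T"
    and Ny: "\<And>t. 0 \<le> t \<Longrightarrow> t \<le> T \<Longrightarrow> Mnorm (y t) \<le> d0"
    and Nx: "\<And>t. 0 \<le> t \<Longrightarrow> t \<le> T \<Longrightarrow> Mnorm (x t) \<le> d0"
    and ny: "\<And>t. 0 \<le> t \<Longrightarrow> t \<le> T \<Longrightarrow> inactive_mass (evol m t) (y t) \<le> \<beta>"
    and nx: "\<And>t. 0 \<le> t \<Longrightarrow> t \<le> T \<Longrightarrow> inactive_mass (evol m t) (x t) \<le> \<beta>"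
    and \<beta>: "\<beta> \<le> d0"
    and small: "168 * B\<^sup>2 * CI * (Mnorm (y T) + Mnorm (x T) + 2 * \<beta>) \<le> 1/8"
  shows "norm (y T - x T) \<le> 2 * exp (8 * mu2 * T) * norm (y 0 - x 0)"
    and "norm (y 0 - x 0) \<le> 2 * exp (- 8 * mu1 * T) * norm (y T - x T)"
    and "(y 0 - x 0) \<bullet> e1 = 0 \<Longrightarrow> norm (y 0 - x 0) \<le> 2 * exp (- 8 * mu2 * T) * norm (y T - x T)"
    and "(y T - x T) \<bullet> e2 = 0 \<Longrightarrow> norm (y T - x T) \<le> 2 * exp (8 * mu1 * T) * \<bar>(y 0 - x 0) \<bullet> e1\<bar>"
proof -
  define d where "d t = y t - x t" for t
  define r where "r t = 8 *\<^sub>R (F (evol m t) (y t) - F (evol m t) (x t) - M (d t))" for t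
  define E where "E t = 168 * B\<^sup>2 * ((Mnorm (y t) + inactive_mass (evol m t) (y t)) + (Mnorm (x t) + inactive_mass (evol m t) (x t)))" for t
  have dd: "((\<lambda>t. d t \<bullet> e) has_real_derivative 8 * (M (d t) \<bullet> e) + r t \<bullet> e) (at t)" for e t
  proof -
    have "(d has_vector_derivative (8 *\<^sub>R F (evol m t) (y t) - 8 *\<^sub>R F (evol m t) (x t))) (at t)"
      unfolding d_def[abs_def] by (intro has_vector_derivative_diff solutionD x y)
    from has_real_derivative_inner_left[OF this, of e] show ?thesis
      by (simp add: r_def inner_commute[of e] inner_diff_left algebra_simps)
  qed
  have d1: "((\<lambda>t. d t \<bullet> e1) has_real_derivative (8 * mu1) * (d t \<bullet> e1) + r t \<bullet> e1) (at t)" for t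
    using dd[of e1 t] by (simp add: M_inner mult.assoc)
  have d2: "((\<lambda>t. d t \<bullet> e2) has_real_derivative (8 * mu2) * (d t \<bullet> e2) + r t \<bullet> e2) (at t)" for t
    using dd[of e2 t] by (simp add: M_inner mult.assoc)
  have er: "(r t \<bullet> e1)\<^sup>2 + (r t \<bullet> e2)\<^sup>2 \<le> (E t)\<^sup>2 * ((d t \<bullet> e1)\<^sup>2 + (d t \<bullet> e2)\<^sup>2)" if t: "0 \<le> t" "t \<le> T" for t
  proof -
    have "norm (F (evol m t) (y t) - F (evol m t) (x t) - M (y t - x t))
       \<le> 21 * B\<^sup>2 * (Mnorm (y t) + Mnorm (x t) + inactive_mass (evol m t) (y t) + inactive_mass (evol m t) (x t)) * norm (y t - x t)"
      using Ny[OF t] Nx[OF t] ny[OF t] nx[OF t] \<beta> d0(2,3) by (intro F_pair mass_profile_evol m) auto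
    from mult_left_mono[OF this, of 8] have "norm (r t) \<le> 8 * (21 * B\<^sup>2 * (Mnorm (y t) + Mnorm (x t) + inactive_mass (evol m t) (y t) + inactive_mass (evol m t) (x t)) * norm (d t))"
      unfolding r_def norm_scaleR d_def abs_numeral by linarith
    also have "\<dots> = E t * norm (d t)" by (simp add: E_def algebra_simps)
    finally have "norm (r t) \<le> E t * norm (d t)" .
    then have "(norm (r t))\<^sup>2 \<le> (E t * norm (d t))\<^sup>2" by (intro power_mono) auto
    then show ?thesis by (simp add: norm_eigen power_mult_distrib)
  qed
  have E0: "0 \<le> E t" if "0 \<le> t" "t \<le> T" for t
    unfolding E_def using Mnorm_nonneg inactive_mass_nonneg[OF mass_profile_evol[OF m]] by (intro mult_nonneg_nonneg add_nonneg_nonneg) auto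
  have cE: "continuous_on {0..T} E"
    unfolding E_def by (intro continuous_intros solution_continuous_inactive_mass[OF y] solution_continuous_inactive_mass[OF x]
        solution_continuous_Mnorm[OF y] solution_continuous_Mnorm[OF x])
  have iE: "integral {0..T} E \<le> 1/8"
  proof -
    have i: "(\<lambda>t. Mnorm (y t) + inactive_mass (evol m t) (y t)) integrable_on {0..T}" "(\<lambda>t. Mnorm (x t) + inactive_mass (evol m t) (x t)) integrable_on {0..T}"
      by (auto intro!: integrable_continuous_real continuous_intros solution_continuous_inactive_mass[OF y] solution_continuous_inactive_mass[OF x]
        solution_continuous_Mnorm[OF y] solution_continuous_Mnorm[OF x])
    have "integral {0..T} E = 168 * B\<^sup>2 * (integral {0..T} (\<lambda>t. Mnorm (y t) + inactive_mass (evol m t) (y t)) + integral {0..T} (\<lambda>t. Mnorm (x t) + inactive_mass (evol m t) (x t)))"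
      unfolding E_def by (subst integral_mult_right, subst integral_add[OF i]) simp
    also have "\<dots> \<le> 168 * B\<^sup>2 * (CI * (Mnorm (y T) + \<beta>) + CI * (Mnorm (x T) + \<beta>))"
      by (intro mult_left_mono add_mono integral_Mnorm_inactive_mass_le[OF m y T Ny ny \<beta>] integral_Mnorm_inactive_mass_le[OF m x T Nx nx \<beta>]) auto
    also have "\<dots> = 168 * B\<^sup>2 * CI * (Mnorm (y T) + Mnorm (x T) + 2 * \<beta>)" by (simp add: algebra_simps)
    finally show ?thesis using small by simp
  qed
  have mm: "8 * mu1 \<le> 8 * mu2" using mu_le by simp
  have nd: "sqrt ((d t \<bullet> e1)\<^sup>2 + (d t \<bullet> e2)\<^sup>2) = norm (d t)" for t
    by (simp add: norm_eigen[symmetric])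
  note fw = dominated_forward[OF T mm d1 d2 er E0 cE iE, unfolded nd]
  note bw = dominated_backward[OF T mm d1 d2 er E0 cE iE, unfolded nd]
  show "norm (y T - x T) \<le> 2 * exp (8 * mu2 * T) * norm (y 0 - x 0)"
    using fw(1) by (simp add: d_def)
  show "norm (y 0 - x 0) \<le> 2 * exp (- 8 * mu1 * T) * norm (y T - x T)"
    using bw(1) by (simp add: d_def)
  have le2: "\<bar>d t \<bullet> e2\<bar> \<le> norm (d t)" for t using Cauchy_Schwarz_ineq2[of "d t" e2] e_norm by simp
  show "norm (y 0 - x 0) \<le> 2 * exp (- 8 * mu2 * T) * norm (y T - x T)" if a: "(y 0 - x 0) \<bullet> e1 = 0"
  proof -
    have "norm (d 0) = \<bar>d 0 \<bullet> e2\<bar>" using nd[of 0] a by (simp add: d_def)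
    also have "\<dots> \<le> 2 * exp (- 8 * mu2 * T) * \<bar>d T \<bullet> e2\<bar>" using fw(2) a by (simp add: d_def)
    also have "\<dots> \<le> 2 * exp (- 8 * mu2 * T) * norm (d T)" by (intro mult_left_mono le2) auto
    finally show ?thesis by (simp add: d_def)
  qed
  show "norm (y T - x T) \<le> 2 * exp (8 * mu1 * T) * \<bar>(y 0 - x 0) \<bullet> e1\<bar>" if a: "(y T - x T) \<bullet> e2 = 0"
  proof -
    have "norm (d T) = \<bar>d T \<bullet> e1\<bar>" using nd[of T] a by (simp add: d_def)
    then show ?thesis using bw(2) a by (simp add: d_def)
  qed
qed

section \<open>Displacement and separation of staying solutions\<close>

text \<open>
  The tube around the torus in log-weight coordinates: the first sum is the squared size of the unstable coordinate of the
  tubular neighborhood, the second sum that of the stable coordinate. The factor \<open>1/2\<close> occurs because \<open>q i \<bullet> y\<close> is the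
  logarithm of a squared modulus.
\<close>
definition in_tube :: "real \<Rightarrow> ('n \<Rightarrow> real) \<Rightarrow> complex \<Rightarrow> bool"
  where "in_tube \<delta> m y \<longleftrightarrow>
    (\<Sum>i\<in>{i. 0 < p i}. (q i \<bullet> y / 2)\<^sup>2) + (\<Sum>k\<in>{k. p k = 0 \<and> norm (q k) < R}. m k * exp (q k \<bullet> y)) < \<delta>\<^sup>2
    \<and> (\<Sum>k\<in>{k. p k = 0 \<and> R < norm (q k)}. m k * exp (q k \<bullet> y)) < \<delta>\<^sup>2"

lemma inactive_mass_split:
  "inactive_mass m y = (\<Sum>k\<in>{k. p k = 0 \<and> norm (q k) < R}. m k * exp (q k \<bullet> y))
    + (\<Sum>k\<in>{k. p k = 0 \<and> R < norm (q k)}. m k * exp (q k \<bullet> y))"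
proof -
  have "{k. p k = 0} = {k. p k = 0 \<and> norm (q k) < R} \<union> {k. p k = 0 \<and> R < norm (q k)}"
    using off_circle by force
  then show ?thesis unfolding inactive_mass_def by (simp only:) (rule sum.union_disjoint, auto)
qed

lemma in_tube_imp:
  assumes m: "mass_profile m" and \<delta>: "0 < \<delta>" and v: "in_tube \<delta> m y"
  shows "Mnorm y \<le> 2 * \<delta>" and "inactive_mass m y \<le> 2 * \<delta>\<^sup>2"
    and "p k = 0 \<Longrightarrow> m k * exp (q k \<bullet> y) < \<delta>\<^sup>2"
proof -
  let ?a = "\<Sum>i\<in>{i. 0 < p i}. (q i \<bullet> y / 2)\<^sup>2"
  let ?b = "\<Sum>k\<in>{k. p k = 0 \<and> norm (q k) < R}. m k * exp (q k \<bullet> y)"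
  let ?c = "\<Sum>k\<in>{k. p k = 0 \<and> R < norm (q k)}. m k * exp (q k \<bullet> y)"
  have m0: "0 \<le> m k * exp (q k \<bullet> y)" for k using m by (simp add: mass_profile_def)
  have nn: "0 \<le> ?a" "0 \<le> ?b" "0 \<le> ?c" by (auto intro!: sum_nonneg m0)
  have lt: "?a + ?b < \<delta>\<^sup>2" "?c < \<delta>\<^sup>2" using v by (auto simp: in_tube_def)
  show "inactive_mass m y \<le> 2 * \<delta>\<^sup>2" unfolding inactive_mass_split using nn lt by linarith
  have p1: "p i \<le> 1" for i using member_le_sum[of i UNIV p] p_nonneg p_sum by simp
  have "(Mnorm y)\<^sup>2 = (\<Sum>i\<in>{i. 0 < p i}. p i * (q i \<bullet> y)\<^sup>2)"
    unfolding Mnorm_sq using p_nonneg by (intro sum.mono_neutral_right) (auto simp: less_le)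
  also have "\<dots> \<le> (\<Sum>i\<in>{i. 0 < p i}. 4 * (q i \<bullet> y / 2)\<^sup>2)"
    by (rule sum_mono) (use p1 in \<open>auto simp: power_divide intro: mult_left_le_one_le p_nonneg\<close>)
  also have "\<dots> = 4 * ?a" by (simp add: sum_distrib_left)
  also have "\<dots> \<le> (2 * \<delta>)\<^sup>2" using nn lt by (simp add: power_mult_distrib)
  finally show "Mnorm y \<le> 2 * \<delta>" by (rule power2_le_imp_le) (use \<delta> in simp)
  show "m k * exp (q k \<bullet> y) < \<delta>\<^sup>2" if k: "p k = 0"
  proof (cases "norm (q k) < R")
    case True
    then have "m k * exp (q k \<bullet> y) \<le> ?b" using k by (intro member_le_sum) (auto intro!: m0)
    then show ?thesis using nn lt by linarith
  next
    case False
    then have "R < norm (q k)" using off_circle[OF k] by simp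
    then have "m k * exp (q k \<bullet> y) \<le> ?c" using k by (intro member_le_sum) (auto intro!: m0)
    then show ?thesis using lt by linarith
  qed
qed

text \<open>
  Since \<open>10752 = 8 * 8 * 168\<close>, tubes of this radius meet the smallness condition of \<open>pair_growth\<close>.
\<close>
definition dU :: real
  where "dU = min (d0 / 2) (1 / (10752 * B\<^sup>2 * CI))"

lemma dU: "0 < dU" "2 * dU \<le> d0" "10752 * B\<^sup>2 * CI * dU \<le> 1"
proof -
  have b: "0 < 10752 * B\<^sup>2 * CI" using B CI_pos by simp
  show "0 < dU" using d0(1) b by (simp add: dU_def)
  show "2 * dU \<le> d0" by (simp add: dU_def)
  have "dU \<le> 1 / (10752 * B\<^sup>2 * CI)" by (simp add: dU_def)
  then show "10752 * B\<^sup>2 * CI * dU \<le> 1" unfolding pos_le_divide_eq[OF b] by (simp only: mult.commute)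
qed

lemma staying_bounds:
  assumes m: "mass_profile m" and \<delta>: "0 < \<delta>" "\<delta> \<le> dU" and y: "in_tube \<delta> (evol m t) (y t)"
  shows "Mnorm (y t) \<le> d0" "inactive_mass (evol m t) (y t) \<le> 2 * \<delta>" "Mnorm (y t) \<le> 2 * \<delta>"
proof -
  have d: "2 * \<delta> \<le> d0" using \<delta> dU by simp
  then have "\<delta> \<le> 1" using d0(3) \<delta> by simp
  then have "\<delta>\<^sup>2 \<le> \<delta>" using \<delta> by (simp add: power2_eq_square mult_left_le)
  then show "inactive_mass (evol m t) (y t) \<le> 2 * \<delta>" using in_tube_imp(2)[OF mass_profile_evol[OF m] \<delta>(1) y] by simp
  show "Mnorm (y t) \<le> 2 * \<delta>" by (rule in_tube_imp(1)[OF mass_profile_evol[OF m] \<delta>(1) y])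
  then show "Mnorm (y t) \<le> d0" using d by simp
qed

lemma staying_displacement:
  assumes m: "mass_profile m" and y: "solution m y" and T: "0 \<le> T" and \<delta>: "0 < \<delta>" "\<delta> \<le> dU"
    and stay: "\<And>t. 0 \<le> t \<Longrightarrow> t \<le> T \<Longrightarrow> in_tube \<delta> (evol m t) (y t)"
  shows "norm (y T - y 0) \<le> 1"
proof -
  have d2: "2 * \<delta> \<le> d0" using \<delta> dU by simp
  note sb = staying_bounds[where y = y, OF m \<delta> stay]
  have "norm (y T - y 0) \<le> 24 * B * CI * (Mnorm (y T) + 2 * \<delta>)"
    by (rule drift_le[OF m y T sb(1) sb(2) d2])
  also have "\<dots> \<le> 24 * B * CI * (4 * dU)"
    using sb(3)[OF T order_refl] \<delta> B CI_pos by (intro mult_left_mono) auto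
  also have "\<dots> = (96 * B * CI * dU) * 1" by simp
  also have "\<dots> \<le> (96 * B * CI * dU) * (112 * B)"
    using B(1,2) CI_pos dU(1) B(4) by (intro mult_left_mono) (auto intro!: mult_nonneg_nonneg)
  also have "\<dots> \<le> 1" using dU(3) by (simp add: power2_eq_square mult_ac)
  finally show ?thesis .
qed

text \<open>
  Both solutions move by at most one, so their distance at time \<open>T\<close> is at most three; the growth estimates carry this bound
  back to time \<open>0\<close>.
\<close>
lemma staying_separation:
  assumes m: "mass_profile m" and y: "solution m y" and x: "solution m x" and T: "0 \<le> T" and \<delta>: "0 < \<delta>" "\<delta> \<le> dU"
    and sy: "\<And>t. 0 \<le> t \<Longrightarrow> t \<le> T \<Longrightarrow> in_tube \<delta> (evol m t) (y t)"
    and sx: "\<And>t. 0 \<le> t \<Longrightarrow> t \<le> T \<Longrightarrow> in_tube \<delta> (evol m t) (x t)"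
    and near: "norm (y 0 - x 0) \<le> 1"
  shows "norm (y 0 - x 0) \<le> 6 * exp (- 8 * mu1 * T)"
    and "(y 0 - x 0) \<bullet> e1 = 0 \<Longrightarrow> norm (y 0 - x 0) \<le> 6 * exp (- 8 * mu2 * T)"
proof -
  have d2: "2 * \<delta> \<le> d0" using \<delta> dU by simp
  note by' = staying_bounds[where y = y, OF m \<delta> sy] and bx = staying_bounds[where y = x, OF m \<delta> sx]
  have small: "168 * B\<^sup>2 * CI * (Mnorm (y T) + Mnorm (x T) + 2 * (2 * \<delta>)) \<le> 1/8"
  proof -
    have "168 * B\<^sup>2 * CI * (Mnorm (y T) + Mnorm (x T) + 2 * (2 * \<delta>)) \<le> 168 * B\<^sup>2 * CI * (8 * dU)"
      using by'(3)[OF T order_refl] bx(3)[OF T order_refl] \<delta> CI_pos by (intro mult_left_mono) auto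
    also have "\<dots> = (10752 * B\<^sup>2 * CI * dU) / 8" by simp
    finally show ?thesis using dU(3) by linarith
  qed
  have g2: "norm (y 0 - x 0) \<le> 2 * exp (- 8 * mu1 * T) * norm (y T - x T)"
    by (rule pair_growth(2)[OF m y x T _ _ _ _ d2 small]) (rule by'(1) bx(1) by'(2) bx(2); assumption)+
  have g3: "norm (y 0 - x 0) \<le> 2 * exp (- 8 * mu2 * T) * norm (y T - x T)" if "(y 0 - x 0) \<bullet> e1 = 0"
    by (rule pair_growth(3)[OF m y x T _ _ _ _ d2 small that]) (rule by'(1) bx(1) by'(2) bx(2); assumption)+
  have "norm (y T - x T) \<le> 3"
  proof -
    have "y T - x T = (y T - y 0) + (y 0 - x 0) - (x T - x 0)" by simp
    also have "norm \<dots> \<le> norm (y T - y 0) + norm (y 0 - x 0) + norm (x T - x 0)"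
      by (metis norm_triangle_ineq norm_triangle_ineq4 add_right_mono order_trans)
    finally show ?thesis
      using staying_displacement[OF m y T \<delta> sy] staying_displacement[OF m x T \<delta> sx] near by simp
  qed
  then have e: "2 * exp c * norm (y T - x T) \<le> 6 * exp c" for c :: real
    by (simp add: mult.commute mult_right_mono)
  show "norm (y 0 - x 0) \<le> 6 * exp (- 8 * mu1 * T)" using g2 e[of "- 8 * mu1 * T"] by linarith
  show "norm (y 0 - x 0) \<le> 6 * exp (- 8 * mu2 * T)" if "(y 0 - x 0) \<bullet> e1 = 0"
    using g3[OF that] e[of "- 8 * mu2 * T"] by linarith
qed

section \<open>Initial values of staying solutions\<close>

text \<open>
  Inner masses are largest at time \<open>T\<close> and outer masses at time \<open>0\<close>, so it suffices to control them there.
\<close>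
lemma mass_small:
  assumes m: "mass_profile m" and d: "0 \<le> d"
    and mi: "\<And>k. p k = 0 \<Longrightarrow> norm (q k) < R \<Longrightarrow> evol m T k \<le> d\<^sup>2"
    and mo: "\<And>k. p k = 0 \<Longrightarrow> R < norm (q k) \<Longrightarrow> m k \<le> d\<^sup>2"
    and t: "0 \<le> t" "t \<le> T" and y: "norm y \<le> 1"
  shows "inactive_mass (evol m t) y \<le> real CARD('n) * exp B * d\<^sup>2"
proof -
  have "evol m t k * exp (q k \<bullet> y) \<le> d\<^sup>2 * exp B" if k: "p k = 0" for k
  proof (rule mult_mono)
    have m0: "0 \<le> m k" using m by (simp add: mass_profile_def)
    show "evol m t k \<le> d\<^sup>2"
    proof (cases "norm (q k) < R")
      case True
      then have "0 \<le> kap k" unfolding kap_def using power_mono[of "norm (q k)" R 2] by simp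
      then have "2 * kap k * t \<le> 2 * kap k * T" using t by (intro mult_left_mono) auto
      then have "evol m t k \<le> evol m T k" unfolding evol_def using m0 by (intro mult_left_mono) auto
      then show ?thesis using mi[OF k True] by simp
    next
      case False
      then have R: "R < norm (q k)" using off_circle[OF k] by simp
      then have "kap k \<le> 0" unfolding kap_def using power_mono[of R "norm (q k)" 2] R_nonneg by simp
      then have "2 * kap k * t \<le> 0" using t by (simp add: mult_nonpos_nonneg)
      then have "evol m t k \<le> m k * 1" unfolding evol_def using m0 by (intro mult_left_mono) auto
      then show ?thesis using mo[OF k R] by simp
    qed
    have "q k \<bullet> y \<le> B * norm y" using inner_q_le[of k y] by linarith
    also have "\<dots> \<le> B" using y B by (simp add: mult_left_le)
    finally show "exp (q k \<bullet> y) \<le> exp B" by simp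
  qed auto
  then have "inactive_mass (evol m t) y \<le> (\<Sum>k\<in>{k. p k = 0}. d\<^sup>2 * exp B)"
    unfolding inactive_mass_def by (intro sum_mono) auto
  also have "\<dots> = real (card {k. p k = 0}) * (exp B * d\<^sup>2)" by simp
  also have "\<dots> \<le> real CARD('n) * (exp B * d\<^sup>2)" by (intro mult_right_mono) (auto intro: card_mono)
  finally show ?thesis by (simp only: mult.assoc)
qed

lemma small_state_stays:
  assumes m: "mass_profile m" and d: "0 \<le> d"
    and mi: "\<And>k. p k = 0 \<Longrightarrow> norm (q k) < R \<Longrightarrow> evol m T k \<le> d\<^sup>2"
    and mo: "\<And>k. p k = 0 \<Longrightarrow> R < norm (q k) \<Longrightarrow> m k \<le> d\<^sup>2"
    and t: "0 \<le> t" "t \<le> T" and y: "norm y \<le> 1" "norm y \<le> A * d"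
    and \<delta>: "(real CARD('n) * B\<^sup>2 * A\<^sup>2 + real CARD('n) * exp B) * d\<^sup>2 < \<delta>\<^sup>2"
  shows "in_tube \<delta> (evol m t) y"
proof -
  have inactive_mass: "inactive_mass (evol m t) y \<le> real CARD('n) * exp B * d\<^sup>2"
    by (rule mass_small[OF m d mi mo t y(1)])
  have "(q i \<bullet> y / 2)\<^sup>2 \<le> B\<^sup>2 * A\<^sup>2 * d\<^sup>2" for i
  proof -
    have "\<bar>q i \<bullet> y / 2\<bar> \<le> B * norm y" using inner_q_le[of i y] by simp
    also have "\<dots> \<le> B * (A * d)" using y B by (intro mult_left_mono) auto
    finally have "\<bar>q i \<bullet> y / 2\<bar>\<^sup>2 \<le> (B * (A * d))\<^sup>2" by (intro power_mono) auto
    then show ?thesis by (simp only: power2_abs power_mult_distrib mult.assoc)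
  qed
  then have "(\<Sum>i\<in>{i. 0 < p i}. (q i \<bullet> y / 2)\<^sup>2) \<le> (\<Sum>i\<in>{i. 0 < p i}. B\<^sup>2 * A\<^sup>2 * d\<^sup>2)"
    by (rule sum_mono)
  also have "\<dots> = real (card {i. 0 < p i}) * (B\<^sup>2 * A\<^sup>2 * d\<^sup>2)" by simp
  also have "\<dots> \<le> real CARD('n) * (B\<^sup>2 * A\<^sup>2 * d\<^sup>2)" by (intro mult_right_mono) (auto intro: card_mono)
  finally have a: "(\<Sum>i\<in>{i. 0 < p i}. (q i \<bullet> y / 2)\<^sup>2) \<le> real CARD('n) * (B\<^sup>2 * A\<^sup>2 * d\<^sup>2)" .
  have m0: "0 \<le> evol m t k * exp (q k \<bullet> y)" for k using mass_profile_evol[OF m, of t] by (simp add: mass_profile_def)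
  have "0 \<le> (\<Sum>k\<in>{k. p k = 0 \<and> norm (q k) < R}. evol m t k * exp (q k \<bullet> y))"
    "0 \<le> (\<Sum>k\<in>{k. p k = 0 \<and> R < norm (q k)}. evol m t k * exp (q k \<bullet> y))"
    "0 \<le> (\<Sum>i\<in>{i. 0 < p i}. (q i \<bullet> y / 2)\<^sup>2)"
    by (auto intro!: sum_nonneg m0)
  moreover have "real CARD('n) * (B\<^sup>2 * A\<^sup>2 * d\<^sup>2) + real CARD('n) * exp B * d\<^sup>2 < \<delta>\<^sup>2"
    using \<delta> by (simp add: algebra_simps)
  ultimately show ?thesis using a inactive_mass unfolding in_tube_def inactive_mass_split by linarith
qed

text \<open>
  Solutions \<open>Y b\<close> with a small terminal value \<open>b\<close> at time \<open>T\<close> stay small on the whole interval, since they drift only a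
  little. For terminal values \<open>b *\<^sub>R e1\<close>, the component of the initial value along \<open>e1\<close> depends continuously on \<open>b\<close>, and the
  values for \<open>b = 0\<close> and \<open>b = d\<close> are at least \<open>d / 2 * exp (- 8 * mu1 * T)\<close> apart. By the intermediate value theorem
  each \<open>a1\<close> between them is attained. Moving such an initial value along \<open>e2\<close> by up to \<open>d / 2 * exp (- 8 * mu2 * T)\<close>
  changes the solution by at most \<open>d\<close> up to time \<open>T\<close>. The solvability of the terminal value problem is a premise because it
  comes from the given flow.
\<close>
lemma staying_initial_values:
  assumes \<delta>: "0 < \<delta>"
  shows "\<exists>d>0. \<forall>T m. 0 \<le> T \<longrightarrow> mass_profile m \<longrightarrow>
      (\<forall>k. p k = 0 \<longrightarrow> norm (q k) < R \<longrightarrow> evol m T k \<le> d\<^sup>2) \<longrightarrow>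
      (\<forall>k. p k = 0 \<longrightarrow> R < norm (q k) \<longrightarrow> m k \<le> d\<^sup>2) \<longrightarrow>
      (\<forall>b. \<exists>y. solution m y \<and> y T = b) \<longrightarrow>
      (\<exists>\<alpha>. \<bar>\<alpha>\<bar> \<le> 1 \<and> (\<forall>a1. \<alpha> \<le> a1 \<and> a1 \<le> \<alpha> + d / 2 * exp (- 8 * mu1 * T) \<longrightarrow>
        (\<exists>\<beta>. \<bar>\<beta>\<bar> \<le> 1 \<and> (\<forall>a2. \<beta> \<le> a2 \<and> a2 \<le> \<beta> + d / 2 * exp (- 8 * mu2 * T) \<longrightarrow>
          (\<forall>x. solution m x \<longrightarrow> x 0 = a1 *\<^sub>R e1 + a2 *\<^sub>R e2 \<longrightarrow>
            (\<forall>t. 0 \<le> t \<and> t \<le> T \<longrightarrow> in_tube \<delta> (evol m t) (x t)))))))"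
proof -
  \<comment> \<open>\<open>K\<close> is the constant of the drift estimate, \<open>nA * d\<^sup>2\<close> bounds the inactive mass, and \<open>A * d\<close> will bound the
    solutions with terminal values of norm at most \<open>d\<close>. All estimates take place in the ball of radius \<open>r\<close>. The number
    \<open>CC\<close> is the sum of all factors that \<open>d\<close> has to compensate.\<close>
  define K where "K = 24 * B * CI"
  define nA where "nA = real CARD('n) * exp B"
  define A where "A = 1 + K * (B + nA)"
  define r where "r = min 1 (min (d0 / B) (1 / (5376 * B ^ 3 * CI)))"
  define CC where "CC = (A + 1) + nA + 336 * B\<^sup>2 * CI * nA + (real CARD('n) * B\<^sup>2 * (A + 1)\<^sup>2 + nA)"
  define \<epsilon> where "\<epsilon> = min r (min d0 (min (1/16) (\<delta>\<^sup>2)))"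
  define d where "d = \<epsilon> / (CC + 1)"
  have K0: "0 \<le> K" using B CI_pos by (simp add: K_def)
  have nA0: "0 \<le> nA" by (simp add: nA_def)
  have A1: "1 \<le> A" using K0 nA0 B by (simp add: A_def)
  have B3: "0 < 5376 * B ^ 3 * CI" using B CI_pos by simp
  have r: "0 < r" "r \<le> 1" "B * r \<le> d0" "5376 * B ^ 3 * CI * r \<le> 1"
  proof -
    show "0 < r" using d0(1) B B3 by (simp add: r_def)
    show "r \<le> 1" by (simp add: r_def)
    have "r \<le> d0 / B" "r \<le> 1 / (5376 * B ^ 3 * CI)" by (simp_all add: r_def)
    then show "B * r \<le> d0" "5376 * B ^ 3 * CI * r \<le> 1"
      unfolding pos_le_divide_eq[OF B(3)] pos_le_divide_eq[OF B3] by (simp_all only: mult.commute)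
  qed
  have \<epsilon>: "0 < \<epsilon>" "\<epsilon> \<le> r" "\<epsilon> \<le> d0" "\<epsilon> \<le> 1/16" "\<epsilon> \<le> \<delta>\<^sup>2"
    using r d0 \<delta> by (auto simp: \<epsilon>_def)
  have terms0: "0 \<le> 336 * B\<^sup>2 * CI * nA" "0 \<le> real CARD('n) * B\<^sup>2 * (A + 1)\<^sup>2"
    using CI_pos nA0 by auto
  have CC0: "0 \<le> CC" using terms0 nA0 A1 by (simp add: CC_def)
  have d: "0 < d" using \<epsilon> CC0 by (simp add: d_def)
  have dlt: "c * d < \<epsilon>" if "c \<le> CC" for c
  proof -
    have "c * d \<le> CC * d" using that d by (intro mult_right_mono) auto
    also have "\<dots> < (CC + 1) * d" using d by (simp add: algebra_simps)
    also have "\<dots> = \<epsilon>" using CC0 by (simp add: d_def)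
    finally show ?thesis .
  qed
  have d1: "(A + 1) * d < r" using dlt[of "A + 1"] \<epsilon> terms0 nA0 by (simp add: CC_def)
  have d2: "nA * d \<le> d0" using dlt[of nA] \<epsilon> terms0 nA0 A1 by (simp add: CC_def)
  have d3: "336 * B\<^sup>2 * CI * nA * d \<le> 1/16" using dlt[of "336 * B\<^sup>2 * CI * nA"] \<epsilon> terms0 nA0 A1 by (simp add: CC_def)
  have dle1: "d \<le> 1"
  proof -
    have "d \<le> (A + 1) * d" using A1 d by simp
    then show ?thesis using d1 r by simp
  qed
  have dd: "d\<^sup>2 \<le> d" using d dle1 by (simp add: power2_eq_square mult_left_le)
  have d4: "(real CARD('n) * B\<^sup>2 * (A + 1)\<^sup>2 + nA) * d\<^sup>2 < \<delta>\<^sup>2"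
  proof -
    have "(real CARD('n) * B\<^sup>2 * (A + 1)\<^sup>2 + nA) * d\<^sup>2 \<le> (real CARD('n) * B\<^sup>2 * (A + 1)\<^sup>2 + nA) * d"
      using dd terms0 nA0 by (intro mult_left_mono) auto
    also have "\<dots> < \<epsilon>" using terms0 nA0 A1 by (intro dlt) (simp add: CC_def)
    finally show ?thesis using \<epsilon> by simp
  qed
  show ?thesis
  proof (rule exI[of _ d], intro conjI d allI impI)
    fix T m
    assume T: "0 \<le> T" and m: "mass_profile m"
      and mi': "\<forall>k. p k = 0 \<longrightarrow> norm (q k) < R \<longrightarrow> evol m T k \<le> d\<^sup>2"
      and mo': "\<forall>k. p k = 0 \<longrightarrow> R < norm (q k) \<longrightarrow> m k \<le> d\<^sup>2"
      and ex: "\<forall>b. \<exists>y. solution m y \<and> y T = b"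
    have mi: "\<And>k. p k = 0 \<Longrightarrow> norm (q k) < R \<Longrightarrow> evol m T k \<le> d\<^sup>2"
      and mo: "\<And>k. p k = 0 \<Longrightarrow> R < norm (q k) \<Longrightarrow> m k \<le> d\<^sup>2" using mi' mo' by auto
    obtain Y where Y: "\<And>b. solution m (Y b)" "\<And>b. Y b T = b" using ex by metis
    have dn: "0 \<le> d" using d by simp
    have near: "Mnorm y \<le> d0" "Mnorm y \<le> B * r" "inactive_mass (evol m t) y \<le> nA * d"
      if y: "norm y \<le> r" and t: "0 \<le> t" "t \<le> T" for t y
    proof -
      have "B * norm y \<le> B * r" using y B by (intro mult_left_mono) auto
      then show "Mnorm y \<le> B * r" using Mnorm_le_norm[of y] by linarith
      then show "Mnorm y \<le> d0" using r by linarith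
      have "inactive_mass (evol m t) y \<le> nA * d\<^sup>2"
        unfolding nA_def by (rule mass_small[OF m dn mi mo t]) (use y r in auto)
      also have "\<dots> \<le> nA * d" using dd nA0 by (intro mult_left_mono)
      finally show "inactive_mass (evol m t) y \<le> nA * d" .
    qed
    have Ysmall: "norm (Y b t) \<le> A * d" if b: "norm b \<le> d" and t: "0 \<le> t" "t \<le> T" for b t
    proof (rule backward_continuation[where f = "\<lambda>t. norm (Y b t)" and r = r, OF T _ _ _ _ t])
      show "continuous_on {0..T} (\<lambda>t. norm (Y b t))" by (intro continuous_intros solution_continuous[OF Y(1)])
      have "d \<le> (A + 1) * d" using A1 d by simp
      then show "norm (Y b T) < r" using b d1 by (simp add: Y(2))
      show "A * d < r" using d1 d by (simp add: algebra_simps)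
      fix s assume s: "0 \<le> s" "s \<le> T" "\<And>t. s \<le> t \<Longrightarrow> t \<le> T \<Longrightarrow> norm (Y b t) \<le> r"
      have "norm (Y b T - Y b s) \<le> 24 * B * CI * (Mnorm (Y b T) + nA * d)"
      proof (rule drift_le[OF m Y(1) s(2) _ _ d2])
        fix t assume "s \<le> t" "t \<le> T"
        then show "Mnorm (Y b t) \<le> d0" "inactive_mass (evol m t) (Y b t) \<le> nA * d"
          using s by (auto intro!: near)
      qed
      also have "\<dots> \<le> K * (B * d + nA * d)"
      proof -
        have "Mnorm b \<le> B * d" using Mnorm_le_norm[of b] mult_left_mono[OF b B(4)] by linarith
        then show ?thesis unfolding K_def[symmetric] Y(2) using K0 by (intro mult_left_mono) auto
      qed
      finally have "norm (Y b T - Y b s) \<le> K * (B * d + nA * d)" .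
      moreover have "norm (Y b s) \<le> norm (Y b T) + norm (Y b T - Y b s)"
        using norm_triangle_ineq4[of "Y b T" "Y b T - Y b s"] by simp
      ultimately show "norm (Y b s) \<le> A * d" using b by (simp add: A_def Y(2) algebra_simps)
    qed
    have pair: "Mnorm (x t) \<le> d0" "Mnorm (y t) \<le> d0" "inactive_mass (evol m t) (x t) \<le> nA * d" "inactive_mass (evol m t) (y t) \<le> nA * d"
      if "norm (x t) \<le> r" "norm (y t) \<le> r" "0 \<le> t" "t \<le> T" for x y :: "real \<Rightarrow> complex" and t
      using near that by auto
    have sm: "168 * B\<^sup>2 * CI * (Mnorm x + Mnorm y + 2 * (nA * d)) \<le> 1/8" if "norm x \<le> r" "norm y \<le> r" for x y
    proof -
      have "168 * B\<^sup>2 * CI * (Mnorm x + Mnorm y + 2 * (nA * d)) \<le> 168 * B\<^sup>2 * CI * (B * r + B * r + 2 * (nA * d))"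
        using near(2)[OF that(1), of 0] near(2)[OF that(2), of 0] T CI_pos nA0 by (intro mult_left_mono add_mono) auto
      also have "\<dots> = (5376 * B ^ 3 * CI * r) / 16 + 336 * B\<^sup>2 * CI * nA * d"
        by (simp add: algebra_simps power2_eq_square power3_eq_cube)
      finally show ?thesis using r(4) d3 by linarith
    qed
    have Adr: "A * d \<le> r" using d1 d by (simp add: algebra_simps)
    have stays: "in_tube \<delta> (evol m t) (x t)"
      if b: "norm b \<le> d" and x: "solution m x" and x0: "norm (x 0 - Y b 0) \<le> d / 2 * exp (- 8 * mu2 * T)"
        and t: "0 \<le> t" "t \<le> T" for b x t
    proof -
      have "norm (x t) \<le> (A + 1) * d"
      proof (rule forward_continuation[where f = "\<lambda>t. norm (x t)" and r = r, OF T _ _ _ d1 t])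
        show "continuous_on {0..T} (\<lambda>t. norm (x t))" by (intro continuous_intros solution_continuous[OF x])
        have "exp (- 8 * mu2 * T) \<le> 1" using mu_nonneg mu_le T by simp
        then have "d / 2 * exp (- 8 * mu2 * T) \<le> d / 2 * 1" using d by (intro mult_left_mono) auto
        then have "norm (x 0 - Y b 0) \<le> d / 2" using x0 by linarith
        then have "norm (x 0) \<le> A * d + d / 2"
          using Ysmall[OF b order_refl T] norm_triangle_ineq2[of "x 0" "Y b 0"] by linarith
        then show "norm (x 0) < r" using d1 d by (simp add: algebra_simps)
        fix s assume s: "0 \<le> s" "s \<le> T" "\<And>t. 0 \<le> t \<Longrightarrow> t \<le> s \<Longrightarrow> norm (x t) \<le> r"
        have nx: "norm (x t) \<le> r" "norm (Y b t) \<le> r" "t \<le> T" if "0 \<le> t" "t \<le> s" for t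
          using s(3)[OF that] Ysmall[OF b, of t] that s Adr by auto
        have "norm (x s - Y b s) \<le> 2 * exp (8 * mu2 * s) * norm (x 0 - Y b 0)"
        proof (rule pair_growth(1)[OF m x Y(1) s(1) _ _ _ _ d2])
          fix t assume t: "0 \<le> t" "t \<le> s"
          show "Mnorm (x t) \<le> d0" "Mnorm (Y b t) \<le> d0" "inactive_mass (evol m t) (x t) \<le> nA * d" "inactive_mass (evol m t) (Y b t) \<le> nA * d"
            using pair[where x = x and y = "Y b", OF nx(1,2)[OF t] t(1) nx(3)[OF t]] by auto
        next
          show "168 * B\<^sup>2 * CI * (Mnorm (x s) + Mnorm (Y b s) + 2 * (nA * d)) \<le> 1 / 8"
            by (rule sm) (use nx[OF s(1) order_refl] in auto)
        qed
        also have "\<dots> \<le> 2 * exp (8 * mu2 * T) * (d / 2 * exp (- 8 * mu2 * T))"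
          using s mu_nonneg mu_le by (intro mult_mono x0) (auto intro!: mult_left_mono)
        also have "\<dots> = d" by (simp add: exp_minus)
        finally show "norm (x s) \<le> (A + 1) * d"
          using Ysmall[OF b s(1,2)] norm_triangle_ineq2[of "x s" "Y b s"] by (simp add: algebra_simps)
      qed
      then show ?thesis
        using d1 r d4 unfolding nA_def by (intro small_state_stays[OF m dn mi mo t]) auto
    qed
    define h where "h b = Y (b *\<^sub>R e1) 0 \<bullet> e1" for b
    have pg: "norm (Y (b *\<^sub>R e1) 0 - Y (b' *\<^sub>R e1) 0) \<le> 2 * exp (- 8 * mu1 * T) * \<bar>b - b'\<bar>"
      "\<bar>b - b'\<bar> \<le> 2 * exp (8 * mu1 * T) * \<bar>h b - h b'\<bar>"
      if b: "0 \<le> b" "b \<le> d" "0 \<le> b'" "b' \<le> d" for b b'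
    proof -
      let ?y = "Y (b *\<^sub>R e1)" and ?x = "Y (b' *\<^sub>R e1)"
      have nb: "norm (b *\<^sub>R e1) \<le> d" "norm (b' *\<^sub>R e1) \<le> d" using b e_norm by auto
      have ny: "norm (?y t) \<le> r" "norm (?x t) \<le> r" if "0 \<le> t" "t \<le> T" for t
        using Ysmall[OF nb(1) that] Ysmall[OF nb(2) that] Adr by auto
      have P: "Mnorm (?y t) \<le> d0" "Mnorm (?x t) \<le> d0" "inactive_mass (evol m t) (?y t) \<le> nA * d" "inactive_mass (evol m t) (?x t) \<le> nA * d"
        if t: "0 \<le> t" "t \<le> T" for t
        using pair[where x = ?y and y = ?x, OF ny[OF t] t] by auto
      have g2: "norm (?y 0 - ?x 0) \<le> 2 * exp (- 8 * mu1 * T) * norm (?y T - ?x T)"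
        by (rule pair_growth(2)[OF m Y(1) Y(1) T _ _ _ _ d2 sm[OF ny[OF T order_refl]]]) (rule P; assumption)+
      have g4: "norm (?y T - ?x T) \<le> 2 * exp (8 * mu1 * T) * \<bar>(?y 0 - ?x 0) \<bullet> e1\<bar>"
        if "(?y T - ?x T) \<bullet> e2 = 0"
        by (rule pair_growth(4)[OF m Y(1) Y(1) T _ _ _ _ d2 sm[OF ny[OF T order_refl]] that]) (rule P; assumption)+
      have e: "?y T - ?x T = (b - b') *\<^sub>R e1" by (simp add: Y(2) scaleR_diff_left)
      show "norm (?y 0 - ?x 0) \<le> 2 * exp (- 8 * mu1 * T) * \<bar>b - b'\<bar>"
        using g2 unfolding e by (simp add: e_norm)
      have "(?y T - ?x T) \<bullet> e2 = 0" unfolding e by (simp add: e_orth)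
      from g4[OF this] show "\<bar>b - b'\<bar> \<le> 2 * exp (8 * mu1 * T) * \<bar>h b - h b'\<bar>"
        unfolding e h_def by (simp add: e_norm inner_diff_left)
    qed
    have ch: "continuous_on {0..d} h"
    proof (rule lipschitz_on_continuous_on[OF lipschitz_onI[of _ _ 2]])
      fix b b' assume "b \<in> {0..d}" "b' \<in> {0..d}"
      then have b: "0 \<le> b" "b \<le> d" "0 \<le> b'" "b' \<le> d" by auto
      have "\<bar>h b - h b'\<bar> \<le> norm (Y (b *\<^sub>R e1) 0 - Y (b' *\<^sub>R e1) 0)"
        using Cauchy_Schwarz_ineq2[of "Y (b *\<^sub>R e1) 0 - Y (b' *\<^sub>R e1) 0" e1] e_norm
        by (simp add: h_def inner_diff_left)
      also have "\<dots> \<le> 2 * exp (- 8 * mu1 * T) * \<bar>b - b'\<bar>" by (rule pg(1)[OF b])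
      also have "\<dots> \<le> 2 * 1 * \<bar>b - b'\<bar>" using mu_nonneg T by (intro mult_right_mono mult_left_mono) auto
      finally show "dist (h b) (h b') \<le> 2 * dist b b'" by (simp add: dist_real_def)
    qed simp
    define \<alpha> where "\<alpha> = min (h 0) (h d)"
    have len: "d / 2 * exp (- 8 * mu1 * T) \<le> \<bar>h d - h 0\<bar>"
      using pg(2)[of d 0] d by (simp add: exp_minus field_simps)
    have hb: "\<bar>h b\<bar> \<le> 1" "\<bar>Y (b *\<^sub>R e1) 0 \<bullet> e2\<bar> \<le> 1" if "0 \<le> b" "b \<le> d" for b
    proof -
      have "norm (Y (b *\<^sub>R e1) 0) \<le> A * d" using that e_norm by (intro Ysmall order_refl T) auto
      then have "norm (Y (b *\<^sub>R e1) 0) \<le> 1" using Adr r by linarith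
      then show "\<bar>h b\<bar> \<le> 1" "\<bar>Y (b *\<^sub>R e1) 0 \<bullet> e2\<bar> \<le> 1" unfolding h_def
        using Cauchy_Schwarz_ineq2[of "Y (b *\<^sub>R e1) 0" e1] Cauchy_Schwarz_ineq2[of "Y (b *\<^sub>R e1) 0" e2] e_norm by auto
    qed
    show "\<exists>\<alpha>. \<bar>\<alpha>\<bar> \<le> 1 \<and> (\<forall>a1. \<alpha> \<le> a1 \<and> a1 \<le> \<alpha> + d / 2 * exp (- 8 * mu1 * T) \<longrightarrow>
        (\<exists>\<beta>. \<bar>\<beta>\<bar> \<le> 1 \<and> (\<forall>a2. \<beta> \<le> a2 \<and> a2 \<le> \<beta> + d / 2 * exp (- 8 * mu2 * T) \<longrightarrow>
          (\<forall>x. solution m x \<longrightarrow> x 0 = a1 *\<^sub>R e1 + a2 *\<^sub>R e2 \<longrightarrow>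
            (\<forall>t. 0 \<le> t \<and> t \<le> T \<longrightarrow> in_tube \<delta> (evol m t) (x t))))))"
    proof (rule exI[of _ \<alpha>], intro conjI allI impI)
      show "\<bar>\<alpha>\<bar> \<le> 1" using hb(1)[of 0] hb(1)[of d] d by (simp add: \<alpha>_def min_def)
      fix a1 assume a1: "\<alpha> \<le> a1 \<and> a1 \<le> \<alpha> + d / 2 * exp (- 8 * mu1 * T)"
      have "a1 \<le> \<alpha> + \<bar>h d - h 0\<bar>" using a1 len by linarith
      then have am: "\<alpha> \<le> a1" "a1 \<le> max (h 0) (h d)" using a1 by (auto simp: \<alpha>_def)
      have "\<exists>b\<ge>0. b \<le> d \<and> h b = a1"
      proof (cases "h 0 \<le> h d")
        case True
        then show ?thesis using IVT'[of h 0 a1 d] am ch d by (auto simp: \<alpha>_def)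
      next
        case False
        then show ?thesis using IVT2'[of h d a1 0] am ch d by (auto simp: \<alpha>_def)
      qed
      then obtain b where b: "0 \<le> b" "b \<le> d" "h b = a1" by auto
      let ?\<beta> = "Y (b *\<^sub>R e1) 0 \<bullet> e2"
      show "\<exists>\<beta>. \<bar>\<beta>\<bar> \<le> 1 \<and> (\<forall>a2. \<beta> \<le> a2 \<and> a2 \<le> \<beta> + d / 2 * exp (- 8 * mu2 * T) \<longrightarrow>
          (\<forall>x. solution m x \<longrightarrow> x 0 = a1 *\<^sub>R e1 + a2 *\<^sub>R e2 \<longrightarrow>
            (\<forall>t. 0 \<le> t \<and> t \<le> T \<longrightarrow> in_tube \<delta> (evol m t) (x t))))"
      proof (rule exI[of _ ?\<beta>], intro conjI allI impI)
        show "\<bar>?\<beta>\<bar> \<le> 1" using hb(2)[OF b(1,2)] .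
        fix a2 x t
        assume a2: "?\<beta> \<le> a2 \<and> a2 \<le> ?\<beta> + d / 2 * exp (- 8 * mu2 * T)"
          and x: "solution m x" and x0: "x 0 = a1 *\<^sub>R e1 + a2 *\<^sub>R e2" and t: "0 \<le> t \<and> t \<le> T"
        have "x 0 - Y (b *\<^sub>R e1) 0 = (a2 - ?\<beta>) *\<^sub>R e2"
        proof -
          define v where "v = Y (b *\<^sub>R e1) 0"
          have "x 0 - v = a1 *\<^sub>R e1 + a2 *\<^sub>R e2 - ((v \<bullet> e1) *\<^sub>R e1 + (v \<bullet> e2) *\<^sub>R e2)"
            by (simp add: eigen_expansion[symmetric] x0)
          then show ?thesis using b(3) by (simp add: h_def v_def scaleR_diff_left)
        qed
        then have "norm (x 0 - Y (b *\<^sub>R e1) 0) \<le> d / 2 * exp (- 8 * mu2 * T)"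
          using a2 by (simp add: e_norm)
        then show "in_tube \<delta> (evol m t) (x t)"
          using b t e_norm by (intro stays[OF _ x]) auto
      qed
    qed
  qed
qed

end

text \<open>
  The off-diagonal entry of \<open>M\<close> in the orthonormal frame \<open>cis t, \<i> * cis t\<close> changes its sign when the frame is rotated by a right
  angle, so it vanishes for some angle.
\<close>
lemma psd_plane_diagonalization:
  fixes q :: "'n::finite \<Rightarrow> complex" and p :: "'n \<Rightarrow> real"
  assumes p: "\<And>i. 0 \<le> p i"
  shows "\<exists>e1 e2 mu1 mu2. norm e1 = 1 \<and> norm e2 = 1 \<and> e1 \<bullet> e2 = 0
    \<and> (\<Sum>i\<in>UNIV. (p i * (q i \<bullet> e1)) *\<^sub>R q i) = mu1 *\<^sub>R e1
    \<and> (\<Sum>i\<in>UNIV. (p i * (q i \<bullet> e2)) *\<^sub>R q i) = mu2 *\<^sub>R e2 \<and> 0 \<le> mu1 \<and> mu1 \<le> mu2"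
proof -
  define M where "M y = (\<Sum>i\<in>UNIV. (p i * (q i \<bullet> y)) *\<^sub>R q i)" for y
  have sym: "M x \<bullet> y = M y \<bullet> x" for x y
    unfolding M_def inner_sum_left by (intro sum.cong refl) (simp add: mult_ac)
  have pos: "0 \<le> M x \<bullet> x" for x
    unfolding M_def inner_sum_left by (intro sum_nonneg) (simp add: p mult.assoc)
  define g where "g t = M (cis t) \<bullet> (\<i> * cis t)" for t
  have g0: "g 0 = M 1 \<bullet> \<i>" by (simp add: g_def)
  have gh: "g (pi/2) = - (M 1 \<bullet> \<i>)"
    using sym[of \<i> 1] by (simp add: g_def)
  have cg: "continuous_on {0..pi/2} g"
    unfolding g_def M_def by (intro continuous_intros)
  have "\<exists>t. g t = 0"
  proof (cases "g 0 \<le> 0")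
    case True
    then show ?thesis using IVT'[of g 0 0 "pi/2"] cg g0 gh pi_gt_zero by auto
  next
    case False
    then show ?thesis using IVT2'[of g "pi/2" 0 0] cg g0 gh pi_gt_zero by auto
  qed
  then obtain t where t: "g t = 0" by blast
  define f1 f2 where "f1 = \<i> * cis t" and "f2 = cis t"
  have n: "norm f1 = 1" "norm f2 = 1" by (simp_all add: f1_def f2_def norm_mult)
  have o: "f1 \<bullet> f2 = 0" "f2 \<bullet> f1 = 0" by (simp_all add: f1_def f2_def inner_complex_def)
  have ex: "y = (y \<bullet> f1) *\<^sub>R f1 + (y \<bullet> f2) *\<^sub>R f2" for y
  proof -
    have cs: "(cos t)\<^sup>2 + (sin t)\<^sup>2 = 1" by simp
    have "Re y = (Re y * cos t + Im y * sin t) * cos t - (Im y * cos t - Re y * sin t) * sin t"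
      "Im y = (Im y * cos t - Re y * sin t) * cos t + (Re y * cos t + Im y * sin t) * sin t"
      using cs by algebra+
    then show ?thesis
      by (simp add: complex_eq_iff inner_complex_def f1_def f2_def)
  qed
  have m12: "M f2 \<bullet> f1 = 0" "M f1 \<bullet> f2 = 0" using t sym[of f1 f2] by (simp_all add: g_def f1_def f2_def)
  have e: "M f1 = (M f1 \<bullet> f1) *\<^sub>R f1" "M f2 = (M f2 \<bullet> f2) *\<^sub>R f2"
    using ex[of "M f1"] ex[of "M f2"] m12 by simp_all
  show ?thesis
  proof (cases "M f1 \<bullet> f1 \<le> M f2 \<bullet> f2")
    case True
    then show ?thesis using n o e pos[of f1] unfolding M_def by blast
  next
    case False
    then have "M f2 \<bullet> f2 \<le> M f1 \<bullet> f1" by simp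
    then show ?thesis using n o e pos[of f2] unfolding M_def by blast
  qed
qed

section \<open>Gradient and Hessian of the residual\<close>

lemma cdot_diff: "cdot u (a - b) = cdot u a - cdot u b"
  by (simp add: cdot_def algebra_simps sum_subtractf)

lemma Re_cdot: "Re (cdot u h) = u \<bullet> h"
  by (simp add: cdot_def inner_vec_def inner_complex_def)

lemma horizontal_inner: "h \<in> horizontal u \<Longrightarrow> u \<bullet> h = 0"
  using Re_cdot[of u h] by (simp add: horizontal_def)

lemma norm_vec_sq: "(norm (w :: complex^'n))\<^sup>2 = (\<Sum>i\<in>UNIV. (norm (w$i))\<^sup>2)"
  by (simp add: power2_norm_eq_inner inner_vec_def)

lemma norm_diff_sq: "(norm (a - b))\<^sup>2 = (norm a)\<^sup>2 - 2 * (b \<bullet> a) + (norm b)\<^sup>2"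
  for a b :: "'a::real_inner"
  unfolding power2_norm_eq_inner inner_diff_left inner_diff_right by (simp add: inner_commute[of a b])

lemma unit_sum: "norm (u :: complex^'n) = 1 \<Longrightarrow> (\<Sum>i\<in>UNIV. u$i \<bullet> u$i) = 1"
  using power2_norm_eq_inner[of u] by (simp add: inner_vec_def)

text \<open>
  The residual does not change when a multiple of the identity is subtracted from the matrix, so all eigenvalues may be
  taken relative to a point \<open>c\<close>.
\<close>
locale spectrum =
  fixes lam :: "complex^'n" and c :: complex
begin

definition q :: "'n \<Rightarrow> complex" where "q i = lam$i - c"

text \<open>
  \<open>Sg w\<close> and \<open>Zq w\<close> are the second and the first moment of \<open>q\<close> under the weights \<open>(norm (w$i))\<^sup>2\<close>. On the unit sphere the residual
  is the variance \<open>Sg u - Zq u \<bullet> Zq u\<close>, and \<open>G\<close> below is its extension that is constant on complex lines; \<open>DSg\<close>,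
  \<open>DZq\<close> and \<open>DG\<close> are the derivatives.
\<close>
definition Sg :: "complex^'n \<Rightarrow> real"
  where "Sg w = (\<Sum>i\<in>UNIV. (norm (q i))\<^sup>2 * (w$i \<bullet> w$i))"

definition Zq :: "complex^'n \<Rightarrow> complex"
  where "Zq w = (\<Sum>i\<in>UNIV. (w$i \<bullet> w$i) *\<^sub>R q i)"

definition DSg :: "complex^'n \<Rightarrow> complex^'n \<Rightarrow> real"
  where "DSg w h = (\<Sum>i\<in>UNIV. (norm (q i))\<^sup>2 * (2 * (w$i \<bullet> h$i)))"

definition DZq :: "complex^'n \<Rightarrow> complex^'n \<Rightarrow> complex"
  where "DZq w h = (\<Sum>i\<in>UNIV. (2 * (w$i \<bullet> h$i)) *\<^sub>R q i)"

definition G :: "complex^'n \<Rightarrow> real"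
  where "G w = Sg w / (w \<bullet> w) - (Zq w \<bullet> Zq w) / (w \<bullet> w)\<^sup>2"

definition DG :: "complex^'n \<Rightarrow> complex^'n \<Rightarrow> real"
  where "DG w h = DSg w h / (w \<bullet> w) - Sg w * (2 * (w \<bullet> h)) / (w \<bullet> w)\<^sup>2
     - 2 * (Zq w \<bullet> DZq w h) / (w \<bullet> w)\<^sup>2 + 2 * (Zq w \<bullet> Zq w) * (2 * (w \<bullet> h)) / (w \<bullet> w) ^ 3"

lemma rayleigh_diag: "norm u = 1 \<Longrightarrow> rayleigh (diag_mat lam) u = c + Zq u"
proof -
  assume u: "norm u = 1"
  have d: "(diag_mat lam *v u) $ i = lam$i * u$i" for i
    by (simp add: matrix_vector_mult_def diag_mat_def if_distrib[of "\<lambda>x. x * _"] cong: if_cong)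
  have n: "(\<Sum>i\<in>UNIV. u$i \<bullet> u$i) = 1" by (rule unit_sum[OF u])
  have "cnj (u$i) * (lam$i * u$i) = (u$i \<bullet> u$i) *\<^sub>R c + (u$i \<bullet> u$i) *\<^sub>R q i" for i
  proof -
    have "cnj (u$i) * u$i = complex_of_real (u$i \<bullet> u$i)"
      by (metis complex_norm_square mult.commute power2_norm_eq_inner)
    then have "cnj (u$i) * (lam$i * u$i) = complex_of_real (u$i \<bullet> u$i) * lam$i" by (simp add: mult_ac)
    then show ?thesis by (simp add: q_def scaleR_conv_of_real algebra_simps)
  qed
  then have "rayleigh (diag_mat lam) u = (\<Sum>i\<in>UNIV. (u$i \<bullet> u$i) *\<^sub>R c) + Zq u"
    by (simp add: rayleigh_def cdot_def d Zq_def sum.distrib)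
  then show ?thesis using n by (simp add: scaleR_sum_left[symmetric])
qed

lemma sum_inner_q: "(\<Sum>i\<in>UNIV. (w$i \<bullet> w$i) * (x \<bullet> q i)) = x \<bullet> Zq w"
  by (simp add: Zq_def inner_sum_right)

lemma residual_diag: "norm u = 1 \<Longrightarrow> residual (diag_mat lam) u = Sg u - Zq u \<bullet> Zq u"
proof -
  assume u: "norm u = 1"
  have d: "(diag_mat lam *v u) $ i = lam$i * u$i" for i
    by (simp add: matrix_vector_mult_def diag_mat_def if_distrib[of "\<lambda>x. x * _"] cong: if_cong)
  have n: "(\<Sum>i\<in>UNIV. u$i \<bullet> u$i) = 1" by (rule unit_sum[OF u])
  have "(norm ((diag_mat lam *v u - rayleigh (diag_mat lam) u *s u) $ i))\<^sup>2
      = (norm (q i))\<^sup>2 * (u$i \<bullet> u$i) - 2 * (Zq u \<bullet> ((u$i \<bullet> u$i) *\<^sub>R q i)) + (Zq u \<bullet> Zq u) * (u$i \<bullet> u$i)" for i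
  proof -
    have "(diag_mat lam *v u - rayleigh (diag_mat lam) u *s u) $ i = (q i - Zq u) * u$i"
      by (simp add: d rayleigh_diag[OF u] q_def algebra_simps)
    then have "(norm ((diag_mat lam *v u - rayleigh (diag_mat lam) u *s u) $ i))\<^sup>2
      = (norm (q i - Zq u))\<^sup>2 * (norm (u$i))\<^sup>2"
      by (simp add: norm_mult power_mult_distrib)
    then show ?thesis unfolding norm_diff_sq by (simp add: dot_square_norm algebra_simps)
  qed
  then have "residual (diag_mat lam) u = Sg u - 2 * (Zq u \<bullet> Zq u) + (Zq u \<bullet> Zq u) * (\<Sum>i\<in>UNIV. u$i \<bullet> u$i)"
    unfolding residual_def norm_vec_sq
    by (simp add: sum.distrib sum_subtractf sum_distrib_left[symmetric] Sg_def sum_inner_q)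
  then show ?thesis using n by simp
qed

lemma hom_ext_G: "w \<noteq> 0 \<Longrightarrow> hom_ext (residual (diag_mat lam)) w = G w"
proof -
  assume w: "w \<noteq> 0"
  define r where "r = inverse (norm w)"
  have s: "sgn w = r *\<^sub>R w" by (simp add: sgn_div_norm r_def)
  have r2: "r\<^sup>2 = 1 / (w \<bullet> w)" by (simp add: r_def power_inverse power2_norm_eq_inner divide_inverse)
  have "Sg (r *\<^sub>R w) = r\<^sup>2 * Sg w" "Zq (r *\<^sub>R w) = r\<^sup>2 *\<^sub>R Zq w"
    by (simp_all add: Sg_def Zq_def sum_distrib_left scaleR_sum_right power2_eq_square mult_ac)
  moreover have "norm (r *\<^sub>R w) = 1" using w by (simp add: r_def)
  ultimately have "hom_ext (residual (diag_mat lam)) w = r\<^sup>2 * Sg w - (r\<^sup>2)\<^sup>2 * (Zq w \<bullet> Zq w)"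
    unfolding hom_ext_def s by (simp add: residual_diag power2_eq_square)
  then show ?thesis unfolding r2 G_def by (simp add: power_divide)
qed

lemma has_derivative_nth_sq:
  "((\<lambda>w :: complex^'n. w$i \<bullet> w$i) has_derivative (\<lambda>h. 2 * (w$i \<bullet> h$i))) (at w)"
proof -
  have d: "((\<lambda>w :: complex^'n. w$i) has_derivative (\<lambda>h. h$i)) (at w)"
    by (rule bounded_linear.has_derivative[OF bounded_linear_vec_nth has_derivative_ident])
  show ?thesis using has_derivative_inner[OF d d] by (simp add: inner_commute)
qed

lemma Sg_deriv: "(Sg has_derivative DSg w) (at w)"
  unfolding Sg_def[abs_def] DSg_def[abs_def]
  by (intro has_derivative_sum has_derivative_mult_right has_derivative_nth_sq)

lemma Zq_deriv: "(Zq has_derivative DZq w) (at w)"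
  unfolding Zq_def[abs_def] DZq_def[abs_def]
  by (intro has_derivative_sum has_derivative_scaleR_left has_derivative_nth_sq)

lemma inner_self_deriv: "((\<lambda>w :: complex^'n. w \<bullet> w) has_derivative (\<lambda>h. 2 * (w \<bullet> h))) (at w)"
  using has_derivative_inner[OF has_derivative_ident has_derivative_ident, of w] by (simp add: inner_commute)

lemma G_deriv: "w \<noteq> 0 \<Longrightarrow> (G has_derivative DG w) (at w)"
proof -
  assume w: "w \<noteq> 0"
  then have n: "w \<bullet> w \<noteq> 0" by simp
  have dZ: "((\<lambda>w. Zq w \<bullet> Zq w) has_derivative (\<lambda>h. 2 * (Zq w \<bullet> DZq w h))) (at w)"
    using has_derivative_inner[OF Zq_deriv Zq_deriv] by (simp add: inner_commute)
  have n2: "(w \<bullet> w)\<^sup>2 \<noteq> 0" using n by simp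
  have d2: "((\<lambda>w :: complex^'n. (w \<bullet> w)\<^sup>2) has_derivative (\<lambda>h. 2 * (w \<bullet> w) * (2 * (w \<bullet> h)))) (at w)"
    using has_derivative_power[OF inner_self_deriv, of 2 w] by (simp add: mult_ac)
  show ?thesis
    unfolding G_def[abs_def]
    apply (rule has_derivative_eq_rhs)
     apply (rule has_derivative_diff)
      apply (rule has_derivative_divide'[OF Sg_deriv inner_self_deriv n])
     apply (rule has_derivative_divide'[OF dZ d2 n2])
    using n by (auto simp: DG_def fun_eq_iff divide_simps power2_eq_square power3_eq_cube) (simp add: algebra_simps)
qed

lemma frechet_hom_ext: "w \<noteq> 0 \<Longrightarrow> frechet_derivative (hom_ext (residual (diag_mat lam))) (at w) = DG w"
proof -
  assume w: "w \<noteq> 0"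
  have "(hom_ext (residual (diag_mat lam)) has_derivative DG w) (at w)"
    by (rule has_derivative_transform_within_open[OF G_deriv[OF w], of "- {0}"])
      (use w in \<open>auto simp: hom_ext_G\<close>)
  then show ?thesis by (rule frechet_derivative_at[symmetric])
qed

definition grad :: "complex^'n \<Rightarrow> complex^'n"
  where "grad u = (\<chi> i. (2 * ((norm (q i - Zq u))\<^sup>2 - (Sg u - Zq u \<bullet> Zq u))) *\<^sub>R u$i)"

lemma grad_horizontal: "norm u = 1 \<Longrightarrow> grad u \<in> horizontal u"
proof -
  assume u: "norm u = 1"
  have n: "(\<Sum>i\<in>UNIV. u$i \<bullet> u$i) = 1" by (rule unit_sum[OF u])
  have "cnj (u$i) * u$i = complex_of_real (u$i \<bullet> u$i)" for i
    by (metis complex_norm_square mult.commute power2_norm_eq_inner)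
  then have "cnj (u$i) * grad u $ i = complex_of_real (2 * ((norm (q i - Zq u))\<^sup>2 - (Sg u - Zq u \<bullet> Zq u)) * (u$i \<bullet> u$i))" for i
    by (simp add: grad_def scaleR_conv_of_real mult_ac)
  then have "cdot u (grad u) = complex_of_real (\<Sum>i\<in>UNIV. 2 * ((norm (q i - Zq u))\<^sup>2 - (Sg u - Zq u \<bullet> Zq u)) * (u$i \<bullet> u$i))"
    by (simp add: cdot_def)
  also have "(\<Sum>i\<in>UNIV. 2 * ((norm (q i - Zq u))\<^sup>2 - (Sg u - Zq u \<bullet> Zq u)) * (u$i \<bullet> u$i))
     = (\<Sum>i\<in>UNIV. 2 * ((norm (q i))\<^sup>2 * (u$i \<bullet> u$i)) - 4 * (Zq u \<bullet> ((u$i \<bullet> u$i) *\<^sub>R q i)) + (4 * (Zq u \<bullet> Zq u) - 2 * Sg u) * (u$i \<bullet> u$i))"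
    by (intro sum.cong refl)
      (simp add: norm_diff_sq dot_square_norm algebra_simps)
  also have "\<dots> = 2 * Sg u - 4 * (Zq u \<bullet> Zq u) + (4 * (Zq u \<bullet> Zq u) - 2 * Sg u) * (\<Sum>i\<in>UNIV. u$i \<bullet> u$i)"
    by (simp add: sum.distrib sum_subtractf sum_distrib_left[symmetric] Sg_def sum_inner_q)
  also have "\<dots> = 0" using n by simp
  finally show ?thesis by (simp add: horizontal_def)
qed

lemma DG_grad: "norm u = 1 \<Longrightarrow> h \<in> horizontal u \<Longrightarrow> DG u h = grad u \<bullet> h"
proof -
  assume u: "norm u = 1" and h: "h \<in> horizontal u"
  have uu: "u \<bullet> u = 1" using u by (simp add: power2_norm_eq_inner[symmetric])
  have uh: "u \<bullet> h = 0" by (rule horizontal_inner[OF h])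
  have "grad u \<bullet> h = (\<Sum>i\<in>UNIV. 2 * ((norm (q i - Zq u))\<^sup>2 - (Sg u - Zq u \<bullet> Zq u)) * (u$i \<bullet> h$i))"
    by (simp add: inner_vec_def grad_def)
  also have "\<dots> = (\<Sum>i\<in>UNIV. (norm (q i))\<^sup>2 * (2 * (u$i \<bullet> h$i)) - 2 * (Zq u \<bullet> ((2 * (u$i \<bullet> h$i)) *\<^sub>R q i)) + (4 * (Zq u \<bullet> Zq u) - 2 * Sg u) * (u$i \<bullet> h$i))"
    by (intro sum.cong refl)
      (simp add: norm_diff_sq dot_square_norm algebra_simps)
  also have "\<dots> = DSg u h - 2 * (Zq u \<bullet> DZq u h) + (4 * (Zq u \<bullet> Zq u) - 2 * Sg u) * (u \<bullet> h)"
    unfolding DSg_def DZq_def inner_sum_right inner_vec_def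
    by (simp add: sum.distrib sum_subtractf sum_distrib_left)
  finally show ?thesis by (simp add: DG_def uu uh)
qed

lemma horizontal_diff: "a \<in> horizontal u \<Longrightarrow> b \<in> horizontal u \<Longrightarrow> a - b \<in> horizontal u"
  by (simp add: horizontal_def cdot_diff)

lemma fs_gradient_diag: 
  assumes u: "norm u = 1"
  shows "fs_gradient (residual (diag_mat lam)) u = grad u"
proof -
  have u0: "u \<noteq> 0" using u by auto
  have d: "fs_differential (residual (diag_mat lam)) u h = grad u \<bullet> h" if "h \<in> horizontal u" for h
    unfolding fs_differential_def frechet_hom_ext[OF u0] by (rule DG_grad[OF u that])
  show ?thesis unfolding fs_gradient_def
  proof (rule the_equality)
    show "grad u \<in> horizontal u \<and> (\<forall>h\<in>horizontal u. fs_differential (residual (diag_mat lam)) u h = grad u \<bullet> h)"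
      using d grad_horizontal[OF u] by blast
    fix g assume g: "g \<in> horizontal u \<and> (\<forall>h\<in>horizontal u. fs_differential (residual (diag_mat lam)) u h = g \<bullet> h)"
    have h: "g - grad u \<in> horizontal u" using g grad_horizontal[OF u] by (intro horizontal_diff) auto
    have "(g - grad u) \<bullet> (g - grad u) = 0" using g d h by (simp add: inner_diff_left)
    then show "g = grad u" by simp
  qed
qed

lemma fs_critical_diag:
  assumes u: "norm u = 1" and crit: "fs_critical (residual (diag_mat lam)) u"
  shows "grad u = 0"
proof -
  have u0: "u \<noteq> 0" using u by auto
  have "DG u (grad u) = 0"
    using crit grad_horizontal[OF u] by (simp add: fs_critical_def fs_differential_def frechet_hom_ext[OF u0])
  then show ?thesis using DG_grad[OF u grad_horizontal[OF u]] by simp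
qed

text \<open>
  Since \<open>Zq u = 0\<close> and \<open>h\<close>, \<open>k\<close> are orthogonal to \<open>u\<close>, only few of the terms in the derivative of \<open>DG w k\<close> at \<open>u\<close> survive.
\<close>
lemma fs_hessian_diag:
  assumes u: "norm u = 1" and Z: "Zq u = 0" and S: "Sg u = r"
    and h: "h \<in> horizontal u" and k: "k \<in> horizontal u"
  shows "fs_hessian (residual (diag_mat lam)) u h k
    = 2 * (\<Sum>i\<in>UNIV. ((norm (q i))\<^sup>2 - r) * (h$i \<bullet> k$i)) - 2 * (DZq u h \<bullet> DZq u k)"
proof -
  have u0: "u \<noteq> 0" using u by auto
  have uu: "u \<bullet> u = 1" using u by (simp add: power2_norm_eq_inner[symmetric])
  have uh: "u \<bullet> h = 0" "u \<bullet> k = 0" by (intro horizontal_inner h k)+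
  have nth: "((\<lambda>w :: complex^'n. w$i \<bullet> k$i) has_derivative (\<lambda>h. h$i \<bullet> k$i)) (at u)" for i
    by (rule has_derivative_inner_left[OF bounded_linear.has_derivative[OF bounded_linear_vec_nth has_derivative_ident]])
  have dS: "((\<lambda>w. DSg w k) has_derivative (\<lambda>h. \<Sum>i\<in>UNIV. (norm (q i))\<^sup>2 * (2 * (h$i \<bullet> k$i)))) (at u)"
    unfolding DSg_def by (intro has_derivative_sum has_derivative_mult_right nth)
  have dZ: "((\<lambda>w. DZq w k) has_derivative (\<lambda>h. \<Sum>i\<in>UNIV. (2 * (h$i \<bullet> k$i)) *\<^sub>R q i)) (at u)"
    unfolding DZq_def by (intro has_derivative_sum has_derivative_scaleR_left has_derivative_mult_right nth)
  have dn: "((\<lambda>w :: complex^'n. 2 * (w \<bullet> k)) has_derivative (\<lambda>h. 2 * (h \<bullet> k))) (at u)"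
    by (rule has_derivative_mult_right[OF has_derivative_inner_left[OF has_derivative_ident]])
  have i1: "((\<lambda>w :: complex^'n. inverse (w \<bullet> w)) has_derivative (\<lambda>h. - (2 * (u \<bullet> h)))) (at u)"
    using Deriv.has_derivative_inverse[OF _ inner_self_deriv[of u]] uu by simp
  define J where "J w = inverse (w \<bullet> w)" for w :: "complex^'n"
  have dJ: "(J has_derivative (\<lambda>h. - (2 * (u \<bullet> h)))) (at u)" using i1 by (simp add: J_def[abs_def])
  have J1: "J u = 1" by (simp add: J_def uu)
  have dZZ: "((\<lambda>w. Zq w \<bullet> DZq w k) has_derivative (\<lambda>h. DZq u h \<bullet> DZq u k)) (at u)"
    using has_derivative_inner[OF Zq_deriv dZ] Z by simp
  have dZ2: "((\<lambda>w. Zq w \<bullet> Zq w) has_derivative (\<lambda>h. 0)) (at u)"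
    using has_derivative_inner[OF Zq_deriv[of u] Zq_deriv] Z by simp
  have eq: "DG w k = DSg w k * J w - (Sg w * (2 * (w \<bullet> k))) * (J w * J w)
     - 2 * ((Zq w \<bullet> DZq w k) * (J w * J w)) + 2 * ((Zq w \<bullet> Zq w) * ((2 * (w \<bullet> k)) * (J w * J w * J w)))" for w
    by (simp add: DG_def J_def divide_inverse power2_eq_square power3_eq_cube mult_ac)
  have d: "((\<lambda>w. DG w k) has_derivative (\<lambda>h. DSg u k * - (2 * (u \<bullet> h)) + (\<Sum>i\<in>UNIV. (norm (q i))\<^sup>2 * (2 * (h$i \<bullet> k$i)))
       - ((Sg u * (2 * (u \<bullet> k))) * (- (2 * (u \<bullet> h)) + - (2 * (u \<bullet> h))) + (Sg u * (2 * (h \<bullet> k)) + DSg u h * (2 * (u \<bullet> k))))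
       - 2 * (DZq u h \<bullet> DZq u k))) (at u)"
    unfolding eq
    apply (rule has_derivative_eq_rhs)
     apply (rule dS dJ Sg_deriv dn dZZ dZ2 has_derivative_add has_derivative_diff has_derivative_mult_right has_derivative_mult)+
    by (simp add: J1 Z fun_eq_iff)
  have "((\<lambda>w. frechet_derivative (hom_ext (residual (diag_mat lam))) (at w) k) has_derivative
      (\<lambda>h. DSg u k * - (2 * (u \<bullet> h)) + (\<Sum>i\<in>UNIV. (norm (q i))\<^sup>2 * (2 * (h$i \<bullet> k$i)))
       - ((Sg u * (2 * (u \<bullet> k))) * (- (2 * (u \<bullet> h)) + - (2 * (u \<bullet> h))) + (Sg u * (2 * (h \<bullet> k)) + DSg u h * (2 * (u \<bullet> k))))
       - 2 * (DZq u h \<bullet> DZq u k))) (at u)"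
    by (rule has_derivative_transform_within_open[OF d, of "- {0}"]) (use u0 in \<open>auto simp: frechet_hom_ext\<close>)
  from frechet_derivative_at[OF this]
  have "fs_hessian (residual (diag_mat lam)) u h k = (\<Sum>i\<in>UNIV. (norm (q i))\<^sup>2 * (2 * (h$i \<bullet> k$i))) - r * (2 * (h \<bullet> k)) - 2 * (DZq u h \<bullet> DZq u k)"
    unfolding fs_hessian_def by (metis (no_types, lifting) S uh mult_zero_right add_0 add_0_right minus_zero diff_zero)
  also have "(\<Sum>i\<in>UNIV. (norm (q i))\<^sup>2 * (2 * (h$i \<bullet> k$i))) - r * (2 * (h \<bullet> k)) = 2 * (\<Sum>i\<in>UNIV. ((norm (q i))\<^sup>2 - r) * (h$i \<bullet> k$i))"
    unfolding inner_vec_def by (simp add: sum_distrib_left sum_subtractf[symmetric] algebra_simps)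
  finally show ?thesis .
qed

end

section \<open>Consequences of the Morse--Bott condition\<close>

lemma norm_sq_inner: "z \<bullet> z = (norm z)\<^sup>2"
  by (rule power2_norm_eq_inner[symmetric])

lemma sum_axis: "(\<Sum>i\<in>UNIV. axis i (h$i)) = (h :: complex^'n)"
  by (simp add: vec_eq_iff axis_def if_distrib cong: if_cong)

locale morse_bott_data = spectrum lam "center lam p"
  for lam :: "complex^'n" and p :: "real^'n" +
  assumes mb: "morse_bott_torus (diag_mat lam) p"
    and off: "\<And>k. k \<notin> active p \<Longrightarrow> cmod (lam$k - center lam p) \<noteq> radius lam p"
begin

abbreviation R :: real where "R \<equiv> radius lam p"

lemma p_nonneg: "0 \<le> p$i" and p_sum: "(\<Sum>i\<in>UNIV. p$i) = 1"
  using mb by (auto simp: morse_bott_torus_def critical_torus_def prob_vector_def)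

lemma active_iff: "i \<in> active p \<longleftrightarrow> 0 < p$i" and inactive_iff: "i \<notin> active p \<longleftrightarrow> p$i = 0"
  using p_nonneg[of i] by (auto simp: active_def)

lemma p_centered: "(\<Sum>i\<in>UNIV. p$i *\<^sub>R q i) = 0"
proof -
  have "(\<Sum>i\<in>UNIV. p$i *\<^sub>R q i) = (\<Sum>i\<in>UNIV. p$i *\<^sub>R lam$i) - (\<Sum>i\<in>UNIV. p$i) *\<^sub>R center lam p"
    by (simp add: q_def scaleR_diff_right sum_subtractf scaleR_sum_left)
  then show ?thesis by (simp add: p_sum center_def scaleR_conv_of_real)
qed

lemma radius_sq: "R\<^sup>2 = (\<Sum>i\<in>UNIV. p$i * (norm (q i))\<^sup>2)"
proof -
  have "0 \<le> radius_sq lam p" unfolding radius_sq_def by (intro sum_nonneg mult_nonneg_nonneg p_nonneg) auto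
  then show ?thesis by (simp add: radius_def radius_sq_def q_def)
qed

lemma lift_inner: "u \<in> torus_lift p \<Longrightarrow> u$i \<bullet> u$i = p$i"
  by (simp add: torus_lift_def norm_sq_inner)

lemma lift_norm: "u \<in> torus_lift p \<Longrightarrow> norm u = 1"
proof -
  assume u: "u \<in> torus_lift p"
  have "(norm u)\<^sup>2 = 1" unfolding norm_vec_sq using u p_sum by (simp add: torus_lift_def)
  then show ?thesis using norm_ge_zero[of u] by (auto simp: power2_eq_1_iff)
qed

lemma lift_Zq: "u \<in> torus_lift p \<Longrightarrow> Zq u = 0"
  by (simp add: Zq_def lift_inner p_centered)

lemma lift_Sg: "u \<in> torus_lift p \<Longrightarrow> Sg u = R\<^sup>2"
  by (simp add: Sg_def lift_inner radius_sq mult.commute)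

lemma torus_point_lift: "torus_point p \<theta> \<in> torus_lift p"
  by (simp add: torus_point_def torus_lift_def norm_mult p_nonneg)

lemma lift_zero: "u \<in> torus_lift p \<Longrightarrow> p$i = 0 \<Longrightarrow> u$i = 0"
  using lift_inner[of u i] by simp

lemma R_nonneg: "0 \<le> R"
  unfolding radius_def radius_sq_def by (intro real_sqrt_ge_zero sum_nonneg mult_nonneg_nonneg p_nonneg) auto

lemma on_circle: "0 < p$i \<Longrightarrow> norm (q i) = R"
proof -
  assume i: "0 < p$i"
  let ?u = "torus_point p 0"
  have u: "?u \<in> torus_lift p" by (rule torus_point_lift)
  have "fs_critical (residual (diag_mat lam)) ?u"
    using mb u by (simp add: morse_bott_torus_def critical_torus_def)
  then have "grad ?u = 0" by (rule fs_critical_diag[OF lift_norm[OF u]])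
  then have "(2 * ((norm (q i))\<^sup>2 - R\<^sup>2)) *\<^sub>R ?u$i = 0"
    by (simp add: grad_def vec_eq_iff lift_Zq[OF u] lift_Sg[OF u])
  moreover have "?u$i \<noteq> 0" using lift_inner[OF u, of i] i by auto
  ultimately have "(norm (q i))\<^sup>2 = R\<^sup>2" by simp
  then show ?thesis using R_nonneg by (simp add: power2_eq_iff_nonneg)
qed

lemma off_circle: "p$i = 0 \<Longrightarrow> norm (q i) \<noteq> R"
  using off[of i] by (simp add: inactive_iff q_def)

lemma hessian: "u \<in> torus_lift p \<Longrightarrow> h \<in> horizontal u \<Longrightarrow> k \<in> horizontal u \<Longrightarrow>
  fs_hessian (residual (diag_mat lam)) u h k
    = 2 * (\<Sum>i\<in>UNIV. ((norm (q i))\<^sup>2 - R\<^sup>2) * (h$i \<bullet> k$i)) - 2 * (DZq u h \<bullet> DZq u k)"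
  by (rule fs_hessian_diag[OF lift_norm lift_Zq lift_Sg])

text \<open>
  A curve \<open>\<gamma>\<close> over the torus satisfies \<open>(norm (\<gamma> s $ i))\<^sup>2 = p$i * (norm (\<gamma> s))\<^sup>2\<close> for all \<open>s\<close>; the claim is the derivative of
  this identity at \<open>0\<close>.
\<close>
lemma tangent_weights:
  assumes u: "u \<in> torus_lift p" and h: "h \<in> tangent_in (torus p) u"
  shows "u$i \<bullet> h$i = 0"
proof -
  obtain \<gamma> :: "real \<Rightarrow> complex^'n" where g: "\<gamma> 0 = u" "\<And>s. \<gamma> s \<noteq> 0" "\<And>s. proj (\<gamma> s) \<in> torus p"
    and dg: "(\<gamma> has_vector_derivative h) (at 0)"
    using h by (auto simp: tangent_in_def)
  have hz: "u \<bullet> h = 0" using h by (auto simp: tangent_in_def horizontal_inner)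
  have eq: "\<gamma> s $ i \<bullet> \<gamma> s $ i - p$i * (\<gamma> s \<bullet> \<gamma> s) = 0" for s
  proof -
    obtain v where v: "v \<in> torus_lift p" "proj (\<gamma> s) = proj v" using g(3)[of s] by (auto simp: torus_def)
    have "1 *s \<gamma> s \<in> proj (\<gamma> s)" unfolding proj_def by (rule rangeI)
    then have "\<gamma> s \<in> proj v" using v(2) by simp
    then obtain b where b: "\<gamma> s = b *s v" by (auto simp: proj_def)
    have "(norm (\<gamma> s $ j))\<^sup>2 = (norm b)\<^sup>2 * p$j" for j
      using v(1) by (simp add: b norm_mult power_mult_distrib torus_lift_def)
    then have "(norm (\<gamma> s $ i))\<^sup>2 = p$i * (norm (\<gamma> s))\<^sup>2"
      unfolding norm_vec_sq by (simp add: sum_distrib_left[symmetric] p_sum)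
    then show ?thesis by (simp add: norm_sq_inner)
  qed
  have di: "((\<lambda>s. \<gamma> s $ i) has_derivative (\<lambda>r. r *\<^sub>R h$i)) (at 0)"
    using bounded_linear.has_derivative[OF bounded_linear_vec_nth dg[unfolded has_vector_derivative_def], of i]
    by simp
  have "((\<lambda>s. \<gamma> s $ i \<bullet> \<gamma> s $ i - p$i * (\<gamma> s \<bullet> \<gamma> s)) has_derivative
     (\<lambda>r. \<gamma> 0 $ i \<bullet> (r *\<^sub>R h$i) + (r *\<^sub>R h$i) \<bullet> \<gamma> 0 $ i
        - p$i * (\<gamma> 0 \<bullet> (r *\<^sub>R h) + (r *\<^sub>R h) \<bullet> \<gamma> 0))) (at 0)"
    by (rule has_derivative_diff[OF has_derivative_inner[OF di di]
          has_derivative_mult_right[OF has_derivative_inner[OF dg[unfolded has_vector_derivative_def] dg[unfolded has_vector_derivative_def]]]])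
  then have "((\<lambda>s :: real. 0 :: real) has_derivative
     (\<lambda>r. \<gamma> 0 $ i \<bullet> (r *\<^sub>R h$i) + (r *\<^sub>R h$i) \<bullet> \<gamma> 0 $ i
        - p$i * (\<gamma> 0 \<bullet> (r *\<^sub>R h) + (r *\<^sub>R h) \<bullet> \<gamma> 0))) (at 0)"
    unfolding eq .
  from has_derivative_unique[OF this has_derivative_const]
  have "(\<lambda>r. \<gamma> 0 $ i \<bullet> (r *\<^sub>R h$i) + (r *\<^sub>R h$i) \<bullet> \<gamma> 0 $ i
        - p$i * (\<gamma> 0 \<bullet> (r *\<^sub>R h) + (r *\<^sub>R h) \<bullet> \<gamma> 0)) = (\<lambda>r. 0)" .
  from fun_cong[OF this, of 1] show ?thesis
    using hz by (simp add: g(1) inner_commute)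
qed

text \<open>
  The variation \<open>a\<close> of the active weights is realized by a real horizontal vector \<open>h\<close>. In the Hessian, the first term vanishes for
  \<open>h\<close> because all active indices lie on the circle, and the second because \<open>a\<close> does not move the mean. So \<open>h\<close> is in the kernel
  of the Hessian, and by the Morse--Bott condition it is tangent to the torus, along which the weights are constant.
\<close>
lemma weights_independent:
  assumes supp: "\<And>i. p$i = 0 \<Longrightarrow> a i = (0::real)" and s: "(\<Sum>i\<in>UNIV. a i) = 0"
    and z: "(\<Sum>i\<in>UNIV. a i *\<^sub>R q i) = 0"
  shows "a i = 0"
proof -
  define u where "u = torus_point p 0"
  have u: "u \<in> torus_lift p" unfolding u_def by (rule torus_point_lift)
  have ui: "u$i = complex_of_real (sqrt (p$i))" for i by (simp add: u_def torus_point_def)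
  \<comment> \<open>For inactive \<open>i\<close> the quotient is \<open>0 / 0 = 0\<close>.\<close>
  define h :: "complex^'n" where "h = (\<chi> i. complex_of_real (a i / (2 * sqrt (p$i))))"
  have uh: "u$i \<bullet> h$i = a i / 2" "cnj (u$i) * h$i = complex_of_real (a i / 2)" for i
  proof -
    have e: "sqrt (p$i) * (a i / (2 * sqrt (p$i))) = a i / 2" using supp[of i] by (cases "p$i = 0") auto
    show "u$i \<bullet> h$i = a i / 2" unfolding ui h_def using e by (simp add: inner_complex_def)
    have "cnj (u$i) * h$i = complex_of_real (sqrt (p$i) * (a i / (2 * sqrt (p$i))))"
      unfolding ui h_def by (simp only: complex_cnj_complex_of_real vec_lambda_beta of_real_mult)
    then show "cnj (u$i) * h$i = complex_of_real (a i / 2)" unfolding e .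
  qed
  have hz: "h \<in> horizontal u"
  proof -
    have "cdot u h = (\<Sum>i\<in>UNIV. complex_of_real (a i / 2))"
      unfolding cdot_def by (intro sum.cong refl uh(2))
    also have "\<dots> = complex_of_real ((\<Sum>i\<in>UNIV. a i) / 2)" by (simp add: sum_divide_distrib)
    finally show ?thesis by (simp add: horizontal_def s)
  qed
  have Dz: "DZq u h = 0" unfolding DZq_def uh using z by simp
  have z: "((norm (q i))\<^sup>2 - R\<^sup>2) * (h$i \<bullet> k) = 0" for i k
    using on_circle[of i] supp[of i] p_nonneg[of i] by (cases "p$i = 0") (auto simp: h_def)
  have "fs_hessian (residual (diag_mat lam)) u h k = 0" if k: "k \<in> horizontal u" for k
    unfolding hessian[OF u hz k] z Dz by simp
  then have "h \<in> hessian_kernel (residual (diag_mat lam)) u"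
    unfolding hessian_kernel_def using hz by simp
  then have "h \<in> tangent_in (torus p) u"
    using mb u by (simp add: morse_bott_torus_def)
  from tangent_weights[OF u this, of i] show ?thesis by (simp add: uh)
qed

lemma planar_flow_exists:
  "\<exists>e1 e2 mu1 mu2. planar_flow q (\<lambda>i. p$i) R e1 e2 mu1 mu2"
proof -
  obtain e1 e2 mu1 mu2 where "norm e1 = 1" "norm e2 = 1" "e1 \<bullet> e2 = 0"
    "(\<Sum>i\<in>UNIV. (p$i * (q i \<bullet> e1)) *\<^sub>R q i) = mu1 *\<^sub>R e1"
    "(\<Sum>i\<in>UNIV. (p$i * (q i \<bullet> e2)) *\<^sub>R q i) = mu2 *\<^sub>R e2" "0 \<le> mu1" "mu1 \<le> mu2"
    using psd_plane_diagonalization[of "\<lambda>i. p$i" q] p_nonneg by blast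
  then have "planar_flow q (\<lambda>i. p$i) R e1 e2 mu1 mu2"
    by unfold_locales (use p_nonneg p_sum p_centered on_circle off_circle in auto)
  then show ?thesis by blast
qed

end

locale morse_bott_flow = morse_bott_data lam p
  + pf: planar_flow "spectrum.q lam (center lam p)" "\<lambda>i. p$i" "radius lam p" e1 e2 mu1 mu2
  for lam :: "complex^'n" and p :: "real^'n" and e1 e2 :: complex and mu1 mu2 :: real
begin

lemma mu_pos_or_orth:
  "mu1 = 0 \<Longrightarrow> 0 < p$i \<Longrightarrow> q i \<bullet> e1 = 0" "mu2 = 0 \<Longrightarrow> 0 < p$i \<Longrightarrow> q i \<bullet> e2 = 0"
proof -
  have "p$i * (q i \<bullet> y)\<^sup>2 \<le> (pf.Mnorm y)\<^sup>2" for y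
    unfolding pf.Mnorm_sq by (rule member_le_sum) (auto intro!: mult_nonneg_nonneg p_nonneg)
  moreover have "(pf.Mnorm e1)\<^sup>2 = mu1" "(pf.Mnorm e2)\<^sup>2 = mu2"
    using pf.e_norm pf.e_orth by (simp_all add: pf.Mnorm_eigen norm_sq_inner inner_commute[of e2 e1])
  ultimately have "p$i * (q i \<bullet> e1)\<^sup>2 \<le> mu1" "p$i * (q i \<bullet> e2)\<^sup>2 \<le> mu2" by metis+
  then show "mu1 = 0 \<Longrightarrow> 0 < p$i \<Longrightarrow> q i \<bullet> e1 = 0" "mu2 = 0 \<Longrightarrow> 0 < p$i \<Longrightarrow> q i \<bullet> e2 = 0"
    by (auto simp: mult_le_0_iff)
qed

text \<open>
  Take \<open>y\<close> with \<open>M y = (\<Sum>i. (p$i * \<xi> i) *\<^sub>R q i)\<close>; this is solvable, since the right-hand side has no component in the kernel of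
  \<open>M\<close>. Then the weights \<open>p$i * (\<xi> i - q i \<bullet> y)\<close> vanish by \<open>weights_independent\<close>.
\<close>
lemma log_weights_planar:
  assumes "(\<Sum>i\<in>UNIV. p$i * \<xi> i) = 0"
  shows "\<exists>y. \<forall>i. 0 < p$i \<longrightarrow> \<xi> i = q i \<bullet> y"
proof -
  define d where "d = (\<Sum>i\<in>UNIV. (p$i * \<xi> i) *\<^sub>R q i)"
  \<comment> \<open>If an eigenvalue is zero, so is the corresponding component of \<open>d\<close>, and the quotient \<open>0 / 0 = 0\<close> is right.\<close>
  define y where "y = ((d \<bullet> e1) / mu1) *\<^sub>R e1 + ((d \<bullet> e2) / mu2) *\<^sub>R e2"
  have d0: "mu1 = 0 \<Longrightarrow> d \<bullet> e1 = 0" "mu2 = 0 \<Longrightarrow> d \<bullet> e2 = 0"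
    unfolding d_def inner_sum_left using mu_pos_or_orth p_nonneg
    by (auto intro!: sum.neutral simp: less_le)
  have "y \<bullet> e1 = (d \<bullet> e1) / mu1" "y \<bullet> e2 = (d \<bullet> e2) / mu2"
    using pf.e_norm pf.e_orth by (simp_all add: y_def inner_add_left norm_sq_inner inner_commute[of e2 e1])
  then have "pf.M y = (d \<bullet> e1) *\<^sub>R e1 + (d \<bullet> e2) *\<^sub>R e2"
    using d0 by (simp add: pf.M_eigen)
  then have My: "pf.M y = d" by (simp add: pf.eigen_expansion[symmetric])
  have "p$i * (\<xi> i - q i \<bullet> y) = 0" for i
  proof (rule weights_independent)
    show "(\<Sum>i\<in>UNIV. p$i * (\<xi> i - q i \<bullet> y)) = 0"
      using assms pf.sum_p_inner[of y] by (simp add: right_diff_distrib sum_subtractf)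
    show "(\<Sum>i\<in>UNIV. (p$i * (\<xi> i - q i \<bullet> y)) *\<^sub>R q i) = 0"
      using My by (simp add: right_diff_distrib scaleR_diff_left sum_subtractf d_def pf.M_def)
  qed auto
  then have "0 < p$i \<longrightarrow> \<xi> i = q i \<bullet> y" for i by (metis eq_iff_diff_eq_0 less_irrefl mult_eq_0_iff)
  then show ?thesis by blast
qed

text \<open>
  The symmetric operator that represents the Hessian at a point of the torus.
\<close>
definition hessian_op :: "complex^'n \<Rightarrow> complex^'n \<Rightarrow> complex^'n"
  where "hessian_op u h = (\<chi> i. (2 * ((norm (q i))\<^sup>2 - R\<^sup>2)) *\<^sub>R h$i - (4 * (q i \<bullet> DZq u h)) *\<^sub>R u$i)"

lemma hessian_op_inner:
  assumes u: "u \<in> torus_lift p" and h: "h \<in> horizontal u" and k: "k \<in> horizontal u"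
  shows "fs_hessian (residual (diag_mat lam)) u h k = hessian_op u h \<bullet> k"
proof -
  have "hessian_op u h \<bullet> k = (\<Sum>i\<in>UNIV. 2 * (((norm (q i))\<^sup>2 - R\<^sup>2) * (h$i \<bullet> k$i)) - 2 * (DZq u h \<bullet> ((2 * (u$i \<bullet> k$i)) *\<^sub>R q i)))"
    unfolding inner_vec_def by (intro sum.cong refl) (simp add: hessian_op_def inner_diff_left inner_commute[of "DZq u h"] mult_ac)
  also have "\<dots> = 2 * (\<Sum>i\<in>UNIV. ((norm (q i))\<^sup>2 - R\<^sup>2) * (h$i \<bullet> k$i)) - 2 * (DZq u h \<bullet> DZq u k)"
    unfolding DZq_def[of u k] inner_sum_right by (simp add: sum_subtractf sum_distrib_left)
  finally show ?thesis by (simp add: hessian[OF u h k])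
qed

lemma cnj_lift: "u \<in> torus_lift p \<Longrightarrow> cnj (u$i) * u$i = complex_of_real (p$i)"
  by (metis complex_norm_square lift_inner mult.commute norm_sq_inner)

lemma hessian_op_horizontal:
  assumes u: "u \<in> torus_lift p"
  shows "hessian_op u h \<in> horizontal u"
proof -
  have "cnj (u$i) * hessian_op u h $ i = - complex_of_real (4 * (p$i * (q i \<bullet> DZq u h)))" for i
  proof (cases "p$i = 0")
    case True
    then show ?thesis using lift_zero[OF u] by simp
  next
    case False
    then have "norm (q i) = R" using p_nonneg[of i] by (intro on_circle) simp
    then have "cnj (u$i) * hessian_op u h $ i = - (complex_of_real (4 * (q i \<bullet> DZq u h)) * (cnj (u$i) * u$i))"
      by (simp add: hessian_op_def scaleR_conv_of_real)
    then show ?thesis by (simp add: cnj_lift[OF u])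
  qed
  then have "cdot u (hessian_op u h) = - complex_of_real (4 * (\<Sum>i\<in>UNIV. p$i * (q i \<bullet> DZq u h)))"
    by (simp add: cdot_def sum_negf sum_distrib_left)
  then show ?thesis by (simp add: horizontal_def pf.sum_p_inner)
qed

lemma horizontal_scale: "h \<in> horizontal u \<Longrightarrow> r *\<^sub>R h \<in> horizontal u"
proof -
  have "cdot u (r *\<^sub>R h) = complex_of_real r * cdot u h"
    unfolding cdot_def sum_distrib_left vector_scaleR_component
    by (intro sum.cong refl) (simp add: scaleR_conv_of_real)
  then show "h \<in> horizontal u \<Longrightarrow> r *\<^sub>R h \<in> horizontal u" by (simp add: horizontal_def)
qed

lemma eigen_iff:
  assumes u: "u \<in> torus_lift p" and h: "h \<in> horizontal u"
  shows "(\<forall>k\<in>horizontal u. fs_hessian (residual (diag_mat lam)) u h k = \<mu> * (h \<bullet> k)) \<longleftrightarrow> hessian_op u h = \<mu> *\<^sub>R h"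
proof
  assume a: "\<forall>k\<in>horizontal u. fs_hessian (residual (diag_mat lam)) u h k = \<mu> * (h \<bullet> k)"
  let ?k = "hessian_op u h - \<mu> *\<^sub>R h"
  have k: "?k \<in> horizontal u" by (intro horizontal_diff hessian_op_horizontal horizontal_scale u h)
  have "?k \<bullet> ?k = 0"
    using a k hessian_op_inner[OF u h k] by (simp add: inner_diff_left)
  then show "hessian_op u h = \<mu> *\<^sub>R h" by simp
next
  assume "hessian_op u h = \<mu> *\<^sub>R h"
  then show "\<forall>k\<in>horizontal u. fs_hessian (residual (diag_mat lam)) u h k = \<mu> * (h \<bullet> k)"
    by (simp add: hessian_op_inner[OF u h])
qed

lemma hessian_op_inactive: "u \<in> torus_lift p \<Longrightarrow> p$i = 0 \<Longrightarrow> hessian_op u h $ i = (2 * ((norm (q i))\<^sup>2 - R\<^sup>2)) *\<^sub>R h$i"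
  by (simp add: hessian_op_def lift_zero)

lemma hessian_op_active: "0 < p$i \<Longrightarrow> hessian_op u h $ i = - (4 * (q i \<bullet> DZq u h)) *\<^sub>R u$i"
  by (simp add: hessian_op_def on_circle)

lemma axis_eigen:
  assumes u: "u \<in> torus_lift p" and i: "p$i = 0"
  shows "axis i z \<in> horizontal u" "hessian_op u (axis i z) = (2 * ((norm (q i))\<^sup>2 - R\<^sup>2)) *\<^sub>R axis i z"
proof -
  have ui: "u$i = 0" by (rule lift_zero[OF u i])
  show "axis i z \<in> horizontal u"
    by (simp add: horizontal_def cdot_def axis_def if_distrib ui cong: if_cong)
  have "DZq u (axis i z) = 0"
    unfolding DZq_def using ui by (intro sum.neutral) (auto simp: axis_def)
  then show "hessian_op u (axis i z) = (2 * ((norm (q i))\<^sup>2 - R\<^sup>2)) *\<^sub>R axis i z"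
    by (simp add: hessian_op_def vec_eq_iff axis_def)
qed

abbreviation outer :: "'n \<Rightarrow> bool" where "outer i \<equiv> p$i = 0 \<and> R < norm (q i)"
abbreviation inner :: "'n \<Rightarrow> bool" where "inner i \<equiv> p$i = 0 \<and> norm (q i) < R"

lemma index_cases: "0 < p$i \<or> outer i \<or> inner i"
  using off_circle[of i] p_nonneg[of i] by fastforce

lemma sq_less: "outer i \<Longrightarrow> 0 < (norm (q i))\<^sup>2 - R\<^sup>2" "inner i \<Longrightarrow> (norm (q i))\<^sup>2 - R\<^sup>2 < 0"
  using R_nonneg power_strict_mono[of R "norm (q i)" 2] power_strict_mono[of "norm (q i)" R 2] by auto

text \<open>
  An eigenvector \<open>h\<close> with a positive eigenvalue \<open>\<mu>\<close> has \<open>D = DZq u h\<close> with \<open>D = - (8 / \<mu>) *\<^sub>R M D\<close>. As \<open>M\<close> is positive semidefinite, \<open>D\<close> vanishes,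
  and with it the active part of \<open>h\<close>. On the inactive coordinates the Hessian is diagonal, and it is positive for
  the outer ones.
\<close>
lemma stable_space_eq:
  assumes u: "u \<in> torus_lift p"
  shows "stable_space (residual (diag_mat lam)) u = {h. \<forall>i. \<not> outer i \<longrightarrow> h$i = 0}"
proof
  have sub: "subspace {h :: complex^'n. \<forall>i. \<not> outer i \<longrightarrow> h$i = 0}" by (auto simp: subspace_def)
  have "{h \<in> horizontal u. \<exists>\<mu>>0. \<forall>k\<in>horizontal u. fs_hessian (residual (diag_mat lam)) u h k = \<mu> * (h \<bullet> k)}
     \<subseteq> {h. \<forall>i. \<not> outer i \<longrightarrow> h$i = 0}"
  proof clarify
    fix h \<mu> i
    assume h: "h \<in> horizontal u" and mu: "0 < (\<mu>::real)"
      and e: "\<forall>k\<in>horizontal u. fs_hessian (residual (diag_mat lam)) u h k = \<mu> * (h \<bullet> k)" and i: "\<not> outer i"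
    have H: "hessian_op u h = \<mu> *\<^sub>R h" using e eigen_iff[OF u h] by blast
    let ?D = "DZq u h"
    have act: "h$j = - (4 / \<mu> * (q j \<bullet> ?D)) *\<^sub>R u$j" if "0 < p$j" for j
    proof -
      have "\<mu> *\<^sub>R h$j = - (4 * (q j \<bullet> ?D)) *\<^sub>R u$j"
        using hessian_op_active[OF that, of u h] H by simp
      then have "(1 / \<mu>) *\<^sub>R (\<mu> *\<^sub>R h$j) = (1 / \<mu>) *\<^sub>R (- (4 * (q j \<bullet> ?D)) *\<^sub>R u$j)" by simp
      then show ?thesis using mu by simp
    qed
    have ip: "2 * (u$j \<bullet> h$j) = - (8 / \<mu>) * (p$j * (q j \<bullet> ?D))" for j
    proof (cases "p$j = 0")
      case True
      then show ?thesis using lift_zero[OF u] by simp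
    next
      case False
      then have j: "0 < p$j" using p_nonneg[of j] by simp
      then show ?thesis by (simp add: act[OF j] lift_inner[OF u])
    qed
    have "?D = - (8 / \<mu>) *\<^sub>R pf.M ?D"
      by (subst DZq_def) (simp add: ip pf.M_def scaleR_sum_right sum_negf)
    then have "?D \<bullet> ?D = - (8 / \<mu>) * (pf.Mnorm ?D)\<^sup>2"
      unfolding pf.Mnorm_sq_inner by (metis inner_scaleR_left)
    moreover have "0 \<le> (8 / \<mu>) * (pf.Mnorm ?D)\<^sup>2" using mu by simp
    ultimately have "?D \<bullet> ?D \<le> 0" by simp
    then have D: "?D = 0" by (metis inner_eq_zero_iff inner_ge_zero order_antisym)
    show "h$i = 0"
    proof (cases "0 < p$i")
      case True
      then show ?thesis using act D by simp
    next
      case False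
      then have n: "inner i" using i index_cases[of i] by blast
      have "(2 * ((norm (q i))\<^sup>2 - R\<^sup>2)) *\<^sub>R h$i = hessian_op u h $ i"
        by (rule hessian_op_inactive[OF u, symmetric]) (use n in simp)
      also have "\<dots> = \<mu> *\<^sub>R h$i" by (simp only: H vector_scaleR_component)
      finally have "(2 * ((norm (q i))\<^sup>2 - R\<^sup>2)) *\<^sub>R h$i = \<mu> *\<^sub>R h$i" .
      moreover have "2 * ((norm (q i))\<^sup>2 - R\<^sup>2) < \<mu>"
        by (rule less_trans[of _ 0]) (use sq_less(2)[OF n] mu in simp_all)
      ultimately show ?thesis by (metis less_irrefl scaleR_cancel_right)
    qed
  qed
  then show "stable_space (residual (diag_mat lam)) u \<subseteq> {h. \<forall>i. \<not> outer i \<longrightarrow> h$i = 0}"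
    unfolding stable_space_def by (intro span_minimal sub)
  show "{h. \<forall>i. \<not> outer i \<longrightarrow> h$i = 0} \<subseteq> stable_space (residual (diag_mat lam)) u"
  proof clarify
    fix h :: "complex^'n" assume h: "\<forall>i. \<not> outer i \<longrightarrow> h$i = 0"
    have "axis i (h$i) \<in> stable_space (residual (diag_mat lam)) u" for i
    proof (cases "outer i")
      case True
      have "0 < 2 * ((norm (q i))\<^sup>2 - R\<^sup>2)" using sq_less(1)[OF True] by simp
      then show ?thesis unfolding stable_space_def
        using axis_eigen[OF u, of i "h$i"] True eigen_iff[OF u axis_eigen(1)[OF u]] by (intro span_base) blast
    next
      case False
      then have "axis i (h$i) = 0" using h by (simp add: axis_def vec_eq_iff)
      then show ?thesis unfolding stable_space_def by (simp only: span_zero)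
    qed
    then have "(\<Sum>i\<in>UNIV. axis i (h$i)) \<in> stable_space (residual (diag_mat lam)) u"
      unfolding stable_space_def by (intro span_sum) auto
    then show "h \<in> stable_space (residual (diag_mat lam)) u" by (simp add: sum_axis)
  qed
qed

text \<open>
  An eigenvector \<open>e\<close> of \<open>M\<close> with eigenvalue \<open>mu > 0\<close> gives the eigenvector \<open>(q i \<bullet> e) *\<^sub>R u$i\<close> of the Hessian with eigenvalue
  \<open>- 8 * mu\<close>; by \<open>log_weights_planar\<close> these span all directions in which only the active weights vary.
\<close>
lemma unstable_space_eq:
  assumes u: "u \<in> torus_lift p"
  shows "unstable_space (residual (diag_mat lam)) u =
    {h. (\<forall>i. outer i \<longrightarrow> h$i = 0) \<and> (\<exists>\<xi>. (\<forall>i. 0 < p$i \<longrightarrow> h$i = \<xi> i *\<^sub>R u$i) \<and> (\<Sum>i\<in>UNIV. p$i * \<xi> i) = 0)}"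
    (is "_ = ?V")
proof
  have sub: "subspace ?V"
    unfolding subspace_def
  proof (intro conjI ballI allI)
    show "0 \<in> ?V" by (auto intro!: exI[of _ "\<lambda>_. 0"])
    fix x y assume "x \<in> ?V" "y \<in> ?V"
    then obtain \<xi> \<eta> where "\<forall>i. 0 < p$i \<longrightarrow> x$i = \<xi> i *\<^sub>R u$i" "(\<Sum>i\<in>UNIV. p$i * \<xi> i) = 0"
      "\<forall>i. 0 < p$i \<longrightarrow> y$i = \<eta> i *\<^sub>R u$i" "(\<Sum>i\<in>UNIV. p$i * \<eta> i) = 0"
      "\<forall>i. outer i \<longrightarrow> x$i = 0" "\<forall>i. outer i \<longrightarrow> y$i = 0" by auto
    then show "x + y \<in> ?V"
      by (auto intro!: exI[of _ "\<lambda>i. \<xi> i + \<eta> i"] simp: scaleR_add_left distrib_left sum.distrib)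
  next
    fix c :: real and x assume "x \<in> ?V"
    then obtain \<xi> where "\<forall>i. 0 < p$i \<longrightarrow> x$i = \<xi> i *\<^sub>R u$i" "(\<Sum>i\<in>UNIV. p$i * \<xi> i) = 0"
      "\<forall>i. outer i \<longrightarrow> x$i = 0" by auto
    then show "c *\<^sub>R x \<in> ?V"
      by (auto intro!: exI[of _ "\<lambda>i. c * \<xi> i"] simp: mult.left_commute[of _ c] sum_distrib_left[symmetric])
  qed
  have "{h \<in> horizontal u. \<exists>\<mu><0. \<forall>k\<in>horizontal u. fs_hessian (residual (diag_mat lam)) u h k = \<mu> * (h \<bullet> k)} \<subseteq> ?V"
  proof safe
    fix h \<mu>
    assume h: "h \<in> horizontal u" and mu: "(\<mu>::real) < 0"
      and e: "\<forall>k\<in>horizontal u. fs_hessian (residual (diag_mat lam)) u h k = \<mu> * (h \<bullet> k)"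
    have H: "hessian_op u h = \<mu> *\<^sub>R h" using e eigen_iff[OF u h] by blast
    have act: "h$j = (- 4 / \<mu> * (q j \<bullet> DZq u h)) *\<^sub>R u$j" if "0 < p$j" for j
    proof -
      have "\<mu> *\<^sub>R h$j = - (4 * (q j \<bullet> DZq u h)) *\<^sub>R u$j"
        using hessian_op_active[OF that, of u h] H by simp
      then have "(1 / \<mu>) *\<^sub>R (\<mu> *\<^sub>R h$j) = (1 / \<mu>) *\<^sub>R (- (4 * (q j \<bullet> DZq u h)) *\<^sub>R u$j)" by simp
      then show ?thesis using mu by simp
    qed
    show "\<exists>\<xi>. (\<forall>i. 0 < p$i \<longrightarrow> h$i = \<xi> i *\<^sub>R u$i) \<and> (\<Sum>i\<in>UNIV. p$i * \<xi> i) = 0"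
    proof (intro exI[of _ "\<lambda>j. - 4 / \<mu> * (q j \<bullet> DZq u h)"] conjI)
      show "\<forall>i. 0 < p$i \<longrightarrow> h$i = (- 4 / \<mu> * (q i \<bullet> DZq u h)) *\<^sub>R u$i" using act by blast
      show "(\<Sum>i\<in>UNIV. p$i * (- 4 / \<mu> * (q i \<bullet> DZq u h))) = 0"
        unfolding mult.left_commute[of "p$_"] sum_distrib_left[symmetric] pf.sum_p_inner by simp
    qed
    fix i assume i: "p$i = 0" "R < norm (q i)"
    have "(2 * ((norm (q i))\<^sup>2 - R\<^sup>2)) *\<^sub>R h$i = hessian_op u h $ i"
      by (rule hessian_op_inactive[OF u, symmetric]) (use i in simp)
    also have "\<dots> = \<mu> *\<^sub>R h$i" by (simp only: H vector_scaleR_component)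
    finally have "(2 * ((norm (q i))\<^sup>2 - R\<^sup>2)) *\<^sub>R h$i = \<mu> *\<^sub>R h$i" .
    moreover have "2 * ((norm (q i))\<^sup>2 - R\<^sup>2) \<noteq> \<mu>" using sq_less(1)[of i] i mu by simp
    ultimately show "h$i = 0" by (metis scaleR_cancel_right)
  qed
  then show "unstable_space (residual (diag_mat lam)) u \<subseteq> ?V"
    unfolding unstable_space_def by (intro span_minimal sub)
  have ax: "axis i z \<in> unstable_space (residual (diag_mat lam)) u" if "inner i" for i z
  proof -
    have "2 * ((norm (q i))\<^sup>2 - R\<^sup>2) < 0" using sq_less(2)[OF that] by simp
    then show ?thesis unfolding unstable_space_def
      using axis_eigen[OF u, of i z] that eigen_iff[OF u axis_eigen(1)[OF u]] by (intro span_base) blast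
  qed
  define act :: "complex \<Rightarrow> complex^'n" where "act y = (\<chi> i. (q i \<bullet> y) *\<^sub>R u$i)" for y
  have act_eig: "act e \<in> unstable_space (residual (diag_mat lam)) u"
    if e: "pf.M e = mu *\<^sub>R e" and mu: "0 < mu" for e mu
  proof -
    have "cnj (u$i) * act e $ i = complex_of_real (p$i * (q i \<bullet> e))" for i
    proof -
      have "cnj (u$i) * act e $ i = complex_of_real (q i \<bullet> e) * (cnj (u$i) * u$i)"
        by (simp add: act_def scaleR_conv_of_real)
      then show ?thesis by (simp add: cnj_lift[OF u])
    qed
    then have "cdot u (act e) = complex_of_real (\<Sum>i\<in>UNIV. p$i * (q i \<bullet> e))"
      by (simp add: cdot_def)
    then have hz: "act e \<in> horizontal u" by (simp add: horizontal_def pf.sum_p_inner)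
    have "DZq u (act e) = 2 *\<^sub>R pf.M e"
      unfolding DZq_def pf.M_def scaleR_sum_right by (intro sum.cong refl) (simp add: act_def lift_inner[OF u] mult_ac)
    then have D: "DZq u (act e) = (2 * mu) *\<^sub>R e"
      using e by simp
    have "hessian_op u (act e) $ i = (- 8 * mu) *\<^sub>R act e $ i" for i
    proof (cases "0 < p$i")
      case True
      then show ?thesis unfolding hessian_op_active[OF True] D by (simp add: act_def)
    next
      case False
      then have "u$i = 0" using lift_zero[OF u] p_nonneg[of i] by force
      then show ?thesis by (simp add: hessian_op_def act_def)
    qed
    then have "hessian_op u (act e) = (- 8 * mu) *\<^sub>R act e" by (simp add: vec_eq_iff)
    moreover have "- 8 * mu < 0" using mu by simp
    ultimately show ?thesis unfolding unstable_space_def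
      using hz eigen_iff[OF u hz] by (intro span_base) blast
  qed
  have act1: "act e1 \<in> unstable_space (residual (diag_mat lam)) u"
  proof (cases "mu1 = 0")
    case True
    then have "(q i \<bullet> e1) *\<^sub>R u$i = 0" for i
      using mu_pos_or_orth(1) lift_zero[OF u, of i] p_nonneg[of i] by (cases "p$i = 0") auto
    then have "act e1 = 0" by (simp add: act_def vec_eq_iff)
    then show ?thesis unfolding unstable_space_def by (simp add: span_zero)
  next
    case False
    then show ?thesis using pf.eigen1 pf.mu_nonneg by (intro act_eig[of _ mu1]) (auto simp: pf.M_def)
  qed
  have act2: "act e2 \<in> unstable_space (residual (diag_mat lam)) u"
  proof (cases "mu2 = 0")
    case True
    then have "(q i \<bullet> e2) *\<^sub>R u$i = 0" for i
      using mu_pos_or_orth(2) lift_zero[OF u, of i] p_nonneg[of i] by (cases "p$i = 0") auto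
    then have "act e2 = 0" by (simp add: act_def vec_eq_iff)
    then show ?thesis unfolding unstable_space_def by (simp add: span_zero)
  next
    case False
    then show ?thesis using pf.eigen2 pf.mu_nonneg pf.mu_le by (intro act_eig[of _ mu2]) (auto simp: pf.M_def)
  qed
  show "?V \<subseteq> unstable_space (residual (diag_mat lam)) u"
  proof clarify
    fix h \<xi> assume h: "\<forall>i. outer i \<longrightarrow> h$i = 0"
      and \<xi>: "\<forall>i. 0 < p$i \<longrightarrow> h$i = \<xi> i *\<^sub>R u$i" "(\<Sum>i\<in>UNIV. p$i * \<xi> i) = 0"
    obtain y where y: "\<forall>i. 0 < p$i \<longrightarrow> \<xi> i = q i \<bullet> y" using log_weights_planar[OF \<xi>(2)] by blast
    have ay: "act y = (y \<bullet> e1) *\<^sub>R act e1 + (y \<bullet> e2) *\<^sub>R act e2"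
      by (subst pf.eigen_expansion[of y]) (simp add: act_def vec_eq_iff inner_add_right scaleR_add_left)
    have au: "act y \<in> unstable_space (residual (diag_mat lam)) u"
      unfolding ay using act1 act2 unfolding unstable_space_def by (intro span_add span_scale)
    have "h = act y + (\<Sum>i\<in>{i. inner i}. axis i (h$i))"
    proof -
      have "h $ j = act y $ j + (\<Sum>i\<in>{i. inner i}. axis i (h$i) $ j)" for j
      proof -
        have s: "(\<Sum>i\<in>{i. inner i}. axis i (h$i) $ j) = (if inner j then h$j else 0)"
          by (simp add: axis_def)
        show ?thesis
          using index_cases[of j] h \<xi>(1) y lift_zero[OF u, of j] unfolding s by (auto simp: act_def)
      qed
      then show ?thesis unfolding vec_eq_iff vector_add_component sum_component by blast
    qed
    also have "\<dots> \<in> unstable_space (residual (diag_mat lam)) u"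
      using au ax unfolding unstable_space_def by (intro span_add span_sum) auto
    finally show "h \<in> unstable_space (residual (diag_mat lam)) u" .
  qed
qed

end

section \<open>Smooth functions\<close>

lemma has_derivative_vec:
  fixes g :: "'i::finite \<Rightarrow> 'a::real_normed_vector \<Rightarrow> 'b::euclidean_space"
  assumes "\<And>i. (g i has_derivative g' i) (at x)"
  shows "((\<lambda>x. \<chi> i. g i x) has_derivative (\<lambda>h. \<chi> i. g' i h)) (at x)"
proof (subst has_derivative_componentwise_within, intro ballI)
  fix b :: "'b^'i" assume "b \<in> Basis"
  then obtain i e where b: "b = axis i e" by (auto simp: Basis_vec_def)
  show "((\<lambda>x. (\<chi> i. g i x) \<bullet> b) has_derivative (\<lambda>h. (\<chi> i. g' i h) \<bullet> b)) (at x)"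
    unfolding b inner_axis vec_lambda_beta
    by (intro has_derivative_inner_left assms)
qed

text \<open>
  A class of smooth functions that contains the components of the tube coordinates and is closed under directional
  derivatives, so that all orders of differentiability follow from the first.
\<close>
inductive smooth_term :: "('a::real_normed_vector \<Rightarrow> complex) \<Rightarrow> bool" where
  linear: "bounded_linear f \<Longrightarrow> smooth_term f"
| const: "smooth_term (\<lambda>_. c)"
| add: "smooth_term f \<Longrightarrow> smooth_term g \<Longrightarrow> smooth_term (\<lambda>x. f x + g x)"
| mult: "smooth_term f \<Longrightarrow> smooth_term g \<Longrightarrow> smooth_term (\<lambda>x. f x * g x)"
| exp: "smooth_term f \<Longrightarrow> smooth_term (\<lambda>x. exp (f x))"

lemma smooth_term_derivative:
  "smooth_term f \<Longrightarrow> \<exists>f'. (\<forall>x. (f has_derivative f' x) (at x)) \<and> (\<forall>v. smooth_term (\<lambda>x. f' x v))"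
proof (induction rule: smooth_term.induct)
  case (linear f)
  then show ?case
    by (intro exI[of _ "\<lambda>_. f"]) (auto intro: bounded_linear_imp_has_derivative smooth_term.const)
next
  case (const c)
  then show ?case by (intro exI[of _ "\<lambda>_ _. 0"]) (auto intro: smooth_term.const)
next
  case (add f g)
  then obtain f' g' where "\<forall>x. (f has_derivative f' x) (at x)" "\<forall>v. smooth_term (\<lambda>x. f' x v)"
    "\<forall>x. (g has_derivative g' x) (at x)" "\<forall>v. smooth_term (\<lambda>x. g' x v)" by blast
  then show ?case
    by (intro exI[of _ "\<lambda>x v. f' x v + g' x v"]) (auto intro: has_derivative_add smooth_term.add)
next
  case (mult f g)
  then obtain f' g' where "\<forall>x. (f has_derivative f' x) (at x)" "\<forall>v. smooth_term (\<lambda>x. f' x v)"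
    "\<forall>x. (g has_derivative g' x) (at x)" "\<forall>v. smooth_term (\<lambda>x. g' x v)" by blast
  note d = this
  have "smooth_term (\<lambda>x. f x * g' x v + f' x v * g x)" for v
    by (rule smooth_term.add[OF smooth_term.mult smooth_term.mult]) (use d mult.hyps in auto)
  then show ?case using d
    by (intro exI[of _ "\<lambda>x v. f x * g' x v + f' x v * g x"]) (auto intro: has_derivative_mult)
next
  case (exp f)
  then obtain f' where f': "\<forall>x. (f has_derivative f' x) (at x)" "\<forall>v. smooth_term (\<lambda>x. f' x v)" by blast
  have "((\<lambda>x. exp (f x)) has_derivative (\<lambda>v. exp (f x) * f' x v)) (at x)" for x
    using has_derivative_compose[OF spec[OF f'(1)] DERIV_exp[of "f x", unfolded has_field_derivative_def]] by simp
  then show ?case using exp f'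
    by (intro exI[of _ "\<lambda>x v. exp (f x) * f' x v"]) (auto intro: smooth_term.exp smooth_term.mult)
qed

lemma Ck_on_smooth_terms:
  fixes g :: "'i::finite \<Rightarrow> 'a::real_normed_vector \<Rightarrow> complex"
  shows "(\<And>i. smooth_term (g i)) \<Longrightarrow> Ck_on k D (\<lambda>x. \<chi> i. g i x)"
proof (induction k arbitrary: g)
  case (0 g)
  have "\<forall>i. \<exists>f'. (\<forall>x. (g i has_derivative f' x) (at x)) \<and> (\<forall>v. smooth_term (\<lambda>x. f' x v))"
    using smooth_term_derivative[OF 0] by blast
  then obtain g' where "\<And>i x. (g i has_derivative g' i x) (at x)" by metis
  then have "((\<lambda>x. \<chi> i. g i x) has_derivative (\<lambda>h. \<chi> i. g' i x h)) (at x)" for x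
    by (rule has_derivative_vec)
  then show ?case by (auto intro!: continuous_at_imp_continuous_on has_derivative_continuous)
next
  case (Suc k g)
  have "\<forall>i. \<exists>f'. (\<forall>x. (g i has_derivative f' x) (at x)) \<and> (\<forall>v. smooth_term (\<lambda>x. f' x v))"
    using smooth_term_derivative[OF Suc.prems] by blast
  then obtain g' where g': "\<And>i x. (g i has_derivative g' i x) (at x)" "\<And>i v. smooth_term (\<lambda>x. g' i x v)" by metis
  have d: "((\<lambda>x. \<chi> i. g i x) has_derivative (\<lambda>h. \<chi> i. g' i x h)) (at x)" for x
    using g'(1) by (rule has_derivative_vec)
  have "frechet_derivative (\<lambda>x. \<chi> i. g i x) (at x) = (\<lambda>h. \<chi> i. g' i x h)" for x
    by (rule frechet_derivative_at[OF d, symmetric])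
  moreover have "Ck_on k D (\<lambda>x. \<chi> i. g' i x v)" for v by (rule Suc.IH[OF g'(2)])
  ultimately show ?case using d by (auto simp: differentiable_def)
qed

section \<open>The escape exponent\<close>

context morse_bott_flow
begin

text \<open>
  The weight variation caused by an infinitesimal change of \<open>y\<close> at \<open>0\<close>. It is defined on the whole plane and maps
  onto \<open>V_act p\<close>; its kernel is that of \<open>M\<close>.
\<close>
definition actw :: "complex \<Rightarrow> real^'n"
  where "actw y = (\<chi> i. p$i * (q i \<bullet> y))"

lemma actw_linear: "actw (x + y) = actw x + actw y" "actw (r *\<^sub>R y) = r *\<^sub>R actw y"
  by (simp_all add: actw_def vec_eq_iff inner_add_right distrib_left mult.left_commute)

lemma sum_active: "(\<And>i. p$i = 0 \<Longrightarrow> f i = (0::'b::comm_monoid_add)) \<Longrightarrow> sum f (active p) = sum f UNIV"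
  by (rule sum.mono_neutral_left) (auto simp: inactive_iff)

lemma actw_0: "actw 0 = 0"
  by (simp add: actw_def vec_eq_iff)

lemma actw_V: "actw y \<in> V_act p"
  unfolding V_act_def using pf.sum_p_inner[of y]
  by (auto simp: inactive_iff actw_def sum_active)

lemma V_act_actw:
  assumes a: "a \<in> V_act p"
  obtains y where "a = actw y"
proof -
  have s: "a$i = 0" if "p$i = 0" for i using a that by (auto simp: V_act_def inactive_iff)
  have "(\<Sum>i\<in>UNIV. p$i * (a$i / p$i)) = (\<Sum>i\<in>UNIV. a$i)"
    by (intro sum.cong refl) (use s in auto)
  also have "\<dots> = 0" using a sum_active[of "\<lambda>i. a$i"] s by (simp add: V_act_def)
  finally obtain y where y: "\<And>i. 0 < p$i \<Longrightarrow> a$i / p$i = q i \<bullet> y"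
    using log_weights_planar[of "\<lambda>i. a$i / p$i"] by blast
  have "a$i = p$i * (q i \<bullet> y)" for i
  proof (cases "p$i = 0")
    case False
    then have "0 < p$i" using p_nonneg[of i] by simp
    then show ?thesis using y[of i] by (simp add: field_simps)
  qed (use s in auto)
  then have "a = actw y" by (simp add: actw_def vec_eq_iff)
  then show ?thesis by (rule that)
qed

lemma L_act_actw: "L_act lam p (actw y) = actw (8 *\<^sub>R pf.M y)"
proof -
  have "(\<Sum>j\<in>active p. of_real (actw y $ j) * (lam$j - center lam p)) = pf.M y"
    unfolding pf.M_def by (subst sum_active) (auto simp: actw_def q_def scaleR_conv_of_real)
  then show ?thesis
    by (simp add: L_act_def actw_def vec_eq_iff q_def inner_complex_def)
qed

lemma actw_eq_0_iff: "actw y = 0 \<longleftrightarrow> mu1 * (y \<bullet> e1) = 0 \<and> mu2 * (y \<bullet> e2) = 0"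
proof -
  have "actw y = 0 \<longleftrightarrow> (\<forall>i. p$i * (q i \<bullet> y)\<^sup>2 = 0)"
    by (auto simp: actw_def vec_eq_iff)
  also have "\<dots> \<longleftrightarrow> (pf.Mnorm y)\<^sup>2 = 0"
    unfolding pf.Mnorm_sq by (subst sum_nonneg_eq_0_iff) (auto intro!: mult_nonneg_nonneg p_nonneg)
  also have "\<dots> \<longleftrightarrow> mu1 * (y \<bullet> e1)\<^sup>2 = 0 \<and> mu2 * (y \<bullet> e2)\<^sup>2 = 0"
    unfolding pf.Mnorm_eigen using pf.mu_nonneg pf.mu_le by (intro add_nonneg_eq_0_iff mult_nonneg_nonneg) auto
  finally show ?thesis by simp
qed

lemma eigen_coords: "(a *\<^sub>R e1 + b *\<^sub>R e2) \<bullet> e1 = a" "(a *\<^sub>R e1 + b *\<^sub>R e2) \<bullet> e2 = b"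
  using pf.e_norm pf.e_orth by (simp_all add: inner_add_left norm_sq_inner inner_commute[of e2 e1])

lemma L_act_shift: "L_act lam p (actw (a *\<^sub>R e1 + b *\<^sub>R e2)) - g *\<^sub>R actw (a *\<^sub>R e1 + b *\<^sub>R e2)
   = actw (((8 * mu1 - g) * a) *\<^sub>R e1 + ((8 * mu2 - g) * b) *\<^sub>R e2)"
proof -
  have "actw (((8 * mu1 - g) * a) *\<^sub>R e1 + ((8 * mu2 - g) * b) *\<^sub>R e2)
      = ((8 * mu1 - g) * a) *\<^sub>R actw e1 + ((8 * mu2 - g) * b) *\<^sub>R actw e2"
    by (simp only: actw_linear)
  moreover have "L_act lam p (actw (a *\<^sub>R e1 + b *\<^sub>R e2)) = (8 * mu1 * a) *\<^sub>R actw e1 + (8 * mu2 * b) *\<^sub>R actw e2"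
    unfolding L_act_actw pf.M_eigen eigen_coords by (simp add: actw_linear scaleR_add_right mult.assoc)
  moreover have "g *\<^sub>R actw (a *\<^sub>R e1 + b *\<^sub>R e2) = (g * a) *\<^sub>R actw e1 + (g * b) *\<^sub>R actw e2"
    by (simp add: actw_linear scaleR_add_right)
  ultimately show ?thesis by (simp add: left_diff_distrib scaleR_diff_left)
qed

lemma L_act_shift_power: "((\<lambda>b. L_act lam p b - g *\<^sub>R b) ^^ k) (actw (a *\<^sub>R e1 + b *\<^sub>R e2))
   = actw (((8 * mu1 - g) ^ k * a) *\<^sub>R e1 + ((8 * mu2 - g) ^ k * b) *\<^sub>R e2)"
  by (induction k) (simp_all add: L_act_shift mult.assoc)

text \<open>
  On the coordinates with respect to \<open>e1\<close>, \<open>e2\<close>, the operator \<open>L_act lam p\<close> is diagonal with the entries \<open>8 * mu1\<close> and \<open>8 * mu2\<close>.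
\<close>
lemma generalized_eigenspace:
  assumes g: "0 < g"
  shows "{a \<in> V_act p. \<exists>k. ((\<lambda>b. L_act lam p b - g *\<^sub>R b) ^^ k) a = 0}
    = {actw (a *\<^sub>R e1 + b *\<^sub>R e2) | a b. (8 * mu1 \<noteq> g \<longrightarrow> a = 0) \<and> (8 * mu2 \<noteq> g \<longrightarrow> b = 0)}"
proof (intro set_eqI iffI)
  fix v assume "v \<in> {a \<in> V_act p. \<exists>k. ((\<lambda>b. L_act lam p b - g *\<^sub>R b) ^^ k) a = 0}"
  then obtain k where v: "v \<in> V_act p" "((\<lambda>b. L_act lam p b - g *\<^sub>R b) ^^ k) v = 0" by blast
  obtain y where "v = actw y" by (rule V_act_actw[OF v(1)])
  then obtain a b where ab: "v = actw (a *\<^sub>R e1 + b *\<^sub>R e2)" using pf.eigen_expansion[of y] by metis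
  have "actw (((8 * mu1 - g) ^ k * a) *\<^sub>R e1 + ((8 * mu2 - g) ^ k * b) *\<^sub>R e2) = 0"
    using v(2) unfolding ab L_act_shift_power .
  then have z: "mu1 * ((8 * mu1 - g) ^ k * a) = 0" "mu2 * ((8 * mu2 - g) ^ k * b) = 0"
    unfolding actw_eq_0_iff eigen_coords by auto
  \<comment> \<open>Components along kernel vectors of \<open>M\<close> need not vanish, but they do not contribute to \<open>v\<close>.\<close>
  let ?a = "if 8 * mu1 = g then a else 0" and ?b = "if 8 * mu2 = g then b else 0"
  have "actw ((a - ?a) *\<^sub>R e1 + (b - ?b) *\<^sub>R e2) = 0"
    unfolding actw_eq_0_iff eigen_coords using z by (auto split: if_splits)
  moreover have "(a *\<^sub>R e1 + b *\<^sub>R e2) = (?a *\<^sub>R e1 + ?b *\<^sub>R e2) + ((a - ?a) *\<^sub>R e1 + (b - ?b) *\<^sub>R e2)"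
    by (simp add: scaleR_diff_left)
  ultimately have "v = actw (?a *\<^sub>R e1 + ?b *\<^sub>R e2)" unfolding ab by (metis actw_linear(1) add.right_neutral)
  then show "v \<in> {actw (a *\<^sub>R e1 + b *\<^sub>R e2) | a b. (8 * mu1 \<noteq> g \<longrightarrow> a = 0) \<and> (8 * mu2 \<noteq> g \<longrightarrow> b = 0)}"
    by (intro CollectI exI[of _ ?a] exI[of _ ?b]) auto
next
  fix v assume "v \<in> {actw (a *\<^sub>R e1 + b *\<^sub>R e2) | a b. (8 * mu1 \<noteq> g \<longrightarrow> a = 0) \<and> (8 * mu2 \<noteq> g \<longrightarrow> b = 0)}"
  then obtain a b where ab: "v = actw (a *\<^sub>R e1 + b *\<^sub>R e2)" "8 * mu1 \<noteq> g \<longrightarrow> a = 0" "8 * mu2 \<noteq> g \<longrightarrow> b = 0"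
    by blast
  have "((\<lambda>b. L_act lam p b - g *\<^sub>R b) ^^ 1) v = 0"
    unfolding ab(1) L_act_shift_power actw_eq_0_iff eigen_coords using ab by auto
  then show "v \<in> {a \<in> V_act p. \<exists>k. ((\<lambda>b. L_act lam p b - g *\<^sub>R b) ^^ k) a = 0}"
    using actw_V unfolding ab(1) by blast
qed

lemma multiplicity:
  assumes g: "0 < g"
  shows "multiplicity_on (V_act p) (L_act lam p) g
    = (if 8 * mu1 = g then 1 else 0) + (if 8 * mu2 = g then 1 else 0)"
proof -
  let ?W = "{actw (a *\<^sub>R e1 + b *\<^sub>R e2) | a b. (8 * mu1 \<noteq> g \<longrightarrow> a = 0) \<and> (8 * mu2 \<noteq> g \<longrightarrow> b = 0)}"
  have W: "multiplicity_on (V_act p) (L_act lam p) g = dim ?W"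
    unfolding multiplicity_on_def generalized_eigenspace[OF g] ..
  have lin: "actw (a *\<^sub>R e1 + b *\<^sub>R e2) = a *\<^sub>R actw e1 + b *\<^sub>R actw e2" for a b by (simp add: actw_linear)
  have nz: "actw e1 \<noteq> 0" if "8 * mu1 = g"
    using actw_eq_0_iff[of "1 *\<^sub>R e1 + 0 *\<^sub>R e2"] that g unfolding eigen_coords by auto
  have nz2: "actw e2 \<noteq> 0" if "8 * mu2 = g"
    using actw_eq_0_iff[of "0 *\<^sub>R e1 + 1 *\<^sub>R e2"] that g unfolding eigen_coords by auto
  show ?thesis
  proof (cases "8 * mu1 = g")
    case m1: True
    show ?thesis
    proof (cases "8 * mu2 = g")
      case m2: True
      have nin: "actw e1 \<notin> span {actw e2}"
      proof
        assume "actw e1 \<in> span {actw e2}"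
        then obtain r where "actw e1 = r *\<^sub>R actw e2" by (auto simp: span_singleton)
        then have "actw (1 *\<^sub>R e1 + (- r) *\<^sub>R e2) = 0" unfolding lin by simp
        then show False unfolding actw_eq_0_iff eigen_coords using m1 g by simp
      qed
      then have ne: "actw e1 \<noteq> actw e2" using span_base[of "actw e2" "{actw e2}"] by auto
      have ind: "independent {actw e1, actw e2}"
        using nin nz2[OF m2] by (intro independent_insertI independent_empty) auto
      have "?W = span {actw e1, actw e2}"
        unfolding span_insert[of _ "{_}"] span_singleton lin using m1 m2 by (force simp: algebra_simps)
      then have "dim ?W = card {actw e1, actw e2}" using real_vector.dim_span_eq_card_independent[OF ind] by simp
      then show ?thesis using ne m1 m2 W by simp
    next
      case m2: False
      have "?W = span {actw e1}" unfolding span_singleton lin using m1 m2 by auto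
      moreover have "independent {actw e1}" using nz[OF m1] by simp
      ultimately have "dim ?W = card {actw e1}" using real_vector.dim_span_eq_card_independent by metis
      then show ?thesis using m1 m2 W by simp
    qed
  next
    case m1: False
    show ?thesis
    proof (cases "8 * mu2 = g")
      case m2: True
      have "?W = span {actw e2}" unfolding span_singleton lin using m1 m2 by auto
      moreover have "independent {actw e2}" using nz2[OF m2] by simp
      ultimately have "dim ?W = card {actw e2}" using real_vector.dim_span_eq_card_independent by metis
      then show ?thesis using m1 m2 W by simp
    next
      case m2: False
      have "?W = {0}" unfolding lin using m1 m2 by auto
      then show ?thesis using m1 m2 W by simp
    qed
  qed
qed

lemma positive_eigenvalue_iff:
  assumes g: "0 < g"
  shows "eigenvalue_on (V_act p) (L_act lam p) g \<longleftrightarrow> 8 * mu1 = g \<or> 8 * mu2 = g"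
proof
  assume "eigenvalue_on (V_act p) (L_act lam p) g"
  then obtain a where a: "a \<in> V_act p" "a \<noteq> 0" "L_act lam p a = g *\<^sub>R a" by (auto simp: eigenvalue_on_def)
  then have "((\<lambda>b. L_act lam p b - g *\<^sub>R b) ^^ 1) a = 0" by simp
  then have "a \<in> {a \<in> V_act p. \<exists>k. ((\<lambda>b. L_act lam p b - g *\<^sub>R b) ^^ k) a = 0}" using a by blast
  then obtain x y where xy: "a = actw (x *\<^sub>R e1 + y *\<^sub>R e2)" "8 * mu1 \<noteq> g \<longrightarrow> x = 0" "8 * mu2 \<noteq> g \<longrightarrow> y = 0"
    unfolding generalized_eigenspace[OF g] by blast
  then show "8 * mu1 = g \<or> 8 * mu2 = g" using a(2) actw_eq_0_iff[of "x *\<^sub>R e1 + y *\<^sub>R e2"] eigen_coords by auto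
next
  have e: "e1 = 1 *\<^sub>R e1 + 0 *\<^sub>R e2" "e2 = 0 *\<^sub>R e1 + 1 *\<^sub>R e2" by simp_all
  assume "8 * mu1 = g \<or> 8 * mu2 = g"
  then show "eigenvalue_on (V_act p) (L_act lam p) g"
  proof
    assume m: "8 * mu1 = g"
    have "actw e1 \<noteq> 0" using actw_eq_0_iff[of "1 *\<^sub>R e1 + 0 *\<^sub>R e2"] m g unfolding eigen_coords by auto
    moreover have "L_act lam p (actw e1) = g *\<^sub>R actw e1"
      using L_act_shift[of 1 0 g] m by (simp add: actw_0)
    ultimately show ?thesis unfolding eigenvalue_on_def using actw_V by blast
  next
    assume m: "8 * mu2 = g"
    have "actw e2 \<noteq> 0" using actw_eq_0_iff[of "0 *\<^sub>R e1 + 1 *\<^sub>R e2"] m g unfolding eigen_coords by auto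
    moreover have "L_act lam p (actw e2) = g *\<^sub>R actw e2"
      using L_act_shift[of 0 1 g] m by (simp add: actw_0)
    ultimately show ?thesis unfolding eigenvalue_on_def using actw_V by blast
  qed
qed

text \<open>
  A vanishing eigenvalue of \<open>M\<close> is not an eigenvalue that counts on the left, and it contributes zero on the right.
\<close>
lemma escape_exponent_eq:
  "escape_exponent lam p = 8 * mu1 + 8 * mu2 + (\<Sum>k\<in>{k. inner k}. 2 * pf.kap k)"
proof -
  let ?E = "{g. 0 < g \<and> eigenvalue_on (V_act p) (L_act lam p) g}"
  have E: "?E = {g. 0 < g \<and> (8 * mu1 = g \<or> 8 * mu2 = g)}" using positive_eigenvalue_iff by blast
  have fin: "finite ?E" unfolding E by (rule finite_subset[of _ "{8 * mu1, 8 * mu2}"]) auto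
  have "(\<Sum>g\<in>?E. real (multiplicity_on (V_act p) (L_act lam p) g) * g)
     = (\<Sum>g\<in>?E. (if g = 8 * mu1 then g else 0) + (if g = 8 * mu2 then g else 0))"
    by (intro sum.cong refl) (auto simp: multiplicity)
  also have "\<dots> = 8 * mu1 + 8 * mu2"
    using pf.mu_nonneg pf.mu_le unfolding sum.distrib sum.delta[OF fin] E by (auto simp: less_le)
  finally have 1: "(\<Sum>g\<in>?E. real (multiplicity_on (V_act p) (L_act lam p) g) * g) = 8 * mu1 + 8 * mu2" .
  have "inner_indices lam p = {k. inner k}"
    by (auto simp: inner_indices_def inactive_iff q_def)
  then have 2: "4 * (\<Sum>k\<in>inner_indices lam p. (radius lam p)\<^sup>2 - (cmod (lam$k - center lam p))\<^sup>2) = (\<Sum>k\<in>{k. inner k}. 2 * pf.kap k)"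
    by (simp add: pf.kap_def q_def sum_distrib_left)
  show ?thesis unfolding escape_exponent_def 1 2 ..
qed

end

section \<open>Log-weight coordinates and tubular neighborhoods\<close>

lemma compact_torus_lift: "compact (torus_lift p)"
proof -
  have "torus_lift p = (\<Inter>i. {u. (cmod (u$i))\<^sup>2 = p$i})" by (auto simp: torus_lift_def)
  then have "closed (torus_lift p)"
    by (auto intro!: closed_INT closed_Collect_eq continuous_intros)
  moreover have "bounded (torus_lift p)"
  proof (rule boundedI)
    fix u assume "u \<in> torus_lift p"
    then have "(norm u)\<^sup>2 = (\<Sum>i\<in>UNIV. p$i)" unfolding norm_vec_sq by (simp add: torus_lift_def)
    then show "norm u \<le> sqrt (\<Sum>i\<in>UNIV. p$i)" by (metis norm_ge_zero real_sqrt_pow2_iff real_sqrt_unique order_refl)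
  qed
  ultimately show ?thesis by (simp add: compact_eq_bounded_closed)
qed

lemma proj_eq_iff:
  assumes "w \<noteq> 0" "v \<noteq> 0"
  shows "proj w = proj v \<longleftrightarrow> (\<exists>a. a \<noteq> 0 \<and> w = a *s v)"
proof
  assume "proj w = proj v"
  moreover have "1 *s w \<in> proj w" unfolding proj_def by (rule rangeI)
  ultimately have "w \<in> proj v" by simp
  then obtain a where "w = a *s v" by (auto simp: proj_def)
  then show "\<exists>a. a \<noteq> 0 \<and> w = a *s v" using assms by (metis vector_smult_lzero)
next
  assume "\<exists>a. a \<noteq> 0 \<and> w = a *s v"
  then obtain a where a: "a \<noteq> 0" "w = a *s v" by blast
  show "proj w = proj v"
  proof (intro set_eqI iffI)
    fix x assume "x \<in> proj w"
    then obtain b where "x = b *s w" by (auto simp: proj_def)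
    then have "x = (b * a) *s v" using a by (simp add: vector_smult_assoc)
    then show "x \<in> proj v" by (auto simp: proj_def)
  next
    fix x assume "x \<in> proj v"
    then obtain b where "x = b *s v" by (auto simp: proj_def)
    then have "x = (b / a) *s w" using a by (simp add: vector_smult_assoc)
    then show "x \<in> proj w" by (auto simp: proj_def)
  qed
qed

lemma proj_scale: "a \<noteq> 0 \<Longrightarrow> proj (a *s w) = proj w"
  by (cases "w = 0") (auto simp: proj_eq_iff[of "a *s w" w])

context morse_bott_flow
begin

text \<open>
  Log-weight coordinates of a vector \<open>w\<close>: its scale \<open>g\<close>, its masses \<open>m\<close> and its tilt \<open>y\<close>. The phases are left out, as the
  flow preserves them. In general \<open>m\<close> and \<open>y\<close> are not unique, because \<open>y\<close> may be changed in the kernel of \<open>M\<close>.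
\<close>
definition weight_coords :: "complex^'n \<Rightarrow> real \<Rightarrow> ('n \<Rightarrow> real) \<Rightarrow> complex \<Rightarrow> bool"
  where "weight_coords w g m y \<longleftrightarrow> 0 < g \<and> pf.mass_profile m \<and> (\<forall>j. (norm (w$j))\<^sup>2 = g\<^sup>2 * (m j * exp (q j \<bullet> y)))"

lemma active_index: obtains i where "0 < p$i"
  using pf.active_nonempty by auto

lemma weight_coords_active: "weight_coords w g m y \<Longrightarrow> 0 < p$i \<Longrightarrow> norm (w$i) = g * sqrt (p$i) * exp (q i \<bullet> y / 2)"
proof -
  assume r: "weight_coords w g m y" and i: "0 < p$i"
  have "exp (q i \<bullet> y) = (exp (q i \<bullet> y / 2))\<^sup>2" by (simp add: exp_double[symmetric])
  then have "(norm (w$i))\<^sup>2 = (g * sqrt (p$i) * exp (q i \<bullet> y / 2))\<^sup>2"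
    using r i by (simp add: weight_coords_def pf.mass_profile_def power_mult_distrib)
  then show ?thesis using r i by (subst (asm) power2_eq_iff_nonneg) (auto simp: weight_coords_def)
qed

lemma weight_coords_nonzero: "weight_coords w g m y \<Longrightarrow> w \<noteq> 0"
proof -
  assume r: "weight_coords w g m y"
  obtain i where i: "0 < p$i" by (rule active_index)
  have "norm (w$i) \<noteq> 0" using weight_coords_active[OF r i] r i by (simp add: weight_coords_def)
  then show ?thesis by auto
qed

lemma weight_coords_scale: "weight_coords w g m y \<Longrightarrow> a \<noteq> 0 \<Longrightarrow> weight_coords (a *s w) (norm a * g) m y"
  by (simp add: weight_coords_def norm_mult power_mult_distrib)

text \<open>
  The scale is determined by the weighted mean of the log moduli of the active coordinates, because the mean of
  \<open>q i \<bullet> y\<close> vanishes.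
\<close>
lemma weight_coords_unique:
  assumes a: "weight_coords w g m y" and b: "weight_coords w g' m' y'"
  shows "g = g'" "0 < p$i \<Longrightarrow> q i \<bullet> y = q i \<bullet> y'" "m k * exp (q k \<bullet> y) = m' k * exp (q k \<bullet> y')"
proof -
  have g: "0 < g" "0 < g'" using a b by (auto simp: weight_coords_def)
  have e: "ln g + q i \<bullet> y / 2 = ln g' + q i \<bullet> y' / 2" if i: "0 < p$i" for i
  proof -
    have "g * exp (q i \<bullet> y / 2) = g' * exp (q i \<bullet> y' / 2)"
      using weight_coords_active[OF a i] weight_coords_active[OF b i] i by simp
    then have "ln (g * exp (q i \<bullet> y / 2)) = ln (g' * exp (q i \<bullet> y' / 2))" by simp
    then show ?thesis using g by (simp add: ln_mult)
  qed
  have "p$i * (ln g + q i \<bullet> y / 2) = p$i * (ln g' + q i \<bullet> y' / 2)" for i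
    using e[of i] p_nonneg[of i] by (cases "p$i = 0") auto
  then have "(\<Sum>i\<in>UNIV. p$i * (ln g + q i \<bullet> y / 2)) = (\<Sum>i\<in>UNIV. p$i * (ln g' + q i \<bullet> y' / 2))"
    by (intro sum.cong refl)
  then have "ln g = ln g'"
    using pf.sum_p_inner[of y] pf.sum_p_inner[of y'] p_sum
    by (simp add: distrib_left sum.distrib sum_distrib_right[symmetric] sum_divide_distrib[symmetric])
  then show gg: "g = g'" using g by simp
  show "q i \<bullet> y = q i \<bullet> y'" if "0 < p$i" using e[OF that] gg by simp
  have "g\<^sup>2 * (m k * exp (q k \<bullet> y)) = g\<^sup>2 * (m' k * exp (q k \<bullet> y'))"
    using a b gg by (simp add: weight_coords_def)
  then show "m k * exp (q k \<bullet> y) = m' k * exp (q k \<bullet> y')" using g by simp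
qed

definition near_torus :: "real \<Rightarrow> complex^'n \<Rightarrow> bool"
  where "near_torus \<delta> w \<longleftrightarrow> (\<exists>g m y. weight_coords w g m y \<and> pf.in_tube \<delta> m y)"

lemma near_torus_weight_coords: "weight_coords w g m y \<Longrightarrow> near_torus \<delta> w \<longleftrightarrow> pf.in_tube \<delta> m y"
proof
  assume r: "weight_coords w g m y" and "near_torus \<delta> w"
  then obtain g' m' y' where r': "weight_coords w g' m' y'" "pf.in_tube \<delta> m' y'" by (auto simp: near_torus_def)
  have "(\<Sum>i\<in>{i. 0 < p$i}. (q i \<bullet> y / 2)\<^sup>2) = (\<Sum>i\<in>{i. 0 < p$i}. (q i \<bullet> y' / 2)\<^sup>2)"
    by (intro sum.cong refl) (simp add: weight_coords_unique(2)[OF r r'(1)])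
  then show "pf.in_tube \<delta> m y" using r'(2) weight_coords_unique(3)[OF r r'(1)] by (simp add: pf.in_tube_def)
qed (auto simp: near_torus_def)

lemma near_torus_scale: "a \<noteq> 0 \<Longrightarrow> near_torus \<delta> (a *s w) \<longleftrightarrow> near_torus \<delta> w"
proof -
  have *: "near_torus \<delta> (a *s w)" if "near_torus \<delta> w" "a \<noteq> 0" for a w
    using that weight_coords_scale by (fastforce simp: near_torus_def)
  show "a \<noteq> 0 \<Longrightarrow> near_torus \<delta> (a *s w) \<longleftrightarrow> near_torus \<delta> w"
    using *[of w a] *[of "a *s w" "inverse a"] by (auto simp: vector_smult_assoc)
qed

definition tube :: "real \<Rightarrow> 'n cpoint set"
  where "tube \<delta> = proj ` {w. near_torus \<delta> w}"

lemma near_torus_nonzero: "near_torus \<delta> w \<Longrightarrow> w \<noteq> 0"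
  by (auto simp: near_torus_def dest: weight_coords_nonzero)

lemma tube_iff: "w \<noteq> 0 \<Longrightarrow> proj w \<in> tube \<delta> \<longleftrightarrow> near_torus \<delta> w"
proof
  assume w: "w \<noteq> 0" and "proj w \<in> tube \<delta>"
  then obtain v where v: "near_torus \<delta> v" "proj w = proj v" by (auto simp: tube_def)
  then obtain a where "a \<noteq> 0" "w = a *s v" using w near_torus_nonzero[OF v(1)] by (auto simp: proj_eq_iff)
  then show "near_torus \<delta> w" using v near_torus_scale by simp
qed (auto simp: tube_def)

text \<open>
  After division by their weighted geometric mean, the active moduli have log weights with mean zero, which are of the form
  \<open>q i \<bullet> y\<close>; the inactive masses are then adjusted to the given moduli.
\<close>
lemma weight_coords_exists:
  assumes w: "\<And>i. 0 < p$i \<Longrightarrow> w$i \<noteq> 0"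
  defines "g \<equiv> exp (\<Sum>i\<in>UNIV. p$i * ln (norm (w$i) / sqrt (p$i)))"
  shows "\<exists>m y. weight_coords w g m y"
proof -
  define L where "L = (\<Sum>i\<in>UNIV. p$i * ln (norm (w$i) / sqrt (p$i)))"
  define \<xi> where "\<xi> i = 2 * (ln (norm (w$i) / sqrt (p$i)) - L)" for i
  have "(\<Sum>i\<in>UNIV. p$i * \<xi> i) = 2 * (\<Sum>i\<in>UNIV. p$i * ln (norm (w$i) / sqrt (p$i)) - p$i * L)"
    unfolding sum_distrib_left by (intro sum.cong refl) (simp add: \<xi>_def algebra_simps)
  also have "\<dots> = 0" by (simp add: sum_subtractf sum_distrib_right[symmetric] p_sum L_def)
  finally obtain y where y: "\<And>i. 0 < p$i \<Longrightarrow> \<xi> i = q i \<bullet> y" using log_weights_planar by blast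
  define m where "m j = (if 0 < p$j then p$j else (norm (w$j) / g)\<^sup>2 * exp (- (q j \<bullet> y)))" for j
  have g: "0 < g" "g = exp L" by (auto simp: g_def L_def)
  have "(norm (w$j))\<^sup>2 = g\<^sup>2 * (m j * exp (q j \<bullet> y))" for j
  proof (cases "0 < p$j")
    case True
    have "exp (\<xi> j) = (exp (ln (norm (w$j) / sqrt (p$j)) - L))\<^sup>2" by (simp add: \<xi>_def exp_double[symmetric])
    also have "\<dots> = ((norm (w$j) / sqrt (p$j)) / g)\<^sup>2" using w[OF True] True by (simp add: exp_diff g(2))
    finally show ?thesis using True g y[OF True] by (simp add: m_def power_divide power_mult_distrib)
  next
    case False
    then show ?thesis using g by (simp add: m_def exp_minus power_divide)
  qed
  moreover have "pf.mass_profile m" by (simp add: pf.mass_profile_def m_def)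
  ultimately show ?thesis using g unfolding weight_coords_def by blast
qed

definition geom_mean :: "complex^'n \<Rightarrow> real"
  where "geom_mean w = exp (\<Sum>i\<in>UNIV. p$i * ln (norm (w$i) / sqrt (p$i)))"

text \<open>
  The condition in terms of continuous functions of \<open>w\<close>, from which openness can be read off.
\<close>
lemma near_torus_explicit:
  "near_torus \<delta> w \<longleftrightarrow> (\<forall>i. 0 < p$i \<longrightarrow> w$i \<noteq> 0) \<and>
    (\<Sum>i\<in>{i. 0 < p$i}. (ln (norm (w$i) / sqrt (p$i)) - ln (geom_mean w))\<^sup>2) + (\<Sum>k\<in>{k. inner k}. (norm (w$k) / geom_mean w)\<^sup>2) < \<delta>\<^sup>2
    \<and> (\<Sum>k\<in>{k. outer k}. (norm (w$k) / geom_mean w)\<^sup>2) < \<delta>\<^sup>2"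
proof (cases "\<forall>i. 0 < p$i \<longrightarrow> w$i \<noteq> 0")
  case True
  then obtain m y where r: "weight_coords w (geom_mean w) m y" using weight_coords_exists[of w] unfolding geom_mean_def by blast
  have a: "ln (norm (w$i) / sqrt (p$i)) - ln (geom_mean w) = q i \<bullet> y / 2" if i: "0 < p$i" for i
  proof -
    have "norm (w$i) / sqrt (p$i) = geom_mean w * exp (q i \<bullet> y / 2)" using weight_coords_active[OF r i] i by simp
    then show ?thesis by (simp add: ln_mult geom_mean_def)
  qed
  have b: "(norm (w$k) / geom_mean w)\<^sup>2 = m k * exp (q k \<bullet> y)" for k
    using r by (simp add: weight_coords_def power_divide)
  have s: "(\<Sum>i\<in>{i. 0 < p$i}. (ln (norm (w$i) / sqrt (p$i)) - ln (geom_mean w))\<^sup>2) = (\<Sum>i\<in>{i. 0 < p$i}. (q i \<bullet> y / 2)\<^sup>2)"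
    by (intro sum.cong refl) (simp add: a)
  show ?thesis unfolding near_torus_weight_coords[OF r] pf.in_tube_def b s using True by blast
next
  case False
  then obtain i where i: "0 < p$i" "w$i = 0" by auto
  have "\<not> near_torus \<delta> w"
  proof
    assume "near_torus \<delta> w"
    then obtain g m y where r: "weight_coords w g m y" by (auto simp: near_torus_def)
    then show False using weight_coords_active[OF r i(1)] i by (simp add: weight_coords_def)
  qed
  then show ?thesis using False by blast
qed

lemma open_near_torus: "open {w. near_torus \<delta> w}"
proof -
  define S where "S = {w :: complex^'n. \<forall>i. 0 < p$i \<longrightarrow> w$i \<noteq> 0}"
  have "S = (\<Inter>i\<in>{i. 0 < p$i}. {w. w$i \<noteq> 0})" by (auto simp: S_def)
  then have S: "open S" by (auto intro!: open_INT open_Collect_neq continuous_intros)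
  have nz: "norm (w$i) / sqrt (p$i) \<noteq> 0" if "w \<in> S" "0 < p$i" for w i using that by (auto simp: S_def)
  have cl: "continuous_on S (\<lambda>w. p$i * ln (norm (w$i) / sqrt (p$i)))" for i
  proof (cases "p$i = 0")
    case False
    then have "0 < p$i" using p_nonneg[of i] by simp
    then show ?thesis using nz by (intro continuous_intros) auto
  qed simp
  have cl': "continuous_on S (\<lambda>w. ln (norm (w$i) / sqrt (p$i)))" if "0 < p$i" for i
    using nz that by (intro continuous_intros) auto
  have cg: "continuous_on S geom_mean" unfolding geom_mean_def by (intro continuous_intros cl)
  have gp: "geom_mean w \<noteq> 0" for w by (simp add: geom_mean_def)
  let ?f = "\<lambda>w. (\<Sum>i\<in>{i. 0 < p$i}. (ln (norm (w$i) / sqrt (p$i)) - ln (geom_mean w))\<^sup>2) + (\<Sum>k\<in>{k. inner k}. (norm (w$k) / geom_mean w)\<^sup>2)"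
  let ?h = "\<lambda>w. (\<Sum>k\<in>{k. outer k}. (norm (w$k) / geom_mean w)\<^sup>2)"
  have cf: "continuous_on S ?f"
    using gp by (intro continuous_intros cl' cg) auto
  have ch: "continuous_on S ?h"
    using gp by (intro continuous_intros cg) auto
  have "{w. near_torus \<delta> w} = (S \<inter> ?f -` {..<\<delta>\<^sup>2}) \<inter> (S \<inter> ?h -` {..<\<delta>\<^sup>2})"
    unfolding near_torus_explicit S_def by auto
  then show ?thesis
    using continuous_open_preimage[OF cf S, of "{..<\<delta>\<^sup>2}"] continuous_open_preimage[OF ch S, of "{..<\<delta>\<^sup>2}"]
    by (simp add: open_Int)
qed

lemma cp_open_tube: "cp_open (tube \<delta>)"
proof -
  have "{w. w \<noteq> 0 \<and> proj w \<in> tube \<delta>} = {w. near_torus \<delta> w}"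
    using tube_iff near_torus_nonzero by blast
  moreover have "tube \<delta> \<subseteq> CP" unfolding tube_def CP_def using near_torus_nonzero by auto
  ultimately show ?thesis by (simp add: cp_open_def open_near_torus)
qed

text \<open>
  An active index whose phase serves as the reference phase for the inactive coordinates.
\<close>
definition i0 :: 'n where "i0 = (SOME i. 0 < p$i)"

lemma i0: "0 < p$i0"
  unfolding i0_def using active_index someI_ex[of "\<lambda>i. 0 < p$i"] by blast

text \<open>
  The tube coordinates \<open>(\<theta>, y, x)\<close>: active coordinates have phase \<open>\<theta>$i\<close> and log modulus shifted by \<open>Re (x$i)\<close>; inactive coordinates are
  stored in \<open>y\<close> (outer) and \<open>x\<close> (inner). They are rotated by the reference phase, so that a common shift of the
  phases multiplies \<open>Psi\<close> by a unit.
\<close>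
definition Psi :: "(real^'n) \<times> (complex^'n) \<times> (complex^'n) \<Rightarrow> complex^'n"
  where "Psi d = (\<chi> i. if 0 < p$i
      then of_real (sqrt (p$i)) * exp (\<i> * of_real (fst d $ i)) * exp (of_real (Re (snd (snd d) $ i)))
      else exp (\<i> * of_real (fst d $ i0)) * (fst (snd d) $ i + snd (snd d) $ i))"

definition Ysp :: "(complex^'n) set"
  where "Ysp = {y. \<forall>i. \<not> outer i \<longrightarrow> y$i = 0}"

definition Xsp :: "(complex^'n) set"
  where "Xsp = {x. (\<forall>i. outer i \<longrightarrow> x$i = 0) \<and> (\<forall>i. 0 < p$i \<longrightarrow> Im (x$i) = 0) \<and> (\<Sum>i\<in>UNIV. p$i * Re (x$i)) = 0}"

lemma subspace_Ysp: "subspace Ysp"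
  by (auto simp: Ysp_def subspace_def)

lemma subspace_Xsp: "subspace Xsp"
  by (auto simp: Xsp_def subspace_def distrib_left sum.distrib mult.left_commute[of "p$_"] sum_distrib_left[symmetric])

lemma Psi_smooth: "Ck_on k D Psi"
proof -
  have bl: "bounded_linear (\<lambda>d :: (real^'n) \<times> (complex^'n) \<times> (complex^'n). fst d)"
    "bounded_linear (\<lambda>d :: (real^'n) \<times> (complex^'n) \<times> (complex^'n). fst (snd d))"
    "bounded_linear (\<lambda>d :: (real^'n) \<times> (complex^'n) \<times> (complex^'n). snd (snd d))"
    by (auto intro: bounded_linear_fst bounded_linear_compose[OF bounded_linear_fst bounded_linear_snd]
        bounded_linear_compose[OF bounded_linear_snd bounded_linear_snd])
  have t: "smooth_term (\<lambda>d :: (real^'n) \<times> (complex^'n) \<times> (complex^'n). complex_of_real (fst d $ i))"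
    "smooth_term (\<lambda>d :: (real^'n) \<times> (complex^'n) \<times> (complex^'n). fst (snd d) $ i)"
    "smooth_term (\<lambda>d :: (real^'n) \<times> (complex^'n) \<times> (complex^'n). snd (snd d) $ i)"
    "smooth_term (\<lambda>d :: (real^'n) \<times> (complex^'n) \<times> (complex^'n). complex_of_real (Re (snd (snd d) $ i)))" for i
    by (intro smooth_term.linear bounded_linear_compose[OF bounded_linear_of_real] bounded_linear_compose[OF bounded_linear_Re]
        bounded_linear_compose[OF bounded_linear_vec_nth] bl)+
  have "smooth_term (\<lambda>d :: (real^'n) \<times> (complex^'n) \<times> (complex^'n). if 0 < p$i
      then of_real (sqrt (p$i)) * exp (\<i> * of_real (fst d $ i)) * exp (of_real (Re (snd (snd d) $ i)))
      else exp (\<i> * of_real (fst d $ i0)) * (fst (snd d) $ i + snd (snd d) $ i))" for i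
    by (cases "0 < p$i") (auto intro!: smooth_term.mult[of "\<lambda>_. _"] smooth_term.exp smooth_term.add t intro: smooth_term.const smooth_term.mult)
  from Ck_on_smooth_terms[OF this] show ?thesis unfolding Psi_def[abs_def] .
qed

definition DPsi :: "(real^'n) \<times> (complex^'n) \<times> (complex^'n) \<Rightarrow> (real^'n) \<times> (complex^'n) \<times> (complex^'n) \<Rightarrow> complex^'n"
  where "DPsi d v = (\<chi> i. if 0 < p$i
      then (\<i> * of_real (fst v $ i) + of_real (Re (snd (snd v) $ i))) * Psi d $ i
      else \<i> * of_real (fst v $ i0) * Psi d $ i + exp (\<i> * of_real (fst d $ i0)) * (fst (snd v) $ i + snd (snd v) $ i))"

lemma Psi_deriv: "(Psi has_derivative DPsi d) (at d)"
proof -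
  have bl: "bounded_linear (\<lambda>d :: (real^'n) \<times> (complex^'n) \<times> (complex^'n). fst d)"
    "bounded_linear (\<lambda>d :: (real^'n) \<times> (complex^'n) \<times> (complex^'n). fst (snd d))"
    "bounded_linear (\<lambda>d :: (real^'n) \<times> (complex^'n) \<times> (complex^'n). snd (snd d))"
    by (auto intro: bounded_linear_fst bounded_linear_compose[OF bounded_linear_fst bounded_linear_snd]
        bounded_linear_compose[OF bounded_linear_snd bounded_linear_snd])
  have l: "((\<lambda>d. \<i> * complex_of_real (fst d $ i)) has_derivative (\<lambda>v. \<i> * complex_of_real (fst v $ i))) (at d)"
    "((\<lambda>d. fst (snd d) $ i + snd (snd d) $ i) has_derivative (\<lambda>v. fst (snd v) $ i + snd (snd v) $ i)) (at d)"
    "((\<lambda>d. complex_of_real (Re (snd (snd d) $ i))) has_derivative (\<lambda>v. complex_of_real (Re (snd (snd v) $ i)))) (at d)"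
    for i and d :: "(real^'n) \<times> (complex^'n) \<times> (complex^'n)"
    by (rule bounded_linear_imp_has_derivative, intro bounded_linear_add
        bounded_linear_compose[OF bounded_linear_mult_right] bounded_linear_compose[OF bounded_linear_of_real] bounded_linear_compose[OF bounded_linear_Re]
        bounded_linear_compose[OF bounded_linear_vec_nth] bl)+
  have ex: "((\<lambda>d. exp (f d)) has_derivative (\<lambda>v. exp (f d) * f' v)) (at d)"
    if "(f has_derivative f') (at d)" for f :: "_ \<Rightarrow> complex" and f' and d :: "(real^'n) \<times> (complex^'n) \<times> (complex^'n)"
    using has_derivative_compose[OF that DERIV_exp[of "f d", unfolded has_field_derivative_def]] by simp
  have c: "((\<lambda>d. Psi d $ i) has_derivative (\<lambda>v. DPsi d v $ i)) (at d)" for i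
  proof (cases "0 < p$i")
    case True
    have "((\<lambda>d. of_real (sqrt (p$i)) * exp (\<i> * of_real (fst d $ i)) * exp (of_real (Re (snd (snd d) $ i)))) has_derivative
      (\<lambda>v. of_real (sqrt (p$i)) * exp (\<i> * of_real (fst d $ i)) * (exp (of_real (Re (snd (snd d) $ i))) * of_real (Re (snd (snd v) $ i)))
         + of_real (sqrt (p$i)) * (exp (\<i> * of_real (fst d $ i)) * (\<i> * of_real (fst v $ i))) * exp (of_real (Re (snd (snd d) $ i))))) (at d)"
      by (intro has_derivative_mult has_derivative_mult_right ex l)
    then show ?thesis using True by (simp add: Psi_def DPsi_def algebra_simps)
  next
    case False
    have "((\<lambda>d. exp (\<i> * of_real (fst d $ i0)) * (fst (snd d) $ i + snd (snd d) $ i)) has_derivative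
      (\<lambda>v. exp (\<i> * of_real (fst d $ i0)) * (fst (snd v) $ i + snd (snd v) $ i)
        + (exp (\<i> * of_real (fst d $ i0)) * (\<i> * of_real (fst v $ i0))) * (fst (snd d) $ i + snd (snd d) $ i))) (at d)"
      by (intro has_derivative_mult ex l)
    then show ?thesis using False by (simp add: Psi_def DPsi_def algebra_simps)
  qed
  show ?thesis using has_derivative_vec[of "\<lambda>i d. Psi d $ i", OF c] by simp
qed

lemma frechet_Psi: "frechet_derivative Psi (at d) = DPsi d"
  by (rule frechet_derivative_at[OF Psi_deriv, symmetric])

lemma Psi_active: "0 < p$i \<Longrightarrow> Psi (\<theta>, y, x) $ i = of_real (sqrt (p$i)) * cis (\<theta>$i) * of_real (exp (Re (x$i)))"
  by (simp add: Psi_def cis_conv_exp exp_of_real)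

lemma Psi_inactive: "p$i = 0 \<Longrightarrow> Psi (\<theta>, y, x) $ i = cis (\<theta>$i0) * (y$i + x$i)"
  by (simp add: Psi_def cis_conv_exp)

lemma Psi_norm_active: "0 < p$i \<Longrightarrow> norm (Psi (\<theta>, y, x) $ i) = sqrt (p$i) * exp (Re (x$i))"
  by (simp add: Psi_active norm_mult)

lemma Psi_nonzero: "Psi (\<theta>, y, x) \<noteq> 0"
proof
  assume "Psi (\<theta>, y, x) = 0"
  then have "norm (Psi (\<theta>, y, x) $ i0) = 0" by simp
  then show False using Psi_norm_active[OF i0, of \<theta> y x] i0 by simp
qed

lemma near_torus_Psi:
  assumes y: "y \<in> Ysp" and x: "x \<in> Xsp" and \<delta>: "0 < \<delta>"
  shows "near_torus \<delta> (Psi (\<theta>, y, x)) \<longleftrightarrow> norm y < \<delta> \<and> norm x < \<delta>"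
proof -
  let ?w = "Psi (\<theta>, y, x)"
  have l: "ln (norm (?w$i) / sqrt (p$i)) = Re (x$i)" if "0 < p$i" for i
    using that by (simp add: Psi_norm_active)
  have "(\<Sum>i\<in>UNIV. p$i * ln (norm (?w$i) / sqrt (p$i))) = (\<Sum>i\<in>UNIV. p$i * Re (x$i))"
    using l p_nonneg by (intro sum.cong refl) (metis less_le mult_zero_left)
  then have g: "geom_mean ?w = 1" using x by (simp add: geom_mean_def Xsp_def)
  have nz: "\<forall>i. 0 < p$i \<longrightarrow> ?w$i \<noteq> 0"
  proof (intro allI impI)
    fix i assume i: "0 < p$i"
    show "?w$i \<noteq> 0" using Psi_norm_active[OF i, of \<theta> y x] i by auto
  qed
  have part: "UNIV = {i. 0 < p$i} \<union> {k. inner k} \<union> {k. outer k}" using index_cases by blast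
  have split: "(norm v)\<^sup>2 = (\<Sum>i\<in>{i. 0 < p$i}. (norm (v$i))\<^sup>2) + (\<Sum>i\<in>{i. inner i}. (norm (v$i))\<^sup>2) + (\<Sum>i\<in>{i. outer i}. (norm (v$i))\<^sup>2)"
    for v :: "complex^'n"
    unfolding norm_vec_sq part
    by (subst sum.union_disjoint; auto)+
  have "(\<Sum>i\<in>{i. 0 < p$i}. (norm (x$i))\<^sup>2) = (\<Sum>i\<in>{i. 0 < p$i}. (Re (x$i))\<^sup>2)"
    using x by (intro sum.cong refl) (auto simp: Xsp_def cmod_def)
  moreover have "(\<Sum>i\<in>{i. outer i}. (norm (x$i))\<^sup>2) = 0" using x by (auto simp: Xsp_def)
  ultimately have nx: "(norm x)\<^sup>2 = (\<Sum>i\<in>{i. 0 < p$i}. (Re (x$i))\<^sup>2) + (\<Sum>i\<in>{i. inner i}. (norm (x$i))\<^sup>2)"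
    using split[of x] by simp
  have ny: "(norm y)\<^sup>2 = (\<Sum>i\<in>{i. outer i}. (norm (y$i))\<^sup>2)"
    using split[of y] y by (auto simp: Ysp_def)
  have a: "(\<Sum>i\<in>{i. 0 < p$i}. (ln (norm (?w$i) / sqrt (p$i)) - ln (geom_mean ?w))\<^sup>2) = (\<Sum>i\<in>{i. 0 < p$i}. (Re (x$i))\<^sup>2)"
    by (intro sum.cong refl) (simp add: l g)
  have b: "(\<Sum>k\<in>{k. inner k}. (norm (?w$k) / geom_mean ?w)\<^sup>2) = (\<Sum>i\<in>{i. inner i}. (norm (x$i))\<^sup>2)"
    using y by (intro sum.cong refl) (auto simp: Psi_inactive g norm_mult Ysp_def)
  have c: "(\<Sum>k\<in>{k. outer k}. (norm (?w$k) / geom_mean ?w)\<^sup>2) = (\<Sum>i\<in>{i. outer i}. (norm (y$i))\<^sup>2)"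
    using x by (intro sum.cong refl) (auto simp: Psi_inactive g norm_mult Xsp_def)
  have sq: "(norm v)\<^sup>2 < \<delta>\<^sup>2 \<longleftrightarrow> norm v < \<delta>" for v :: "complex^'n"
    using \<delta> by (metis norm_ge_zero power_strict_mono power_less_imp_less_base less_imp_le zero_less_numeral)
  show ?thesis unfolding near_torus_explicit a b c nx[symmetric] ny[symmetric] sq using nz by blast
qed

lemma Psi_covers:
  assumes w: "near_torus \<delta> w"
  obtains \<theta> y x a where "y \<in> Ysp" "x \<in> Xsp" "a \<noteq> 0" "Psi (\<theta>, y, x) = a *s w"
proof -
  have nz: "w$i \<noteq> 0" if "0 < p$i" for i using w that by (simp add: near_torus_explicit)
  define \<theta> :: "real^'n" where "\<theta> = (\<chi> i. Arg (w$i))"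
  define g where "g = geom_mean w"
  have g: "0 < g" by (simp add: g_def geom_mean_def)
  define x :: "complex^'n" where "x = (\<chi> i. if 0 < p$i then of_real (ln (norm (w$i) / sqrt (p$i)) - ln g)
      else if outer i then 0 else cis (- (\<theta>$i0)) * w$i / of_real g)"
  define y :: "complex^'n" where "y = (\<chi> i. if outer i then cis (- (\<theta>$i0)) * w$i / of_real g else 0)"
  have "p$i * Re (x$i) = p$i * ln (norm (w$i) / sqrt (p$i)) - p$i * ln g" for i
    using p_nonneg[of i] by (cases "p$i = 0") (auto simp: x_def right_diff_distrib)
  then have "(\<Sum>i\<in>UNIV. p$i * Re (x$i)) = (\<Sum>i\<in>UNIV. p$i * ln (norm (w$i) / sqrt (p$i))) - ln g"
    by (simp add: sum_subtractf sum_distrib_right[symmetric] p_sum)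
  then have "(\<Sum>i\<in>UNIV. p$i * Re (x$i)) = 0" by (simp add: g_def geom_mean_def)
  then have x: "x \<in> Xsp" by (auto simp: Xsp_def x_def)
  have y: "y \<in> Ysp" by (auto simp: Ysp_def y_def)
  have "Psi (\<theta>, y, x) $ i = of_real (inverse g) * w$i" for i
  proof (cases "0 < p$i")
    case True
    have "exp (Re (x$i)) = norm (w$i) / sqrt (p$i) / g"
      using True nz[OF True] g by (simp add: x_def exp_diff)
    moreover have "w$i = of_real (norm (w$i)) * cis (\<theta>$i)"
      using rcis_cmod_Arg[of "w$i"] by (simp add: rcis_def \<theta>_def)
    ultimately show ?thesis using True g
      by (simp add: Psi_active divide_inverse mult_ac)
  next
    case False
    then have p: "p$i = 0" using p_nonneg[of i] by simp
    have "y$i + x$i = cis (- (\<theta>$i0)) * w$i / of_real g" using False by (simp add: x_def y_def)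
    then have "Psi (\<theta>, y, x) $ i = (cis (\<theta>$i0) * cis (- (\<theta>$i0))) * w$i / of_real g"
      by (simp add: Psi_inactive[OF p])
    then show ?thesis by (simp add: cis_mult divide_inverse mult.commute)
  qed
  then have "Psi (\<theta>, y, x) = of_real (inverse g) *s w" by (simp add: vec_eq_iff)
  moreover have "complex_of_real (inverse g) \<noteq> 0" using g by simp
  ultimately show ?thesis using that x y by blast
qed

lemma tube_eq_image:
  assumes \<delta>: "0 < \<delta>"
  shows "tube \<delta> = (\<lambda>d. proj (Psi d)) ` (UNIV \<times> (Ysp \<inter> ball 0 \<delta>) \<times> (Xsp \<inter> ball 0 \<delta>))"
proof (intro set_eqI iffI)
  fix z assume "z \<in> tube \<delta>"
  then obtain w where w: "near_torus \<delta> w" "z = proj w" by (auto simp: tube_def)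
  obtain \<theta> y x a where d: "y \<in> Ysp" "x \<in> Xsp" "a \<noteq> 0" "Psi (\<theta>, y, x) = a *s w"
    by (rule Psi_covers[OF w(1)])
  have "near_torus \<delta> (Psi (\<theta>, y, x))" using w(1) d by (simp add: near_torus_scale)
  then have "norm y < \<delta>" "norm x < \<delta>" using near_torus_Psi[OF d(1,2) \<delta>] by auto
  moreover have "z = proj (Psi (\<theta>, y, x))" using w(2) d(3,4) by (simp add: proj_scale)
  ultimately show "z \<in> (\<lambda>d. proj (Psi d)) ` (UNIV \<times> (Ysp \<inter> ball 0 \<delta>) \<times> (Xsp \<inter> ball 0 \<delta>))"
    using d(1,2) by (intro image_eqI[of _ _ "(\<theta>, y, x)"]) auto
next
  fix z assume "z \<in> (\<lambda>d. proj (Psi d)) ` (UNIV \<times> (Ysp \<inter> ball 0 \<delta>) \<times> (Xsp \<inter> ball 0 \<delta>))"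
  then obtain \<theta> y x where "y \<in> Ysp" "x \<in> Xsp" "norm y < \<delta>" "norm x < \<delta>" "z = proj (Psi (\<theta>, y, x))"
    by auto
  then show "z \<in> tube \<delta>" using near_torus_Psi[OF _ _ \<delta>] by (auto simp: tube_def)
qed

lemma torus_point_nonzero: "torus_point p \<theta> \<noteq> 0"
  using lift_norm[OF torus_point_lift, of \<theta>] by auto

lemma torus_point_proj_iff: "proj (torus_point p \<theta>) = proj (torus_point p \<theta>')
   \<longleftrightarrow> (\<exists>a. norm a = 1 \<and> (\<forall>i. 0 < p$i \<longrightarrow> cis (\<theta>$i) = a * cis (\<theta>'$i)))"
proof -
  have "proj (torus_point p \<theta>) = proj (torus_point p \<theta>') \<longleftrightarrow> (\<exists>a. a \<noteq> 0 \<and> torus_point p \<theta> = a *s torus_point p \<theta>')"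
    by (rule proj_eq_iff[OF torus_point_nonzero torus_point_nonzero])
  also have "\<dots> \<longleftrightarrow> (\<exists>a. norm a = 1 \<and> (\<forall>i. 0 < p$i \<longrightarrow> cis (\<theta>$i) = a * cis (\<theta>'$i)))"
  proof (intro iffI; elim exE conjE)
    fix a assume a: "a \<noteq> 0" "torus_point p \<theta> = a *s torus_point p \<theta>'"
    have "cis (\<theta>$i) = a * cis (\<theta>'$i)" if i: "0 < p$i" for i
    proof -
      have "complex_of_real (sqrt (p$i)) * cis (\<theta>$i) = complex_of_real (sqrt (p$i)) * (a * cis (\<theta>'$i))"
        using arg_cong[OF a(2), of "\<lambda>v. v$i"] by (simp add: torus_point_def mult_ac)
      then show ?thesis using i by simp
    qed
    moreover have "norm a = 1" using calculation[OF i0] by (metis norm_cis norm_mult mult.right_neutral)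
    ultimately show "\<exists>a. norm a = 1 \<and> (\<forall>i. 0 < p$i \<longrightarrow> cis (\<theta>$i) = a * cis (\<theta>'$i))" by blast
  next
    fix a assume a: "norm (a::complex) = 1" "\<forall>i. 0 < p$i \<longrightarrow> cis (\<theta>$i) = a * cis (\<theta>'$i)"
    have "torus_point p \<theta> $ i = a * torus_point p \<theta>' $ i" for i
      using a(2) p_nonneg[of i] by (cases "p$i = 0") (auto simp: torus_point_def)
    then have "torus_point p \<theta> = a *s torus_point p \<theta>'" by (simp add: vec_eq_iff)
    then show "\<exists>a. a \<noteq> 0 \<and> torus_point p \<theta> = a *s torus_point p \<theta>'" using a(1) by (intro exI[of _ a]) auto
  qed
  finally show ?thesis .
qed

text \<open>
  If two values of \<open>Psi\<close> differ by a factor \<open>a\<close>, the weighted mean of the log moduli shows \<open>norm a = 1\<close>, and then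
  the moduli, the phases and the inactive coordinates can be compared.
\<close>
lemma Psi_inj:
  assumes y: "y \<in> Ysp" "y' \<in> Ysp" and x: "x \<in> Xsp" "x' \<in> Xsp"
  shows "proj (Psi (\<theta>, y, x)) = proj (Psi (\<theta>', y', x')) \<longleftrightarrow>
     proj (torus_point p \<theta>) = proj (torus_point p \<theta>') \<and> y = y' \<and> x = x'"
proof
  assume "proj (Psi (\<theta>, y, x)) = proj (Psi (\<theta>', y', x'))"
  then obtain a where a: "a \<noteq> 0" "Psi (\<theta>, y, x) = a *s Psi (\<theta>', y', x')"
    using Psi_nonzero by (auto simp: proj_eq_iff)
  have ai: "Psi (\<theta>, y, x) $ i = a * Psi (\<theta>', y', x') $ i" for i using a(2) by simp
  have r: "Re (x$i) = ln (norm a) + Re (x'$i)" if i: "0 < p$i" for i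
  proof -
    have "sqrt (p$i) * exp (Re (x$i)) = norm a * (sqrt (p$i) * exp (Re (x'$i)))"
      using arg_cong[OF ai[of i], of norm] by (simp add: norm_mult Psi_norm_active[OF i])
    then have "exp (Re (x$i)) = norm a * exp (Re (x'$i))" using i by simp
    then have "ln (exp (Re (x$i))) = ln (norm a * exp (Re (x'$i)))" by simp
    then show ?thesis using a(1) by (simp add: ln_mult)
  qed
  have "p$i * Re (x$i) = p$i * ln (norm a) + p$i * Re (x'$i)" for i
    using r[of i] p_nonneg[of i] by (cases "p$i = 0") (auto simp: distrib_left)
  then have "(\<Sum>i\<in>UNIV. p$i * Re (x$i)) = ln (norm a) + (\<Sum>i\<in>UNIV. p$i * Re (x'$i))"
    by (simp add: sum.distrib sum_distrib_right[symmetric] p_sum)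
  then have "ln (norm a) = 0" using x by (simp add: Xsp_def)
  then have na: "norm a = 1" using a(1) by simp
  have xa: "x$i = x'$i" if i: "0 < p$i" for i
    using r[OF i] na x i by (simp add: Xsp_def complex_eq_iff)
  have c: "cis (\<theta>$i) = a * cis (\<theta>'$i)" if i: "0 < p$i" for i
  proof -
    have "complex_of_real (sqrt (p$i) * exp (Re (x$i))) * cis (\<theta>$i) = complex_of_real (sqrt (p$i) * exp (Re (x$i))) * (a * cis (\<theta>'$i))"
      using ai[of i] xa[OF i] by (simp add: Psi_active[OF i] mult_ac)
    then show ?thesis using i by simp
  qed
  have s: "y$i + x$i = y'$i + x'$i" if i: "p$i = 0" for i
    using ai[of i] c[OF i0] a(1) by (simp add: Psi_inactive[OF i])
  have "y$i = y'$i \<and> x$i = x'$i" for i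
    using index_cases[of i] s[of i] xa[of i] x y by (auto simp: Xsp_def Ysp_def)
  then have "y = y'" "x = x'" by (simp_all add: vec_eq_iff)
  then show "proj (torus_point p \<theta>) = proj (torus_point p \<theta>') \<and> y = y' \<and> x = x'"
    unfolding torus_point_proj_iff using na c by blast
next
  assume "proj (torus_point p \<theta>) = proj (torus_point p \<theta>') \<and> y = y' \<and> x = x'"
  then obtain a where a: "norm a = 1" "\<And>i. 0 < p$i \<Longrightarrow> cis (\<theta>$i) = a * cis (\<theta>'$i)" and e: "y = y'" "x = x'"
    unfolding torus_point_proj_iff by blast
  have "Psi (\<theta>, y, x) $ i = a * Psi (\<theta>', y', x') $ i" for i
    using a(2)[of i] a(2)[OF i0] e p_nonneg[of i]
    by (cases "p$i = 0") (auto simp: Psi_active Psi_inactive)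
  then have "Psi (\<theta>, y, x) = a *s Psi (\<theta>', y', x')" by (simp add: vec_eq_iff)
  moreover have "a \<noteq> 0" using a(1) by auto
  ultimately show "proj (Psi (\<theta>, y, x)) = proj (Psi (\<theta>', y', x'))" by (simp add: proj_scale)
qed

lemma Psi_immersion:
  assumes eta: "\<eta> \<in> Ysp" and xi: "\<xi> \<in> Xsp" and a: "DPsi (\<theta>, y, x) (\<alpha>, \<eta>, \<xi>) = a *s Psi (\<theta>, y, x)"
  shows "(\<exists>\<kappa>. \<forall>i\<in>active p. \<alpha>$i = \<kappa>) \<and> \<eta> = 0 \<and> \<xi> = 0"
proof -
  have ai: "DPsi (\<theta>, y, x) (\<alpha>, \<eta>, \<xi>) $ i = a * Psi (\<theta>, y, x) $ i" for i using a by simp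
  have act: "Re (\<xi>$i) = Re a" "\<alpha>$i = Im a" if i: "0 < p$i" for i
  proof -
    have "Psi (\<theta>, y, x) $ i \<noteq> 0" using Psi_norm_active[OF i, of \<theta> y x] i by auto
    then have "\<i> * of_real (\<alpha>$i) + of_real (Re (\<xi>$i)) = a" using ai[of i] i by (simp add: DPsi_def)
    then show "Re (\<xi>$i) = Re a" "\<alpha>$i = Im a" by auto
  qed
  have "p$i * Re (\<xi>$i) = p$i * Re a" for i
    using act(1)[of i] p_nonneg[of i] by (cases "p$i = 0") auto
  then have "(\<Sum>i\<in>UNIV. p$i * Re (\<xi>$i)) = (\<Sum>i\<in>UNIV. p$i * Re a)" by (intro sum.cong refl)
  then have "(\<Sum>i\<in>UNIV. p$i * Re (\<xi>$i)) = Re a"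
    by (simp add: sum_distrib_right[symmetric] p_sum)
  then have ra: "Re a = 0" using xi by (simp add: Xsp_def)
  have a0: "a = \<i> * of_real (\<alpha>$i0)" using ra act(2)[OF i0] by (simp add: complex_eq_iff)
  have s: "\<eta>$i + \<xi>$i = 0" if i: "p$i = 0" for i
    using ai[of i] i unfolding a0 by (simp add: DPsi_def)
  have "\<eta>$i = 0 \<and> \<xi>$i = 0" for i
    using index_cases[of i] s[of i] act(1)[of i] ra xi eta by (auto simp: Xsp_def Ysp_def complex_eq_iff)
  then have "\<eta> = 0" "\<xi> = 0" by (simp_all add: vec_eq_iff)
  then show ?thesis using act(2) by (auto simp: active_iff)
qed

lemma Psi_torus: "Psi (\<theta>, 0, 0) = torus_point p \<theta>"
  unfolding vec_eq_iff
proof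
  fix i show "Psi (\<theta>, 0, 0) $ i = torus_point p \<theta> $ i"
    using p_nonneg[of i] by (cases "p$i = 0") (auto simp: Psi_active Psi_inactive torus_point_def)
qed

lemma hor_part_id: "h \<in> horizontal u \<Longrightarrow> hor_part u h = h"
  by (simp add: hor_part_def horizontal_def)

lemma Psi_stable_directions:
  "(\<lambda>\<eta>. hor_part (torus_point p \<theta>) (DPsi (\<theta>, 0, 0) (0, \<eta>, 0))) ` Ysp
     = stable_space (residual (diag_mat lam)) (torus_point p \<theta>)"
proof -
  let ?u = "torus_point p \<theta>"
  have D: "DPsi (\<theta>, 0, 0) (0, \<eta>, 0) $ i = (if 0 < p$i then 0 else cis (\<theta>$i0) * \<eta>$i)" for \<eta> i
    by (simp add: DPsi_def cis_conv_exp)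
  have hz: "DPsi (\<theta>, 0, 0) (0, \<eta>, 0) \<in> horizontal ?u" for \<eta>
    unfolding horizontal_def cdot_def mem_Collect_eq
    by (rule sum.neutral) (use p_nonneg in \<open>auto simp: D torus_point_def less_le\<close>)
  show ?thesis unfolding hor_part_id[OF hz] stable_space_eq[OF torus_point_lift]
  proof (intro set_eqI iffI)
    fix h assume "h \<in> (\<lambda>\<eta>. DPsi (\<theta>, 0, 0) (0, \<eta>, 0)) ` Ysp"
    then show "h \<in> {h. \<forall>i. \<not> outer i \<longrightarrow> h$i = 0}" by (auto simp: D Ysp_def)
  next
    fix h :: "complex^'n" assume h: "h \<in> {h. \<forall>i. \<not> outer i \<longrightarrow> h$i = 0}"
    define \<eta> where "\<eta> = cis (- (\<theta>$i0)) *s h"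
    have "\<eta> \<in> Ysp" using h by (simp add: Ysp_def \<eta>_def)
    moreover have "h = DPsi (\<theta>, 0, 0) (0, \<eta>, 0)"
      using h by (auto simp: vec_eq_iff D \<eta>_def mult.assoc[symmetric] cis_mult)
    ultimately show "h \<in> (\<lambda>\<eta>. DPsi (\<theta>, 0, 0) (0, \<eta>, 0)) ` Ysp" by blast
  qed
qed

lemma Psi_unstable_directions:
  "(\<lambda>\<xi>. hor_part (torus_point p \<theta>) (DPsi (\<theta>, 0, 0) (0, 0, \<xi>))) ` Xsp
     = unstable_space (residual (diag_mat lam)) (torus_point p \<theta>)"
proof -
  let ?u = "torus_point p \<theta>"
  have D: "DPsi (\<theta>, 0, 0) (0, 0, \<xi>) $ i = (if 0 < p$i then Re (\<xi>$i) *\<^sub>R ?u$i else cis (\<theta>$i0) * \<xi>$i)" for \<xi> i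
    by (simp add: DPsi_def Psi_torus scaleR_conv_of_real cis_conv_exp)
  have hz: "DPsi (\<theta>, 0, 0) (0, 0, \<xi>) \<in> horizontal ?u" if xi: "\<xi> \<in> Xsp" for \<xi>
  proof -
    have "cnj (?u$i) * DPsi (\<theta>, 0, 0) (0, 0, \<xi>) $ i = complex_of_real (p$i * Re (\<xi>$i))" for i
    proof (cases "0 < p$i")
      case True
      then have "cnj (?u$i) * DPsi (\<theta>, 0, 0) (0, 0, \<xi>) $ i = complex_of_real (Re (\<xi>$i)) * (cnj (?u$i) * ?u$i)"
        by (simp add: D scaleR_conv_of_real)
      then show ?thesis by (simp add: cnj_lift[OF torus_point_lift])
    next
      case False
      then have "p$i = 0" using p_nonneg[of i] by simp
      then show ?thesis using lift_zero[OF torus_point_lift] by simp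
    qed
    then have "cdot ?u (DPsi (\<theta>, 0, 0) (0, 0, \<xi>)) = complex_of_real (\<Sum>i\<in>UNIV. p$i * Re (\<xi>$i))"
      by (simp add: cdot_def)
    moreover have "(\<Sum>i\<in>UNIV. p$i * Re (\<xi>$i)) = 0" using xi by (simp add: Xsp_def)
    ultimately show ?thesis by (simp only: horizontal_def mem_Collect_eq of_real_0)
  qed
  have im: "(\<lambda>\<xi>. hor_part ?u (DPsi (\<theta>, 0, 0) (0, 0, \<xi>))) ` Xsp = (\<lambda>\<xi>. DPsi (\<theta>, 0, 0) (0, 0, \<xi>)) ` Xsp"
    by (intro image_cong refl hor_part_id hz)
  show ?thesis unfolding im unstable_space_eq[OF torus_point_lift]
  proof (intro set_eqI iffI)
    fix h assume "h \<in> (\<lambda>\<xi>. DPsi (\<theta>, 0, 0) (0, 0, \<xi>)) ` Xsp"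
    then obtain \<xi> where xi: "\<xi> \<in> Xsp" "h = DPsi (\<theta>, 0, 0) (0, 0, \<xi>)" by blast
    then show "h \<in> {h. (\<forall>i. outer i \<longrightarrow> h$i = 0) \<and> (\<exists>\<xi>. (\<forall>i. 0 < p$i \<longrightarrow> h$i = \<xi> i *\<^sub>R ?u$i) \<and> (\<Sum>i\<in>UNIV. p$i * \<xi> i) = 0)}"
      by (auto simp: D Xsp_def intro!: exI[of _ "\<lambda>i. Re (\<xi>$i)"])
  next
    fix h assume "h \<in> {h. (\<forall>i. outer i \<longrightarrow> h$i = 0) \<and> (\<exists>\<xi>. (\<forall>i. 0 < p$i \<longrightarrow> h$i = \<xi> i *\<^sub>R ?u$i) \<and> (\<Sum>i\<in>UNIV. p$i * \<xi> i) = 0)}"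
    then obtain r where h: "\<forall>i. outer i \<longrightarrow> h$i = 0" "\<forall>i. 0 < p$i \<longrightarrow> h$i = r i *\<^sub>R ?u$i" "(\<Sum>i\<in>UNIV. p$i * r i) = 0"
      by blast
    define \<xi> :: "complex^'n" where "\<xi> = (\<chi> i. if 0 < p$i then of_real (r i) else cis (- (\<theta>$i0)) * h$i)"
    have "p$i * Re (\<xi>$i) = p$i * r i" for i using p_nonneg[of i] by (cases "p$i = 0") (auto simp: \<xi>_def)
    then have "(\<Sum>i\<in>UNIV. p$i * Re (\<xi>$i)) = (\<Sum>i\<in>UNIV. p$i * r i)" by (intro sum.cong refl)
    then have "(\<Sum>i\<in>UNIV. p$i * Re (\<xi>$i)) = 0" using h(3) by simp
    then have "\<xi> \<in> Xsp" using h(1) unfolding Xsp_def by (simp add: \<xi>_def)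
    moreover have "h = DPsi (\<theta>, 0, 0) (0, 0, \<xi>)"
      using h by (auto simp: vec_eq_iff D \<xi>_def mult.assoc[symmetric] cis_mult)
    ultimately show "h \<in> (\<lambda>\<xi>. DPsi (\<theta>, 0, 0) (0, 0, \<xi>)) ` Xsp" by blast
  qed
qed

lemma tube_adapted:
  assumes \<delta>: "0 < \<delta>"
  shows "adapted_tubular_nbhd (diag_mat lam) p (tube \<delta>)"
proof -
  have sm: "smooth_on_open (UNIV \<times> ball 0 \<delta> \<times> ball 0 \<delta>) Psi"
    unfolding smooth_on_open_def by (auto intro!: open_Times Psi_smooth)
  show ?thesis
    unfolding adapted_tubular_nbhd_def Let_def
    apply (rule conjI[OF cp_open_tube])
    apply (rule exI[of _ Psi], rule exI[of _ Ysp], rule exI[of _ Xsp], rule exI[of _ \<delta>], rule exI[of _ \<delta>])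
    apply (intro conjI subspace_Ysp subspace_Xsp \<delta> sm tube_eq_image)
    subgoal using Psi_nonzero by auto
    subgoal using Psi_inj by auto
    subgoal unfolding frechet_Psi by clarify (rule Psi_immersion; blast)
    subgoal unfolding frechet_Psi using Psi_torus Psi_stable_directions Psi_unstable_directions by blast
    done
qed

text \<open>
  By compactness, the open set over \<open>W\<close> contains a neighborhood of the lifted torus of uniform width, and the point with
  coordinates \<open>(\<theta>, y, x)\<close> is close to the point of the torus with the same phases.
\<close>
lemma tube_small:
  assumes W: "cp_open W" "torus p \<subseteq> W"
  shows "\<exists>\<delta>1>0. \<forall>\<delta>. 0 < \<delta> \<longrightarrow> \<delta> \<le> \<delta>1 \<longrightarrow> tube \<delta> \<subseteq> W"
proof -
  define V where "V = {w. w \<noteq> 0 \<and> proj w \<in> W}"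
  have V: "open V" using W(1) by (simp add: cp_open_def V_def)
  have "u \<noteq> 0" if "u \<in> torus_lift p" for u using lift_norm[OF that] by auto
  then have "torus_lift p \<subseteq> V" using W(2) by (auto simp: V_def torus_def)
  then obtain e where e: "0 < e" "(\<Union>u\<in>torus_lift p. ball u e) \<subseteq> V"
    using compact_subset_open_imp_ball_epsilon_subset[OF compact_torus_lift V] by blast
  define \<delta>1 where "\<delta>1 = min 1 (e / (4 * real CARD('n)))"
  have d1: "0 < \<delta>1" using e by (simp add: \<delta>1_def)
  have "tube \<delta> \<subseteq> W" if \<delta>: "0 < \<delta>" "\<delta> \<le> \<delta>1" for \<delta>
    unfolding tube_eq_image[OF \<delta>(1)]
  proof clarify
    fix \<theta> y x assume y: "y \<in> Ysp" "y \<in> ball 0 \<delta>" and x: "x \<in> Xsp" "x \<in> ball 0 \<delta>"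
    have "norm (Psi (\<theta>, y, x) $ i - torus_point p \<theta> $ i) \<le> 2 * \<delta>" for i
    proof (cases "p$i = 0")
      case True
      have "norm (Psi (\<theta>, y, x) $ i - torus_point p \<theta> $ i) = norm (y$i + x$i)"
        by (simp add: Psi_inactive[OF True] torus_point_def True norm_mult)
      also have "\<dots> \<le> norm y + norm x"
        by (rule order_trans[OF norm_triangle_ineq]) (intro add_mono Finite_Cartesian_Product.norm_nth_le)
      finally show ?thesis using y x by simp
    next
      case False
      then have i: "0 < p$i" using p_nonneg[of i] by simp
      have r: "\<bar>Re (x$i)\<bar> \<le> norm x" by (rule order_trans[OF abs_Re_le_cmod Finite_Cartesian_Product.norm_nth_le])
      have "Psi (\<theta>, y, x) $ i - torus_point p \<theta> $ i = of_real (sqrt (p$i)) * cis (\<theta>$i) * of_real (exp (Re (x$i)) - 1)"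
        by (simp add: Psi_active[OF i] torus_point_def algebra_simps)
      then have "norm (Psi (\<theta>, y, x) $ i - torus_point p \<theta> $ i) = sqrt (p$i) * \<bar>exp (Re (x$i)) - 1\<bar>"
        using i by (simp only: norm_mult norm_of_real norm_cis) simp
      also have "\<dots> \<le> 1 * (2 * \<bar>Re (x$i)\<bar>)"
      proof (intro mult_mono)
        show "sqrt (p$i) \<le> 1" using member_le_sum[of i UNIV "\<lambda>i. p$i"] p_nonneg p_sum by simp
        have "norm x \<le> 1" using x \<delta> by (simp add: \<delta>1_def)
        then show "\<bar>exp (Re (x$i)) - 1\<bar> \<le> 2 * \<bar>Re (x$i)\<bar>" using r by (intro exp_quadratic_bounds) simp
      qed auto
      finally show ?thesis using r x by simp
    qed
    then have "norm (Psi (\<theta>, y, x) - torus_point p \<theta>) \<le> (\<Sum>i\<in>(UNIV::'n set). 2 * \<delta>)"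
      unfolding norm_vec_def by (intro order_trans[OF L2_set_le_sum] sum_mono) simp_all
    also have "\<dots> = 2 * real CARD('n) * \<delta>" by simp
    also have "\<dots> \<le> 2 * real CARD('n) * (e / (4 * real CARD('n)))" using \<delta> by (intro mult_left_mono) (auto simp: \<delta>1_def)
    also have "\<dots> < e" using e by simp
    finally have "Psi (\<theta>, y, x) \<in> ball (torus_point p \<theta>) e" by (simp add: dist_norm norm_minus_commute)
    then have "Psi (\<theta>, y, x) \<in> V" using e(2) torus_point_lift by blast
    then show "proj (Psi (\<theta>, y, x)) \<in> W" by (simp add: V_def)
  qed
  then show ?thesis using d1 by blast
qed

end

section \<open>The flow in log-weight coordinates\<close>

lemma antiderivative_exists:
  fixes f :: "real \<Rightarrow> 'a::euclidean_space"
  assumes c: "continuous_on UNIV f"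
  obtains H where "H 0 = 0" "\<And>t. (H has_vector_derivative f t) (at t)"
proof -
  define H where "H t = (LBINT x=ereal 0..ereal t. f x)" for t :: real
  have "(H has_vector_derivative f t) (at t)" for t
  proof -
    define b where "b = \<bar>t\<bar> + 1"
    have "((\<lambda>u. LBINT x=ereal 0..ereal u. f x) has_vector_derivative f t) (at t within {- b..b})"
      by (rule interval_integral_FTC2) (auto simp: b_def intro: continuous_on_subset[OF c])
    moreover have "at t within {- b..b} = at t"
      by (rule at_within_interior) (auto simp: b_def)
    ultimately show ?thesis by (simp add: H_def[abs_def])
  qed
  moreover have "H 0 = 0" by (simp add: H_def)
  ultimately show ?thesis using that by blast
qed

lemma smult_of_real: "complex_of_real r *s w = r *\<^sub>R (w :: complex^'n)"
  unfolding vec_eq_iff vector_smult_component vector_scaleR_component by (simp add: scaleR_conv_of_real)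

lemma proj_sgn: "w \<noteq> 0 \<Longrightarrow> proj (sgn w) = proj (w :: complex^'n)"
proof -
  assume w: "w \<noteq> 0"
  have "sgn w = complex_of_real (inverse (norm w)) *s w"
    unfolding smult_of_real by (simp add: sgn_div_norm)
  then show ?thesis using w by (simp add: proj_scale)
qed

text \<open>
  Boundedness is included to make the notion stable under products, and thereby applicable to polynomial maps.
\<close>
definition unit_lipschitz :: "('a::real_normed_vector \<Rightarrow> 'b::real_normed_vector) \<Rightarrow> bool"
  where "unit_lipschitz f \<longleftrightarrow> (\<exists>K L. 0 \<le> K \<and> 0 \<le> L \<and>
    (\<forall>u v. norm u \<le> 1 \<longrightarrow> norm v \<le> 1 \<longrightarrow> norm (f u) \<le> K \<and> norm (f u - f v) \<le> L * norm (u - v)))"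

lemma unit_lipschitz_linear:
  assumes "bounded_linear f" shows "unit_lipschitz f"
proof -
  interpret bounded_linear f by fact
  obtain K where K: "0 \<le> K" "\<And>x. norm (f x) \<le> norm x * K" using nonneg_bounded by auto
  have "norm (f u) \<le> K" if "norm u \<le> 1" for u
    using K(2)[of u] mult_right_mono[OF that K(1)] by simp
  moreover have "norm (f u - f v) \<le> K * norm (u - v)" for u v
    using K(2)[of "u - v"] by (simp add: diff mult.commute)
  ultimately show ?thesis using K(1) unfolding unit_lipschitz_def by blast
qed

lemma unit_lipschitz_const: "unit_lipschitz (\<lambda>_. c)"
  unfolding unit_lipschitz_def by (intro exI[of _ "norm c"] exI[of _ 0]) auto

lemma unit_lipschitz_add:
  assumes "unit_lipschitz f" "unit_lipschitz g"
  shows "unit_lipschitz (\<lambda>u. f u + g u)"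
proof -
  obtain K L K' L' where a: "0 \<le> K" "0 \<le> L" "0 \<le> K'" "0 \<le> L'"
    "\<And>u v. norm u \<le> 1 \<Longrightarrow> norm v \<le> 1 \<Longrightarrow> norm (f u) \<le> K \<and> norm (f u - f v) \<le> L * norm (u - v)"
    "\<And>u v. norm u \<le> 1 \<Longrightarrow> norm v \<le> 1 \<Longrightarrow> norm (g u) \<le> K' \<and> norm (g u - g v) \<le> L' * norm (u - v)"
    using assms unfolding unit_lipschitz_def by metis
  have "norm (f u + g u) \<le> K + K' \<and> norm (f u + g u - (f v + g v)) \<le> (L + L') * norm (u - v)"
    if "norm u \<le> 1" "norm v \<le> 1" for u v
    using a(5)[OF that] a(6)[OF that] norm_triangle_ineq[of "f u" "g u"] norm_triangle_ineq[of "f u - f v" "g u - g v"]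
    by (simp add: algebra_simps)
  then show ?thesis unfolding unit_lipschitz_def using a(1-4) by (intro exI[of _ "K + K'"] exI[of _ "L + L'"]) auto
qed

lemma unit_lipschitz_bilinear:
  assumes "bounded_bilinear mul" "unit_lipschitz f" "unit_lipschitz g"
  shows "unit_lipschitz (\<lambda>u. mul (f u) (g u))"
proof -
  interpret bounded_bilinear mul by fact
  obtain C where C: "0 \<le> C" "\<And>a b. norm (mul a b) \<le> norm a * norm b * C" using nonneg_bounded by auto
  obtain K L K' L' where a: "0 \<le> K" "0 \<le> L" "0 \<le> K'" "0 \<le> L'"
    "\<And>u v. norm u \<le> 1 \<Longrightarrow> norm v \<le> 1 \<Longrightarrow> norm (f u) \<le> K \<and> norm (f u - f v) \<le> L * norm (u - v)"
    "\<And>u v. norm u \<le> 1 \<Longrightarrow> norm v \<le> 1 \<Longrightarrow> norm (g u) \<le> K' \<and> norm (g u - g v) \<le> L' * norm (u - v)"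
    using assms(2,3) unfolding unit_lipschitz_def by metis
  have "norm (mul (f u) (g u)) \<le> K * K' * C \<and> norm (mul (f u) (g u) - mul (f v) (g v)) \<le> (L * K' * C + K * L' * C) * norm (u - v)"
    if u: "norm u \<le> 1" "norm v \<le> 1" for u v
  proof
    have "norm (f u) * norm (g u) * C \<le> K * K' * C"
      using a(5)[OF u] a(6)[OF u] a(1-4) C by (intro mult_right_mono mult_mono) auto
    then show "norm (mul (f u) (g u)) \<le> K * K' * C" using C(2)[of "f u" "g u"] by linarith
    have "mul (f u) (g u) - mul (f v) (g v) = mul (f u - f v) (g u) + mul (f v) (g u - g v)"
      by (simp add: diff_left diff_right)
    also have "norm \<dots> \<le> norm (f u - f v) * norm (g u) * C + norm (f v) * norm (g u - g v) * C"
      by (rule order_trans[OF norm_triangle_ineq add_mono[OF C(2) C(2)]])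
    also have "\<dots> \<le> (L * norm (u - v)) * K' * C + K * (L' * norm (u - v)) * C"
      using a(5)[OF u] a(5)[OF u(2,1)] a(6)[OF u] a(1-4) C by (intro add_mono mult_right_mono mult_mono) auto
    finally show "norm (mul (f u) (g u) - mul (f v) (g v)) \<le> (L * K' * C + K * L' * C) * norm (u - v)"
      by (simp add: algebra_simps)
  qed
  then show ?thesis unfolding unit_lipschitz_def using a(1-4) C(1)
    by (intro exI[of _ "K * K' * C"] exI[of _ "L * K' * C + K * L' * C"]) auto
qed

lemma unit_lipschitz_sum:
  "finite A \<Longrightarrow> (\<And>i. i \<in> A \<Longrightarrow> unit_lipschitz (f i)) \<Longrightarrow> unit_lipschitz (\<lambda>u. \<Sum>i\<in>A. f i u)"
  by (induction A rule: finite_induct) (auto intro: unit_lipschitz_const unit_lipschitz_add)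

lemma unit_lipschitz_vec:
  fixes f :: "'i::finite \<Rightarrow> 'a::real_normed_vector \<Rightarrow> 'b::real_normed_vector"
  assumes "\<And>i. unit_lipschitz (f i)"
  shows "\<exists>L\<ge>0. \<forall>u v. norm u \<le> 1 \<longrightarrow> norm v \<le> 1 \<longrightarrow> norm ((\<chi> i. f i u) - (\<chi> i. f i v)) \<le> L * norm (u - v)"
proof -
  have "\<forall>i. \<exists>L\<ge>0. \<forall>u v. norm u \<le> 1 \<longrightarrow> norm v \<le> 1 \<longrightarrow> norm (f i u - f i v) \<le> L * norm (u - v)"
    using assms unfolding unit_lipschitz_def by metis
  then obtain L where L: "\<And>i. 0 \<le> L i" "\<And>i u v. norm u \<le> 1 \<Longrightarrow> norm v \<le> 1 \<Longrightarrow> norm (f i u - f i v) \<le> L i * norm (u - v)"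
    by metis
  have "norm ((\<chi> i. f i u) - (\<chi> i. f i v)) \<le> (\<Sum>i\<in>UNIV. L i) * norm (u - v)" if "norm u \<le> 1" "norm v \<le> 1" for u v
  proof -
    have "norm ((\<chi> i. f i u) - (\<chi> i. f i v)) \<le> (\<Sum>i\<in>UNIV. norm (f i u - f i v))"
      unfolding norm_vec_def by (rule order_trans[OF L2_set_le_sum]) auto
    also have "\<dots> \<le> (\<Sum>i\<in>UNIV. L i * norm (u - v))" by (intro sum_mono L that)
    finally show ?thesis by (simp add: sum_distrib_right)
  qed
  then show ?thesis using L(1) by (intro exI[of _ "\<Sum>i\<in>UNIV. L i"]) (auto intro: sum_nonneg)
qed

lemma gronwall_distance:
  fixes v v' :: "real \<Rightarrow> 'a::real_inner"
  assumes dv: "\<And>t. (v has_vector_derivative X (v t)) (at t)" and dv': "\<And>t. (v' has_vector_derivative X (v' t)) (at t)"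
    and L: "\<And>t. norm (X (v t) - X (v' t)) \<le> L * norm (v t - v' t)" and t: "0 \<le> t"
  shows "norm (v t - v' t) \<le> exp (L * t) * norm (v 0 - v' 0)"
proof -
  define d where "d s = v s - v' s" for s
  have dd: "(d has_vector_derivative (X (v s) - X (v' s))) (at s)" for s
    unfolding d_def[abs_def] by (intro has_vector_derivative_diff dv dv')
  have di: "((\<lambda>s. d s \<bullet> d s) has_real_derivative 2 * (d s \<bullet> (X (v s) - X (v' s)))) (at s)" for s
    using has_derivative_inner[OF dd[unfolded has_vector_derivative_def] dd[unfolded has_vector_derivative_def], of s]
    unfolding has_field_derivative_def by (rule has_derivative_eq_rhs) (auto simp: inner_commute)
  have "exp (- 2 * L * t) * (d t \<bullet> d t) \<le> exp (- 2 * L * 0) * (d 0 \<bullet> d 0)"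
  proof (rule DERIV_nonpos_imp_nonincreasing[OF t])
    fix s assume "0 \<le> s" "s \<le> t"
    have "((\<lambda>s. exp (- 2 * L * s) * (d s \<bullet> d s)) has_real_derivative
        exp (- 2 * L * s) * (2 * (d s \<bullet> (X (v s) - X (v' s))) - 2 * (L * (d s \<bullet> d s)))) (at s)"
      by (rule DERIV_cong, (rule derivative_eq_intros refl di)+) (simp add: algebra_simps)
    moreover have "d s \<bullet> (X (v s) - X (v' s)) \<le> L * (d s \<bullet> d s)"
    proof -
      have "d s \<bullet> (X (v s) - X (v' s)) \<le> norm (d s) * norm (X (v s) - X (v' s))" by (rule norm_cauchy_schwarz)
      also have "\<dots> \<le> norm (d s) * (L * norm (d s))" using L[of s] by (intro mult_left_mono) (auto simp: d_def)
      finally show ?thesis by (simp add: norm_sq_inner power2_eq_square mult_ac)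
    qed
    then have "exp (- 2 * L * s) * (2 * (d s \<bullet> (X (v s) - X (v' s))) - 2 * (L * (d s \<bullet> d s))) \<le> 0"
      by (intro mult_nonneg_nonpos) auto
    ultimately show "\<exists>y. ((\<lambda>s. exp (- 2 * L * s) * (d s \<bullet> d s)) has_real_derivative y) (at s) \<and> y \<le> 0" by blast
  qed
  then have le: "exp (- 2 * L * t) * (norm (d t))\<^sup>2 \<le> (norm (d 0))\<^sup>2" by (simp add: norm_sq_inner)
  have e: "exp (- 2 * L * t) * (exp (L * t))\<^sup>2 = 1" by (simp add: exp_double[symmetric] exp_add[symmetric])
  have "(norm (d t))\<^sup>2 = (exp (- 2 * L * t) * (exp (L * t))\<^sup>2) * (norm (d t))\<^sup>2" unfolding e by simp
  also have "\<dots> = (exp (L * t))\<^sup>2 * (exp (- 2 * L * t) * (norm (d t))\<^sup>2)" by (simp only: mult_ac)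
  also have "\<dots> \<le> (exp (L * t))\<^sup>2 * (norm (d 0))\<^sup>2" by (intro mult_left_mono le) auto
  finally have "(norm (d t))\<^sup>2 \<le> (exp (L * t) * norm (d 0))\<^sup>2" by (simp add: power_mult_distrib)
  then have "norm (d t) \<le> exp (L * t) * norm (d 0)" by (rule power2_le_imp_le) auto
  then show ?thesis by (simp add: d_def)
qed

context morse_bott_flow
begin

lemma grad_lipschitz: "\<exists>L\<ge>0. \<forall>u v. norm u \<le> 1 \<longrightarrow> norm v \<le> 1 \<longrightarrow> norm (grad u - grad v) \<le> L * norm (u - v)"
proof -
  have n: "unit_lipschitz (\<lambda>u :: complex^'n. u$i)" for i by (rule unit_lipschitz_linear[OF bounded_linear_vec_nth])
  have ii: "unit_lipschitz (\<lambda>u :: complex^'n. u$i \<bullet> u$i)" for i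
    by (rule unit_lipschitz_bilinear[OF bounded_bilinear_inner n n])
  have Z: "unit_lipschitz Zq"
    unfolding Zq_def[abs_def]
    by (intro unit_lipschitz_sum unit_lipschitz_bilinear[OF bounded_bilinear_scaleR ii unit_lipschitz_const]) auto
  have S: "unit_lipschitz Sg"
    unfolding Sg_def[abs_def]
    by (intro unit_lipschitz_sum unit_lipschitz_bilinear[OF bounded_bilinear_mult unit_lipschitz_const ii]) auto
  have ZZ: "unit_lipschitz (\<lambda>u. Zq u \<bullet> Zq u)" by (rule unit_lipschitz_bilinear[OF bounded_bilinear_inner Z Z])
  have m: "unit_lipschitz (\<lambda>u. r * f u)" if "unit_lipschitz f" for r :: real and f :: "complex^'n \<Rightarrow> real"
    by (rule unit_lipschitz_bilinear[OF bounded_bilinear_mult unit_lipschitz_const that])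
  have c: "unit_lipschitz (\<lambda>u. 2 * (norm (q i))\<^sup>2 + ((- 4) * (Zq u \<bullet> q i) + (4 * (Zq u \<bullet> Zq u) + (- 2) * Sg u)))" for i
    by (intro unit_lipschitz_add unit_lipschitz_const m ZZ S unit_lipschitz_bilinear[OF bounded_bilinear_inner Z unit_lipschitz_const])
  have e: "2 * ((norm (q i - Zq u))\<^sup>2 - (Sg u - Zq u \<bullet> Zq u))
     = 2 * (norm (q i))\<^sup>2 + ((- 4) * (Zq u \<bullet> q i) + (4 * (Zq u \<bullet> Zq u) + (- 2) * Sg u))" for i u
    unfolding norm_diff_sq norm_sq_inner by simp
  have "unit_lipschitz (\<lambda>u. (2 * ((norm (q i - Zq u))\<^sup>2 - (Sg u - Zq u \<bullet> Zq u))) *\<^sub>R u$i)" for i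
    unfolding e by (rule unit_lipschitz_bilinear[OF bounded_bilinear_scaleR c n])
  from unit_lipschitz_vec[OF this] show ?thesis by (simp add: grad_def)
qed

lemma orbit_exists:
  assumes flow: "is_residual_flow (diag_mat lam) \<Phi>" and u: "norm u = 1"
  obtains v where "v 0 = u" "\<And>t. norm (v t) = 1" "\<And>t. (v has_vector_derivative - grad (v t)) (at t)"
    "\<And>t. \<Phi> t (proj u) = proj (v t)"
proof -
  obtain v where "v 0 = u" and v: "\<And>t. norm (v t) = 1 \<and> (v has_vector_derivative - fs_gradient (residual (diag_mat lam)) (v t)) (at t)
     \<and> \<Phi> t (proj u) = proj (v t)"
    using flow u unfolding is_residual_flow_def by blast
  then show ?thesis using that[of v] fs_gradient_diag by metis
qed

text \<open>
  The right-hand side of the flow equation for \<open>v t $ i\<close> is a real multiple of \<open>v t $ i\<close>. Its factor depends on \<open>i\<close> only through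
  the constant \<open>kap i\<close> and the linear term \<open>4 * (q i \<bullet> Zq (v t))\<close>; integrating it gives the exponent.
\<close>
lemma orbit_formula:
  assumes nv: "\<And>t. norm (v t) = 1" and dv: "\<And>t. (v has_vector_derivative - grad (v t)) (at t)"
  obtains s c where "s 0 = 0" "\<And>t. (s has_vector_derivative 8 *\<^sub>R Zq (v t)) (at t)"
    "\<And>t i. v t $ i = exp (c t + pf.kap i * t + q i \<bullet> s t / 2) *\<^sub>R v 0 $ i"
proof -
  have cv: "continuous_on UNIV v"
    by (meson continuous_at_imp_continuous_on has_vector_derivative_continuous dv)
  have cZ: "continuous_on UNIV (\<lambda>t. Zq (v t))" unfolding Zq_def by (intro continuous_intros cv)
  have cS: "continuous_on UNIV (\<lambda>t. Sg (v t))" unfolding Sg_def by (intro continuous_intros cv)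
  define C where "C t = 2 * (Sg (v t) - 2 * (Zq (v t) \<bullet> Zq (v t))) - 2 * R\<^sup>2" for t
  have "continuous_on UNIV (\<lambda>t. 8 *\<^sub>R Zq (v t))" by (intro continuous_intros cZ)
  from antiderivative_exists[OF this]
  obtain s where s: "s 0 = 0" "\<And>t. (s has_vector_derivative 8 *\<^sub>R Zq (v t)) (at t)" by blast
  have "continuous_on UNIV C" unfolding C_def by (intro continuous_intros cZ cS)
  from antiderivative_exists[OF this]
  obtain c where c: "c 0 = 0" "\<And>t. (c has_vector_derivative C t) (at t)" by blast
  have "v t $ i = exp (c t + pf.kap i * t + q i \<bullet> s t / 2) *\<^sub>R v 0 $ i" for t i
  proof -
    define r where "r t = c t + pf.kap i * t + q i \<bullet> s t / 2" for t
    define a where "a t = C t + pf.kap i + 4 * (q i \<bullet> Zq (v t))" for t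
    have dr: "(r has_real_derivative a t) (at t)" for t
    proof -
      have "(c has_real_derivative C t) (at t)" using c(2)[of t] by (simp add: has_real_derivative_iff_has_vector_derivative)
      moreover have "((\<lambda>t. q i \<bullet> s t) has_real_derivative q i \<bullet> (8 *\<^sub>R Zq (v t))) (at t)"
        by (rule has_real_derivative_inner_left[OF s(2)])
      ultimately show ?thesis unfolding r_def[abs_def] a_def
        by (auto intro!: derivative_eq_intros)
    qed
    have de: "((\<lambda>t. exp (- r t)) has_vector_derivative - (a t * exp (- r t))) (at t)" for t
      unfolding has_real_derivative_iff_has_vector_derivative[symmetric]
      by (rule DERIV_cong, (rule derivative_eq_intros refl dr)+) simp
    \<comment> \<open>Expand the square of the norm of \<open>q i - Zq w\<close>; the part without \<open>i\<close> goes into \<open>C\<close>.\<close>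
    have rate: "- grad w $ i = (2 * (Sg w - 2 * (Zq w \<bullet> Zq w)) - 2 * R\<^sup>2 + pf.kap i + 4 * (q i \<bullet> Zq w)) *\<^sub>R w$i" for w
      unfolding grad_def vec_lambda_beta norm_diff_sq pf.kap_def norm_sq_inner
      by (simp add: inner_commute[of "q i"] scaleR_left_diff_distrib[symmetric] scaleR_minus_left[symmetric] algebra_simps del: scaleR_minus_left)
    have dvi: "((\<lambda>t. v t $ i) has_vector_derivative a t *\<^sub>R v t $ i) (at t)" for t
      using bounded_linear.has_vector_derivative[OF bounded_linear_vec_nth dv[of t], of i] rate[of "v t"]
      by (simp add: a_def C_def)
    have "((\<lambda>t. exp (- r t) *\<^sub>R v t $ i) has_vector_derivative 0) (at t)" for t
      using has_vector_derivative_scaleR[OF de[unfolded has_real_derivative_iff_has_vector_derivative[symmetric]] dvi, of t]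
      by (simp add: mult.commute)
    then obtain k where k: "\<And>t. exp (- r t) *\<^sub>R v t $ i = k"
      using has_vector_derivative_zero_constant[of UNIV "\<lambda>t. exp (- r t) *\<^sub>R v t $ i"] by auto
    have "r 0 = 0" by (simp add: r_def c s)
    then have "k = v 0 $ i" using k[of 0] by simp
    then have "exp (r t) *\<^sub>R (exp (- r t) *\<^sub>R v t $ i) = exp (r t) *\<^sub>R v 0 $ i" using k[of t] by simp
    moreover have "exp (r t) *\<^sub>R (exp (- r t) *\<^sub>R v t $ i) = v t $ i" by (simp add: exp_minus)
    ultimately show ?thesis unfolding r_def by simp
  qed
  then show ?thesis using that s by blast
qed

lemma weight_coords_F: "weight_coords w g m y \<Longrightarrow> norm w = 1 \<Longrightarrow> Zq w = pf.F m y"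
proof -
  assume r: "weight_coords w g m y" and n: "norm w = 1"
  have wi: "w$i \<bullet> w$i = g\<^sup>2 * (m i * exp (q i \<bullet> y))" for i using r by (simp add: weight_coords_def norm_sq_inner)
  have "(\<Sum>i\<in>UNIV. w$i \<bullet> w$i) = 1" by (rule unit_sum[OF n])
  then have "g\<^sup>2 * pf.Z m y = 1" by (simp add: wi pf.Z_def sum_distrib_left)
  then have "g\<^sup>2 = inverse (pf.Z m y)" by (metis inverse_unique mult.commute)
  then show ?thesis by (simp add: Zq_def wi pf.F_def scaleR_sum_right)
qed

text \<open>
  By the formula for orbits, the flow adds \<open>s t\<close> to the tilt, and the derivative \<open>8 *\<^sub>R Zq (v t)\<close> of \<open>s\<close> is a function of masses
  and tilt alone, namely the mean \<open>F\<close>.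
\<close>
lemma flow_weight_coords:
  assumes flow: "is_residual_flow (diag_mat lam) \<Phi>" and r: "weight_coords w g m y0"
  obtains y where "y 0 = y0" "pf.solution m y"
    "\<And>t. \<exists>w' g'. weight_coords w' g' (pf.evol m t) (y t) \<and> \<Phi> t (proj w) = proj w'"
proof -
  have w0: "w \<noteq> 0" by (rule weight_coords_nonzero[OF r])
  define a where "a = complex_of_real (inverse (norm w))"
  have a: "a \<noteq> 0" using w0 by (simp add: a_def)
  define u where "u = a *s w"
  have ru: "weight_coords u (norm a * g) m y0" unfolding u_def by (rule weight_coords_scale[OF r a])
  have "norm u = 1"
  proof -
    have "u = inverse (norm w) *\<^sub>R w" unfolding u_def a_def by (rule smult_of_real)
    then show ?thesis using w0 by simp
  qed
  then obtain v where v: "v 0 = u" "\<And>t. norm (v t) = 1" "\<And>t. (v has_vector_derivative - grad (v t)) (at t)"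
    "\<And>t. \<Phi> t (proj u) = proj (v t)"
    using orbit_exists[OF flow] by blast
  obtain s c where s: "s 0 = 0" "\<And>t. (s has_vector_derivative 8 *\<^sub>R Zq (v t)) (at t)"
    "\<And>t i. v t $ i = exp (c t + pf.kap i * t + q i \<bullet> s t / 2) *\<^sub>R v 0 $ i"
    using orbit_formula[OF v(2,3)] by blast
  have rv: "weight_coords (v t) (norm a * g * exp (c t)) (pf.evol m t) (y0 + s t)" for t
  proof -
    have "(norm (v t $ i))\<^sup>2 = (norm a * g * exp (c t))\<^sup>2 * (pf.evol m t i * exp (q i \<bullet> (y0 + s t)))" for i
    proof -
      have "(norm (v t $ i))\<^sup>2 = (exp (c t + pf.kap i * t + q i \<bullet> s t / 2))\<^sup>2 * (norm (u$i))\<^sup>2"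
        unfolding s(3)[of t i] v(1) by (simp add: power_mult_distrib)
      also have "(norm (u$i))\<^sup>2 = (norm a * g)\<^sup>2 * (m i * exp (q i \<bullet> y0))" using ru by (simp add: weight_coords_def)
      also have "(exp (c t + pf.kap i * t + q i \<bullet> s t / 2))\<^sup>2 = (exp (c t))\<^sup>2 * exp (2 * pf.kap i * t) * exp (q i \<bullet> s t)"
        by (simp add: exp_double[symmetric] exp_add[symmetric] algebra_simps)
      finally show ?thesis by (simp add: pf.evol_def inner_add_right exp_add power_mult_distrib mult_ac)
    qed
    then show ?thesis using ru pf.mass_profile_evol by (simp add: weight_coords_def)
  qed
  show ?thesis
  proof (rule that[of "\<lambda>t. y0 + s t"])
    show "y0 + s 0 = y0" by (simp add: s)
    show "pf.solution m (\<lambda>t. y0 + s t)"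
      unfolding pf.solution_def weight_coords_F[OF rv v(2), symmetric]
      using s(2) by (auto intro!: derivative_eq_intros)
    fix t
    have "proj w = proj u" unfolding u_def by (rule proj_scale[OF a, symmetric])
    then show "\<exists>w' g'. weight_coords w' g' (pf.evol m t) (y0 + s t) \<and> \<Phi> t (proj w) = proj w'" using rv v(4) by auto
  qed
qed

lemma stay_set_weight_coords:
  assumes flow: "is_residual_flow (diag_mat lam) \<Phi>" and r: "weight_coords w g m y0" and T: "0 \<le> T"
  obtains y where "y 0 = y0" "pf.solution m y"
    "proj w \<in> stay_set \<Phi> (tube \<delta>) T \<longleftrightarrow> (\<forall>t. 0 \<le> t \<and> t \<le> T \<longrightarrow> pf.in_tube \<delta> (pf.evol m t) (y t))"
proof -
  obtain y where y: "y 0 = y0" "pf.solution m y"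
    "\<And>t. \<exists>w' g'. weight_coords w' g' (pf.evol m t) (y t) \<and> \<Phi> t (proj w) = proj w'"
    using flow_weight_coords[OF flow r] by blast
  have "\<Phi> t (proj w) \<in> tube \<delta> \<longleftrightarrow> pf.in_tube \<delta> (pf.evol m t) (y t)" for t
    using y(3)[of t] tube_iff[OF weight_coords_nonzero] near_torus_weight_coords by metis
  moreover have "proj w \<in> tube \<delta> \<longleftrightarrow> pf.in_tube \<delta> (pf.evol m 0) (y 0)"
    unfolding tube_iff[OF weight_coords_nonzero[OF r]] near_torus_weight_coords[OF r] by (simp add: pf.evol_0 y)
  ultimately have "proj w \<in> stay_set \<Phi> (tube \<delta>) T \<longleftrightarrow> (\<forall>t. 0 \<le> t \<and> t \<le> T \<longrightarrow> pf.in_tube \<delta> (pf.evol m t) (y t))"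
    using T unfolding stay_set_def by auto
  then show ?thesis using that y by blast
qed

text \<open>
  The masses evolve autonomously, so a solution that starts in \<open>b\<close> with the masses of time \<open>T\<close> can be translated in time by \<open>T\<close>.
\<close>
lemma terminal_solution_exists:
  assumes flow: "is_residual_flow (diag_mat lam) \<Phi>" and m: "pf.mass_profile m"
  shows "\<exists>y. pf.solution m y \<and> y T = b"
proof -
  define w :: "complex^'n" where "w = (\<chi> j. of_real (sqrt (pf.evol m T j * exp (q j \<bullet> b))))"
  have "0 \<le> pf.evol m T j" for j using pf.mass_profile_evol[OF m] by (simp add: pf.mass_profile_def)
  then have r: "weight_coords w 1 (pf.evol m T) b" using pf.mass_profile_evol[OF m] by (simp add: weight_coords_def w_def)
  obtain y where y: "y 0 = b" "pf.solution (pf.evol m T) y" using flow_weight_coords[OF flow r] by blast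
  have "((\<lambda>t. y (t - T)) has_vector_derivative 8 *\<^sub>R pf.F (pf.evol m t) (y (t - T))) (at t)" for t
  proof -
    have d: "((\<lambda>t. t - T) has_vector_derivative 1) (at t)" by (auto intro!: derivative_eq_intros)
    have "pf.evol (pf.evol m T) (t - T) = pf.evol m t" by (simp add: pf.evol_evol)
    then show ?thesis
      using vector_diff_chain_at[OF d pf.solutionD[OF y(2), of "t - T"]] by (simp add: o_def)
  qed
  then have "pf.solution m (\<lambda>t. y (t - T))" by (simp add: pf.solution_def)
  then show ?thesis using y(1) by (intro exI[of _ "\<lambda>t. y (t - T)"]) simp
qed

definition cone :: "(real \<Rightarrow> 'n cpoint \<Rightarrow> 'n cpoint) \<Rightarrow> real \<Rightarrow> real \<Rightarrow> (complex^'n) set"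
  where "cone \<Phi> \<delta> T = {w. w \<noteq> 0 \<and> proj w \<in> stay_set \<Phi> (tube \<delta>) T}"

text \<open>
  An orbit that stays in the open tube up to time \<open>T\<close> has a neighborhood of uniform width in it; by Gronwall's inequality
  the orbits of nearby points remain in that neighborhood.
\<close>
lemma open_cone:
  assumes flow: "is_residual_flow (diag_mat lam) \<Phi>" and T: "0 \<le> T"
  shows "open (cone \<Phi> \<delta> T)"
proof -
  obtain L where L: "0 \<le> L" "\<And>u v. norm u \<le> 1 \<Longrightarrow> norm v \<le> 1 \<Longrightarrow> norm (grad u - grad v) \<le> L * norm (u - v)"
    using grad_lipschitz by blast
  have stay: "proj (v 0) \<in> stay_set \<Phi> (tube \<delta>) T \<longleftrightarrow> (\<forall>t. 0 \<le> t \<and> t \<le> T \<longrightarrow> near_torus \<delta> (v t))"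
    if v: "\<And>t. norm (v t) = 1" "\<And>t. \<Phi> t (proj (v 0)) = proj (v t)" for v
  proof -
    have nz: "v t \<noteq> 0" for t using v(1)[of t] by auto
    show ?thesis unfolding stay_set_def using T by (auto simp: v(2) tube_iff[OF nz])
  qed
  have loc: "\<exists>r>0. \<forall>u. norm u = 1 \<longrightarrow> norm (u - u0) < r \<longrightarrow> proj u \<in> stay_set \<Phi> (tube \<delta>) T"
    if u0: "norm u0 = 1" "proj u0 \<in> stay_set \<Phi> (tube \<delta>) T" for u0
  proof -
    obtain v0 where v0: "v0 0 = u0" "\<And>t. norm (v0 t) = 1" "\<And>t. (v0 has_vector_derivative - grad (v0 t)) (at t)"
      "\<And>t. \<Phi> t (proj u0) = proj (v0 t)"
      using orbit_exists[OF flow u0(1)] by blast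
    have "continuous_on {0..T} v0"
      by (meson continuous_at_imp_continuous_on has_vector_derivative_continuous v0(3))
    then have cp: "compact (v0 ` {0..T})" by (intro compact_continuous_image) auto
    have "v0 ` {0..T} \<subseteq> {w. near_torus \<delta> w}" using stay[of v0] v0 u0 by auto
    then obtain e where e: "0 < e" "(\<Union>x\<in>v0 ` {0..T}. ball x e) \<subseteq> {w. near_torus \<delta> w}"
      using compact_subset_open_imp_ball_epsilon_subset[OF cp open_near_torus] by blast
    have "proj u \<in> stay_set \<Phi> (tube \<delta>) T" if u: "norm u = 1" "norm (u - u0) < e * exp (- L * T)" for u
    proof -
      obtain v where v: "v 0 = u" "\<And>t. norm (v t) = 1" "\<And>t. (v has_vector_derivative - grad (v t)) (at t)"
        "\<And>t. \<Phi> t (proj u) = proj (v t)"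
        using orbit_exists[OF flow u(1)] by blast
      have "near_torus \<delta> (v t)" if t: "0 \<le> t" "t \<le> T" for t
      proof -
        have "norm (v t - v0 t) \<le> exp (L * t) * norm (v 0 - v0 0)"
        proof (rule gronwall_distance[where X = "\<lambda>u. - grad u", OF v(3) v0(3) _ t(1)])
          fix t
          have "norm (- grad (v t) - - grad (v0 t)) = norm (grad (v t) - grad (v0 t))"
            by (metis minus_diff_minus norm_minus_cancel)
          then show "norm (- grad (v t) - - grad (v0 t)) \<le> L * norm (v t - v0 t)"
            using L(2)[of "v t" "v0 t"] v(2) v0(2) by simp
        qed
        also have "\<dots> \<le> exp (L * T) * norm (v 0 - v0 0)"
          using t L(1) by (intro mult_right_mono) (auto intro: mult_left_mono)
        also have "\<dots> < exp (L * T) * (e * exp (- L * T))"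
          using u(2) by (intro mult_strict_left_mono) (auto simp: v v0)
        also have "\<dots> = e" by (simp add: exp_minus)
        finally have "v t \<in> ball (v0 t) e" by (simp add: dist_norm norm_minus_commute)
        then have "v t \<in> (\<Union>x\<in>v0 ` {0..T}. ball x e)" using t by auto
        then show ?thesis using e(2) by blast
      qed
      then show ?thesis using stay[of v] v by auto
    qed
    then show ?thesis using e(1) by (intro exI[of _ "e * exp (- L * T)"]) auto
  qed
  show ?thesis
  proof (rule openI)
    fix w assume "w \<in> cone \<Phi> \<delta> T"
    then have w: "w \<noteq> 0" "proj (sgn w) \<in> stay_set \<Phi> (tube \<delta>) T" by (auto simp: cone_def proj_sgn)
    then obtain r where r: "0 < r" "\<And>u. norm u = 1 \<Longrightarrow> norm (u - sgn w) < r \<Longrightarrow> proj u \<in> stay_set \<Phi> (tube \<delta>) T"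
      using loc[of "sgn w"] by (auto simp: norm_sgn)
    have "continuous_on (- {0}) (sgn :: complex^'n \<Rightarrow> _)"
      by (intro continuous_on_sgn continuous_on_id) auto
    then have o: "open (- {0} \<inter> sgn -` ball (sgn w) r)" by (intro continuous_open_preimage) auto
    have "- {0} \<inter> sgn -` ball (sgn w) r \<subseteq> cone \<Phi> \<delta> T"
    proof
      fix x assume x: "x \<in> - {0} \<inter> sgn -` ball (sgn w) r"
      then have "norm (sgn x - sgn w) < r" by (simp add: dist_norm norm_minus_commute)
      then have "proj (sgn x) \<in> stay_set \<Phi> (tube \<delta>) T" using x by (intro r(2)) (auto simp: norm_sgn)
      then show "x \<in> cone \<Phi> \<delta> T" using x by (simp add: cone_def proj_sgn)
    qed
    moreover have "w \<in> - {0} \<inter> sgn -` ball (sgn w) r" using w r by simp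
    ultimately show "\<exists>e>0. ball w e \<subseteq> cone \<Phi> \<delta> T" using o open_contains_ball by (meson order_trans)
  qed
qed

end

section \<open>Diagonal scalings and the Fubini--Study volume\<close>

definition diag_scale :: "('n \<Rightarrow> real) \<Rightarrow> complex^'n \<Rightarrow> complex^'n"
  where "diag_scale a w = (\<chi> i. a i *\<^sub>R w$i)"

lemma diag_scale_inverse:
  assumes "\<And>i. a i \<noteq> 0"
  shows "diag_scale (\<lambda>i. inverse (a i)) (diag_scale a w) = w" "diag_scale a (diag_scale (\<lambda>i. inverse (a i)) w) = w"
  using assms by (simp_all add: diag_scale_def vec_eq_iff)

lemma continuous_diag_scale: "continuous_on S (diag_scale a)"
  unfolding diag_scale_def by (intro continuous_intros)

lemma diag_scale_image:
  assumes "\<And>i. a i \<noteq> 0"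
  shows "diag_scale a ` A = diag_scale (\<lambda>i. inverse (a i)) -` A"
proof (intro set_eqI iffI)
  fix x assume "x \<in> diag_scale (\<lambda>i. inverse (a i)) -` A"
  then show "x \<in> diag_scale a ` A"
    using diag_scale_inverse(2)[where a = a and w = x, OF assms] by (metis vimageD image_eqI)
qed (use diag_scale_inverse(1)[where a = a, OF assms] in auto)

lemma borel_diag_scale_image:
  assumes "\<And>i. a i \<noteq> 0" and A: "A \<in> sets borel"
  shows "diag_scale a ` A \<in> sets (borel :: (complex^'n) measure)"
proof -
  have "diag_scale (\<lambda>i. inverse (a i)) \<in> borel_measurable (borel :: (complex^'n) measure)"
    by (rule borel_measurable_continuous_onI[OF continuous_diag_scale])
  from measurable_sets[OF this A] show ?thesis by (simp add: diag_scale_image[OF assms(1)])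
qed

lemma prod_Basis_complex_vec:
  "(\<Prod>j\<in>(Basis :: (complex^'n) set). f j) = (\<Prod>i\<in>(UNIV :: 'n set). f (axis i 1) * f (axis i \<i>))" for f :: "_ \<Rightarrow> real"
proof -
  have B: "(Basis :: (complex^'n) set) = (\<Union>i\<in>UNIV. {axis i 1, axis i \<i>})"
    by (auto simp: Basis_vec_def Basis_complex_def)
  have "(\<Prod>j\<in>(\<Union>i\<in>(UNIV::'n set). {axis i 1, axis i \<i>}). f j) = (\<Prod>i\<in>(UNIV :: 'n set). \<Prod>j\<in>{axis i 1, axis i \<i>}. f j)"
    by (rule prod.UNION_disjoint) (auto simp: axis_eq_axis)
  also have "\<dots> = (\<Prod>i\<in>(UNIV :: 'n set). f (axis i 1) * f (axis i \<i>))"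
    by (intro prod.cong refl) (simp add: axis_eq_axis)
  finally show ?thesis unfolding B .
qed

text \<open>
  Each factor occurs squared because a complex coordinate has two real dimensions.
\<close>
lemma measure_diag_scale:
  fixes a :: "'n::finite \<Rightarrow> real"
  assumes a: "\<And>i. 0 < a i" and A: "A \<in> sets borel"
  shows "measure lborel (diag_scale a ` A) = (\<Prod>i\<in>UNIV. (a i)\<^sup>2) * measure lborel A"
proof -
  have nz: "a i \<noteq> 0" for i using a[of i] by simp
  define c :: "complex^'n \<Rightarrow> real" where "c j = (\<Sum>i\<in>UNIV. a i * norm (j$i))" for j
  have c: "c (axis i b) = a i" if "norm b = 1" for i b
  proof -
    have "c (axis i b) = (\<Sum>k\<in>UNIV. if k = i then a k * norm b else 0)"
      unfolding c_def by (intro sum.cong refl) (auto simp: axis_def)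
    then show ?thesis using that by simp
  qed
  have cB: "c j \<noteq> 0" if j: "j \<in> Basis" for j
  proof -
    obtain i b where "j = axis i b" "b \<in> Basis" using j by (auto simp: Basis_vec_def)
    then show ?thesis using c[of b i] nz by (simp add: norm_Basis)
  qed
  have T: "0 + (\<Sum>j\<in>Basis. (c j * (x \<bullet> j)) *\<^sub>R j) = diag_scale a x" for x
  proof (rule euclidean_eqI)
    fix k :: "complex^'n" assume k: "k \<in> Basis"
    then obtain i b where ib: "k = axis i b" "b \<in> Basis" by (auto simp: Basis_vec_def)
    have "(0 + (\<Sum>j\<in>Basis. (c j * (x \<bullet> j)) *\<^sub>R j)) \<bullet> k = c k * (x \<bullet> k)"
      using k by (simp add: inner_sum_left inner_Basis if_distrib sum.delta cong: if_cong)
    also have "\<dots> = diag_scale a x \<bullet> k"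
      using c[of b i] ib by (simp add: norm_Basis inner_axis diag_scale_def)
    finally show "(0 + (\<Sum>j\<in>Basis. (c j * (x \<bullet> j)) *\<^sub>R j)) \<bullet> k = diag_scale a x \<bullet> k" .
  qed
  have pr: "(\<Prod>j\<in>(Basis :: (complex^'n) set). \<bar>c j\<bar>) = (\<Prod>i\<in>UNIV. (a i)\<^sup>2)"
    unfolding prod_Basis_complex_vec using a
    by (intro prod.cong refl) (simp add: c abs_of_pos power2_eq_square)
  have eq: "lborel = density (distr lborel borel (diag_scale a)) (\<lambda>_. (\<Prod>i\<in>UNIV. (a i)\<^sup>2))"
    using lborel_affine_euclidean[of c 0, OF cB] unfolding T pr by simp
  have B: "diag_scale a ` A \<in> sets borel" by (rule borel_diag_scale_image[OF nz A])
  have "diag_scale a -` (diag_scale a ` A) = A"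
    using diag_scale_inverse(1)[where a = a, OF nz] by (auto, metis)
  moreover have "diag_scale a \<in> borel_measurable borel"
    by (rule borel_measurable_continuous_onI[OF continuous_diag_scale])
  ultimately have "emeasure lborel (diag_scale a ` A) = ennreal (\<Prod>i\<in>UNIV. (a i)\<^sup>2) * emeasure lborel A"
    by (subst eq) (use B in \<open>simp add: emeasure_density nn_integral_cmult emeasure_distr\<close>)
  then show ?thesis
    by (simp add: measure_def enn2real_mult prod_nonneg)
qed

text \<open>
  The surface measure is defined as a cone measure, and the preimage of a phase invariant set under \<open>sgn\<close> is a cone of
  representatives.
\<close>
lemma fs_volume_cone:
  fixes E :: "'n::finite cpoint set"
  assumes o: "open {w. w \<noteq> 0 \<and> proj w \<in> E}"
  shows "fs_volume E = real DIM(complex^'n) / (2 * pi) * measure lborel ({w. w \<noteq> 0 \<and> proj w \<in> E} \<inter> cball 0 1)"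
proof -
  let ?C = "{w :: complex^'n. w \<noteq> 0 \<and> proj w \<in> E}"
  let ?A = "{u :: complex^'n. norm u = 1 \<and> proj u \<in> E}"
  have "?A = sphere 0 1 \<inter> ?C" by auto
  then have A: "?A \<in> sets borel" using o by auto
  have m: "sgn \<in> measurable (restrict_space lborel (cball (0::complex^'n) 1)) borel"
  proof -
    have "(\<lambda>x :: complex^'n. inverse (norm x) *\<^sub>R x) \<in> borel_measurable borel" by measurable
    then have "(sgn :: complex^'n \<Rightarrow> _) \<in> borel_measurable lborel" by (simp add: sgn_div_norm[abs_def])
    then show ?thesis by (rule measurable_restrict_space1)
  qed
  have pre: "sgn -` ?A \<inter> space (restrict_space lborel (cball 0 1)) = ?C \<inter> cball 0 1"
    by (auto simp: space_restrict_space norm_sgn proj_sgn split: if_splits)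
  have "measure (distr (restrict_space lborel (cball 0 1)) borel sgn) ?A = measure (restrict_space lborel (cball 0 1)) (?C \<inter> cball 0 1)"
    unfolding measure_distr[OF m A] pre ..
  also have "\<dots> = measure lborel (?C \<inter> cball 0 1)"
    unfolding measure_def by (subst emeasure_restrict_space) auto
  finally show ?thesis
    unfolding fs_volume_def sphere_measure_def by (simp add: measure_def enn2real_mult)
qed

section \<open>The upper bound\<close>

context morse_bott_flow
begin

text \<open>
  Adds \<open>a\<close> to the tilt \<open>y\<close> and keeps scale and masses.
\<close>
definition shift :: "complex \<Rightarrow> complex^'n \<Rightarrow> complex^'n"
  where "shift a = diag_scale (\<lambda>j. exp (q j \<bullet> a / 2))"

text \<open>
  Scales the inner coordinates down by the factor by which the linearized flow expands them up to time \<open>T\<close>.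
\<close>
definition squeeze :: "real \<Rightarrow> complex^'n \<Rightarrow> complex^'n"
  where "squeeze T = diag_scale (\<lambda>j. if inner j then exp (- pf.kap j * T) else 1)"

lemma shift_add: "shift a (shift b w) = shift (a + b) w"
  by (simp add: shift_def diag_scale_def vec_eq_iff inner_add_right add_divide_distrib exp_add)

lemma shift_0: "shift 0 w = w"
  by (simp add: shift_def diag_scale_def vec_eq_iff)

lemma weight_coords_shift: "weight_coords w g m y \<Longrightarrow> weight_coords (shift a w) g m (y + a)"
proof -
  assume r: "weight_coords w g m y"
  have "(norm (shift a w $ j))\<^sup>2 = g\<^sup>2 * (m j * exp (q j \<bullet> (y + a)))" for j
  proof -
    have "(norm (shift a w $ j))\<^sup>2 = (exp (q j \<bullet> a / 2))\<^sup>2 * (norm (w$j))\<^sup>2"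
      by (simp add: shift_def diag_scale_def power_mult_distrib)
    also have "(exp (q j \<bullet> a / 2))\<^sup>2 = exp (q j \<bullet> a)" by (simp add: exp_double[symmetric])
    also have "(norm (w$j))\<^sup>2 = g\<^sup>2 * (m j * exp (q j \<bullet> y))" using r by (simp add: weight_coords_def)
    finally show ?thesis by (simp add: inner_add_right exp_add)
  qed
  then show ?thesis using r by (simp add: weight_coords_def)
qed

lemma shift_component_le: "norm (shift a w $ j) \<le> exp (pf.B * norm a / 2) * norm (w$j)"
proof -
  have "exp (q j \<bullet> a / 2) \<le> exp (pf.B * norm a / 2)" using pf.inner_q_le[of j a] by simp
  then show ?thesis by (simp add: shift_def diag_scale_def mult_right_mono)
qed

lemma norm_shift_le: "norm (shift a w) \<le> exp (pf.B * norm a / 2) * norm w"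
proof (rule power2_le_imp_le)
  have "(norm (shift a w))\<^sup>2 \<le> (\<Sum>j\<in>UNIV. (exp (pf.B * norm a / 2) * norm (w$j))\<^sup>2)"
    unfolding norm_vec_sq by (intro sum_mono power_mono shift_component_le) auto
  also have "\<dots> = (exp (pf.B * norm a / 2) * norm w)\<^sup>2"
    by (simp add: power_mult_distrib norm_vec_sq[of w] sum_distrib_left)
  finally show "(norm (shift a w))\<^sup>2 \<le> (exp (pf.B * norm a / 2) * norm w)\<^sup>2" .
qed auto

lemma measure_shift:
  assumes A: "A \<in> sets borel"
  shows "measure lborel (shift a ` A) = exp (\<Sum>j\<in>UNIV. q j \<bullet> a) * measure lborel A"
proof -
  have "(\<Prod>j\<in>UNIV. (exp (q j \<bullet> a / 2))\<^sup>2) = exp (\<Sum>j\<in>UNIV. q j \<bullet> a)"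
    by (simp add: exp_double[symmetric] exp_sum)
  then show ?thesis unfolding shift_def by (subst measure_diag_scale[OF _ A]) auto
qed

lemma sum_inner_bound: "\<bar>\<Sum>j\<in>UNIV. q j \<bullet> a\<bar> \<le> real CARD('n) * (pf.B * norm a)"
proof -
  have "\<bar>\<Sum>j\<in>UNIV. q j \<bullet> a\<bar> \<le> (\<Sum>j\<in>(UNIV :: 'n set). pf.B * norm a)"
    by (rule order_trans[OF sum_abs sum_mono]) (rule pf.inner_q_le)
  then show ?thesis by simp
qed

lemma measure_squeeze:
  assumes A: "A \<in> sets borel"
  shows "measure lborel (squeeze T ` A) = exp (- (\<Sum>k\<in>{k. inner k}. 2 * pf.kap k) * T) * measure lborel A"
proof -
  have "(\<Prod>j\<in>UNIV. (if inner j then exp (- pf.kap j * T) else 1)\<^sup>2) = (\<Prod>j\<in>{j. inner j}. exp (- (2 * pf.kap j) * T))"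
    by (rule prod.mono_neutral_cong_right) (auto simp: exp_double[symmetric] mult_ac)
  also have "\<dots> = exp (- (\<Sum>k\<in>{k. inner k}. 2 * pf.kap k) * T)"
    by (simp add: exp_sum[symmetric] sum_distrib_right sum_negf)
  finally show ?thesis unfolding squeeze_def by (subst measure_diag_scale[OF _ A]) auto
qed

text \<open>
  A component of \<open>y\<close> in the kernel of \<open>M\<close> does not affect the active weights and can be moved into the inactive masses. The others are
  controlled by \<open>Mnorm\<close>. If an eigenvalue is zero, its summand under the root is \<open>1 / 0 = 0\<close>, in accordance with the
  vanishing component.
\<close>
lemma log_weights_bounded:
  assumes r: "weight_coords w g m y" and K: "\<And>i. 0 < p$i \<Longrightarrow> \<bar>q i \<bullet> y\<bar> \<le> K"
  obtains m' y' where "weight_coords w g m' y'" "norm y' \<le> K * sqrt (1 / mu1 + 1 / mu2)"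
proof -
  define y1 where "y1 = (if mu1 = 0 then 0 else y \<bullet> e1)"
  define y2 where "y2 = (if mu2 = 0 then 0 else y \<bullet> e2)"
  define y' where "y' = y1 *\<^sub>R e1 + y2 *\<^sub>R e2"
  have co: "y' \<bullet> e1 = y1" "y' \<bullet> e2 = y2" unfolding y'_def by (rule eigen_coords)+
  have q: "q i \<bullet> y' = q i \<bullet> y" if i: "0 < p$i" for i
    unfolding pf.inner_eigen[of "q i" y'] pf.inner_eigen[of "q i" y] co
    using mu_pos_or_orth[OF _ i] by (auto simp: y1_def y2_def)
  obtain i where i: "0 < p$i" by (rule active_index)
  have K0: "0 \<le> K" using K[OF i] by linarith
  have "(pf.Mnorm y')\<^sup>2 \<le> (\<Sum>i\<in>UNIV. p$i * K\<^sup>2)"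
    unfolding pf.Mnorm_sq
  proof (rule sum_mono)
    fix i show "p$i * (q i \<bullet> y')\<^sup>2 \<le> p$i * K\<^sup>2"
    proof (cases "p$i = 0")
      case False
      then have i: "0 < p$i" using p_nonneg[of i] by simp
      have "\<bar>q i \<bullet> y'\<bar> \<le> \<bar>K\<bar>" using K[OF i] q[OF i] by simp
      then have "(q i \<bullet> y')\<^sup>2 \<le> K\<^sup>2" by (simp add: abs_le_square_iff)
      then show ?thesis using i by simp
    qed simp
  qed
  then have N: "mu1 * y1\<^sup>2 + mu2 * y2\<^sup>2 \<le> K\<^sup>2"
    unfolding pf.Mnorm_eigen co by (simp add: sum_distrib_right[symmetric] p_sum)
  have mu: "0 \<le> mu1" "0 \<le> mu2" using pf.mu_nonneg pf.mu_le by auto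
  have "0 \<le> mu1 * y1\<^sup>2" "0 \<le> mu2 * y2\<^sup>2" using mu by auto
  then have "mu1 * y1\<^sup>2 \<le> K\<^sup>2" "mu2 * y2\<^sup>2 \<le> K\<^sup>2" using N by linarith+
  note small = this
  have b: "y1\<^sup>2 \<le> K\<^sup>2 * (1 / mu1)" "y2\<^sup>2 \<le> K\<^sup>2 * (1 / mu2)"
  proof -
    show "y1\<^sup>2 \<le> K\<^sup>2 * (1 / mu1)"
    proof (cases "mu1 = 0")
      case False
      then have "0 < mu1" using mu by simp
      then show ?thesis using small(1) by (simp add: pos_le_divide_eq mult.commute)
    qed (simp add: y1_def)
    show "y2\<^sup>2 \<le> K\<^sup>2 * (1 / mu2)"
    proof (cases "mu2 = 0")
      case False
      then have "0 < mu2" using mu by simp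
      then show ?thesis using small(2) by (simp add: pos_le_divide_eq mult.commute)
    qed (simp add: y2_def)
  qed
  have "(norm y')\<^sup>2 \<le> (K * sqrt (1 / mu1 + 1 / mu2))\<^sup>2"
    unfolding pf.norm_eigen co using b mu by (simp add: power_mult_distrib distrib_left)
  then have n: "norm y' \<le> K * sqrt (1 / mu1 + 1 / mu2)"
    by (rule power2_le_imp_le) (use K0 mu in simp)
  define m' where "m' j = m j * exp (q j \<bullet> y - q j \<bullet> y')" for j
  have "pf.mass_profile m'" using r q by (auto simp: weight_coords_def pf.mass_profile_def m'_def)
  moreover have "m' j * exp (q j \<bullet> y') = m j * exp (q j \<bullet> y)" for j by (simp add: m'_def exp_add[symmetric] mult.assoc)
  ultimately have "weight_coords w g m' y'" using r by (simp add: weight_coords_def)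
  then show ?thesis using that n by blast
qed

text \<open>
  The log moduli of the active coordinates vary in an interval of length \<open>ln 3 \<le> 2\<close>, so that \<open>q i \<bullet> y / 2\<close>, a difference
  of such a value and a mean, is at most two in absolute value.
\<close>
lemma weight_coords_near_torus:
  assumes r: "0 < r" and w: "\<And>i. 0 < p$i \<Longrightarrow> r / 2 \<le> norm (w$i) / sqrt (p$i) \<and> norm (w$i) / sqrt (p$i) \<le> 3 / 2 * r"
  obtains g m y where "weight_coords w g m y" "r / 2 \<le> g" "norm y \<le> 4 * sqrt (1 / mu1 + 1 / mu2)"
proof -
  have nz: "w$i \<noteq> 0" if "0 < p$i" for i using w[OF that] r by auto
  obtain m y where r1: "weight_coords w (geom_mean w) m y" using weight_coords_exists[of w, OF nz] unfolding geom_mean_def by blast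
  have l: "ln (r / 2) \<le> ln (norm (w$i) / sqrt (p$i))" "ln (norm (w$i) / sqrt (p$i)) \<le> ln (3 / 2 * r)" if i: "0 < p$i" for i
  proof -
    have pos: "0 < norm (w$i) / sqrt (p$i)" using nz[OF i] i by simp
    show "ln (r / 2) \<le> ln (norm (w$i) / sqrt (p$i))"
      by (subst ln_le_cancel_iff[OF _ pos]) (use w[OF i] r in auto)
    show "ln (norm (w$i) / sqrt (p$i)) \<le> ln (3 / 2 * r)"
      by (subst ln_le_cancel_iff[OF pos]) (use w[OF i] r in auto)
  qed
  have lw: "p$i * ln (r / 2) \<le> p$i * ln (norm (w$i) / sqrt (p$i))" "p$i * ln (norm (w$i) / sqrt (p$i)) \<le> p$i * ln (3 / 2 * r)" for i
    using l[of i] p_nonneg[of i] by (cases "p$i = 0"; simp)+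
  have g: "ln (r / 2) \<le> ln (geom_mean w)" "ln (geom_mean w) \<le> ln (3 / 2 * r)"
  proof -
    have "(\<Sum>i\<in>UNIV. p$i * ln (r / 2)) \<le> ln (geom_mean w)" unfolding geom_mean_def ln_exp by (intro sum_mono lw)
    then show "ln (r / 2) \<le> ln (geom_mean w)" by (simp add: sum_distrib_right[symmetric] p_sum)
    have "ln (geom_mean w) \<le> (\<Sum>i\<in>UNIV. p$i * ln (3 / 2 * r))" unfolding geom_mean_def ln_exp by (intro sum_mono lw)
    then show "ln (geom_mean w) \<le> ln (3 / 2 * r)" by (simp add: sum_distrib_right[symmetric] p_sum)
  qed
  have gp: "0 < geom_mean w" by (simp add: geom_mean_def)
  have K: "\<bar>q i \<bullet> y\<bar> \<le> 4" if i: "0 < p$i" for i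
  proof -
    have "norm (w$i) / sqrt (p$i) = geom_mean w * exp (q i \<bullet> y / 2)" using weight_coords_active[OF r1 i] i by simp
    then have e: "ln (norm (w$i) / sqrt (p$i)) = ln (geom_mean w) + q i \<bullet> y / 2" using gp by (simp add: ln_mult)
    have "ln (3 / 2 * r) - ln (r / 2) = ln 3" using r by (simp add: ln_mult ln_div)
    moreover have "ln 3 \<le> (2::real)" using ln_le_minus_one[of "3::real"] by simp
    ultimately show ?thesis using l[OF i] g e by linarith
  qed
  obtain m' y' where "weight_coords w (geom_mean w) m' y'" "norm y' \<le> 4 * sqrt (1 / mu1 + 1 / mu2)"
    by (rule log_weights_bounded[OF r1 K])
  moreover have "r / 2 \<le> geom_mean w" using g(1) r gp by simp
  ultimately show ?thesis using that by blast
qed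

lemma card_grid_ge:
  fixes e :: real
  assumes e: "0 < e"
  shows "1 / (4 * e) \<le> real (nat \<lceil>1 / (4 * e)\<rceil>)"
    and "l < nat \<lceil>1 / (4 * e)\<rceil> \<Longrightarrow> real l * e \<le> 1 / 4"
proof -
  show "1 / (4 * e) \<le> real (nat \<lceil>1 / (4 * e)\<rceil>)" by (simp add: real_nat_ceiling_ge)
  assume "l < nat \<lceil>1 / (4 * e)\<rceil>"
  then have "real l < 1 / (4 * e)" by (meson linorder_not_less nat_ceiling_le_eq)
  then have "real l * (4 * e) < 1" using e by (simp add: pos_less_divide_eq)
  then show "real l * e \<le> 1 / 4" by simp
qed

lemma cone_borel:
  assumes flow: "is_residual_flow (diag_mat lam) \<Phi>" and T: "0 \<le> T"
  shows "cone \<Phi> \<delta> T \<inter> cball 0 1 \<in> sets borel"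
  using open_cone[OF flow T] by (intro sets.Int) auto

lemma bounded_borel_fmeasurable: "A \<in> sets borel \<Longrightarrow> bounded A \<Longrightarrow> A \<in> fmeasurable (lborel :: (complex^'n) measure)"
  using emeasure_bounded_finite[of A] by (auto intro: fmeasurableI)

lemma bounded_shift: "bounded A \<Longrightarrow> bounded (shift a ` A)"
proof -
  assume "bounded A"
  then obtain b where b: "\<And>x. x \<in> A \<Longrightarrow> norm x \<le> b" by (auto simp: bounded_iff)
  have "norm (shift a x) \<le> exp (pf.B * norm a / 2) * b" if "x \<in> A" for x
    using norm_shift_le[of a x] mult_left_mono[OF b[OF that] exp_ge_zero, of "pf.B * norm a / 2"] by linarith
  then show ?thesis by (auto intro!: boundedI)
qed

lemma borel_shift: "A \<in> sets borel \<Longrightarrow> shift a ` A \<in> sets borel"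
  unfolding shift_def by (rule borel_diag_scale_image) auto

lemma borel_squeeze: "A \<in> sets borel \<Longrightarrow> squeeze T ` A \<in> sets borel"
  unfolding squeeze_def by (rule borel_diag_scale_image) auto

lemma kap_inner_pos: "inner k \<Longrightarrow> 0 < pf.kap k"
  using sq_less(2)[of k] by (simp add: pf.kap_def)

lemma norm_squeeze_le: "0 \<le> T \<Longrightarrow> norm (squeeze T w) \<le> norm w"
proof (rule power2_le_imp_le)
  assume T: "0 \<le> T"
  have "norm (squeeze T w $ j) \<le> norm (w$j)" for j
  proof (cases "inner j")
    case True
    then have "exp (- pf.kap j * T) \<le> 1" using kap_inner_pos[OF True] T by simp
    then show ?thesis using True mult_right_mono[of "exp (- pf.kap j * T)" 1 "norm (w$j)"]
      by (simp add: squeeze_def diag_scale_def)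
  qed (auto simp: squeeze_def diag_scale_def)
  then show "(norm (squeeze T w))\<^sup>2 \<le> (norm w)\<^sup>2"
    unfolding norm_vec_sq by (intro sum_mono power_mono) auto
qed auto

lemma cone_weight_coords:
  assumes w: "w \<in> cone \<Phi> \<delta> T"
  obtains g m y where "weight_coords w g m y" "pf.in_tube \<delta> m y"
  using w tube_iff[of w \<delta>] by (auto simp: cone_def stay_set_def near_torus_def)

text \<open>
  If the shifts of two points of the cone agree, the points have the same masses and their tilts differ by the difference of the
  shift vectors, to which \<open>staying_separation\<close> applies.
\<close>
lemma shifted_cones_disjoint:
  assumes flow: "is_residual_flow (diag_mat lam) \<Phi>" and T: "0 \<le> T" and \<delta>: "0 < \<delta>" "\<delta> \<le> pf.dU"
    and w: "w \<in> cone \<Phi> \<delta> T" "w' \<in> cone \<Phi> \<delta> T" and e: "shift a w = shift a' w'" and near: "norm (a' - a) \<le> 1"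
  shows "norm (a' - a) \<le> 6 * exp (- 8 * mu1 * T)"
    and "(a' - a) \<bullet> e1 = 0 \<Longrightarrow> norm (a' - a) \<le> 6 * exp (- 8 * mu2 * T)"
proof -
  obtain g m y0 where r': "weight_coords w' g m y0" using cone_weight_coords[OF w(2)] by blast
  have "w = shift (- a) (shift a w)" by (simp add: shift_add shift_0)
  also have "\<dots> = shift (a' - a) w'" unfolding e by (simp add: shift_add)
  finally have r: "weight_coords w g m (y0 + (a' - a))" using weight_coords_shift[OF r', of "a' - a"] by simp
  have m: "pf.mass_profile m" using r by (simp add: weight_coords_def)
  obtain y where y: "y 0 = y0 + (a' - a)" "pf.solution m y"
    "proj w \<in> stay_set \<Phi> (tube \<delta>) T \<longleftrightarrow> (\<forall>t. 0 \<le> t \<and> t \<le> T \<longrightarrow> pf.in_tube \<delta> (pf.evol m t) (y t))"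
    by (rule stay_set_weight_coords[OF flow r T, of \<delta>])
  obtain x where x: "x 0 = y0" "pf.solution m x"
    "proj w' \<in> stay_set \<Phi> (tube \<delta>) T \<longleftrightarrow> (\<forall>t. 0 \<le> t \<and> t \<le> T \<longrightarrow> pf.in_tube \<delta> (pf.evol m t) (x t))"
    by (rule stay_set_weight_coords[OF flow r' T, of \<delta>])
  have sy: "\<And>t. 0 \<le> t \<Longrightarrow> t \<le> T \<Longrightarrow> pf.in_tube \<delta> (pf.evol m t) (y t)" using y(3) w(1) by (auto simp: cone_def)
  have sx: "\<And>t. 0 \<le> t \<Longrightarrow> t \<le> T \<Longrightarrow> pf.in_tube \<delta> (pf.evol m t) (x t)" using x(3) w(2) by (auto simp: cone_def)
  have d: "y 0 - x 0 = a' - a" by (simp add: x y)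
  have n1: "norm (y 0 - x 0) \<le> 1" using near d by simp
  note ps = pf.staying_separation[OF m y(2) x(2) T \<delta> sy sx n1]
  show "norm (a' - a) \<le> 6 * exp (- 8 * mu1 * T)" using ps(1) unfolding d by blast
  show "(a' - a) \<bullet> e1 = 0 \<Longrightarrow> norm (a' - a) \<le> 6 * exp (- 8 * mu2 * T)" using ps(2) unfolding d by blast
qed

text \<open>
  At time \<open>T\<close> the inner mass is smaller than \<open>\<delta>\<^sup>2\<close> up to a tilt that has moved by at most one, and going back to time \<open>0\<close>
  multiplies it by \<open>exp (- 2 * kap k * T)\<close>. The scale is bounded because the active coordinate with index \<open>i0\<close> is at
  most one.
\<close>
lemma cone_in_box:
  assumes flow: "is_residual_flow (diag_mat lam) \<Phi>" and T: "0 \<le> T" and \<delta>: "0 < \<delta>" "\<delta> \<le> pf.dU"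
    and w: "w \<in> cone \<Phi> \<delta> T" "norm w \<le> 1" and k: "inner k"
  shows "norm (w$k) \<le> sqrt (exp 1 / p$i0 * (exp pf.B * \<delta>\<^sup>2)) * exp (- pf.kap k * T)"
proof -
  obtain g m y0 where r: "weight_coords w g m y0" and v: "pf.in_tube \<delta> m y0" by (rule cone_weight_coords[OF w(1)])
  have m: "pf.mass_profile m" using r by (simp add: weight_coords_def)
  obtain y where y: "y 0 = y0" "pf.solution m y"
    "proj w \<in> stay_set \<Phi> (tube \<delta>) T \<longleftrightarrow> (\<forall>t. 0 \<le> t \<and> t \<le> T \<longrightarrow> pf.in_tube \<delta> (pf.evol m t) (y t))"
    by (rule stay_set_weight_coords[OF flow r T, of \<delta>])
  have sy: "\<And>t. 0 \<le> t \<Longrightarrow> t \<le> T \<Longrightarrow> pf.in_tube \<delta> (pf.evol m t) (y t)" using y(3) w(1) by (auto simp: cone_def)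
  have disp: "norm (y T - y 0) \<le> 1" by (rule pf.staying_displacement[OF m y(2) T \<delta> sy])
  have kk: "p$k = 0" using k by simp
  have end': "pf.evol m T k * exp (q k \<bullet> y T) < \<delta>\<^sup>2"
    by (rule pf.in_tube_imp(3)[OF pf.mass_profile_evol[OF m] \<delta>(1) sy[OF T order_refl] kk])
  have "m k * exp (q k \<bullet> y0) = (pf.evol m T k * exp (q k \<bullet> y T)) * exp (q k \<bullet> (y 0 - y T)) * exp (- 2 * pf.kap k * T)"
    by (simp add: pf.evol_def y(1) inner_diff_right exp_diff exp_minus)
  also have "\<dots> \<le> \<delta>\<^sup>2 * exp pf.B * exp (- 2 * pf.kap k * T)"
  proof (intro mult_right_mono mult_mono)
    have "q k \<bullet> (y 0 - y T) \<le> pf.B * norm (y T - y 0)"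
      using pf.inner_q_le[of k "y 0 - y T"] by (simp add: norm_minus_commute)
    also have "\<dots> \<le> pf.B * 1" using disp pf.B by (intro mult_left_mono) auto
    finally show "exp (q k \<bullet> (y 0 - y T)) \<le> exp pf.B" by simp
  qed (use end' in auto)
  finally have mk: "m k * exp (q k \<bullet> y0) \<le> \<delta>\<^sup>2 * exp pf.B * exp (- 2 * pf.kap k * T)" .
  have g2: "g\<^sup>2 \<le> exp 1 / p$i0"
  proof -
    have "pf.Mnorm y0 \<le> 2 * \<delta>" by (rule pf.in_tube_imp(1)[OF m \<delta>(1) v])
    then have "pf.Mnorm y0 \<le> pf.N0" using \<delta> pf.dU pf.d0(2) by linarith
    then have "\<bar>q i0 \<bullet> y0\<bar> \<le> 1" using i0 by (intro pf.Mnorm_small_imp) auto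
    then have a: "exp (- 1) \<le> exp (q i0 \<bullet> y0)" by simp
    have "(norm (w$i0))\<^sup>2 = g\<^sup>2 * (p$i0 * exp (q i0 \<bullet> y0))" using r i0 by (simp add: weight_coords_def pf.mass_profile_def)
    moreover have "(norm (w$i0))\<^sup>2 \<le> 1"
      using order_trans[OF Finite_Cartesian_Product.norm_nth_le w(2), of i0] by (simp add: power_le_one)
    moreover have "g\<^sup>2 * (p$i0 * exp (- 1)) \<le> g\<^sup>2 * (p$i0 * exp (q i0 \<bullet> y0))"
      using a p_nonneg[of i0] by (intro mult_left_mono) auto
    ultimately have "g\<^sup>2 * (p$i0 * exp (- 1)) \<le> 1" by linarith
    then show ?thesis using i0 by (simp add: exp_minus field_simps)
  qed
  have "(norm (w$k))\<^sup>2 = g\<^sup>2 * (m k * exp (q k \<bullet> y0))" using r by (simp add: weight_coords_def)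
  also have "\<dots> \<le> exp 1 / p$i0 * (\<delta>\<^sup>2 * exp pf.B * exp (- 2 * pf.kap k * T))"
  proof (rule mult_mono[OF g2 mk])
    show "0 \<le> m k * exp (q k \<bullet> y0)" using m by (simp add: pf.mass_profile_def)
  qed (use i0 in simp)
  also have "exp (- 2 * pf.kap k * T) = (exp (- pf.kap k * T))\<^sup>2" by (simp add: exp_double[symmetric])
  also have "exp 1 / p$i0 * (\<delta>\<^sup>2 * exp pf.B * (exp (- pf.kap k * T))\<^sup>2)
      = (sqrt (exp 1 / p$i0 * (exp pf.B * \<delta>\<^sup>2)) * exp (- pf.kap k * T))\<^sup>2"
    using i0 by (simp add: power_mult_distrib mult_ac)
  finally show ?thesis by (rule power2_le_imp_le) (use i0 in simp)
qed

text \<open>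
  About \<open>exp ((8 * mu1 + 8 * mu2) * T)\<close> many shifts of the cone are disjoint, have comparable volumes, and fit into a squeezed ball.
  The vectors of the grid have mesh \<open>12 * exp (- 8 * mu1 * T)\<close> and \<open>12 * exp (- 8 * mu2 * T)\<close>, twice the bounds of the separation
  estimate: a difference in the first coordinate contradicts the first estimate, and a difference in the second coordinate
  alone contradicts the second.
\<close>
lemma volume_upper_bound:
  assumes flow: "is_residual_flow (diag_mat lam) \<Phi>" and \<delta>: "0 < \<delta>" "\<delta> \<le> pf.dU"
  shows "\<exists>K>0. \<forall>T\<ge>0. measure lborel (cone \<Phi> \<delta> T \<inter> cball 0 1) \<le> K * exp (- escape_exponent lam p * T)"
proof -
  define G where "G = sqrt (exp 1 / p$i0 * (exp pf.B * \<delta>\<^sup>2))"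
  define \<rho> where "\<rho> = real CARD('n) * (exp pf.B * (1 + G))"
  define V where "V = measure lborel (cball (0::complex^'n) \<rho>)"
  define c0 where "c0 = exp (- (real CARD('n) * pf.B))"
  \<comment> \<open>Here \<open>c0\<close> bounds the volume distortion of the shifts from below, and \<open>2304 = 16 * 12 * 12\<close> comes from the number of grid points.\<close>
  define K where "K = 2304 * V / c0"
  have G: "0 \<le> G" using i0 by (simp add: G_def)
  have \<rho>: "0 < \<rho>" using G by (simp add: \<rho>_def add_pos_nonneg)
  have V: "0 < V" unfolding V_def using \<rho> content_ball_pos[of \<rho> "0::complex^'n"] by (simp add: content_cball_conv_ball)
  have c0: "0 < c0" by (simp add: c0_def)
  have K: "0 < K" using V c0 by (simp add: K_def)
  have "measure lborel (cone \<Phi> \<delta> T \<inter> cball 0 1) \<le> K * exp (- escape_exponent lam p * T)" if T: "0 \<le> T" for T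
  proof -
    let ?A = "cone \<Phi> \<delta> T \<inter> cball 0 1"
    have A: "?A \<in> sets borel" by (rule cone_borel[OF flow T])
    define \<epsilon>1 where "\<epsilon>1 = 12 * exp (- 8 * mu1 * T)"
    define \<epsilon>2 where "\<epsilon>2 = 12 * exp (- 8 * mu2 * T)"
    have e: "0 < \<epsilon>1" "0 < \<epsilon>2" by (simp_all add: \<epsilon>1_def \<epsilon>2_def)
    define N1 where "N1 = nat \<lceil>1 / (4 * \<epsilon>1)\<rceil>"
    define N2 where "N2 = nat \<lceil>1 / (4 * \<epsilon>2)\<rceil>"
    define a where "a z = (real (fst z) * \<epsilon>1) *\<^sub>R e1 + (real (snd z) * \<epsilon>2) *\<^sub>R e2" for z :: "nat \<times> nat"
    define I where "I = {..<N1} \<times> {..<N2}"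
    have aI: "norm (a z) \<le> 1 / 2" "0 \<le> real (fst z) * \<epsilon>1 \<and> real (fst z) * \<epsilon>1 \<le> 1 / 4" "0 \<le> real (snd z) * \<epsilon>2 \<and> real (snd z) * \<epsilon>2 \<le> 1 / 4" if z: "z \<in> I" for z
    proof -
      show b1: "0 \<le> real (fst z) * \<epsilon>1 \<and> real (fst z) * \<epsilon>1 \<le> 1 / 4"
        using card_grid_ge(2)[OF e(1), of "fst z"] z e by (auto simp: I_def N1_def)
      show b2: "0 \<le> real (snd z) * \<epsilon>2 \<and> real (snd z) * \<epsilon>2 \<le> 1 / 4"
        using card_grid_ge(2)[OF e(2), of "snd z"] z e by (auto simp: I_def N2_def)
      have "norm (a z) \<le> \<bar>real (fst z) * \<epsilon>1\<bar> + \<bar>real (snd z) * \<epsilon>2\<bar>"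
        unfolding a_def by (rule order_trans[OF norm_triangle_ineq]) (simp add: pf.e_norm)
      then show "norm (a z) \<le> 1 / 2" using b1 b2 by linarith
    qed
    have dis: "disjoint_family_on (\<lambda>z. shift (a z) ` ?A) I"
      unfolding disjoint_family_on_def
    proof (intro ballI impI)
      fix z z' assume z: "z \<in> I" "z' \<in> I" "z \<noteq> z'"
      show "shift (a z) ` ?A \<inter> shift (a z') ` ?A = {}"
      proof (rule ccontr)
        assume "shift (a z) ` ?A \<inter> shift (a z') ` ?A \<noteq> {}"
        then obtain w w' where w: "w \<in> cone \<Phi> \<delta> T" "w' \<in> cone \<Phi> \<delta> T" "shift (a z) w = shift (a z') w'" by auto
        have near: "norm (a z' - a z) \<le> 1"
          using aI(1)[OF z(1)] aI(1)[OF z(2)] norm_triangle_ineq4[of "a z'" "a z"] by linarith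
        note sc = shifted_cones_disjoint[OF flow T \<delta> w near]
        have d: "a z' - a z = ((real (fst z') - real (fst z)) * \<epsilon>1) *\<^sub>R e1 + ((real (snd z') - real (snd z)) * \<epsilon>2) *\<^sub>R e2"
          by (simp add: a_def left_diff_distrib scaleR_diff_left)
        have co: "(a z' - a z) \<bullet> e1 = (real (fst z') - real (fst z)) * \<epsilon>1" "(a z' - a z) \<bullet> e2 = (real (snd z') - real (snd z)) * \<epsilon>2"
          unfolding d by (rule eigen_coords)+
        have le: "\<bar>(a z' - a z) \<bullet> e1\<bar> \<le> norm (a z' - a z)" "\<bar>(a z' - a z) \<bullet> e2\<bar> \<le> norm (a z' - a z)"
          using Cauchy_Schwarz_ineq2[of "a z' - a z" e1] Cauchy_Schwarz_ineq2[of "a z' - a z" e2] pf.e_norm by auto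
        have f: "fst z = fst z'"
        proof (rule ccontr)
          assume "fst z \<noteq> fst z'"
          then have "1 \<le> \<bar>real (fst z') - real (fst z)\<bar>" by linarith
          then have "1 * \<epsilon>1 \<le> \<bar>real (fst z') - real (fst z)\<bar> * \<epsilon>1" using e by (intro mult_right_mono) auto
          then have "\<epsilon>1 \<le> \<bar>(a z' - a z) \<bullet> e1\<bar>" unfolding co using e by (simp add: abs_mult)
          then have "\<epsilon>1 \<le> 6 * exp (- 8 * mu1 * T)" using le(1) sc(1) by linarith
          then show False by (simp add: \<epsilon>1_def)
        qed
        then have s: "snd z \<noteq> snd z'" using z(3) by (simp add: prod_eq_iff)
        then have "1 \<le> \<bar>real (snd z') - real (snd z)\<bar>" by linarith
        then have "1 * \<epsilon>2 \<le> \<bar>real (snd z') - real (snd z)\<bar> * \<epsilon>2" using e by (intro mult_right_mono) auto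
        then have "\<epsilon>2 \<le> \<bar>(a z' - a z) \<bullet> e2\<bar>" unfolding co using e by (simp add: abs_mult)
        moreover have "(a z' - a z) \<bullet> e1 = 0" unfolding co using f by simp
        ultimately have "\<epsilon>2 \<le> 6 * exp (- 8 * mu2 * T)" using le(2) sc(2) by linarith
        then show False by (simp add: \<epsilon>2_def)
      qed
    qed
    have box: "shift (a z) ` ?A \<subseteq> squeeze T ` cball 0 \<rho>" if z: "z \<in> I" for z
    proof
      fix x assume "x \<in> shift (a z) ` ?A"
      then obtain w where w: "w \<in> cone \<Phi> \<delta> T" "norm w \<le> 1" "x = shift (a z) w" by auto
      define v where "v = diag_scale (\<lambda>j. inverse (if inner j then exp (- pf.kap j * T) else 1)) x"
      have x: "x = squeeze T v"
        unfolding squeeze_def v_def by (rule diag_scale_inverse(2)[symmetric]) auto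
      have "norm (v$j) \<le> exp pf.B * (1 + G)" for j
      proof -
        have "pf.B * norm (a z) \<le> pf.B * (1/2)" using aI(1)[OF z] pf.B by (intro mult_left_mono) auto
        then have "exp (pf.B * norm (a z) / 2) \<le> exp pf.B" using pf.B(4) by (simp del: pf.B)
        then have xj: "norm (x$j) \<le> exp pf.B * norm (w$j)"
          unfolding w(3) using shift_component_le[of "a z" w j] mult_right_mono[of _ _ "norm (w$j)"] by (meson norm_ge_zero order_trans)
        show ?thesis
        proof (cases "inner j")
          case True
          have "norm (v$j) = exp (pf.kap j * T) * norm (x$j)"
            using True by (simp add: v_def diag_scale_def exp_minus)
          also have "\<dots> \<le> exp (pf.kap j * T) * (exp pf.B * (G * exp (- pf.kap j * T)))"
            unfolding G_def by (intro mult_left_mono order_trans[OF xj] cone_in_box[OF flow T \<delta> w(1,2) True]) auto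
          also have "\<dots> = exp pf.B * G" by (simp add: exp_minus)
          also have "\<dots> \<le> exp pf.B * (1 + G)" by simp
          finally show ?thesis .
        next
          case False
          have "norm (v$j) = norm (x$j)" unfolding v_def diag_scale_def vec_lambda_beta if_not_P[OF False] by simp
          also have "\<dots> \<le> exp pf.B * norm (w$j)" by (rule xj)
          also have "\<dots> \<le> exp pf.B * (1 + G)"
            using order_trans[OF Finite_Cartesian_Product.norm_nth_le w(2), of j] G by (intro mult_left_mono) auto
          finally show ?thesis .
        qed
      qed
      then have "norm v \<le> (\<Sum>j\<in>(UNIV :: 'n set). exp pf.B * (1 + G))"
        unfolding norm_vec_def by (intro order_trans[OF L2_set_le_sum] sum_mono) auto
      then have "v \<in> cball 0 \<rho>" by (simp add: \<rho>_def)
      then show "x \<in> squeeze T ` cball 0 \<rho>" using x by blast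
    qed
    have boxB: "squeeze T ` cball 0 \<rho> \<in> sets borel" by (rule borel_squeeze) simp
    have boxf: "squeeze T ` cball 0 \<rho> \<in> fmeasurable lborel"
    proof (rule bounded_borel_fmeasurable[OF boxB])
      show "bounded (squeeze T ` cball 0 \<rho>)"
      proof (rule boundedI[of _ \<rho>])
        fix x assume "x \<in> squeeze T ` cball 0 \<rho>"
        then obtain v where "norm v \<le> \<rho>" "x = squeeze T v" by auto
        then show "norm x \<le> \<rho>" using norm_squeeze_le[OF T, of v] by simp
      qed
    qed
    have bA: "bounded ?A" by (rule bounded_subset[OF bounded_cball]) auto
    have fm: "shift b ` ?A \<in> fmeasurable lborel" for b
      by (intro bounded_borel_fmeasurable borel_shift A bounded_shift bA)
    have fin: "finite I" by (simp add: I_def)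
    have "real (card I) * (c0 * measure lborel ?A) \<le> (\<Sum>z\<in>I. measure lborel (shift (a z) ` ?A))"
    proof -
      have "c0 * measure lborel ?A \<le> measure lborel (shift (a z) ` ?A)" if z: "z \<in> I" for z
      proof -
        have "real CARD('n) * (pf.B * norm (a z)) \<le> real CARD('n) * (pf.B * 1)"
          using aI(1)[OF z] pf.B by (intro mult_left_mono) auto
        then have "- (real CARD('n) * pf.B) \<le> (\<Sum>j\<in>UNIV. q j \<bullet> a z)"
          using sum_inner_bound[of "a z"] unfolding mult_1_right by linarith
        then have "c0 \<le> exp (\<Sum>j\<in>UNIV. q j \<bullet> a z)" unfolding c0_def by (simp only: exp_le_cancel_iff)
        then show ?thesis unfolding measure_shift[OF A] by (intro mult_right_mono) auto
      qed
      then have "(\<Sum>z\<in>I. c0 * measure lborel ?A) \<le> (\<Sum>z\<in>I. measure lborel (shift (a z) ` ?A))" by (rule sum_mono)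
      then show ?thesis by simp
    qed
    also have "\<dots> = measure lborel (\<Union>z\<in>I. shift (a z) ` ?A)"
    proof (intro measure_finite_Union[symmetric] fin dis)
      show "(\<lambda>z. shift (a z) ` ?A) ` I \<subseteq> sets lborel" using fmeasurableD[OF fm] by blast
      fix z show "emeasure lborel (shift (a z) ` ?A) \<noteq> \<infinity>" using fm[of "a z"] by (auto simp: fmeasurable_def)
    qed
    also have "\<dots> \<le> measure lborel (squeeze T ` cball 0 \<rho>)"
    proof (rule measure_mono_fmeasurable[OF _ _ boxf])
      show "(\<Union>z\<in>I. shift (a z) ` ?A) \<subseteq> squeeze T ` cball 0 \<rho>" using box by (rule UN_least)
      show "(\<Union>z\<in>I. shift (a z) ` ?A) \<in> sets lborel"
        by (intro sets.finite_UN fin fmeasurableD[OF fm])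
    qed
    also have "\<dots> = exp (- (\<Sum>k\<in>{k. inner k}. 2 * pf.kap k) * T) * V"
      unfolding V_def by (rule measure_squeeze) simp
    finally have main: "real (card I) * (c0 * measure lborel ?A) \<le> exp (- (\<Sum>k\<in>{k. inner k}. 2 * pf.kap k) * T) * V" .
    have "1 / (4 * \<epsilon>1) * (1 / (4 * \<epsilon>2)) \<le> real N1 * real N2"
      unfolding N1_def N2_def
      by (rule mult_mono[OF card_grid_ge(1)[OF e(1)] card_grid_ge(1)[OF e(2)] of_nat_0_le_iff]) (use e in simp)
    then have "1 / (16 * \<epsilon>1 * \<epsilon>2) \<le> real (card I)" by (simp add: I_def)
    then have "1 / (16 * \<epsilon>1 * \<epsilon>2) * (c0 * measure lborel ?A) \<le> real (card I) * (c0 * measure lborel ?A)"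
      using c0 by (intro mult_right_mono) auto
    then have "1 / (16 * \<epsilon>1 * \<epsilon>2) * (c0 * measure lborel ?A) \<le> exp (- (\<Sum>k\<in>{k. inner k}. 2 * pf.kap k) * T) * V"
      using main by linarith
    then have "measure lborel ?A \<le> 16 * \<epsilon>1 * \<epsilon>2 * (exp (- (\<Sum>k\<in>{k. inner k}. 2 * pf.kap k) * T) * V) / c0"
      using e c0 by (simp add: field_simps)
    also have "\<dots> = K * (exp (- 8 * mu1 * T) * exp (- 8 * mu2 * T) * exp (- (\<Sum>k\<in>{k. inner k}. 2 * pf.kap k) * T))"
      by (simp add: K_def \<epsilon>1_def \<epsilon>2_def)
    also have "exp (- 8 * mu1 * T) * exp (- 8 * mu2 * T) * exp (- (\<Sum>k\<in>{k. inner k}. 2 * pf.kap k) * T) = exp (- escape_exponent lam p * T)"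
      unfolding escape_exponent_eq exp_add[symmetric] by (simp add: algebra_simps)
    finally show ?thesis .
  qed
  then show ?thesis using K by blast
qed

end

section \<open>The lower bound and the rate\<close>

lemma exponential_rate:
  fixes f :: "real \<Rightarrow> real"
  assumes K: "0 < K1" "0 < K2"
    and b: "\<And>T. T0 \<le> T \<Longrightarrow> K1 * exp (- g * T) \<le> f T \<and> f T \<le> K2 * exp (- g * T)"
  shows "((\<lambda>T. ln (f T) / T) \<longlongrightarrow> - g) at_top"
proof -
  have lim: "((\<lambda>T. ln K / T - g) \<longlongrightarrow> - g) at_top" for K :: real
  proof -
    have "((\<lambda>T. ln K / T) \<longlongrightarrow> 0) at_top"
      by (intro tendsto_divide_0[OF tendsto_const] filterlim_at_top_imp_at_infinity filterlim_ident)
    from tendsto_diff[OF this tendsto_const[of g]] show ?thesis by simp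
  qed
  have ev: "\<forall>\<^sub>F T in at_top. ln K1 / T - g \<le> ln (f T) / T \<and> ln (f T) / T \<le> ln K2 / T - g"
    using eventually_ge_at_top[of "max 1 T0"]
  proof eventually_elim
    case (elim T)
    then have T: "0 < T" "T0 \<le> T" by auto
    have p: "0 < K1 * exp (- g * T)" using K by simp
    have "ln (K1 * exp (- g * T)) \<le> ln (f T)" "ln (f T) \<le> ln (K2 * exp (- g * T))"
      using b[OF T(2)] p by (auto intro!: ln_mono)
    then have l: "ln K1 - g * T \<le> ln (f T)" "ln (f T) \<le> ln K2 - g * T"
      using K by (simp_all add: ln_mult)
    have "(ln K1 - g * T) / T \<le> ln (f T) / T" "ln (f T) / T \<le> (ln K2 - g * T) / T"
      using l T by (intro divide_right_mono; simp)+
    then show ?case using T by (simp add: diff_divide_distrib)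
  qed
  show ?thesis
    by (rule tendsto_sandwich[OF _ _ lim[of K1] lim[of K2]]) (use ev in \<open>auto elim: eventually_mono\<close>)
qed

lemma card_int_grid:
  fixes A e :: real
  assumes e: "0 < e" "e \<le> A"
  shows "real (card {- \<lfloor>A / e\<rfloor>..\<lfloor>A / e\<rfloor>}) \<le> 3 * A / e"
    and "l \<in> {- \<lfloor>A / e\<rfloor>..\<lfloor>A / e\<rfloor>} \<longleftrightarrow> \<bar>real_of_int l\<bar> * e \<le> A"
proof -
  have a: "1 \<le> A / e" using e by simp
  then have "0 \<le> \<lfloor>A / e\<rfloor>" by simp
  then have "real (card {- \<lfloor>A / e\<rfloor>..\<lfloor>A / e\<rfloor>}) = 2 * real_of_int \<lfloor>A / e\<rfloor> + 1" by simp
  also have "\<dots> \<le> 2 * (A / e) + A / e" using a by (intro add_mono mult_left_mono) auto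
  finally show "real (card {- \<lfloor>A / e\<rfloor>..\<lfloor>A / e\<rfloor>}) \<le> 3 * A / e" by simp
  have "l \<in> {- \<lfloor>A / e\<rfloor>..\<lfloor>A / e\<rfloor>} \<longleftrightarrow> real_of_int l \<le> A / e \<and> real_of_int (- l) \<le> A / e"
    unfolding le_floor_iff[symmetric] by auto
  also have "\<dots> \<longleftrightarrow> \<bar>real_of_int l\<bar> \<le> A / e" by auto
  also have "\<dots> \<longleftrightarrow> \<bar>real_of_int l\<bar> * e \<le> A" using e by (simp add: pos_le_divide_eq)
  finally show "l \<in> {- \<lfloor>A / e\<rfloor>..\<lfloor>A / e\<rfloor>} \<longleftrightarrow> \<bar>real_of_int l\<bar> * e \<le> A" .
qed

lemma grid_point_between:
  fixes y \<alpha> e :: real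
  assumes e: "0 < e"
  obtains l :: int where "\<alpha> \<le> y + real_of_int l * e" "y + real_of_int l * e \<le> \<alpha> + e"
    "\<bar>real_of_int l\<bar> * e \<le> \<bar>\<alpha> - y\<bar> + e"
proof -
  define l where "l = \<lceil>(\<alpha> - y) / e\<rceil>"
  have "(\<alpha> - y) / e \<le> real_of_int l" "real_of_int l \<le> (\<alpha> - y) / e + 1"
    unfolding l_def by (auto simp: of_int_ceiling_le_add_one)
  then have "(\<alpha> - y) / e \<le> real_of_int l" "real_of_int l - 1 \<le> (\<alpha> - y) / e" by linarith+
  then have "\<alpha> - y \<le> real_of_int l * e" "(real_of_int l - 1) * e \<le> \<alpha> - y"
    unfolding pos_divide_le_eq[OF e] pos_le_divide_eq[OF e] .
  then have a: "\<alpha> - y \<le> real_of_int l * e" "real_of_int l * e \<le> \<alpha> - y + e"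
    by (simp_all add: left_diff_distrib)
  then have "\<bar>real_of_int l * e\<bar> \<le> \<bar>\<alpha> - y\<bar> + e" using e by linarith
  then have "\<bar>real_of_int l\<bar> * e \<le> \<bar>\<alpha> - y\<bar> + e" using e by (simp add: abs_mult)
  then show ?thesis using a that[of l] by linarith
qed

context morse_bott_flow
begin

lemma N0_le_sqrt: "0 < p$i \<Longrightarrow> pf.N0 \<le> sqrt (p$i)"
  unfolding pf.N0_def by (intro min.coboundedI2 real_sqrt_le_mono Min_le) auto

text \<open>
  A point of a squeezed small ball around a multiple of a torus point has small inner masses at time \<open>T\<close> and small
  outer masses at time \<open>0\<close>. So the initial tilts for which it would stay contain an interval as long as the mesh in each
  coordinate, and a shift by a grid vector moves its tilt there. Hence the squeezed ball is covered by at most a multiple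
  of \<open>exp ((8 * mu1 + 8 * mu2) * T)\<close> shifts of the cone, all of comparable volume.
\<close>
lemma volume_lower_bound:
  assumes flow: "is_residual_flow (diag_mat lam) \<Phi>" and \<delta>: "0 < \<delta>"
  shows "\<exists>K>0. \<forall>T\<ge>0. K * exp (- escape_exponent lam p * T) \<le> measure lborel (cone \<Phi> \<delta> T \<inter> cball 0 1)"
proof -
  obtain d where d: "0 < d" and siv: "\<And>T m. 0 \<le> T \<Longrightarrow> pf.mass_profile m \<Longrightarrow>
      (\<And>k. inner k \<Longrightarrow> pf.evol m T k \<le> d\<^sup>2) \<Longrightarrow> (\<And>k. outer k \<Longrightarrow> m k \<le> d\<^sup>2) \<Longrightarrow>
      (\<exists>\<alpha>. \<bar>\<alpha>\<bar> \<le> 1 \<and> (\<forall>a1. \<alpha> \<le> a1 \<and> a1 \<le> \<alpha> + d / 2 * exp (- 8 * mu1 * T) \<longrightarrow>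
        (\<exists>\<beta>. \<bar>\<beta>\<bar> \<le> 1 \<and> (\<forall>a2. \<beta> \<le> a2 \<and> a2 \<le> \<beta> + d / 2 * exp (- 8 * mu2 * T) \<longrightarrow>
          (\<forall>x. pf.solution m x \<longrightarrow> x 0 = a1 *\<^sub>R e1 + a2 *\<^sub>R e2 \<longrightarrow>
            (\<forall>t. 0 \<le> t \<and> t \<le> T \<longrightarrow> pf.in_tube \<delta> (pf.evol m t) (x t)))))))"
    using pf.staying_initial_values[OF \<delta>] terminal_solution_exists[OF flow] by metis
  define Y where "Y = 4 * sqrt (1 / mu1 + 1 / mu2)"
  define Am where "Am = 1 + Y + d"
  \<comment> \<open>The center of the ball has norm \<open>\<tau>\<close>, so small that the shifted points do not leave the unit ball. The radius \<open>\<eta>\<close> keeps the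
    active moduli between half and three halves of those of the center and makes the inactive masses at most \<open>d\<^sup>2\<close>. All grid
    coordinates that occur are bounded by \<open>Am\<close>.\<close>
  define \<tau> where "\<tau> = exp (- (pf.B * Am)) / 2"
  define \<eta> where "\<eta> = min (\<tau> * pf.N0 / 2) (d * \<tau> / 2 * exp (- (pf.B * Y) / 2))"
  define c :: "complex^'n" where "c = \<tau> *\<^sub>R torus_point p 0"
  define V where "V = measure lborel (ball c \<eta>)"
  define C0 where "C0 = exp (real CARD('n) * (pf.B * (2 * Am)))"
  define K where "K = V * d\<^sup>2 / (36 * Am\<^sup>2 * C0)"
  have Y: "0 \<le> Y" unfolding Y_def using pf.mu_nonneg pf.mu_le by auto
  have Am: "0 < Am" using Y d by (simp add: Am_def)
  have \<tau>: "0 < \<tau>" by (simp add: \<tau>_def)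
  have \<eta>: "0 < \<eta>" using \<tau> d pf.N0(1) by (simp add: \<eta>_def)
  have \<eta>\<tau>: "\<eta> \<le> \<tau>"
  proof -
    have "\<eta> \<le> \<tau> * pf.N0 / 2" by (simp add: \<eta>_def)
    also have "\<dots> \<le> \<tau> * 1" using pf.N0 \<tau> by (simp add: mult_left_le)
    finally show ?thesis by simp
  qed
  have \<eta>d: "\<eta>\<^sup>2 * exp (pf.B * Y) * (4 / \<tau>\<^sup>2) \<le> d\<^sup>2"
  proof -
    have "\<eta> \<le> d * \<tau> / 2 * exp (- (pf.B * Y) / 2)" by (simp add: \<eta>_def)
    then have "\<eta>\<^sup>2 \<le> (d * \<tau> / 2 * exp (- (pf.B * Y) / 2))\<^sup>2" using \<eta> by (intro power_mono) auto
    also have "\<dots> = d\<^sup>2 * \<tau>\<^sup>2 / 4 * exp (- (pf.B * Y))"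
      by (simp add: power_mult_distrib power_divide exp_double[symmetric])
    finally have "\<eta>\<^sup>2 * (exp (pf.B * Y) * (4 / \<tau>\<^sup>2)) \<le> (d\<^sup>2 * \<tau>\<^sup>2 / 4 * exp (- (pf.B * Y))) * (exp (pf.B * Y) * (4 / \<tau>\<^sup>2))"
      by (rule mult_right_mono) simp
    also have "\<dots> = d\<^sup>2" using \<tau> by (simp add: exp_minus)
    finally show ?thesis by (simp add: mult.assoc)
  qed
  have V: "0 < V" unfolding V_def using content_ball_pos[OF \<eta>, of c] by simp
  have C0: "0 < C0" by (simp add: C0_def)
  have K: "0 < K" using V C0 Am d by (simp add: K_def)
  have cover: "\<exists>l1 l2 :: int. \<bar>real_of_int l1\<bar> * (d / 2 * exp (- 8 * mu1 * T)) \<le> Am \<and> \<bar>real_of_int l2\<bar> * (d / 2 * exp (- 8 * mu2 * T)) \<le> Am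
      \<and> shift ((real_of_int l1 * (d / 2 * exp (- 8 * mu1 * T))) *\<^sub>R e1 + (real_of_int l2 * (d / 2 * exp (- 8 * mu2 * T))) *\<^sub>R e2) (squeeze T v) \<in> cone \<Phi> \<delta> T \<inter> cball 0 1"
    if T: "0 \<le> T" and v: "v \<in> ball c \<eta>" for T v
  proof -
    define \<epsilon>1 where "\<epsilon>1 = d / 2 * exp (- 8 * mu1 * T)"
    define \<epsilon>2 where "\<epsilon>2 = d / 2 * exp (- 8 * mu2 * T)"
    have mu: "0 \<le> mu1" "0 \<le> mu2" using pf.mu_nonneg pf.mu_le by auto
    have e: "0 < \<epsilon>1" "0 < \<epsilon>2" using d by (simp_all add: \<epsilon>1_def \<epsilon>2_def)
    have "exp (- 8 * mu1 * T) \<le> 1" "exp (- 8 * mu2 * T) \<le> 1" using mu T by simp_all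
    then have "d / 2 * exp (- 8 * mu1 * T) \<le> d / 2 * 1" "d / 2 * exp (- 8 * mu2 * T) \<le> d / 2 * 1"
      using d by (intro mult_left_mono; simp)+
    then have ed: "\<epsilon>1 \<le> d" "\<epsilon>2 \<le> d" using d unfolding \<epsilon>1_def \<epsilon>2_def by linarith+
    define w where "w = squeeze T v"
    have vc: "norm (v$i - c$i) < \<eta>" for i
    proof -
      have "norm ((v - c)$i) \<le> norm (v - c)" by (rule Finite_Cartesian_Product.norm_nth_le)
      then show ?thesis using v by (simp add: dist_norm norm_minus_commute)
    qed
    have "\<tau> / 2 \<le> norm (w$i) / sqrt (p$i) \<and> norm (w$i) / sqrt (p$i) \<le> 3 / 2 * \<tau>" if i: "0 < p$i" for i
    proof -
      have wi: "w$i = v$i" using i by (simp add: w_def squeeze_def diag_scale_def)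
      have ci: "norm (c$i) = \<tau> * sqrt (p$i)" using \<tau> i by (simp add: c_def torus_point_def norm_mult)
      have "\<eta> \<le> \<tau> * pf.N0 / 2" by (simp add: \<eta>_def)
      also have "\<dots> \<le> \<tau> * sqrt (p$i) / 2" using N0_le_sqrt[OF i] \<tau> by simp
      finally have "\<bar>norm (v$i) - \<tau> * sqrt (p$i)\<bar> \<le> \<tau> * sqrt (p$i) / 2"
        using norm_triangle_ineq3[of "v$i" "c$i"] vc[of i] unfolding ci by linarith
      then have "\<tau> * sqrt (p$i) / 2 \<le> norm (v$i)" "norm (v$i) \<le> 3 / 2 * (\<tau> * sqrt (p$i))"
        by linarith+
      then have "\<tau> / 2 * sqrt (p$i) \<le> norm (w$i)" "norm (w$i) \<le> 3 / 2 * \<tau> * sqrt (p$i)"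
        unfolding wi by simp_all
      then show ?thesis using i by (simp add: pos_le_divide_eq pos_divide_le_eq)
    qed
    then obtain g m y0 where r: "weight_coords w g m y0" and g: "\<tau> / 2 \<le> g" and y0: "norm y0 \<le> Y"
      using weight_coords_near_torus[OF \<tau>, of w] unfolding Y_def by blast
    have m: "pf.mass_profile m" using r by (simp add: weight_coords_def)
    have mass: "m k * s \<le> d\<^sup>2" if k: "p$k = 0" and s: "(norm (w$k))\<^sup>2 * s = (norm (v$k))\<^sup>2" for k s
    proof -
      have gg: "0 < g\<^sup>2" using g \<tau> by auto
      have "g\<^sup>2 * (m k * exp (q k \<bullet> y0)) = (norm (w$k))\<^sup>2" using r by (simp add: weight_coords_def)
      then have "g\<^sup>2 * (m k * s * exp (q k \<bullet> y0)) = (norm (v$k))\<^sup>2" using s by (metis mult.assoc mult.commute)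
      then have "m k * s = (norm (v$k))\<^sup>2 * exp (- (q k \<bullet> y0)) * (1 / g\<^sup>2)"
        using gg by (simp add: exp_minus field_simps)
      also have "\<dots> \<le> \<eta>\<^sup>2 * exp (pf.B * Y) * (4 / \<tau>\<^sup>2)"
      proof (intro mult_mono)
        have "c$k = 0" using k by (simp add: c_def torus_point_def)
        then show "(norm (v$k))\<^sup>2 \<le> \<eta>\<^sup>2" using vc[of k] by (intro power_mono) auto
        have "- (q k \<bullet> y0) \<le> pf.B * norm y0" using pf.inner_q_le[of k y0] by linarith
        also have "\<dots> \<le> pf.B * Y" using y0 pf.B by (intro mult_left_mono) auto
        finally show "exp (- (q k \<bullet> y0)) \<le> exp (pf.B * Y)" by simp
        have "(\<tau> / 2)\<^sup>2 \<le> g\<^sup>2" using g \<tau> by (intro power_mono) auto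
        then have "1 / g\<^sup>2 \<le> 1 / (\<tau> / 2)\<^sup>2" using \<tau> gg by (intro divide_left_mono mult_pos_pos) auto
        then show "1 / g\<^sup>2 \<le> 4 / \<tau>\<^sup>2" by (simp add: power_divide)
      qed auto
      finally show ?thesis using \<eta>d by linarith
    qed
    have mi: "pf.evol m T k \<le> d\<^sup>2" if k: "inner k" for k
      unfolding pf.evol_def
    proof (rule mass)
      show "p$k = 0" using k by simp
      have "norm (w$k) = exp (- pf.kap k * T) * norm (v$k)" using k by (simp add: w_def squeeze_def diag_scale_def)
      then have "(norm (w$k))\<^sup>2 * exp (2 * pf.kap k * T) = (exp (- pf.kap k * T))\<^sup>2 * exp (2 * pf.kap k * T) * (norm (v$k))\<^sup>2"
        by (simp add: power_mult_distrib)
      also have "(exp (- pf.kap k * T))\<^sup>2 * exp (2 * pf.kap k * T) = 1" by (simp add: exp_double[symmetric] exp_add[symmetric])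
      finally show "(norm (w$k))\<^sup>2 * exp (2 * pf.kap k * T) = (norm (v$k))\<^sup>2" by simp
    qed
    have mo: "m k \<le> d\<^sup>2" if k: "outer k" for k
      using mass[of k 1] k by (simp add: w_def squeeze_def diag_scale_def)
    obtain \<alpha> where \<alpha>: "\<bar>\<alpha>\<bar> \<le> 1" and \<alpha>': "\<And>a1. \<alpha> \<le> a1 \<Longrightarrow> a1 \<le> \<alpha> + \<epsilon>1 \<Longrightarrow>
        (\<exists>\<beta>. \<bar>\<beta>\<bar> \<le> 1 \<and> (\<forall>a2. \<beta> \<le> a2 \<and> a2 \<le> \<beta> + \<epsilon>2 \<longrightarrow>
          (\<forall>x. pf.solution m x \<longrightarrow> x 0 = a1 *\<^sub>R e1 + a2 *\<^sub>R e2 \<longrightarrow>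
            (\<forall>t. 0 \<le> t \<and> t \<le> T \<longrightarrow> pf.in_tube \<delta> (pf.evol m t) (x t)))))"
      using siv[OF T m mi mo] unfolding \<epsilon>1_def \<epsilon>2_def by blast
    have yc: "\<bar>y0 \<bullet> e1\<bar> \<le> Y" "\<bar>y0 \<bullet> e2\<bar> \<le> Y"
      using Cauchy_Schwarz_ineq2[of y0 e1] Cauchy_Schwarz_ineq2[of y0 e2] pf.e_norm y0 by auto
    obtain l1 where l1: "\<alpha> \<le> y0 \<bullet> e1 + real_of_int l1 * \<epsilon>1" "y0 \<bullet> e1 + real_of_int l1 * \<epsilon>1 \<le> \<alpha> + \<epsilon>1"
      "\<bar>real_of_int l1\<bar> * \<epsilon>1 \<le> \<bar>\<alpha> - y0 \<bullet> e1\<bar> + \<epsilon>1"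
      by (rule grid_point_between[OF e(1)])
    obtain \<beta> where \<beta>: "\<bar>\<beta>\<bar> \<le> 1" and \<beta>': "\<And>a2 x t. \<beta> \<le> a2 \<Longrightarrow> a2 \<le> \<beta> + \<epsilon>2 \<Longrightarrow> pf.solution m x \<Longrightarrow>
        x 0 = (y0 \<bullet> e1 + real_of_int l1 * \<epsilon>1) *\<^sub>R e1 + a2 *\<^sub>R e2 \<Longrightarrow> 0 \<le> t \<Longrightarrow> t \<le> T \<Longrightarrow> pf.in_tube \<delta> (pf.evol m t) (x t)"
      using \<alpha>'[OF l1(1,2)] by blast
    obtain l2 where l2: "\<beta> \<le> y0 \<bullet> e2 + real_of_int l2 * \<epsilon>2" "y0 \<bullet> e2 + real_of_int l2 * \<epsilon>2 \<le> \<beta> + \<epsilon>2"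
      "\<bar>real_of_int l2\<bar> * \<epsilon>2 \<le> \<bar>\<beta> - y0 \<bullet> e2\<bar> + \<epsilon>2"
      by (rule grid_point_between[OF e(2)])
    have n: "\<bar>real_of_int l1\<bar> * \<epsilon>1 \<le> Am" "\<bar>real_of_int l2\<bar> * \<epsilon>2 \<le> Am"
      using l1(3) l2(3) \<alpha> \<beta> yc ed unfolding Am_def by linarith+
    define b where "b = (real_of_int l1 * \<epsilon>1) *\<^sub>R e1 + (real_of_int l2 * \<epsilon>2) *\<^sub>R e2"
    have nb: "norm b \<le> 2 * Am"
    proof -
      have "norm b \<le> \<bar>real_of_int l1 * \<epsilon>1\<bar> + \<bar>real_of_int l2 * \<epsilon>2\<bar>"
        unfolding b_def by (rule order_trans[OF norm_triangle_ineq]) (simp add: pf.e_norm)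
      then show ?thesis using n e by (simp add: abs_mult)
    qed
    have rb: "weight_coords (shift b w) g m (y0 + b)" by (rule weight_coords_shift[OF r])
    obtain x where x: "x 0 = y0 + b" "pf.solution m x"
      "proj (shift b w) \<in> stay_set \<Phi> (tube \<delta>) T \<longleftrightarrow> (\<forall>t. 0 \<le> t \<and> t \<le> T \<longrightarrow> pf.in_tube \<delta> (pf.evol m t) (x t))"
      by (rule stay_set_weight_coords[OF flow rb T, of \<delta>])
    have "x 0 = ((y0 \<bullet> e1) *\<^sub>R e1 + (y0 \<bullet> e2) *\<^sub>R e2) + b"
      unfolding x(1) by (simp only: pf.eigen_expansion[symmetric])
    then have "x 0 = (y0 \<bullet> e1 + real_of_int l1 * \<epsilon>1) *\<^sub>R e1 + (y0 \<bullet> e2 + real_of_int l2 * \<epsilon>2) *\<^sub>R e2"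
      by (simp add: b_def scaleR_add_left)
    then have "proj (shift b w) \<in> stay_set \<Phi> (tube \<delta>) T"
      using \<beta>'[OF l2(1,2) x(2)] x(3) by blast
    then have co: "shift b w \<in> cone \<Phi> \<delta> T" using weight_coords_nonzero[OF rb] by (simp add: cone_def)
    have "norm (shift b w) \<le> exp (pf.B * norm b / 2) * norm w" by (rule norm_shift_le)
    also have "\<dots> \<le> exp (pf.B * Am) * (2 * \<tau>)"
    proof (intro mult_mono)
      have "pf.B * norm b \<le> pf.B * (2 * Am)" using nb pf.B by (intro mult_left_mono) auto
      then show "exp (pf.B * norm b / 2) \<le> exp (pf.B * Am)" by simp
      have "norm w \<le> norm v" unfolding w_def by (rule norm_squeeze_le[OF T])
      also have "\<dots> \<le> norm c + norm (v - c)" using norm_triangle_ineq[of c "v - c"] by simp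
      also have "\<dots> \<le> \<tau> + \<eta>"
        using v \<tau> lift_norm[OF torus_point_lift, of 0] by (simp add: c_def dist_norm norm_minus_commute)
      finally show "norm w \<le> 2 * \<tau>" using \<eta>\<tau> by simp
    qed auto
    also have "\<dots> = 1" by (simp add: \<tau>_def exp_minus)
    finally show ?thesis using n co unfolding b_def w_def \<epsilon>1_def \<epsilon>2_def by auto
  qed
  have "K * exp (- escape_exponent lam p * T) \<le> measure lborel (cone \<Phi> \<delta> T \<inter> cball 0 1)" if T: "0 \<le> T" for T
  proof -
    let ?A = "cone \<Phi> \<delta> T \<inter> cball 0 1"
    have A: "?A \<in> sets borel" by (rule cone_borel[OF flow T])
    have bA: "bounded ?A" by (rule bounded_subset[OF bounded_cball]) auto
    define \<epsilon>1 where "\<epsilon>1 = d / 2 * exp (- 8 * mu1 * T)"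
    define \<epsilon>2 where "\<epsilon>2 = d / 2 * exp (- 8 * mu2 * T)"
    have mu: "0 \<le> mu1" "0 \<le> mu2" using pf.mu_nonneg pf.mu_le by auto
    have e: "0 < \<epsilon>1" "0 < \<epsilon>2" using d by (simp_all add: \<epsilon>1_def \<epsilon>2_def)
    have "exp (- 8 * mu1 * T) \<le> 1" "exp (- 8 * mu2 * T) \<le> 1" using mu T by simp_all
    then have "d / 2 * exp (- 8 * mu1 * T) \<le> d / 2 * 1" "d / 2 * exp (- 8 * mu2 * T) \<le> d / 2 * 1"
      using d by (intro mult_left_mono; simp)+
    then have eA: "\<epsilon>1 \<le> Am" "\<epsilon>2 \<le> Am" using d Y unfolding \<epsilon>1_def \<epsilon>2_def Am_def by linarith+
    define I where "I = {- \<lfloor>Am / \<epsilon>1\<rfloor>..\<lfloor>Am / \<epsilon>1\<rfloor>} \<times> {- \<lfloor>Am / \<epsilon>2\<rfloor>..\<lfloor>Am / \<epsilon>2\<rfloor>}"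
    define b where "b z = (real_of_int (fst z) * \<epsilon>1) *\<^sub>R e1 + (real_of_int (snd z) * \<epsilon>2) *\<^sub>R e2" for z :: "int \<times> int"
    have fin: "finite I" by (simp add: I_def)
    have mem: "z \<in> I \<longleftrightarrow> \<bar>real_of_int (fst z)\<bar> * \<epsilon>1 \<le> Am \<and> \<bar>real_of_int (snd z)\<bar> * \<epsilon>2 \<le> Am" for z
      unfolding I_def mem_Times_iff card_int_grid(2)[OF e(1) eA(1)] card_int_grid(2)[OF e(2) eA(2)] ..
    have sub: "squeeze T ` ball c \<eta> \<subseteq> (\<Union>z\<in>I. shift (- b z) ` ?A)"
    proof
      fix x assume "x \<in> squeeze T ` ball c \<eta>"
      then obtain v where v: "v \<in> ball c \<eta>" "x = squeeze T v" by auto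
      obtain l1 l2 :: int where l: "\<bar>real_of_int l1\<bar> * \<epsilon>1 \<le> Am" "\<bar>real_of_int l2\<bar> * \<epsilon>2 \<le> Am"
        "shift ((real_of_int l1 * \<epsilon>1) *\<^sub>R e1 + (real_of_int l2 * \<epsilon>2) *\<^sub>R e2) (squeeze T v) \<in> ?A"
        using cover[OF T v(1)] unfolding \<epsilon>1_def \<epsilon>2_def by blast
      have "(l1, l2) \<in> I" using l by (simp add: mem)
      moreover have "shift (b (l1, l2)) x \<in> ?A" using l(3) v(2) by (simp add: b_def)
      moreover have "x = shift (- b (l1, l2)) (shift (b (l1, l2)) x)" by (simp add: shift_add shift_0)
      ultimately show "x \<in> (\<Union>z\<in>I. shift (- b z) ` ?A)" by blast
    qed
    have fm: "shift a ` ?A \<in> fmeasurable lborel" for a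
      by (intro bounded_borel_fmeasurable borel_shift A bounded_shift bA)
    have "exp (- (\<Sum>k\<in>{k. inner k}. 2 * pf.kap k) * T) * V = measure lborel (squeeze T ` ball c \<eta>)"
      unfolding V_def by (rule measure_squeeze[symmetric]) simp
    also have "\<dots> \<le> measure lborel (\<Union>z\<in>I. shift (- b z) ` ?A)"
    proof (rule measure_mono_fmeasurable[OF sub])
      show "squeeze T ` ball c \<eta> \<in> sets lborel" using borel_squeeze[of "ball c \<eta>" T] by simp
      show "(\<Union>z\<in>I. shift (- b z) ` ?A) \<in> fmeasurable lborel"
        using fm fin by (intro fmeasurable.finite_UN) auto
    qed
    also have "\<dots> \<le> (\<Sum>z\<in>I. measure lborel (shift (- b z) ` ?A))"
      using fm by (intro measure_UNION_le fin) (auto simp: fmeasurable_def)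
    also have "\<dots> \<le> (\<Sum>z\<in>I. C0 * measure lborel ?A)"
    proof (rule sum_mono)
      fix z assume z: "z \<in> I"
      have "norm (b z) \<le> \<bar>real_of_int (fst z) * \<epsilon>1\<bar> + \<bar>real_of_int (snd z) * \<epsilon>2\<bar>"
        unfolding b_def by (rule order_trans[OF norm_triangle_ineq]) (simp add: pf.e_norm)
      then have "norm (- b z) \<le> 2 * Am" using z e unfolding mem by (simp add: abs_mult)
      then have "real CARD('n) * (pf.B * norm (- b z)) \<le> real CARD('n) * (pf.B * (2 * Am))"
        using pf.B by (intro mult_left_mono) auto
      then have "(\<Sum>j\<in>UNIV. q j \<bullet> (- b z)) \<le> real CARD('n) * (pf.B * (2 * Am))"
        using sum_inner_bound[of "- b z"] by linarith
      then have "exp (\<Sum>j\<in>UNIV. q j \<bullet> (- b z)) \<le> C0" unfolding C0_def by (simp only: exp_le_cancel_iff)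
      then show "measure lborel (shift (- b z) ` ?A) \<le> C0 * measure lborel ?A"
        unfolding measure_shift[OF A] by (intro mult_right_mono) auto
    qed
    also have "\<dots> = real (card I) * (C0 * measure lborel ?A)" by simp
    also have "\<dots> \<le> (3 * Am / \<epsilon>1 * (3 * Am / \<epsilon>2)) * (C0 * measure lborel ?A)"
    proof (rule mult_right_mono)
      have "real (card I) = real (card {- \<lfloor>Am / \<epsilon>1\<rfloor>..\<lfloor>Am / \<epsilon>1\<rfloor>}) * real (card {- \<lfloor>Am / \<epsilon>2\<rfloor>..\<lfloor>Am / \<epsilon>2\<rfloor>})"
        unfolding I_def card_cartesian_product by simp
      also have "\<dots> \<le> 3 * Am / \<epsilon>1 * (3 * Am / \<epsilon>2)"
        using e Am by (intro mult_mono card_int_grid(1)[OF e(1) eA(1)] card_int_grid(1)[OF e(2) eA(2)]) auto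
      finally show "real (card I) \<le> 3 * Am / \<epsilon>1 * (3 * Am / \<epsilon>2)" .
    qed (use C0 in simp)
    finally have main: "exp (- (\<Sum>k\<in>{k. inner k}. 2 * pf.kap k) * T) * V \<le> (3 * Am / \<epsilon>1 * (3 * Am / \<epsilon>2)) * (C0 * measure lborel ?A)" .
    have "K * (exp (- 8 * mu1 * T) * exp (- 8 * mu2 * T) * exp (- (\<Sum>k\<in>{k. inner k}. 2 * pf.kap k) * T))
       = exp (- (\<Sum>k\<in>{k. inner k}. 2 * pf.kap k) * T) * V * (\<epsilon>1 * \<epsilon>2 / (9 * Am\<^sup>2 * C0))"
      by (simp add: K_def \<epsilon>1_def \<epsilon>2_def power2_eq_square mult_ac)
    also have "\<dots> \<le> (3 * Am / \<epsilon>1 * (3 * Am / \<epsilon>2)) * (C0 * measure lborel ?A) * (\<epsilon>1 * \<epsilon>2 / (9 * Am\<^sup>2 * C0))"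
      using e Am C0 by (intro mult_right_mono main) auto
    also have "\<dots> = measure lborel ?A" using e Am C0 by (simp add: power2_eq_square)
    also have "exp (- 8 * mu1 * T) * exp (- 8 * mu2 * T) * exp (- (\<Sum>k\<in>{k. inner k}. 2 * pf.kap k) * T) = exp (- escape_exponent lam p * T)"
      unfolding escape_exponent_eq exp_add[symmetric] by (simp add: algebra_simps)
    finally show ?thesis .
  qed
  then show ?thesis using K by blast
qed

lemma stay_volume:
  assumes flow: "is_residual_flow (diag_mat lam) \<Phi>" and T: "0 \<le> T"
  shows "fs_volume (stay_set \<Phi> (tube \<delta>) T) = real DIM(complex^'n) / (2 * pi) * measure lborel (cone \<Phi> \<delta> T \<inter> cball 0 1)"
  using fs_volume_cone[of "stay_set \<Phi> (tube \<delta>) T"] open_cone[OF flow T, of \<delta>] by (simp add: cone_def)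

lemma escape_volume:
  assumes flow: "is_residual_flow (diag_mat lam) \<Phi>" and W: "cp_open W" "torus p \<subseteq> W"
  shows "\<exists>U. U \<subseteq> W \<and> adapted_tubular_nbhd (diag_mat lam) p U \<and>
      (\<exists>K1 K2. K1 > 0 \<and> K2 > 0 \<and> (\<forall>T\<ge>0.
          K1 * exp (- escape_exponent lam p * T) \<le> fs_volume (stay_set \<Phi> U T) \<and>
          fs_volume (stay_set \<Phi> U T) \<le> K2 * exp (- escape_exponent lam p * T)))"
proof -
  obtain \<delta>1 where d1: "0 < \<delta>1" "\<And>\<delta>. 0 < \<delta> \<Longrightarrow> \<delta> \<le> \<delta>1 \<Longrightarrow> tube \<delta> \<subseteq> W"
    using tube_small[OF W] by blast
  define \<delta> where "\<delta> = min \<delta>1 pf.dU"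
  have \<delta>: "0 < \<delta>" "\<delta> \<le> \<delta>1" "\<delta> \<le> pf.dU" using d1 pf.dU(1) by (auto simp: \<delta>_def)
  obtain K1 where K1: "0 < K1" "\<And>T. 0 \<le> T \<Longrightarrow> K1 * exp (- escape_exponent lam p * T) \<le> measure lborel (cone \<Phi> \<delta> T \<inter> cball 0 1)"
    using volume_lower_bound[OF flow \<delta>(1)] by blast
  obtain K2 where K2: "0 < K2" "\<And>T. 0 \<le> T \<Longrightarrow> measure lborel (cone \<Phi> \<delta> T \<inter> cball 0 1) \<le> K2 * exp (- escape_exponent lam p * T)"
    using volume_upper_bound[OF flow \<delta>(1,3)] by blast
  define s where "s = real DIM(complex^'n) / (2 * pi)"
  have s: "0 < s" unfolding s_def by (intro divide_pos_pos) auto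
  have "s * K1 * exp (- escape_exponent lam p * T) \<le> fs_volume (stay_set \<Phi> (tube \<delta>) T) \<and>
      fs_volume (stay_set \<Phi> (tube \<delta>) T) \<le> s * K2 * exp (- escape_exponent lam p * T)" if T: "0 \<le> T" for T
    unfolding stay_volume[OF flow T] s_def[symmetric] mult.assoc
    using K1(2)[OF T] K2(2)[OF T] s by (intro conjI mult_left_mono) auto
  then have "\<exists>K1 K2. K1 > 0 \<and> K2 > 0 \<and> (\<forall>T\<ge>0.
          K1 * exp (- escape_exponent lam p * T) \<le> fs_volume (stay_set \<Phi> (tube \<delta>) T) \<and>
          fs_volume (stay_set \<Phi> (tube \<delta>) T) \<le> K2 * exp (- escape_exponent lam p * T))"
    using s K1(1) K2(1) by (intro exI[of _ "s * K1"] exI[of _ "s * K2"]) auto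
  then show ?thesis using d1(2)[OF \<delta>(1,2)] tube_adapted[OF \<delta>(1)] by blast
qed

end

theorem theorem5p5:
  fixes lam :: "complex^'n" and p :: "real^'n"
    and \<Phi> :: "real \<Rightarrow> 'n cpoint \<Rightarrow> 'n cpoint"
  assumes distinct: "inj (\<lambda>i. lam$i)"
    and flow: "is_residual_flow (diag_mat lam) \<Phi>"
    and morse_bott: "morse_bott_torus (diag_mat lam) p"
    and off_circle: "\<forall>k. k \<notin> active p \<longrightarrow> cmod (lam$k - center lam p) \<noteq> radius lam p"
  shows "\<forall>W. cp_open W \<and> torus p \<subseteq> W \<longrightarrow>
    (\<exists>U. U \<subseteq> W \<and> adapted_tubular_nbhd (diag_mat lam) p U \<and>
      (\<exists>K1 K2 T0. K1 > 0 \<and> K2 > 0 \<and> T0 > 0 \<and>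
        (\<forall>T\<ge>T0.
          K1 * exp (- escape_exponent lam p * T) \<le> fs_volume (stay_set \<Phi> U T) \<and>
          fs_volume (stay_set \<Phi> U T) \<le> K2 * exp (- escape_exponent lam p * T))) \<and>
      ((\<lambda>T. ln (fs_volume (stay_set \<Phi> U T)) / T) \<longlongrightarrow> - escape_exponent lam p) at_top)"
proof (intro allI impI)
  fix W assume W: "cp_open W \<and> torus p \<subseteq> W"
  interpret morse_bott_data lam p
    by unfold_locales (use morse_bott off_circle in auto)
  obtain e1 e2 mu1 mu2 where "planar_flow q (\<lambda>i. p$i) (radius lam p) e1 e2 mu1 mu2"
    using planar_flow_exists by blast
  then interpret morse_bott_flow lam p e1 e2 mu1 mu2
    by (intro morse_bott_flow.intro morse_bott_data_axioms)
  obtain U K1 K2 where U: "U \<subseteq> W" "adapted_tubular_nbhd (diag_mat lam) p U" "0 < K1" "0 < K2"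
    "\<And>T. 0 \<le> T \<Longrightarrow> K1 * exp (- escape_exponent lam p * T) \<le> fs_volume (stay_set \<Phi> U T) \<and>
          fs_volume (stay_set \<Phi> U T) \<le> K2 * exp (- escape_exponent lam p * T)"
    using escape_volume[OF flow] W by metis
  have lim: "((\<lambda>T. ln (fs_volume (stay_set \<Phi> U T)) / T) \<longlongrightarrow> - escape_exponent lam p) at_top"
    by (rule exponential_rate[OF U(3,4,5)])
  have "\<exists>K1 K2 T0. K1 > 0 \<and> K2 > 0 \<and> T0 > 0 \<and> (\<forall>T\<ge>T0.
      K1 * exp (- escape_exponent lam p * T) \<le> fs_volume (stay_set \<Phi> U T) \<and>
      fs_volume (stay_set \<Phi> U T) \<le> K2 * exp (- escape_exponent lam p * T))"
    by (intro exI[of _ K1] exI[of _ K2] exI[of _ 1]) (use U in auto)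
  then show "\<exists>U. U \<subseteq> W \<and> adapted_tubular_nbhd (diag_mat lam) p U \<and>
      (\<exists>K1 K2 T0. K1 > 0 \<and> K2 > 0 \<and> T0 > 0 \<and>
        (\<forall>T\<ge>T0.
          K1 * exp (- escape_exponent lam p * T) \<le> fs_volume (stay_set \<Phi> U T) \<and>
          fs_volume (stay_set \<Phi> U T) \<le> K2 * exp (- escape_exponent lam p * T))) \<and>
      ((\<lambda>T. ln (fs_volume (stay_set \<Phi> U T)) / T) \<longlongrightarrow> - escape_exponent lam p) at_top"
    using U(1,2) lim by blast
qed

end
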